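(* Let $q\in(0,1)$, let $l\ge-1$ be a fixed integer, let $\beta_0,\dots,\beta_l>0$ and $\tau\in\mathbb{R}$ be fixed, and for $n\in\mathbb{N}$ set $$M=n+l+1,\qquad t=n-\tau\sqrt n,\qquad b_k=\frac{\beta_k}{\sqrt n}\ \ (k=0,1,\dots,l),\qquad b_k=1\ \ (k>l).$$ With these parameters let $K_{M,t}$ be the integral operator defined in the context. Then, as $n\to\infty$, uniformly for $\zeta$ in any compact subset of $\mathbb{C}$, $$\lim_{n\to\infty}\det(I+\zeta K_{M,t})\big|_{M=n+l+1,\ t=n-\tau\sqrt n}=\det(I+\zeta\mathcal{K}),$$ where $\mathcal{K}$ is the integral operator on $L^2(\Gamma_\infty)$, $(\mathcal{K}f)(z)=\frac1{2\pi i}\int_{\Gamma_\infty}\mathcal{K}(z,w)f(w)\,dw$, on the infinite vertical contour $\Gamma_\infty=\{-1-yi: y\in\mathbb{R}\}$ oriented downward, with kernel $$\mathcal{K}(z,w)=\mathcal{K}_{\tau;\beta_0,\dots,\beta_l}(z,w)=\frac{e^{w^2/2+\tau w}}{qz-w}\,\gamma(w),\qquad \gamma(w)=\prod_{k=0}^l\frac{\beta_k}{\beta_k-w}$$ (with $\gamma\equiv1$ if $l=-1$). Hence, for every fixed integer $m\ge1$, for the $q$-TAZRP with step initial condition and with the parameters $b_k=\beta_k/\sqrt n$ for $k=0,1,\dots,l$ and $b_k=1$ for $k>l$, $$\lim_{n\to\infty}\mathbb{P}_{0^\infty}(x_m(t)>M)\big|_{M=n+l+1,\ t=n-\tau\sqrt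 n}=\frac1{2\pi i}\oint_C\frac{d\zeta}{\zeta}\,\frac{\det(I+\zeta\mathcal{K})}{(1-\zeta)(1-q\zeta)\cdots(1-q^{m-1}\zeta)},$$ where $C$ is a positively oriented circle centred at $0$ large enough to enclose $1,q^{-1},\dots,q^{1-m}$.
   Context: Let $q\in(0,1)$, let $(a_x)_{x\in\mathbb{Z}}$ be positive numbers and $b_x=(1-q)a_x$. The $q$-TAZRP is the continuous-time Markov particle system on $\mathbb{Z}$ in which, for each site $x$ occupied by $k\ge1$ particles, one particle jumps from $x$ to $x+1$ at rate $a_x(1-q^k)$, all exponential clocks being independent; if $x$ is occupied by infinitely many particles the rate is $a_x$. In the step initial condition $0^\infty$, infinitely many particles labelled $1,2,3,\dots$ all sit at site $0$ at time $0$ and all other sites are empty (so sites $x<0$ are never occupied and their rates play no role). Among the particles at a site, the one with smallest label jumps, and it becomes the one with largest label at $x+1$, so $x_m(t)$ is the position of the $m$-th rightmost particle. $\mathbb{P}_{0^\infty}$ is the law of this process. In the theorem the rates depend on $n$ through $b_k$. The operator $K_{M,t}$ acts on $L^2(\Gamma)$ by $$(K_{M,t}f)(w)=\frac1{2\pi i}\oint_\Gamma K_{M,t}(w,w')f(w')\,dw',\qquad K_{M,t}(w,w')=\frac{e^{-wt}}{qw'-w}\prod_{k=0}^M\left(\frac{b_k}{b_k-w}\right),$$ where $\Gamma$ is any positively oriented simple closed contour enclosing $0$, $b_0,\dots,b_M$ and the scaled contour $q\Gamma$; $K_{M,t}$ is trace class and its Fredholm determinant does not depend on the choice of such $\Gamma$.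 *)

theory Defs
  imports
    "HOL-Complex_Analysis.Complex_Analysis"
    "HOL-Probability.Probability"
    "Jordan_Normal_Form.Determinant"
begin

text \<open>
  Fredholm's series for \<open>det (I + A)\<close>, where \<open>A\<close> is the integral operator
  \<open>(A f) x = \<integral>y. k x y * f y \<partial>\<mu>\<close>. The term with index \<open>n\<close> is an integral over the
  \<open>n\<close>-fold product of \<open>\<mu>\<close>; the term with index \<open>0\<close> equals \<open>1\<close>.
\<close>

definition fredholm_det :: "'a measure \<Rightarrow> ('a \<Rightarrow> 'a \<Rightarrow> complex) \<Rightarrow> complex" where
  "fredholm_det \<mu> k =
     (\<Sum>n. (\<integral>x. Determinant.det (Matrix.mat n n (\<lambda>(i, j). k (x i) (x j)))
               \<partial>(Pi\<^sub>M {..<n} (\<lambda>_. \<mu>))) / fact n)"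

text \<open>
  \<open>det (I + A)\<close> for the operator \<open>(A f) w = 1 / (2 \<pi> i) \<integral>\<^bsub>\<Gamma>\<^esub> K w w' f w' dw'\<close>,
  the contour \<open>\<Gamma>\<close> being traversed by its parametrization on the interval \<open>J\<close>. The line element
  \<open>dw' / (2 \<pi> i)\<close> is absorbed into the second argument of the kernel.
\<close>

definition contour_fredholm_det ::
  "real set \<Rightarrow> (real \<Rightarrow> complex) \<Rightarrow> (complex \<Rightarrow> complex \<Rightarrow> complex) \<Rightarrow> complex" where
  "contour_fredholm_det J \<Gamma> K =
     fredholm_det (restrict_space lborel J)
       (\<lambda>s u. K (\<Gamma> s) (\<Gamma> u) * vector_derivative \<Gamma> (at u) / (2 * of_real pi * \<i>))"

definition K_pre ::
  "real \<Rightarrow> (nat \<Rightarrow> real) \<Rightarrow> nat \<Rightarrow> real \<Rightarrow> complex \<Rightarrow> complex \<Rightarrow> complex" where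
  "K_pre q b M t w w' =
     exp (- w * of_real t) / (of_real q * w' - w) *
     (\<Prod>k\<le>M. of_real (b k) / (of_real (b k) - w))"

text \<open>
  Positively oriented simple closed contours enclosing \<open>0\<close>, \<open>b 0, \<dots>, b M\<close> and \<open>q \<Gamma>\<close>.
  A \<^const>\<open>valid_path\<close> may have an unbounded derivative at its finitely many break points, so
  finite length has to be required separately.
\<close>

definition admissible_contour ::
  "real \<Rightarrow> (nat \<Rightarrow> real) \<Rightarrow> nat \<Rightarrow> (real \<Rightarrow> complex) \<Rightarrow> bool" where
  "admissible_contour q b M \<Gamma> \<longleftrightarrow>
     valid_path \<Gamma> \<and>
     (\<lambda>s. vector_derivative \<Gamma> (at s)) absolutely_integrable_on {0..1} \<and>
     simple_path \<Gamma> \<and> pathfinish \<Gamma> = pathstart \<Gamma> \<and>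
     (\<forall>z\<in>inside (path_image \<Gamma>). winding_number \<Gamma> z = 1) \<and>
     0 \<in> inside (path_image \<Gamma>) \<and>
     (\<forall>k\<le>M. of_real (b k) \<in> inside (path_image \<Gamma>)) \<and>
     (\<lambda>w. of_real q * w) ` path_image \<Gamma> \<subseteq> inside (path_image \<Gamma>)"

definition gamma_factor :: "int \<Rightarrow> (nat \<Rightarrow> real) \<Rightarrow> complex \<Rightarrow> complex" where
  "gamma_factor l \<beta> w =
     (\<Prod>k\<in>{k. int k \<le> l}. of_real (\<beta> k) / (of_real (\<beta> k) - w))"

definition K_lim ::
  "real \<Rightarrow> real \<Rightarrow> int \<Rightarrow> (nat \<Rightarrow> real) \<Rightarrow> complex \<Rightarrow> complex \<Rightarrow> complex" where
  "K_lim q \<tau> l \<beta> z w =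
     exp (w\<^sup>2 / 2 + of_real \<tau> * w) / (of_real q * z - w) * gamma_factor l \<beta> w"

definition Gamma_inf :: "real \<Rightarrow> complex" where
  "Gamma_inf y = - 1 - of_real y * \<i>"

text \<open>
  A configuration gives the position of each particle; the particles are labelled \<open>1, 2, 3, \<dots>\<close>
  (the value at \<open>0\<close> is irrelevant).
\<close>

type_synonym config = "nat \<Rightarrow> int"

definition particles_at :: "config \<Rightarrow> int \<Rightarrow> nat set" where
  "particles_at s x = {m. 1 \<le> m \<and> s m = x}"

definition occupied :: "config \<Rightarrow> int set" where
  "occupied s = {x. particles_at s x \<noteq> {}}"

definition jump_rate :: "real \<Rightarrow> (int \<Rightarrow> real) \<Rightarrow> config \<Rightarrow> int \<Rightarrow> real" where
  "jump_rate q a s x =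
     (if finite (particles_at s x) then a x * (1 - q ^ card (particles_at s x)) else a x)"

definition jump_from :: "config \<Rightarrow> int \<Rightarrow> config" where
  "jump_from s x = s ((LEAST m. m \<in> particles_at s x) := x + 1)"

definition step_initial :: config where
  "step_initial = (\<lambda>_. 0)"

text \<open>
  The process is realized by its jump chain and holding times. After the \<open>n\<close>-th jump every
  occupied site \<open>x\<close> carries an independent exponential clock whose rate is the current jump rate
  at \<open>x\<close>, namely a standard exponential variable \<open>\<omega> (n, x)\<close> divided by that rate; the first clock
  to ring triggers the next jump. By memorylessness, restarting all clocks after each jump does
  not affect the law. In configurations reachable from the step initial condition only finitely
  many sites are occupied, so the minimum is attained.
\<close>

definition clock_space :: "(nat \<times> int \<Rightarrow> real) measure" where
  "clock_space = Pi\<^sub>M UNIV (\<lambda>_. density lborel (exponential_density 1))"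

definition ring_time ::
  "real \<Rightarrow> (int \<Rightarrow> real) \<Rightarrow> (nat \<times> int \<Rightarrow> real) \<Rightarrow> nat \<Rightarrow> config \<Rightarrow> int \<Rightarrow> real" where
  "ring_time q a \<omega> n s x = \<omega> (n, x) / jump_rate q a s x"

definition jump_site ::
  "real \<Rightarrow> (int \<Rightarrow> real) \<Rightarrow> (nat \<times> int \<Rightarrow> real) \<Rightarrow> nat \<Rightarrow> config \<Rightarrow> int" where
  "jump_site q a \<omega> n s = arg_min_on (ring_time q a \<omega> n s) (occupied s)"

primrec jump_chain ::
  "real \<Rightarrow> (int \<Rightarrow> real) \<Rightarrow> config \<Rightarrow> (nat \<times> int \<Rightarrow> real) \<Rightarrow> nat \<Rightarrow> config" where
  "jump_chain q a s\<^sub>0 \<omega> 0 = s\<^sub>0"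
| "jump_chain q a s\<^sub>0 \<omega> (Suc n) =
     (let s = jump_chain q a s\<^sub>0 \<omega> n in jump_from s (jump_site q a \<omega> n s))"

definition jump_time ::
  "real \<Rightarrow> (int \<Rightarrow> real) \<Rightarrow> config \<Rightarrow> (nat \<times> int \<Rightarrow> real) \<Rightarrow> nat \<Rightarrow> real" where
  "jump_time q a s\<^sub>0 \<omega> n =
     (\<Sum>i<n. let s = jump_chain q a s\<^sub>0 \<omega> i in ring_time q a \<omega> i s (jump_site q a \<omega> i s))"

text \<open>
  For \<open>t \<ge> 0\<close> the index below is the number of jumps up to and including time \<open>t\<close>, so paths are
  right-continuous.
\<close>

definition qTAZRP ::
  "real \<Rightarrow> (int \<Rightarrow> real) \<Rightarrow> config \<Rightarrow> (nat \<times> int \<Rightarrow> real) \<Rightarrow> real \<Rightarrow> config" where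
  "qTAZRP q a s\<^sub>0 \<omega> t = jump_chain q a s\<^sub>0 \<omega> (LEAST n. t < jump_time q a s\<^sub>0 \<omega> (Suc n))"

end

theory Submission
  imports Defs "HOL-Real_Asymp.Real_Asymp"
begin

text \<open>
  For weakly decreasing \<open>p\<close> the observables \<open>\<Prod>i<k. (q ^ N (p i) - q ^ i)\<close>, where \<open>N v\<close> counts the
  particles at sites \<open>\<ge> v\<close>, satisfy a closed linear system of evolution equations. Nested
  contour integrals over a single contour \<open>\<Gamma>\<close> solve the same system: at equal coordinates the
  boundary condition holds because the integrand can be antisymmetrized. When all coordinates
  agree, symmetrization and the Cauchy determinant turn the integral into the \<open>k\<close>-th term of the
  Fredholm series, so that the coefficient of \<open>\<zeta> ^ k\<close> in \<open>det (I + \<zeta> K)\<close> is the expectation of a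
  q-binomial expression in the number of particles beyond \<open>M\<close>. It is therefore independent of
  \<open>\<Gamma>\<close> and bounded by \<open>q ^ (k (k - 1) / 2) / (q; q)_k\<close> uniformly in all other parameters, and only
  the limit of each single coefficient remains to be found. This is done by dominated convergence on
  the circle with centre \<open>1\<close> and radius \<open>1 + 1 / sqrt n\<close>.
\<close>

subsection \<open>Symmetrization and the Cauchy determinant\<close>

text \<open>The contour encloses \<open>q \<Gamma>\<close>. In the variable \<open>z j\<close> the
  factor \<open>1 / (z i - q z j)\<close> has its pole at \<open>z i / q\<close>, outside the
  contour; in \<open>z i\<close> the pole \<open>q z j\<close> lies inside. So a last variable with
  coordinate \<open>0\<close> can be integrated out by its pole at \<open>0\<close> alone, while at
  time \<open>0\<close> the first variable has all its poles inside and contributes nothing, by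
  decay at infinity. These two boundary data identify the integrals with the moments, on one contour
  for all variables. Agreement is an induction on \<open>k\<close> plus the sum of the coordinates;
  each step is a scalar linear equation. The direct estimates of the Fredholm terms made here grow
  geometrically in \<open>k\<close>; the probabilistic meaning of the coefficients supplies a
  super-exponential bound, good for \<open>\<zeta>\<close> of any size. The exponent
  \<open>- n z - n log (1 - z)\<close> is \<open>n z^2 / 2\<close> to second order, so
  \<open>z = w / sqrt n\<close> is the natural scale, on which the slow poles
  \<open>\<beta> k / sqrt n\<close> live as well. The radius makes the circle cross the negative
  axis at \<open>- 1 / sqrt n\<close>, which becomes the point \<open>- 1\<close> of
  \<open>Gamma_inf\<close>.\<close>

lemma lagrange_sum:
  fixes z :: "'i \<Rightarrow> complex"
  assumes fin: "finite I" and ne: "I \<noteq> {}" and inj: "inj_on z I" and nz: "\<And>i. i \<in> I \<Longrightarrow>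
      z i \<noteq> 0" and q1: "q \<noteq> 1"
  shows "(\<Sum>i\<in>I. \<Prod>j\<in>I - {i}. (z i - q * z j) / (z i - z j)) = (1 - q ^ card I) / (1 - q)"
proof -
  define n where "n = card I"
  define p1 where "p1 = (\<Prod>j\<in>I. [:- (q * z j), 1:])"
  define p2 where "p2 = (\<Prod>j\<in>I. [:- z j, 1:])"
  define w where "w i = (\<Prod>j\<in>I - {i}. (z i - q * z j) / (z i - z j))" for i
  \<comment> \<open>\<open>p1\<close> and \<open>p2\<close> are monic of degree \<open>n\<close>, so
    \<open>p1 - p2\<close> has degree below \<open>n\<close> and equals its Lagrange interpolant
    \<open>L\<close> at the nodes \<open>z i\<close>. Comparing values at \<open>0\<close> yields
    the sum, because there the factor \<open>z i\<close> in the coefficient completes the product to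
    \<open>Q\<close> up to sign.\<close>
  define L where "L = (\<Sum>i\<in>I. Polynomial.smult ((1 - q) * z i * w i) (\<Prod>j\<in>I - {i}. [:- z j, 1:]))"
  have npos: "n > 0" unfolding n_def using fin ne by (simp add: card_gt_0_iff)
  have d1: "degree p1 = n" unfolding p1_def n_def by (subst degree_prod_eq_sum_degree) auto
  have d2: "degree p2 = n" unfolding p2_def n_def by (subst degree_prod_eq_sum_degree) auto
  have l1: "poly.coeff p1 n = 1"
    using lead_coeff_prod[of "\<lambda>j. [:- (q * z j), 1:]" I] d1 by (simp add: p1_def)
  have l2: "poly.coeff p2 n = 1"
    using lead_coeff_prod[of "\<lambda>j. [:- z j, 1:]" I] d2 by (simp add: p2_def)
  have dL: "degree L < n"
  proof -
    have "degree (Polynomial.smult ((1 - q) * z i * w i) (\<Prod>j\<in>I - {i}. [:- z j, 1:])) \<le> n - 1"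
      if "i \<in> I" for i
    proof -
      have "degree (\<Prod>j\<in>I - {i}. [:- z j, 1:]) = n - 1"
        using that fin by (subst degree_prod_eq_sum_degree) (auto simp: n_def)
      then show ?thesis using degree_smult_le by metis
    qed
    then have "degree L \<le> n - 1" unfolding L_def by (intro degree_sum_le fin) auto
    then show ?thesis using npos by simp
  qed
  have eq: "p1 = p2 + L"
  proof (rule poly_eqI_degree_lead_coeff[where n = n and A = "z ` I"])
    show "poly.coeff p1 n = poly.coeff (p2 + L) n" using l1 l2 dL by (simp add: coeff_eq_0)
    show "n \<le> card (z ` I)" using inj by (simp add: card_image n_def)
    show "degree p1 \<le> n" "degree (p2 + L) \<le> n" using d1 d2 dL by (auto intro: degree_add_le)
    fix x assume "x \<in> z ` I"
    then obtain i where i: "i \<in> I" "x = z i" by auto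
    have "poly p2 x = 0" unfolding p2_def using i fin by (auto simp: poly_prod)
    moreover have "poly L x = (\<Sum>k\<in>I. if k = i then (1 - q) * z i * w i *
        (\<Prod>j\<in>I - {i}. z i - z j) else 0)"
      unfolding L_def poly_sum using i fin
      by (intro sum.cong refl) (auto simp: poly_prod)
    moreover have "\<dots> = (1 - q) * z i * w i * (\<Prod>j\<in>I - {i}. z i - z j)"
      using i fin by simp
    moreover have "w i * (\<Prod>j\<in>I - {i}. z i - z j) = (\<Prod>j\<in>I - {i}. z i - q * z j)"
      unfolding w_def prod.distrib[symmetric]
      using i inj by (intro prod.cong refl) (auto simp: inj_on_def)
    moreover have "poly p1 x = (1 - q) * z i * (\<Prod>j\<in>I - {i}. z i - q * z j)"
      unfolding p1_def poly_prod using i fin by (simp add: prod.remove algebra_simps)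
    ultimately show "poly p1 x = poly (p2 + L) x" by (simp add: mult.assoc)
  qed
  define Q where "Q = (\<Prod>j\<in>I. - z j)"
  have Q: "Q \<noteq> 0" unfolding Q_def using fin nz by simp
  have "poly p1 0 = q ^ n * Q"
    unfolding p1_def poly_prod Q_def n_def by (simp add: prod.distrib[symmetric] flip: prod_constant)
  moreover have "poly p2 0 = Q" unfolding p2_def poly_prod Q_def by simp
  moreover have "poly L 0 = (\<Sum>i\<in>I. - (1 - q) * Q * w i)"
    unfolding L_def poly_sum Q_def
    by (intro sum.cong refl) (use fin in \<open>auto simp: poly_prod prod.remove algebra_simps\<close>)
  moreover have "\<dots> = - (1 - q) * Q * (\<Sum>i\<in>I. w i)"
    by (simp add: sum_distrib_left)
  ultimately have "q ^ n * Q = Q - (1 - q) * Q * (\<Sum>i\<in>I. w i)"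
    using eq by (metis (no_types, lifting) add_uminus_conv_diff minus_mult_left poly_add)
  then have "Q * ((1 - q) * (\<Sum>i\<in>I. w i)) = Q * (1 - q ^ n)"
    by (simp add: algebra_simps)
  then have "(1 - q) * (\<Sum>i\<in>I. w i) = 1 - q ^ n" using Q by simp
  then show ?thesis using q1 unfolding w_def n_def by (simp add: field_simps)
qed

text \<open>Both orders of each pair occur, so the product is symmetric in the variables;
  \<open>ord_prod\<close> keeps only the factor with the smaller index in front. Up to elementary
  factors \<open>pair_prod\<close> is the determinant with entries
  \<open>1 / (q * z j - z i)\<close>, see \<open>det_q_cauchy\<close>.\<close>

definition pair_prod :: "complex \<Rightarrow> nat set \<Rightarrow> (nat \<Rightarrow> complex) \<Rightarrow> complex" where
  "pair_prod q I z = (\<Prod>i\<in>I. \<Prod>j\<in>I - {i}. (z i - z j) / (z i - q * z j))"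

definition ord_prod :: "complex \<Rightarrow> nat \<Rightarrow> (nat \<Rightarrow> complex) \<Rightarrow> complex" where
  "ord_prod q k z = (\<Prod>j<k. \<Prod>i<j. (z i - z j) / (z i - q * z j))"

lemma pair_prod_insert:
  assumes "finite I" "c \<notin> I"
  shows "pair_prod q (insert c I) z =
    pair_prod q I z * (\<Prod>j\<in>I. (z c - z j) / (z c - q * z j) * ((z j - z c) / (z j - q * z c)))"
proof -
  have 1: "insert c I - {i} = insert c (I - {i})" if "i \<in> I" for i using assms that by auto
  have "(\<Prod>i\<in>I. \<Prod>j\<in>insert c I - {i}. (z i - z j) / (z i - q * z j))
      = (\<Prod>i\<in>I. (z i - z c) / (z i - q * z c) * (\<Prod>j\<in>I - {i}. (z i - z j) / (z i - q * z j)))"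
    using assms 1 by (intro prod.cong refl) auto
  also have "\<dots> = (\<Prod>j\<in>I. (z j - z c) / (z j - q * z c)) * pair_prod q I z"
    by (simp only: prod.distrib pair_prod_def)
  finally have 2: "(\<Prod>i\<in>I. \<Prod>j\<in>insert c I - {i}. (z i - z j) / (z i - q * z j)) =
    (\<Prod>j\<in>I. (z j - z c) / (z j - q * z c)) * pair_prod q I z" .
  have "pair_prod q (insert c I) z = (\<Prod>j\<in>I. (z c - z j) / (z c - q * z j)) *
    (\<Prod>i\<in>I. \<Prod>j\<in>insert c I - {i}. (z i - z j) / (z i - q * z j))"
    unfolding pair_prod_def using assms by simp
  then show ?thesis
    unfolding 2 by (simp only: prod.distrib mult_ac)
qed

lemma pair_prod_zero:
  assumes "finite I" "i \<in> I" "j \<in> I" "i \<noteq> j" "z i = z j"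
  shows "pair_prod q I z = 0"
  unfolding pair_prod_def using assms by (intro prod_zero bexI[of _ i] bexI[of _ j]) auto

text \<open>The transposition carries \<open>{..<k}\<close> onto \<open>{..<Suc k} - {b}\<close>, so
  after relabelling exactly the variable \<open>z b\<close> is missing. This is the form in which
  the induction hypothesis enters \<open>sum_permutes_ord_prod\<close>.\<close>

lemma pair_prod_transpose:
  assumes "b \<le> k"
  shows "pair_prod q {..<k} (z \<circ> Transposition.transpose k b) = pair_prod q ({..<Suc k} - {b}) z"
proof -
  let ?t = "Transposition.transpose k b"
  have inj: "inj_on ?t A" for A by (rule inj_onI) (metis transpose_involutory)
  have im: "?t ` {..<k} = {..<Suc k} - {b}"
  proof -
    have "?t permutes {..<Suc k}" using assms by (intro permutes_swap_id) auto
    then have "?t ` {..<Suc k} = {..<Suc k}" by (rule permutes_image)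
    moreover have "?t ` ({..<Suc k} - {k}) = ?t ` {..<Suc k} - {b}"
      using inj[of UNIV] by (auto simp: inj_on_image_set_diff[of ?t UNIV])
    moreover have "{..<Suc k} - {k} = {..<k}" by auto
    ultimately show ?thesis by simp
  qed
  have im2: "?t ` ({..<k} - {i}) = {..<Suc k} - {b} - {?t i}" if "i < k" for i
    using im inj[of UNIV] by (auto simp: inj_on_image_set_diff[of ?t UNIV])
  have "pair_prod q ({..<Suc k} - {b}) z
      = (\<Prod>i<k. \<Prod>j\<in>{..<Suc k} - {b} - {?t i}. (z (?t i) - z j) / (z (?t i) - q * z j))"
    unfolding pair_prod_def im[symmetric] by (subst prod.reindex[OF inj]) simp
  also have "\<dots> = (\<Prod>i<k. \<Prod>j\<in>{..<k} - {i}. (z (?t i) - z (?t j)) / (z (?t i) - q * z (?t j)))"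
  proof (rule prod.cong[OF refl])
    fix i assume "i \<in> {..<k}"
    then have "{..<Suc k} - {b} - {?t i} = ?t ` ({..<k} - {i})" using im2 by simp
    then show "(\<Prod>j\<in>{..<Suc k} - {b} - {?t i}. (z (?t i) - z j) / (z (?t i) - q * z j)) =
      (\<Prod>j\<in>{..<k} - {i}. (z (?t i) - z (?t j)) / (z (?t i) - q * z (?t j)))"
      by (simp only: prod.reindex[OF inj] o_def)
  qed
  finally show ?thesis by (simp add: pair_prod_def)
qed

text \<open>Permutations of \<open>Suc k\<close> indices are grouped by the index \<open>b\<close>
  that ends up last. The last variable contributes a factor symmetric in the others, the rest is the
  induction hypothesis with \<open>z b\<close> removed, and the remaining sum over \<open>b\<close>
  is \<open>lagrange_sum\<close> after \<open>pair_prod\<close> of all variables is taken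
  out.\<close>

lemma sum_permutes_ord_prod:
  fixes q :: complex
  assumes "\<And>i. i < k \<Longrightarrow> z i \<noteq> 0" "\<And>i j. i < k \<Longrightarrow> j < k \<Longrightarrow> z i \<noteq> q * z j" "q \<noteq> 1"
  shows "(\<Sum>p | p permutes {..<k}. ord_prod q k (z \<circ> p)) =
    (\<Prod>i<k. (1 - q ^ Suc i) / (1 - q)) * pair_prod q {..<k} z"
  using assms
proof (induction k arbitrary: z)
  case 0
  then show ?case by (simp add: ord_prod_def pair_prod_def)
next
  case (Suc k)
  let ?c = "\<Prod>i<k. (1 - q ^ Suc i) / (1 - q)"
  have "(\<Sum>p | p permutes {..<Suc k}. ord_prod q (Suc k) (z \<circ> p)) =
     (\<Sum>b\<in>{..<Suc k}. \<Sum>p | p permutes {..<k}. ord_prod q (Suc k)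
       (z \<circ> (Transposition.transpose k b \<circ> p)))"
    unfolding lessThan_Suc by (subst sum_over_permutations_insert) auto
  also have "\<dots> = (\<Sum>b\<in>{..<Suc k}. ?c * (pair_prod q ({..<Suc k} - {b}) z *
      (\<Prod>j\<in>{..<Suc k} - {b}. (z j - z b) / (z j - q * z b))))"
  proof (intro sum.cong refl)
    fix b assume b: "b \<in> {..<Suc k}"
    define y where "y = z \<circ> Transposition.transpose k b"
    have yk: "y k = z b" by (simp add: y_def)
    have lt: "Transposition.transpose k b i < Suc k" if "i < k" for i
      using b that by (cases "i = b") (auto simp: Transposition.transpose_def)
    have "ord_prod q (Suc k) (y \<circ> p) = ord_prod q k (y \<circ> p) * (\<Prod>i<k. (y i - z b) / (y i - q * z b))"
      if p: "p permutes {..<k}" for p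
    proof -
      have "(\<Prod>i<k. (y (p i) - y k) / (y (p i) - q * y k)) = (\<Prod>i<k. (y i - y k) / (y i - q * y k))"
        using prod.permute[OF p, of "\<lambda>i. (y i - y k) / (y i - q * y k)"] by (simp add: o_def)
      then show ?thesis using p yk permutes_not_in[OF p, of k] by (simp add: ord_prod_def)
    qed
    then have "(\<Sum>p | p permutes {..<k}. ord_prod q (Suc k) (y \<circ> p)) =
       (\<Sum>p | p permutes {..<k}. ord_prod q k (y \<circ> p)) * (\<Prod>i<k. (y i - z b) / (y i - q * z b))"
      by (simp add: sum_distrib_right)
    also have "(\<Sum>p | p permutes {..<k}. ord_prod q k (y \<circ> p)) = ?c * pair_prod q {..<k} y"
      using lt Suc.prems by (intro Suc.IH) (auto simp: y_def)
    also have "pair_prod q {..<k} y = pair_prod q ({..<Suc k} - {b}) z"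
      using b by (simp add: y_def pair_prod_transpose)
    also have "(\<Prod>i<k. (y i - z b) / (y i - q * z b)) =
        (\<Prod>j\<in>{..<Suc k} - {b}. (z j - z b) / (z j - q * z b))"
      by (rule prod.reindex_bij_witness[of _ "Transposition.transpose k b"
        "Transposition.transpose k b"])
        (use b in \<open>auto simp: y_def Transposition.transpose_def split: if_splits\<close>)
    finally show "(\<Sum>p | p permutes {..<k}. ord_prod q (Suc k)
        (z \<circ> (Transposition.transpose k b \<circ> p))) = 
       ?c * (pair_prod q ({..<Suc k} - {b}) z *
         (\<Prod>j\<in>{..<Suc k} - {b}. (z j - z b) / (z j - q * z b)))"
      by (simp add: y_def o_def mult.assoc)
  qed
  also have "\<dots> = ?c * (\<Sum>b\<in>{..<Suc k}. pair_prod q ({..<Suc k} - {b}) z *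
      (\<Prod>j\<in>{..<Suc k} - {b}. (z j - z b) / (z j - q * z b)))"
    by (simp only: sum_distrib_left)
  also have "(\<Sum>b\<in>{..<Suc k}. pair_prod q ({..<Suc k} - {b}) z *
      (\<Prod>j\<in>{..<Suc k} - {b}. (z j - z b) / (z j - q * z b))) =
      pair_prod q {..<Suc k} z * ((1 - q ^ Suc k) / (1 - q))"
  \<comment> \<open>\<open>lagrange_sum\<close> divides by differences of the variables. If two of
    them coincide, both sides vanish: every summand then contains a zero factor, either in
    \<open>pair_prod\<close> or in the product over \<open>j\<close>.\<close>
  proof (cases "inj_on z {..<Suc k}")
    case True
    have "pair_prod q ({..<Suc k} - {b}) z * (\<Prod>j\<in>{..<Suc k} - {b}. (z j - z b) / (z j - q * z b))
        = pair_prod q {..<Suc k} z * (\<Prod>j\<in>{..<Suc k} - {b}. (z b - q * z j) / (z b - z j))"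
      if b: "b \<in> {..<Suc k}" for b
    proof -
      have "pair_prod q {..<Suc k} z = pair_prod q ({..<Suc k} - {b}) z *
        (\<Prod>j\<in>{..<Suc k} - {b}. (z b - z j) / (z b - q * z j) * ((z j - z b) / (z j - q * z b)))"
        using pair_prod_insert[of "{..<Suc k} - {b}" b q z] b by (simp add: insert_absorb)
      moreover have "(\<Prod>j\<in>{..<Suc k} - {b}. (z b - z j) / (z b - q * z j) *
          ((z j - z b) / (z j - q * z b))) *
         (\<Prod>j\<in>{..<Suc k} - {b}. (z b - q * z j) / (z b - z j)) = (\<Prod>j\<in>{..<Suc k} - {b}. (z j - z b) /
           (z j - q * z b))"
        unfolding prod.distrib[symmetric]
        using b True Suc.prems(2) by (intro prod.cong refl) (auto simp: inj_on_def)
      ultimately show ?thesis by (simp add: mult.assoc)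
    qed
    then have "(\<Sum>b\<in>{..<Suc k}. pair_prod q ({..<Suc k} - {b}) z *
      (\<Prod>j\<in>{..<Suc k} - {b}. (z j - z b) / (z j - q * z b))) =
      pair_prod q {..<Suc k} z * (\<Sum>b\<in>{..<Suc k}. \<Prod>j\<in>{..<Suc k} - {b}. (z b - q * z j) /
        (z b - z j))"
      by (simp add: sum_distrib_left del: sum.lessThan_Suc)
    moreover have "(\<Sum>b\<in>{..<Suc k}. \<Prod>j\<in>{..<Suc k} - {b}. (z b - q * z j) / (z b - z j)) =
        (1 - q ^ card {..<Suc k}) / (1 - q)"
      using True Suc.prems by (intro lagrange_sum) auto
    ultimately show ?thesis by simp
  next
    case False
    then obtain i j where ij: "i < Suc k" "j < Suc k" "i \<noteq> j" "z i = z j" by (auto simp: inj_on_def)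
    have "pair_prod q ({..<Suc k} - {b}) z * (\<Prod>j\<in>{..<Suc k} - {b}. (z j - z b) / (z j - q * z b)) =
        0"
      if b: "b \<in> {..<Suc k}" for b
    proof (cases "b = i \<or> b = j")
      case True
      then have "\<exists>l\<in>{..<Suc k} - {b}. z l = z b" using ij by auto
      then have "(\<Prod>j\<in>{..<Suc k} - {b}. (z j - z b) / (z j - q * z b)) = 0"
        by (intro prod_zero) auto
      then show ?thesis by simp
    next
      case False
      then have "pair_prod q ({..<Suc k} - {b}) z = 0"
        using ij by (intro pair_prod_zero[of _ i j]) auto
      then show ?thesis by simp
    qed
    moreover have "pair_prod q {..<Suc k} z = 0" using ij by (intro pair_prod_zero[of _ i j]) auto
    ultimately show ?thesis using sum.neutral by (metis (no_types, lifting) mult_zero_left)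
  qed
  finally show ?case by (simp add: mult_ac)
qed

text \<open>Column elimination with pivot \<open>A k k\<close>: multiplication from the right by a
  unit lower triangular matrix clears the last row to the left of the pivot and leaves the Schur
  complement in the upper left block.\<close>

lemma det_schur:
  fixes A :: "nat \<Rightarrow> nat \<Rightarrow> complex"
  assumes nz: "A k k \<noteq> 0"
  shows "Determinant.det (Matrix.mat (Suc k) (Suc k) (\<lambda>(i,j). A i j)) =
    A k k * Determinant.det (Matrix.mat k k (\<lambda>(i,j). A i j - A i k * A k j / A k k))"
proof -
  let ?A = "Matrix.mat (Suc k) (Suc k) (\<lambda>(i,j). A i j)"
  let ?B = "Matrix.mat (Suc k) (Suc k) (\<lambda>(i,j). if i = j then 1 else if i = k then -
      A k j / A k k else 0)"
  let ?C = "Matrix.mat k k (\<lambda>(i,j). A i j - A i k * A k j / A k k)"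
  have detB: "Determinant.det ?B = 1"
  proof -
    have "Determinant.det ?B = prod_list (diag_mat ?B)"
      by (rule det_lower_triangular[of "Suc k"]) auto
    also have "diag_mat ?B = map (\<lambda>i. 1) [0..<Suc k]"
      unfolding diag_mat_def by (intro map_cong) auto
    also have "prod_list (map (\<lambda>i. 1::complex) [0..<Suc k]) = 1" by (induction k) auto
    finally show ?thesis .
  qed
  have "?A * ?B = four_block_mat ?C (Matrix.mat k 1 (\<lambda>(i,j). A i k)) (0\<^sub>m 1 k)
      (Matrix.mat 1 1 (\<lambda>(i,j). A k k))"
  proof (rule eq_matI)
    fix i j assume "i < dim_row (four_block_mat ?C (Matrix.mat k 1 (\<lambda>(i,j). A i k)) (0\<^sub>m 1 k)
        (Matrix.mat 1 1 (\<lambda>(i,j). A k k)))"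
      and "j < dim_col (four_block_mat ?C (Matrix.mat k 1 (\<lambda>(i,j). A i k)) (0\<^sub>m 1 k)
          (Matrix.mat 1 1 (\<lambda>(i,j). A k k)))"
    then have ij: "i < Suc k" "j < Suc k" by auto
    have "(?A * ?B) $$ (i, j) = (\<Sum>m = 0..<Suc k. A i m *
        (if m = j then 1 else if m = k then - A k j / A k k else 0))"
      using ij by (simp add: scalar_prod_def)
    also have "\<dots> = (\<Sum>m = 0..<k. A i m * (if m = j then 1 else 0)) + A i k *
        (if k = j then 1 else - A k j / A k k)"
      by (auto simp: sum.atLeast0_lessThan_Suc intro!: sum.cong)
    also have "(\<Sum>m = 0..<k. A i m * (if m = j then 1 else 0)) = (if j < k then A i j else 0)"
      by (simp add: if_distrib cong: if_cong)
    finally show "(?A * ?B) $$ (i, j) = four_block_mat ?C (Matrix.mat k 1 (\<lambda>(i,j). A i k)) (0\<^sub>m 1 k)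
        (Matrix.mat 1 1 (\<lambda>(i,j). A k k)) $$ (i, j)"
      using ij nz by (cases "i < k"; cases "j < k") (auto simp: less_Suc_eq)
  qed auto
  then have "Determinant.det (?A * ?B) = Determinant.det (four_block_mat ?C
      (Matrix.mat k 1 (\<lambda>(i,j). A i k)) (0\<^sub>m 1 k) (Matrix.mat 1 1 (\<lambda>(i,j). A k k)))"
    by (rule arg_cong)
  also have "\<dots> = Determinant.det ?C * A k k"
    by (subst det_four_block_mat_lower_left_zero[of _ k _ 1]) (auto simp: det_single)
  finally have "Determinant.det (?A * ?B) = Determinant.det ?C * A k k" .
  moreover have "Determinant.det (?A * ?B) = Determinant.det ?A"
    by (subst det_mult[of _ "Suc k"]) (auto simp: detB)
  ultimately show ?thesis by (simp add: mult.commute)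
qed

lemma det_mat_expand:
  fixes A :: "nat \<Rightarrow> nat \<Rightarrow> complex"
  shows "Determinant.det (Matrix.mat k k (\<lambda>(i, j). A i j)) =
      (\<Sum>p | p permutes {0..<k}. signof p * (\<Prod>i = 0..<k. A i (p i)))"
  by (subst det_def'[of _ k]) (auto intro!: sum.cong simp: permutes_in_image[of _
    "{0..<k}", simplified])

lemma det_mat_scale:
  fixes A :: "nat \<Rightarrow> nat \<Rightarrow> complex"
  shows "Determinant.det (Matrix.mat k k (\<lambda>(i,j). r i * c j * A i j)) =
    (\<Prod>i<k. r i) * (\<Prod>i<k. c i) * Determinant.det (Matrix.mat k k (\<lambda>(i,j). A i j))"
proof -
  have "(\<Prod>i=0..<k. r i * c (p i) * A i (p i)) = (\<Prod>i<k. r i) * (\<Prod>i<k. c i) * (\<Prod>i=0..<k. A i (p i))"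
    if p: "p permutes {0..<k}" for p
    using prod.permute[OF p, of c] by (simp add: prod.distrib o_def lessThan_atLeast0)
  then show ?thesis
    unfolding det_mat_expand by (auto simp: sum_distrib_left intro!: sum.cong)
qed

text \<open>The Schur complement of a Cauchy matrix is again a Cauchy matrix up to a factor for each
  row and one for each column, and \<open>det_mat_scale\<close> pulls these out. Iterating produces
  the product over pairs.\<close>

lemma cauchy_det:
  fixes x y :: "nat \<Rightarrow> complex"
  assumes "\<And>i j. i < k \<Longrightarrow> j < k \<Longrightarrow> x i \<noteq> y j"
  shows "Determinant.det (Matrix.mat k k (\<lambda>(i,j). 1 / (x i - y j))) =
    (\<Prod>i<k. 1 / (x i - y i) * (\<Prod>j<i. (x i - x j) * (y j - y i) / ((x i - y j) * (x j - y i))))"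
  using assms
proof (induction k)
  case (Suc k)
  have "Determinant.det (Matrix.mat (Suc k) (Suc k) (\<lambda>(i,j). 1 / (x i - y j))) =
    1 / (x k - y k) * Determinant.det (Matrix.mat k k (\<lambda>(i,j). 1 / (x i - y j) -
        1 / (x i - y k) * (1 / (x k - y j)) / (1 / (x k - y k))))"
    using Suc.prems[of k k] by (intro det_schur) auto
  also have "Matrix.mat k k (\<lambda>(i,j). 1 / (x i - y j) - 1 / (x i - y k) *
      (1 / (x k - y j)) / (1 / (x k - y k)))
     = Matrix.mat k k (\<lambda>(i,j). ((x k - x i) / (x i - y k)) * ((y j - y k) / (x k - y j)) *
       (1 / (x i - y j)))"
  proof (rule eq_matI; clarsimp)
    fix i j assume "i < k" "j < k"
    then have "x i \<noteq> y j" "x i \<noteq> y k" "x k \<noteq> y j" "x k \<noteq> y k" using Suc.prems by auto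
    then have nz: "x i - y j \<noteq> 0" "x i - y k \<noteq> 0" "x k - y j \<noteq> 0" by auto
    show "1 / (x i - y j) - (x k - y k) / ((x i - y k) * (x k - y j)) =
      (x k - x i) * (y j - y k) / ((x i - y k) * (x k - y j) * (x i - y j))"
      using nz by (simp add: divide_simps) (simp add: algebra_simps)
  qed
  also have "Determinant.det \<dots> = (\<Prod>i<k. (x k - x i) / (x i - y k)) *
      (\<Prod>j<k. (y j - y k) / (x k - y j)) *
      Determinant.det (Matrix.mat k k (\<lambda>(i,j). 1 / (x i - y j)))"
    by (rule det_mat_scale)
  also have "(\<Prod>i<k. (x k - x i) / (x i - y k)) * (\<Prod>j<k. (y j - y k) / (x k - y j)) =
     (\<Prod>j<k. (x k - x j) * (y j - y k) / ((x k - y j) * (x j - y k)))"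
    by (simp add: prod.distrib[symmetric] mult_ac)
  also have "Determinant.det (Matrix.mat k k (\<lambda>(i,j). 1 / (x i - y j))) =
    (\<Prod>i<k. 1 / (x i - y i) * (\<Prod>j<i. (x i - x j) * (y j - y i) / ((x i - y j) * (x j - y i))))"
    using Suc by auto
  finally show ?case by (simp add: mult_ac)
qed simp

lemma prod_pairs:
  fixes f :: "nat \<Rightarrow> nat \<Rightarrow> complex"
  shows "(\<Prod>i<k. \<Prod>j\<in>{..<k} - {i}. f i j) = (\<Prod>i<k. \<Prod>j<i. f i j * f j i)"
proof (induction k)
  case (Suc k)
  have "{..<Suc k} - {i} = insert k ({..<k} - {i})" if "i < k" for i using that by auto
  moreover have "{..<Suc k} - {k} = {..<k}" by auto
  ultimately show ?case using Suc by (simp add: prod.distrib mult_ac)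
qed simp

text \<open>Cauchy's formula with second nodes \<open>q * z j\<close>: each pair
  \<open>j < i\<close> contributes one factor \<open>q\<close> from
  \<open>q * z j - q * z i\<close>, together \<open>(\<Prod>i<k. q ^ i)\<close>, and the diagonal
  gives \<open>1 / ((1 - q) * z i)\<close>.\<close>

lemma det_q_cauchy:
  fixes q :: complex
  assumes "\<And>i j. i < k \<Longrightarrow> j < k \<Longrightarrow> z i \<noteq> q * z j" "\<And>i. i < k \<Longrightarrow> z i \<noteq> 0" "q \<noteq> 1"
  shows "Determinant.det (Matrix.mat k k (\<lambda>(i,j). 1 / (q * z j - z i))) =
    (- 1) ^ k * (\<Prod>i<k. q ^ i) / (1 - q) ^ k * pair_prod q {..<k} z * (\<Prod>i<k. 1 / z i)"
proof -
  have "Matrix.mat k k (\<lambda>(i,j). 1 / (q * z j - z i)) =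
      Matrix.mat k k (\<lambda>(i,j). (-1) * 1 * (1 / (z i - q * z j)))"
    by (rule eq_matI) (auto simp: divide_simps)
  then have "Determinant.det (Matrix.mat k k (\<lambda>(i,j). 1 / (q * z j - z i))) =
     (-1) ^ k * Determinant.det (Matrix.mat k k (\<lambda>(i,j). 1 / (z i - q * z j)))"
    by (simp only: det_mat_scale) simp
  also have "Determinant.det (Matrix.mat k k (\<lambda>(i,j). 1 / (z i - q * z j))) =
     (\<Prod>i<k. 1 / (z i - q * z i) * (\<Prod>j<i. (z i - z j) * (q * z j - q * z i) /
       ((z i - q * z j) * (z j - q * z i))))"
    using assms by (intro cauchy_det) auto
  also have "\<dots> = (\<Prod>i<k. 1 / (1 - q) * (1 / z i) *
      (q ^ i * (\<Prod>j<i. (z i - z j) / (z i - q * z j) * ((z j - z i) / (z j - q * z i)))))"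
  proof (intro prod.cong refl arg_cong2[where f = "(*)"])
    fix i show "1 / (z i - q * z i) = 1 / (1 - q) * (1 / z i)" by (simp add: algebra_simps)
    have "(\<Prod>j<i. (z i - z j) * (q * z j - q * z i) / ((z i - q * z j) * (z j - q * z i)))
        = (\<Prod>j<i. q * ((z i - z j) / (z i - q * z j) * ((z j - z i) / (z j - q * z i))))"
      by (intro prod.cong refl) (simp add: right_diff_distrib[symmetric])
    then show "(\<Prod>j<i. (z i - z j) * (q * z j - q * z i) / ((z i - q * z j) * (z j - q * z i)))
        = q ^ i * (\<Prod>j<i. (z i - z j) / (z i - q * z j) * ((z j - z i) / (z j - q * z i)))"
      by (simp only: prod.distrib prod_constant card_lessThan)
  qed
  also have "\<dots> = (1 / (1 - q)) ^ k * (\<Prod>i<k. 1 / z i) * (\<Prod>i<k. q ^ i) *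
      (\<Prod>i<k. \<Prod>j<i. (z i - z j) / (z i - q * z j) * ((z j - z i) / (z j - q * z i)))"
    by (simp only: prod.distrib prod_constant card_lessThan mult_ac)
  also have "(\<Prod>i<k. \<Prod>j<i. (z i - z j) / (z i - q * z j) * ((z j - z i) / (z j - q * z i))) =
      pair_prod q {..<k} z"
    unfolding pair_prod_def by (rule prod_pairs[symmetric])
  finally show ?thesis by (simp add: power_one_over)
qed

subsection \<open>Competing exponential clocks\<close>

abbreviation std_exp :: "real measure" where
  "std_exp \<equiv> density lborel (exponential_density 1)"

lemma prob_space_std_exp: "prob_space std_exp"
  by (rule prob_space_exponential_density) simp

lemma emeasure_std_exp_greaterThan:
  assumes "0 \<le> c"
  shows "emeasure std_exp {c<..} = ennreal (exp (- c))"
proof -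
  interpret prob_space std_exp by (rule prob_space_std_exp)
  have "{c<..} = space std_exp - {..c}" by auto
  then have "prob {c<..} = 1 - prob {..c}" using prob_compl[of "{..c}"] by simp
  also have "prob {..c} = 1 - exp (- c)"
    using emeasure_erlang_density[of 1 0 c] assms by (simp add: measure_def erlang_CDF_def)
  finally show ?thesis by (simp add: emeasure_eq_measure)
qed

lemma product_sigma_finite_std_exp: "product_sigma_finite (\<lambda>_. std_exp)"
  by (rule product_sigma_finite.intro)
    (use prob_space_std_exp in \<open>simp add: prob_space.axioms prob_space_imp_sigma_finite\<close>)

lemma nn_integral_exp_Icc:
  fixes c u :: real
  assumes "0 < c" "0 \<le> u"
  shows "(\<integral>\<^sup>+ v. ennreal (exp (- v * c)) * indicator {0..u} v \<partial>lborel) =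
      ennreal ((1 - exp (- u * c)) / c)"
proof -
  have "(\<integral>\<^sup>+ v. ennreal (exp (- v * c)) * indicator {0..u} v \<partial>lborel) =
     ennreal ((- exp (- u * c) / c) - (- exp (- 0 * c) / c))"
    by (rule nn_integral_FTC_Icc) (use assms in \<open>auto intro!: derivative_eq_intros\<close>)
  also have "(- exp (- u * c) / c) - (- exp (- 0 * c) / c) = (1 - exp (- u * c)) / c"
    by (simp add: diff_divide_distrib)
  finally show ?thesis .
qed

text \<open>Given the value \<open>v\<close> of the clock at \<open>x\<close>, each other clock
  \<open>y\<close> rings later with probability \<open>exp (- r y * v / r x)\<close>. With the
  density of \<open>v\<close> itself this makes \<open>exp (- v * \<Lambda> / r x)\<close>, to be
  integrated over \<open>0 \<le> v \<le> u * r x\<close>.\<close>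

lemma emeasure_first_clock:
  fixes r :: "'i \<Rightarrow> real"
  assumes S: "finite S" "x \<in> S" and r: "\<And>y. y \<in> S \<Longrightarrow> 0 < r y" and u: "0 \<le> u"
  defines "\<Lambda> \<equiv> \<Sum>y\<in>S. r y"
  shows "emeasure (PiM S (\<lambda>_. std_exp))
     {\<eta> \<in> space (PiM S (\<lambda>_. std_exp)). (\<forall>y\<in>S - {x}. \<eta> x / r x < \<eta> y / r y) \<and> \<eta> x / r x \<le> u} =
     ennreal (r x / \<Lambda> * (1 - exp (- \<Lambda> * u)))"
proof -
  interpret product_sigma_finite "\<lambda>_::'i. std_exp" by (rule product_sigma_finite_std_exp)
  define S' where "S' = S - {x}"
  have S': "S = insert x S'" "finite S'" "x \<notin> S'" using S by (auto simp: S'_def)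
  have rx: "0 < r x" using S r by auto
  have \<Lambda>: "0 < \<Lambda>" unfolding \<Lambda>_def using S r by (intro sum_pos) auto
  have \<Lambda>S': "\<Lambda> = r x + (\<Sum>y\<in>S'. r y)" unfolding \<Lambda>_def S'(1) using S' by simp
  let ?P = "PiM S (\<lambda>_. std_exp)" and ?P' = "PiM S' (\<lambda>_. std_exp)"
  let ?D = "{\<eta> \<in> space ?P. (\<forall>y\<in>S'. \<eta> x / r x < \<eta> y / r y) \<and> \<eta> x / r x \<le> u}"
  have D: "?D \<in> sets ?P" unfolding S'(1) using S'(2) by measurable
  have "emeasure ?P ?D = (\<integral>\<^sup>+ \<eta>. indicator ?D \<eta> \<partial>?P)" using D by simp
  also have "\<dots> = (\<integral>\<^sup>+ v. (\<integral>\<^sup>+ \<eta>. indicator ?D (\<eta>(x := v)) \<partial>?P') \<partial>std_exp)"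
    using D unfolding S'(1) by (intro product_nn_integral_insert_rev S') auto
  also have "\<dots> = (\<integral>\<^sup>+ v. indicator {..u * r x} v *
      (\<Prod>y\<in>S'. emeasure std_exp {r y * v / r x<..}) \<partial>std_exp)"
  proof (intro nn_integral_cong)
    fix v :: real
    have "(\<integral>\<^sup>+ \<eta>. indicator ?D (\<eta>(x := v)) \<partial>?P') =
      (\<integral>\<^sup>+ \<eta>. indicator {..u * r x} v * indicator (\<Pi>\<^sub>E y\<in>S'. {r y * v / r x<..}) \<eta> \<partial>?P')"
    proof (intro nn_integral_cong)
      fix \<eta> assume \<eta>: "\<eta> \<in> space ?P'"
      then have "\<eta>(x := v) \<in> space ?P"
        unfolding S'(1) by (auto simp: space_PiM PiE_iff extensional_def)
      moreover have "(\<forall>y\<in>S'. v / r x < \<eta> y / r y) \<longleftrightarrow> \<eta> \<in> (\<Pi>\<^sub>E y\<in>S'. {r y * v / r x<..})"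
      proof -
        have "v / r x < \<eta> y / r y \<longleftrightarrow> r y * v / r x < \<eta> y" if "y \<in> S'" for y
          using r[of y] that rx S'(1) by (simp add: field_simps)
        then show ?thesis using \<eta> by (auto simp: space_PiM PiE_iff)
      qed
      moreover have "(\<forall>y\<in>S'. (\<eta>(x := v)) x / r x < (\<eta>(x := v)) y / r y) \<longleftrightarrow>
          (\<forall>y\<in>S'. v / r x < \<eta> y / r y)"
        using S'(3) by (metis fun_upd_apply)
      moreover have "v / r x \<le> u \<longleftrightarrow> v \<le> u * r x" using rx by (simp add: field_simps)
      ultimately show "indicator ?D (\<eta>(x := v)) =
          (indicator {..u * r x} v * indicator (\<Pi>\<^sub>E y\<in>S'. {r y * v / r x<..}) \<eta> :: ennreal)"
        by (auto simp: indicator_def)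
    qed
    also have "\<dots> = indicator {..u * r x} v * emeasure ?P' (\<Pi>\<^sub>E y\<in>S'. {r y * v / r x<..})"
      using S'(2) by (subst nn_integral_cmult) auto
    also have "emeasure ?P' (\<Pi>\<^sub>E y\<in>S'. {r y * v / r x<..}) =
        (\<Prod>y\<in>S'. emeasure std_exp {r y * v / r x<..})"
      using S'(2) by (subst emeasure_PiM) auto
    finally show "(\<integral>\<^sup>+ \<eta>. indicator ?D (\<eta>(x := v)) \<partial>?P') =
      indicator {..u * r x} v * (\<Prod>y\<in>S'. emeasure std_exp {r y * v / r x<..})" .
  qed
  also have "\<dots> = (\<integral>\<^sup>+ v. ennreal (exponential_density 1 v) *
      (indicator {..u * r x} v * (\<Prod>y\<in>S'. emeasure std_exp {r y * v / r x<..})) \<partial>lborel)"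
  proof (intro nn_integral_density)
    have "(\<lambda>v. emeasure std_exp {c * v<..}) \<in> borel_measurable borel" for c
    proof -
      have E: "sigma_finite_measure std_exp"
        by (intro prob_space_imp_sigma_finite prob_space_std_exp)
      have "emeasure std_exp {c * v<..} = emeasure std_exp (Pair v -` {p. c * fst p < snd p})"
        for v :: real
        by (intro arg_cong[where f = "emeasure std_exp"]) auto
      moreover have "(\<lambda>v. emeasure std_exp (Pair v -` {p::real\<times>real. c * fst p < snd p})) \<in>
          borel_measurable borel"
        proof (intro sigma_finite_measure.measurable_emeasure_Pair[OF E])
          have "{p \<in> space (borel \<Otimes>\<^sub>M std_exp). c * fst p < snd p} \<in> sets (borel \<Otimes>\<^sub>M std_exp)"
            by measurable
          then show "{p. c * fst p < snd p} \<in> sets (borel \<Otimes>\<^sub>M std_exp)"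
            by (simp add: space_pair_measure)
        qed
      ultimately show ?thesis by simp
    qed
    from this[of "r y / r x" for y] have "(\<lambda>v. emeasure std_exp {r y *
        v / r x<..}) \<in> borel_measurable borel" for y
      by simp
    then show "(\<lambda>v. indicator {..u * r x} v *
        (\<Prod>y\<in>S'. emeasure std_exp {r y * v / r x<..})) \<in> borel_measurable lborel"
      by measurable
  qed auto
  also have "\<dots> = (\<integral>\<^sup>+ v. ennreal (exp (- v * (\<Lambda> / r x))) * indicator {0..u * r x} v \<partial>lborel)"
  proof (intro nn_integral_cong)
    fix v :: real
    show "ennreal (exponential_density 1 v) *
      (indicator {..u * r x} v * (\<Prod>y\<in>S'. emeasure std_exp {r y * v / r x<..})) =
      ennreal (exp (- v * (\<Lambda> / r x))) * indicator {0..u * r x} v"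
    proof (cases "0 \<le> v")
      case True
      have "(\<Prod>y\<in>S'. emeasure std_exp {r y * v / r x<..}) =
          (\<Prod>y\<in>S'. ennreal (exp (- (r y * v / r x))))"
      proof (intro prod.cong refl emeasure_std_exp_greaterThan)
        fix y assume "y \<in> S'"
        then have "0 < r y" using r S'(1) by auto
        then show "0 \<le> r y * v / r x" using True rx by simp
      qed
      also have "\<dots> = ennreal (exp (- (\<Sum>y\<in>S'. r y) * v / r x))"
      proof -
        have "(\<Prod>y\<in>S'. exp (- (r y * v / r x))) = exp (\<Sum>y\<in>S'. - (r y * v / r x))"
          using S'(2) by (rule exp_sum[symmetric])
        also have "(\<Sum>y\<in>S'. - (r y * v / r x)) = - (\<Sum>y\<in>S'. r y) * v / r x"
          by (simp add: sum_negf sum_distrib_right[symmetric] sum_divide_distrib[symmetric])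
        finally show ?thesis by (simp add: prod_ennreal)
      qed
      finally have *: "(\<Prod>y\<in>S'. emeasure std_exp {r y * v / r x<..}) =
          ennreal (exp (- (\<Sum>y\<in>S'. r y) * v / r x))" .
      have "- v + - s * v / r x = - v * ((r x + s) / r x)" for s
        using rx by (simp add: field_simps)
      then have "exp (- v) * exp (- (\<Sum>y\<in>S'. r y) * v / r x) = exp (- v * (\<Lambda> / r x))"
        unfolding exp_add[symmetric] \<Lambda>S' by (rule arg_cong)
      then show ?thesis unfolding * using True
        by (simp add: exponential_density_def indicator_def ennreal_mult[symmetric])
    qed (auto simp: exponential_density_def)
  qed
  also have "\<dots> = ennreal ((1 - exp (- (u * r x) * (\<Lambda> / r x))) / (\<Lambda> / r x))"
    using \<Lambda> rx u by (intro nn_integral_exp_Icc) auto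
  also have "(1 - exp (- (u * r x) * (\<Lambda> / r x))) / (\<Lambda> / r x) = r x / \<Lambda> * (1 - exp (- \<Lambda> * u))"
    using rx by (simp add: mult_ac)
  finally show ?thesis unfolding S'_def .
qed

context
  fixes S :: "'i set" and r :: "'i \<Rightarrow> real" and \<Lambda> :: real
  assumes S: "finite S" "S \<noteq> {}" and r: "\<And>y. y \<in> S \<Longrightarrow> 0 < r y" and \<Lambda>: "\<Lambda> = (\<Sum>y\<in>S. r y)"
begin

interpretation P: prob_space "PiM S (\<lambda>_. std_exp)"
  by (intro prob_space_PiM prob_space_std_exp)

private definition "win x = {\<eta> \<in> space (PiM S (\<lambda>_. std_exp)). \<forall>y\<in>S - {x}. \<eta> x / r x < \<eta> y / r y}"

private lemma win_sets [measurable]: "x \<in> S \<Longrightarrow> win x \<in> sets (PiM S (\<lambda>_. std_exp))"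
proof -
  assume [measurable]: "x \<in> S"
  have [measurable]: "finite (S - {x})" "\<And>y. y \<in> S - {x} \<Longrightarrow> y \<in> S" using S by auto
  show ?thesis unfolding win_def by measurable
qed

private lemma \<Lambda>_pos: "0 < \<Lambda>" unfolding \<Lambda> using S r by (intro sum_pos) auto

private lemma win_prob:
  assumes "x \<in> S" "0 \<le> u"
  shows "P.prob {\<eta> \<in> win x. \<eta> x / r x \<le> u} = r x / \<Lambda> * (1 - exp (- \<Lambda> * u))"
proof -
  have "{\<eta> \<in> win x. \<eta> x / r x \<le> u} = {\<eta> \<in> space (PiM S (\<lambda>_. std_exp)).
      (\<forall>y\<in>S - {x}. \<eta> x / r x < \<eta> y / r y) \<and> \<eta> x / r x \<le> u}"
    by (auto simp: win_def)
  moreover have "0 \<le> r x / \<Lambda> * (1 - exp (- \<Lambda> * u))"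
    using \<Lambda>_pos assms r[of x] by (intro mult_nonneg_nonneg) auto
  ultimately show ?thesis
    using emeasure_first_clock[of S x r u] S assms r by (simp add: P.emeasure_eq_measure \<Lambda>)
qed

private lemma win_disjoint: "x \<in> S \<Longrightarrow> y \<in> S \<Longrightarrow> x \<noteq> y \<Longrightarrow> win x \<inter> win y = {}"
proof -
  assume xy: "x \<in> S" "y \<in> S" "x \<noteq> y"
  have False if "\<eta> \<in> win x" "\<eta> \<in> win y" for \<eta>
  proof -
    have "\<eta> x / r x < \<eta> y / r y" "\<eta> y / r y < \<eta> x / r x" using that xy by (auto simp: win_def)
    then show False by simp
  qed
  then show ?thesis by auto
qed

text \<open>That ties are negligible follows from the probabilities alone: the events
  \<open>win x\<close> are disjoint, and by time \<open>n\<close> their probabilities already add up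
  to \<open>1 - exp (- \<Lambda> * n)\<close>, which tends to \<open>1\<close>.\<close>

private lemma win_cover: "AE \<eta> in PiM S (\<lambda>_. std_exp). \<eta> \<in> (\<Union>x\<in>S. win x)"
proof -
  have meas: "(\<Union>x\<in>S. win x) \<in> P.events" using S by auto
  have "1 - exp (- \<Lambda> * real n) \<le> P.prob (\<Union>x\<in>S. win x)" for n :: nat
  proof -
    have "1 - exp (- \<Lambda> * real n) = (\<Sum>x\<in>S. r x / \<Lambda> * (1 - exp (- \<Lambda> * real n)))"
      using \<Lambda>_pos by (simp add: sum_distrib_right[symmetric] sum_divide_distrib[symmetric] \<Lambda>)
    also have "\<dots> = (\<Sum>x\<in>S. P.prob {\<eta> \<in> win x. \<eta> x / r x \<le> real n})"
      by (intro sum.cong refl) (auto simp: win_prob)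
    also have "\<dots> \<le> (\<Sum>x\<in>S. P.prob (win x))"
      by (intro sum_mono P.finite_measure_mono) auto
    also have "\<dots> = P.prob (\<Union>x\<in>S. win x)"
      using S win_disjoint by (intro P.finite_measure_finite_Union[symmetric])
        (auto simp: disjoint_family_on_def)
    finally show ?thesis .
  qed
  moreover have "(\<lambda>n. 1 - exp (- \<Lambda> * real n)) \<longlonglongrightarrow> 1 - 0"
    using \<Lambda>_pos by (intro tendsto_diff tendsto_const) real_asymp
  ultimately have "1 - 0 \<le> P.prob (\<Union>x\<in>S. win x)"
    by (intro LIMSEQ_le_const2[of _ _ "P.prob (\<Union>x\<in>S. win x)"]) auto
  then have "P.prob (\<Union>x\<in>S. win x) = 1" using P.prob_le_1[of "\<Union>x\<in>S. win x"] by linarith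
  then show ?thesis using P.prob_eq_1[OF meas] by simp
qed

private lemma win_arg_min: "x \<in> S \<Longrightarrow> \<eta> \<in> win x \<Longrightarrow> arg_min_on (\<lambda>y. \<eta> y / r y) S = x"
proof -
  assume x: "x \<in> S" "\<eta> \<in> win x"
  let ?m = "arg_min_on (\<lambda>y. \<eta> y / r y) S"
  have m: "?m \<in> S" "\<eta> ?m / r ?m \<le> \<eta> x / r x"
    using arg_min_if_finite(1)[OF S] arg_min_least[OF S x(1), of "\<lambda>y. \<eta> y / r y"] by auto
  show "?m = x"
  proof (rule ccontr)
    assume "?m \<noteq> x"
    then have "\<eta> x / r x < \<eta> ?m / r ?m" using x(2) \<open>?m \<in> S\<close> unfolding win_def by simp
    with \<open>\<eta> ?m / r ?m \<le> \<eta> x / r x\<close> show False by simp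
  qed
qed

text \<open>In case of a tie \<open>arg_min_on\<close> makes an unspecified choice, so the event
  agrees with a sub-event of \<open>win x\<close> only up to a null set. Hence its measurability is
  a hypothesis, which the callers supply.\<close>

lemma prob_first_clock_le:
  assumes x: "x \<in> S" and u: "0 \<le> u"
    and D: "{\<eta> \<in> space (PiM S (\<lambda>_. std_exp)). arg_min_on (\<lambda>y. \<eta> y / r y) S = x \<and>
        \<eta> x / r x \<le> u} \<in> sets (PiM S (\<lambda>_. std_exp))"
  shows "emeasure (PiM S (\<lambda>_. std_exp)) {\<eta> \<in> space (PiM S (\<lambda>_. std_exp)).
      arg_min_on (\<lambda>y. \<eta> y / r y) S = x \<and> \<eta> x / r x \<le> u}
     = ennreal (r x / \<Lambda> * (1 - exp (- \<Lambda> * u)))"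
proof -
  have "emeasure (PiM S (\<lambda>_. std_exp)) {\<eta> \<in> space (PiM S (\<lambda>_. std_exp)).
      arg_min_on (\<lambda>y. \<eta> y / r y) S = x \<and> \<eta> x / r x \<le> u} 
     = emeasure (PiM S (\<lambda>_. std_exp)) {\<eta> \<in> win x. \<eta> x / r x \<le> u}"
  proof (rule emeasure_eq_AE)
    show "AE \<eta> in Pi\<^sub>M S (\<lambda>_. std_exp). (\<eta> \<in> {\<eta> \<in> space (Pi\<^sub>M S (\<lambda>_. std_exp)).
        arg_min_on (\<lambda>y. \<eta> y / r y) S = x \<and> \<eta> x / r x \<le> u}) =
       (\<eta> \<in> {\<eta> \<in> win x. \<eta> x / r x \<le> u})"
      using win_cover by eventually_elim (use x win_arg_min in \<open>auto simp: win_def\<close>)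
    have "{\<eta> \<in> win x. \<eta> x / r x \<le> u} = win x \<inter> {\<eta> \<in> space (Pi\<^sub>M S (\<lambda>_. std_exp)). \<eta> x / r x \<le> u}"
      by (auto simp: win_def)
    then show "{\<eta> \<in> win x. \<eta> x / r x \<le> u} \<in> sets (PiM S (\<lambda>_. std_exp))" using x by simp
  qed (fact D)
  then show ?thesis using win_prob[OF x u] by (simp add: P.emeasure_eq_measure)
qed

text \<open>The complement is the disjoint union over \<open>x\<close> of the events that
  \<open>x\<close> rings first and by time \<open>u\<close>; their probabilities sum to
  \<open>1 - exp (- \<Lambda> * u)\<close>.\<close>

lemma prob_min_clock_gt:
  assumes u: "0 \<le> u"
    and D: "\<And>x. x \<in> S \<Longrightarrow> {\<eta> \<in> space (PiM S (\<lambda>_. std_exp)). arg_min_on (\<lambda>y. \<eta> y / r y) S = x \<and>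
        \<eta> x / r x \<le> u} \<in> sets (PiM S (\<lambda>_. std_exp))"
  defines "site \<equiv> \<lambda>\<eta>. arg_min_on (\<lambda>y. \<eta> y / r y) S"
  shows "emeasure (PiM S (\<lambda>_. std_exp)) {\<eta> \<in> space (PiM S (\<lambda>_. std_exp)).
      u < \<eta> (site \<eta>) / r (site \<eta>)}
     = ennreal (exp (- \<Lambda> * u))"
proof -
  let ?D = "\<lambda>x. {\<eta> \<in> space (PiM S (\<lambda>_. std_exp)). arg_min_on (\<lambda>y. \<eta> y / r y) S = x \<and> \<eta> x / r x \<le> u}"
  have site: "site \<eta> \<in> S" for \<eta> unfolding site_def using S by (intro arg_min_if_finite)
  have "P.prob (\<Union>x\<in>S. ?D x) = (\<Sum>x\<in>S. P.prob (?D x))"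
    using S D by (intro P.finite_measure_finite_Union) (auto simp: disjoint_family_on_def)
  also have "\<dots> = (\<Sum>x\<in>S. r x / \<Lambda> * (1 - exp (- \<Lambda> * u)))"
  proof (intro sum.cong refl)
    fix x assume "x \<in> S"
    then have "0 \<le> r x / \<Lambda> * (1 - exp (- \<Lambda> * u))"
      using \<Lambda>_pos u r[of x] by (intro mult_nonneg_nonneg) auto
    then show "P.prob (?D x) = r x / \<Lambda> * (1 - exp (- \<Lambda> * u))"
      using prob_first_clock_le[OF \<open>x \<in> S\<close> u D[OF \<open>x \<in> S\<close>]] by (simp add: P.emeasure_eq_measure)
  qed
  also have "\<dots> = 1 - exp (- \<Lambda> * u)"
    using \<Lambda>_pos by (simp add: sum_distrib_right[symmetric] sum_divide_distrib[symmetric] \<Lambda>)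
  finally have "P.prob (space (PiM S (\<lambda>_. std_exp)) - (\<Union>x\<in>S. ?D x)) = exp (- \<Lambda> * u)"
    using S D by (subst P.prob_compl) auto
  moreover have "{\<eta> \<in> space (PiM S (\<lambda>_. std_exp)). u < \<eta> (site \<eta>) / r (site \<eta>)} =
      space (PiM S (\<lambda>_. std_exp)) - (\<Union>x\<in>S. ?D x)"
    using site by (auto simp: site_def not_le)
  ultimately show ?thesis by (simp add: P.emeasure_eq_measure)
qed

end

subsection \<open>Reachable configurations\<close>

text \<open>The number of jumps is recorded because each of these sets is finite: expectations of
  functions of the state after \<open>n\<close> jumps become finite sums, and the total rate can be
  bounded in terms of \<open>n\<close>.\<close>

primrec reach :: "nat \<Rightarrow> config set" where
  "reach 0 = {step_initial}"
| "reach (Suc n) = (\<Union>s\<in>reach n. jump_from s ` occupied s)"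

definition good_config :: "nat \<Rightarrow> config \<Rightarrow> bool" where
  "good_config n s \<longleftrightarrow> (\<forall>m\<ge>1. 0 \<le> s m \<and> s m \<le> int n) \<and>
     (\<forall>m m'. 1 \<le> m \<longrightarrow> m \<le> m' \<longrightarrow> s m' \<le> s m) \<and> finite {m. s m \<noteq> 0}"

lemma least_particle:
  assumes "x \<in> occupied s"
  defines "L \<equiv> LEAST m. m \<in> particles_at s x"
  shows "1 \<le> L" "s L = x" "\<And>m. 1 \<le> m \<Longrightarrow> s m = x \<Longrightarrow> L \<le> m"
proof -
  have "\<exists>m. m \<in> particles_at s x" using assms by (auto simp: occupied_def)
  then have "L \<in> particles_at s x" unfolding L_def by (rule LeastI_ex)
  then show "1 \<le> L" "s L = x" by (auto simp: particles_at_def)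
  show "L \<le> m" if "1 \<le> m" "s m = x" for m
    unfolding L_def by (intro Least_le) (use that in \<open>auto simp: particles_at_def\<close>)
qed

text \<open>The jumping particle has the smallest label at its site, so all smaller labels already
  sit at \<open>x + 1\<close> or beyond. This is what keeps the labels ordered from right to
  left.\<close>

lemma good_jump_from:
  assumes "good_config n s" "x \<in> occupied s"
  shows "good_config (Suc n) (jump_from s x)"
proof -
  define L where "L = (LEAST m. m \<in> particles_at s x)"
  note L = least_particle[OF assms(2), folded L_def]
  have jf: "jump_from s x = s(L := x + 1)" by (simp add: jump_from_def L_def)
  have g: "\<And>m. 1 \<le> m \<Longrightarrow> 0 \<le> s m \<and> s m \<le> int n" "\<And>m m'. 1 \<le> m \<Longrightarrow> m \<le> m' \<Longrightarrow> s m' \<le> s m"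
      "finite {m. s m \<noteq> 0}"
    using assms(1) by (auto simp: good_config_def)
  have "finite {m. (s(L := x + 1)) m \<noteq> 0}"
    by (rule finite_subset[of _ "insert L {m. s m \<noteq> 0}"]) (use g(3) in auto)
  moreover have "(s(L := x + 1)) m' \<le> (s(L := x + 1)) m" if "1 \<le> m" "m \<le> m'" for m m'
  proof -
    have "x + 1 \<le> s m" if "1 \<le> m" "m < L" for m
      using g(2)[of m L] L that by (metis add1_zle_eq leD less_imp_le_nat order_le_imp_less_or_eq)
    moreover have "s m' \<le> x" if "L \<le> m'" for m' using g(2)[of L m'] L that by simp
    ultimately show ?thesis using g(2)[OF that] that
      by (cases "m = L"; cases "m' = L") (auto, force)
  qed
  moreover have "0 \<le> (s(L := x + 1)) m \<and> (s(L := x + 1)) m \<le> int (Suc n)" if "1 \<le> m" for m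
    using g(1)[OF that] g(1)[OF L(1)] L(2) by auto
  ultimately show ?thesis unfolding good_config_def jf by blast
qed

lemma reach_good: "s \<in> reach n \<Longrightarrow> good_config n s"
proof (induction n arbitrary: s)
  case 0
  then show ?case by (simp add: good_config_def step_initial_def)
next
  case (Suc n)
  then show ?case using good_jump_from by auto
qed

text \<open>Only finitely many particles have ever left site \<open>0\<close>. Hence it stays
  infinitely occupied, every other site holds finitely many particles, and the set of occupied sites
  is finite and non-empty, so that the minimum over the clocks is attained.\<close>

lemma good_occupied:
  assumes "good_config n s"
  shows "occupied s \<subseteq> {0..int n}" "0 \<in> occupied s" "finite (occupied s)"
    "infinite (particles_at s 0)"
    "\<And>x. x \<noteq> 0 \<Longrightarrow> finite (particles_at s x)"
proof -
  show 1: "occupied s \<subseteq> {0..int n}"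
    using assms by (auto simp: occupied_def particles_at_def good_config_def)
  then show "finite (occupied s)" by (rule finite_subset) simp
  have fin: "finite {m. s m \<noteq> 0}" using assms by (simp add: good_config_def)
  have "particles_at s 0 = - ({m. s m \<noteq> 0} \<union> {0})"
    by (auto simp: particles_at_def)
  then show "infinite (particles_at s 0)" using fin by (simp add: finite_compl)
  then show "0 \<in> occupied s" by (auto simp: occupied_def)
  show "finite (particles_at s x)" if "x \<noteq> 0" for x
    by (rule finite_subset[OF _ fin]) (use that in \<open>auto simp: particles_at_def\<close>)
qed

lemma reach_occupied:
  assumes "s \<in> reach n"
  shows "finite (occupied s)" "occupied s \<noteq> {}" "occupied s \<subseteq> {0..int n}"
  using good_occupied[OF reach_good[OF assms]] by auto

lemma finite_reach: "finite (reach n)"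
  by (induction n) (auto simp: reach_occupied)

lemma reach_Suc: "s \<in> reach n \<Longrightarrow> x \<in> occupied s \<Longrightarrow> jump_from s x \<in> reach (Suc n)"
  by auto

subsection \<open>The jump chain as a random process\<close>

text \<open>The choice made by \<open>arg_min_on\<close> depends on \<open>\<omega>\<close> only
  through the set \<open>B \<omega>\<close> of minimizers. The preimage of \<open>x\<close> is thus
  a finite union over the subsets \<open>C\<close> of \<open>S\<close> from which \<open>x\<close>
  is chosen, and \<open>B \<omega> = C\<close> is a finite combination of inequalities.\<close>

lemma measurable_arg_min_on:
  fixes f :: "'i \<Rightarrow> 'a \<Rightarrow> real"
  assumes S: "finite S" "S \<noteq> {}" and f: "\<And>y. y \<in> S \<Longrightarrow> f y \<in> borel_measurable M"
  shows "(\<lambda>\<omega>. arg_min_on (\<lambda>y. f y \<omega>) S) \<in> M \<rightarrow>\<^sub>M count_space S"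
proof (subst measurable_count_space_eq2[OF S(1)], intro conjI ballI Pi_I)
  show "arg_min_on (\<lambda>y. f y \<omega>) S \<in> S" for \<omega> using S by (rule arg_min_if_finite)
  fix x assume "x \<in> S"
  define B where "B \<omega> = {y \<in> S. \<forall>z\<in>S. f y \<omega> \<le> f z \<omega>}" for \<omega>
  define Cs where "Cs = {C \<in> Pow S. (SOME y. y \<in> C) = x}"
  have am: "arg_min_on (\<lambda>y. f y \<omega>) S = (SOME y. y \<in> B \<omega>)" for \<omega>
    unfolding arg_min_on_def arg_min_def is_arg_min_linorder B_def by (simp add: Ball_def)
  have "(\<lambda>\<omega>. arg_min_on (\<lambda>y. f y \<omega>) S) -` {x} \<inter> space M =
     (\<Union>C\<in>Cs. {\<omega> \<in> space M. \<forall>y\<in>S. y \<in> C \<longleftrightarrow> (\<forall>z\<in>S. f y \<omega> \<le> f z \<omega>)})"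
  proof (rule Set.set_eqI, rule iffI)
    fix \<omega> assume "\<omega> \<in> (\<lambda>\<omega>. arg_min_on (\<lambda>y. f y \<omega>) S) -` {x} \<inter> space M"
    then show "\<omega> \<in> (\<Union>C\<in>Cs. {\<omega> \<in> space M. \<forall>y\<in>S. y \<in> C \<longleftrightarrow> (\<forall>z\<in>S. f y \<omega> \<le> f z \<omega>)})"
      unfolding am by (intro UN_I[of "B \<omega>"]) (auto simp: Cs_def B_def)
  next
    fix \<omega> assume "\<omega> \<in> (\<Union>C\<in>Cs. {\<omega> \<in> space M. \<forall>y\<in>S. y \<in> C \<longleftrightarrow> (\<forall>z\<in>S. f y \<omega> \<le> f z \<omega>)})"
    then obtain C where C: "C \<in> Cs" "\<omega> \<in> space M" "\<forall>y\<in>S. y \<in> C \<longleftrightarrow> (\<forall>z\<in>S. f y \<omega> \<le> f z \<omega>)" by auto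
    then have "B \<omega> = C" by (auto simp: B_def Cs_def)
    then show "\<omega> \<in> (\<lambda>\<omega>. arg_min_on (\<lambda>y. f y \<omega>) S) -` {x} \<inter> space M"
      using C unfolding vimage_def am by (simp add: Cs_def)
  qed
  also have "\<dots> \<in> sets M"
  proof (rule sets.finite_UN)
    show "finite Cs" using S by (simp add: Cs_def)
    fix C assume "C \<in> Cs"
    have "{\<omega> \<in> space M. f y \<omega> \<le> f z \<omega>} \<in> sets M" if "y \<in> S" "z \<in> S" for y z
      using f[OF that(1)] f[OF that(2)] by measurable
    then have 1: "{\<omega> \<in> space M. \<forall>z\<in>S. f y \<omega> \<le> f z \<omega>} \<in> sets M" if "y \<in> S" for y
      using S that by (intro sets.sets_Collect_finite_All) auto
    have "{\<omega> \<in> space M. y \<in> C \<longleftrightarrow> (\<forall>z\<in>S. f y \<omega> \<le> f z \<omega>)} \<in> sets M" if "y \<in> S" for y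
      using 1[OF that] sets.sets_Collect_neg[OF 1[OF that]]
        by (cases "y \<in> C") (auto cong: conj_cong)
    then show "{\<omega> \<in> space M. \<forall>y\<in>S. y \<in> C \<longleftrightarrow> (\<forall>z\<in>S. f y \<omega> \<le> f z \<omega>)} \<in> sets M"
      using S by (intro sets.sets_Collect_finite_All) auto
  qed
  finally show "(\<lambda>\<omega>. arg_min_on (\<lambda>y. f y \<omega>) S) -` {x} \<inter> space M \<in> sets M" .
qed

text \<open>The uniform bound \<open>A\<close> on the rates at the sites \<open>x \<ge> 0\<close> is
  what excludes infinitely many jumps in finite time.\<close>

locale tazrp =
  fixes q :: real and a :: "int \<Rightarrow> real" and A :: real
  assumes q: "0 < q" "q < 1" and a_pos: "\<And>x. 0 < a x" and a_le: "\<And>x. 0 \<le> x \<Longrightarrow> a x \<le> A"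
begin

abbreviation "rate s x \<equiv> jump_rate q a s x"
abbreviation "site \<omega> n s \<equiv> jump_site q a \<omega> n s"
abbreviation "chain \<omega> n \<equiv> jump_chain q a step_initial \<omega> n"
abbreviation "time \<omega> n \<equiv> jump_time q a step_initial \<omega> n"

definition total_rate :: "config \<Rightarrow> real" where
  "total_rate s = (\<Sum>x\<in>occupied s. rate s x)"

lemma rate_pos: "x \<in> occupied s \<Longrightarrow> 0 < rate s x"
  using a_pos[of x] q by (auto simp: jump_rate_def occupied_def card_gt_0_iff power_Suc_less_one intro!: mult_pos_pos power_less_one_iff[THEN iffD2])

lemma rate_le: "0 \<le> x \<Longrightarrow> rate s x \<le> A"
proof -
  assume x: "0 \<le> x"
  have "a x * (1 - q ^ card (particles_at s x)) \<le> a x * 1"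
    using a_pos[of x] q by (intro mult_left_mono) auto
  then show ?thesis using a_le[OF x] by (simp add: jump_rate_def)
qed

lemma total_rate_pos: "s \<in> reach n \<Longrightarrow> 0 < total_rate s"
  unfolding total_rate_def using reach_occupied rate_pos by (intro sum_pos) auto

lemma total_rate_le: "s \<in> reach n \<Longrightarrow> total_rate s \<le> A * real (Suc n)"
proof -
  assume s: "s \<in> reach n"
  have A: "0 \<le> A" using a_pos[of 0] a_le[of 0] by simp
  have "total_rate s \<le> real (card (occupied s)) * A"
    unfolding total_rate_def using reach_occupied[OF s] by (intro sum_bounded_above rate_le) auto
  also have "card (occupied s) \<le> Suc n"
    using card_mono[OF _ reach_occupied(3)[OF s]] by simp
  then have "real (card (occupied s)) * A \<le> real (Suc n) * A" using A
    by (intro mult_right_mono) auto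
  finally show ?thesis by (simp add: mult.commute)
qed

lemma site_occupied: "s \<in> reach n \<Longrightarrow> site \<omega> k s \<in> occupied s"
  unfolding jump_site_def using reach_occupied by (intro arg_min_if_finite) auto

lemma chain_Suc: "chain \<omega> (Suc n) = jump_from (chain \<omega> n) (site \<omega> n (chain \<omega> n))"
  by (simp add: Let_def)

lemma chain_reach: "chain \<omega> n \<in> reach n"
proof (induction n)
  case (Suc n)
  then show ?case by (metis chain_Suc reach_Suc site_occupied)
qed simp

lemma time_Suc: "time \<omega> (Suc n) = time \<omega> n + ring_time q a \<omega> n (chain \<omega> n) (site \<omega> n (chain \<omega> n))"
  by (simp add: jump_time_def Let_def)

lemma time_0 [simp]: "time \<omega> 0 = 0" by (simp add: jump_time_def)

text \<open>The state after \<open>n\<close> jumps is determined by the clock rows below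
  \<open>n\<close>. Together with \<open>time_cong\<close> this makes row \<open>n\<close>
  independent of the past.\<close>

lemma chain_cong: "(\<And>p. fst p < n \<Longrightarrow> \<omega> p = \<omega>' p) \<Longrightarrow> chain \<omega> n = chain \<omega>' n"
proof (induction n)
  case (Suc n)
  have "site \<omega> n s = site \<omega>' n s" for s
  proof -
    have "ring_time q a \<omega> n s = ring_time q a \<omega>' n s"
      using Suc.prems by (auto simp: ring_time_def fun_eq_iff)
    then show ?thesis by (simp add: jump_site_def)
  qed
  then show ?case using Suc by (simp add: chain_Suc del: jump_chain.simps)
qed simp

lemma time_cong: "(\<And>p. fst p < n \<Longrightarrow> \<omega> p = \<omega>' p) \<Longrightarrow> time \<omega> n = time \<omega>' n"
proof (induction n)
  case (Suc n)
  have rt: "ring_time q a \<omega> n s = ring_time q a \<omega>' n s" for s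
      using Suc.prems by (auto simp: ring_time_def fun_eq_iff)
  then have "site \<omega> n s = site \<omega>' n s" for s
    by (simp add: jump_site_def)
  moreover have "chain \<omega> n = chain \<omega>' n" using Suc.prems by (intro chain_cong) auto
  ultimately show ?case using Suc rt by (simp add: time_Suc)
qed simp

lemma site_measurable:
  assumes s: "s \<in> reach m" and K: "{n} \<times> UNIV \<subseteq> K"
  shows "(\<lambda>\<omega>. site \<omega> n s) \<in> PiM K (\<lambda>_. std_exp) \<rightarrow>\<^sub>M count_space (occupied s)"
proof -
  have "(\<lambda>\<omega>. ring_time q a \<omega> n s x) \<in> borel_measurable (PiM K (\<lambda>_. std_exp))" for x
  proof -
    have "(n, x) \<in> K" using K by auto
    then have "(\<lambda>\<omega>. \<omega> (n, x)) \<in> PiM K (\<lambda>_. std_exp) \<rightarrow>\<^sub>M std_exp"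
      by (rule measurable_component_singleton)
    then show ?thesis unfolding ring_time_def by simp
  qed
  then show ?thesis unfolding jump_site_def using reach_occupied[OF s]
    by (intro measurable_arg_min_on) auto
qed

text \<open>The index set \<open>K\<close> is left general because the statement serves both on the
  full \<open>clock_space\<close> and on the product over the rows below a given one, where the past
  lives in \<open>row_split\<close>.\<close>

lemma chain_measurable:
  assumes "{..<n} \<times> UNIV \<subseteq> K"
  shows "(\<lambda>\<omega>. chain \<omega> n) \<in> PiM K (\<lambda>_. std_exp) \<rightarrow>\<^sub>M count_space (reach n)"
  using assms
proof (induction n)
  case (Suc n)
  show ?case unfolding chain_Suc
  proof (rule measurable_compose_countable'[where I = "reach n" and g = "\<lambda>\<omega>. chain \<omega> n"
        and f = "\<lambda>s \<omega>. jump_from s (site \<omega> n s)"])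
    fix s assume s: "s \<in> reach n"
    have "(\<lambda>\<omega>. site \<omega> n s) \<in> PiM K (\<lambda>_. std_exp) \<rightarrow>\<^sub>M count_space (occupied s)"
      using s Suc.prems by (intro site_measurable) auto
    moreover have "jump_from s \<in> count_space (occupied s) \<rightarrow>\<^sub>M count_space (reach (Suc n))"
      using s by auto
    ultimately show "(\<lambda>\<omega>. jump_from s (site \<omega> n s)) \<in> PiM K (\<lambda>_. std_exp) \<rightarrow>\<^sub>M count_space
        (reach (Suc n))"
      by (rule measurable_compose)
  next
    have "{..<n} \<times> UNIV \<subseteq> K" using Suc.prems by fastforce
    then show "(\<lambda>\<omega>. chain \<omega> n) \<in> PiM K (\<lambda>_. std_exp) \<rightarrow>\<^sub>M count_space (reach n)" by (rule Suc.IH)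
  qed (simp add: finite_reach countable_finite)
qed simp

lemma ring_time_site_measurable:
  assumes s: "s \<in> reach m" and K: "{n} \<times> UNIV \<subseteq> K"
  shows "(\<lambda>\<omega>. ring_time q a \<omega> n s (site \<omega> n s)) \<in> borel_measurable (PiM K (\<lambda>_. std_exp))"
proof (rule measurable_compose_countable'[where I = "occupied s"])
  fix x
  have "(n, x) \<in> K" using K by auto
  then have "(\<lambda>\<omega>. \<omega> (n, x)) \<in> PiM K (\<lambda>_. std_exp) \<rightarrow>\<^sub>M std_exp"
    by (rule measurable_component_singleton)
  then show "(\<lambda>\<omega>. ring_time q a \<omega> n s x) \<in> borel_measurable (PiM K (\<lambda>_. std_exp))" 
    unfolding ring_time_def by simp
qed (use site_measurable[OF s K] reach_occupied[OF s] in \<open>auto intro: countable_finite\<close>)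

lemma time_measurable:
  assumes "{..<n} \<times> UNIV \<subseteq> K"
  shows "(\<lambda>\<omega>. time \<omega> n) \<in> borel_measurable (PiM K (\<lambda>_. std_exp))"
  using assms
proof (induction n)
  case (Suc n)
  have K: "{..<n} \<times> UNIV \<subseteq> K" using Suc.prems by fastforce
  have "(\<lambda>\<omega>. ring_time q a \<omega> n (chain \<omega> n) (site \<omega> n (chain \<omega> n))) \<in> borel_measurable
      (PiM K (\<lambda>_. std_exp))"
  proof (rule measurable_compose_countable'[where I = "reach n" and g = "\<lambda>\<omega>. chain \<omega> n"])
    fix s assume "s \<in> reach n"
    then show "(\<lambda>\<omega>. ring_time q a \<omega> n s (site \<omega> n s)) \<in> borel_measurable (PiM K (\<lambda>_. std_exp))"
      using Suc.prems by (intro ring_time_site_measurable) auto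
  qed (use K in \<open>auto intro!: chain_measurable simp: finite_reach countable_finite\<close>)
  moreover have "(\<lambda>\<omega>. time \<omega> n) \<in> borel_measurable (PiM K (\<lambda>_. std_exp))" using K by (rule Suc.IH)
  ultimately show ?case unfolding time_Suc by simp
qed simp

end

section \<open>Independence of the clock rows and the law of a single step\<close>

lemma arg_min_on_cong:
  fixes f g :: "'i \<Rightarrow> real"
  assumes "\<And>x. x \<in> S \<Longrightarrow> f x = g x"
  shows "arg_min_on f S = arg_min_on g S"
proof -
  have "(\<lambda>x. x \<in> S \<and> (\<forall>y. y \<in> S \<longrightarrow> f x \<le> f y)) = (\<lambda>x. x \<in> S \<and> (\<forall>y. y \<in> S \<longrightarrow> g x \<le> g y))"
    using assms by fastforce
  then show ?thesis unfolding arg_min_on_def arg_min_def is_arg_min_linorder by (simp only:)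
qed

lemma AE_std_exp_nonneg: "AE x in std_exp. 0 \<le> x"
  by (subst AE_density) (auto simp: exponential_density_def)

lemma prob_space_clock: "prob_space clock_space"
  unfolding clock_space_def by (intro prob_space_PiM prob_space_std_exp)

interpretation clock: prob_space clock_space
  by (rule prob_space_clock)

lemma AE_clock_nonneg: "AE \<omega> in clock_space. \<forall>p. 0 \<le> \<omega> p"
  unfolding clock_space_def
  by (subst AE_all_countable)
    (intro allI AE_PiM_component[of UNIV] prob_space_std_exp AE_std_exp_nonneg UNIV_I)

lemma indep_vars_coordinates:
  "clock.indep_vars (\<lambda>_. std_exp) (\<lambda>p \<omega>. \<omega> p) UNIV"
proof -
  have rv: "clock.random_variable std_exp (\<lambda>\<omega>. \<omega> p)" for p
    unfolding clock_space_def by (rule measurable_component_singleton) simp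
  have "distr clock_space (\<Pi>\<^sub>M i\<in>UNIV. std_exp) (\<lambda>x. \<lambda>i\<in>UNIV. x i) =
      distr clock_space clock_space (\<lambda>x. x)"
    unfolding clock_space_def by (intro distr_cong) auto
  also have "\<dots> = (\<Pi>\<^sub>M i\<in>UNIV. distr clock_space std_exp (\<lambda>\<omega>. \<omega> i))"
    unfolding clock_space_def
    by (subst distr_PiM_component) (auto intro: prob_space_std_exp simp: distr_id)
  finally show ?thesis using rv
    by (subst clock.indep_vars_iff_distr_eq_PiM) auto
qed

context tazrp
begin

text \<open>The Markov property after \<open>j\<close> jumps. State and time are functions of the
  rows below \<open>j\<close>, hence independent of row \<open>j\<close>; by Fubini that row may be
  replaced by a fresh family of standard exponential variables on the sites occupied in
  \<open>s\<close>.\<close>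

lemma row_split:
  fixes j :: nat
  assumes s: "s \<in> reach j" and D: "D \<in> sets (borel \<Otimes>\<^sub>M PiM (occupied s) (\<lambda>_. std_exp))"
  defines "S \<equiv> occupied s"
  shows "emeasure clock_space {\<omega> \<in> space clock_space. chain \<omega> j = s \<and>
      (time \<omega> j, \<lambda>x\<in>S. \<omega> (j, x)) \<in> D} =
     (\<integral>\<^sup>+ \<omega>. indicator {\<omega>. chain \<omega> j = s} \<omega> *
        emeasure (PiM S (\<lambda>_. std_exp)) {\<eta> \<in> space (PiM S (\<lambda>_. std_exp)).
          (time \<omega> j, \<eta>) \<in> D} \<partial>clock_space)"
proof -
  let ?E = "\<lambda>I. PiM I (\<lambda>_. std_exp)"
  \<comment> \<open>\<open>K\<close> indexes the past and \<open>R\<close> the clocks of row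
    \<open>j\<close> at the occupied sites. The two index sets are disjoint, which gives the
    independence; \<open>row\<close> forgets the first index.\<close>
  define K :: "(nat \<times> int) set" where "K = {..<j} \<times> UNIV"
  define R :: "(nat \<times> int) set" where "R = {j} \<times> S"
  define row where "row = (\<lambda>\<omega> :: nat \<times> int \<Rightarrow> real. \<lambda>x\<in>S. \<omega> (j, x))"
  have "clock.indep_var (?E K) (\<lambda>\<omega>. restrict (\<lambda>p. \<omega> p) K) (?E R) (\<lambda>\<omega>. restrict (\<lambda>p. \<omega> p) R)"
    by (rule clock.indep_var_restrict[OF indep_vars_coordinates]) (auto simp: K_def R_def)
  then have rv [measurable]: "(\<lambda>\<omega>. restrict \<omega> K) \<in> clock_space \<rightarrow>\<^sub>M ?E K"
    "(\<lambda>\<omega>. restrict \<omega> R) \<in> clock_space \<rightarrow>\<^sub>M ?E R"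
    and de: "distr clock_space (?E K) (\<lambda>\<omega>. restrict \<omega> K) \<Otimes>\<^sub>M distr clock_space (?E R)
        (\<lambda>\<omega>. restrict \<omega> R)
      = distr clock_space (?E K \<Otimes>\<^sub>M ?E R) (\<lambda>\<omega>. (restrict \<omega> K, restrict \<omega> R))"
    by (auto simp: clock.indep_var_distribution_eq)
  have row [measurable]: "row \<in> ?E R \<rightarrow>\<^sub>M ?E S"
    unfolding row_def by (intro measurable_restrict measurable_component_singleton)
      (auto simp: R_def)
  have row_restrict: "row (restrict \<omega> R) = row \<omega>" for \<omega>
    by (auto simp: row_def R_def fun_eq_iff)
  have rr: "distr clock_space (?E R) (\<lambda>\<omega>. restrict \<omega> R) = ?E R"
    unfolding clock_space_def using distr_PiM_reindex[of UNIV "\<lambda>_. std_exp" "\<lambda>x. x" R]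
    by (simp add: prob_space_std_exp restrict_def)
  have rd: "distr (?E R) (?E S) row = ?E S"
    unfolding row_def
    by (rule distr_PiM_reindex[of R "\<lambda>_. std_exp" "Pair j" S])
      (auto intro: prob_space_std_exp inj_onI simp: R_def)
  interpret PR: prob_space "?E R" by (intro prob_space_PiM prob_space_std_exp)
  define D' where "D' = {p \<in> space (?E K \<Otimes>\<^sub>M ?E R). chain (fst p) j = s \<and>
      (time (fst p) j, row (snd p)) \<in> D}"
  have [measurable]: "(\<lambda>\<kappa>. chain \<kappa> j) \<in> ?E K \<rightarrow>\<^sub>M count_space (reach j)"
    "(\<lambda>\<kappa>. time \<kappa> j) \<in> borel_measurable (?E K)"
    using chain_measurable[of j K] time_measurable[of j K] by (auto simp: K_def)
  have D'm: "D' \<in> sets (?E K \<Otimes>\<^sub>M ?E R)"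
  proof -
    have "{\<kappa> \<in> space (?E K). chain \<kappa> j = s} \<in> sets (?E K)"
    proof -
      have "(\<lambda>\<kappa>. chain \<kappa> j) -` {s} \<inter> space (?E K) \<in> sets (?E K)"
        using s by (intro measurable_sets[where A = "count_space (reach j)"]) measurable
      then show ?thesis by (simp add: vimage_def Int_def conj_commute)
    qed
    then have 1: "{p \<in> space (?E K \<Otimes>\<^sub>M ?E R). chain (fst p) j = s} \<in> sets (?E K \<Otimes>\<^sub>M ?E R)"
    proof -
      assume *: "{\<kappa> \<in> space (?E K). chain \<kappa> j = s} \<in> sets (?E K)"
      have "fst -` {\<kappa> \<in> space (?E K). chain \<kappa> j = s} \<inter> space (?E K \<Otimes>\<^sub>M ?E R) \<in> sets (?E K \<Otimes>\<^sub>M ?E R)"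
        by (rule measurable_sets[OF measurable_fst *])
      also have "fst -` {\<kappa> \<in> space (?E K). chain \<kappa> j = s} \<inter> space (?E K \<Otimes>\<^sub>M ?E R) =
          {p \<in> space (?E K \<Otimes>\<^sub>M ?E R). chain (fst p) j = s}"
        by (auto simp: space_pair_measure)
      finally show ?thesis .
    qed
    have "(\<lambda>p. (time (fst p) j, row (snd p))) -` D \<inter> space (?E K \<Otimes>\<^sub>M ?E R) \<in> sets (?E K \<Otimes>\<^sub>M ?E R)"
      by (rule measurable_sets[OF _ D[folded S_def]]) measurable
    with 1 have "{p \<in> space (?E K \<Otimes>\<^sub>M ?E R). chain (fst p) j = s} \<inter>
        ((\<lambda>p. (time (fst p) j, row (snd p))) -` D \<inter> space (?E K \<Otimes>\<^sub>M ?E R)) \<in> sets (?E K \<Otimes>\<^sub>M ?E R)"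
      by (rule sets.Int)
    also have "{p \<in> space (?E K \<Otimes>\<^sub>M ?E R). chain (fst p) j = s} \<inter>
        ((\<lambda>p. (time (fst p) j, row (snd p))) -` D \<inter> space (?E K \<Otimes>\<^sub>M ?E R)) = D'"
      by (auto simp: D'_def)
    finally show ?thesis .
  qed
  have c: "chain (restrict \<omega> K) j = chain \<omega> j" "time (restrict \<omega> K) j = time \<omega> j" for \<omega>
    by (auto intro!: chain_cong time_cong simp: K_def restrict_def)
  have "emeasure clock_space {\<omega> \<in> space clock_space. chain \<omega> j = s \<and> (time \<omega> j, row \<omega>) \<in> D} =
      emeasure (distr clock_space (?E K \<Otimes>\<^sub>M ?E R) (\<lambda>\<omega>. (restrict \<omega> K, restrict \<omega> R))) D'"
  proof -
    have "(\<lambda>\<omega>. (restrict \<omega> K, restrict \<omega> R)) -` D' \<inter> space clock_space =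
       {\<omega> \<in> space clock_space. chain \<omega> j = s \<and> (time \<omega> j, row \<omega>) \<in> D}"
      using rv[THEN measurable_space] by (auto simp: D'_def c space_pair_measure row_restrict)
    then show ?thesis using D'm by (subst emeasure_distr) auto
  qed
  also have "\<dots> = emeasure (distr clock_space (?E K) (\<lambda>\<omega>. restrict \<omega> K) \<Otimes>\<^sub>M ?E R) D'"
    unfolding de[symmetric] rr ..
  also have "\<dots> = (\<integral>\<^sup>+ \<kappa>. emeasure (?E R) (Pair \<kappa> -` D') \<partial>distr clock_space (?E K)
      (\<lambda>\<omega>. restrict \<omega> K))"
    using D'm by (intro PR.emeasure_pair_measure_alt) (simp cong: sets_pair_measure_cong)
  also have "\<dots> = (\<integral>\<^sup>+ \<omega>. emeasure (?E R) (Pair (restrict \<omega> K) -` D') \<partial>clock_space)"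
    using PR.measurable_emeasure_Pair[OF D'm] by (intro nn_integral_distr rv) simp
  also have "\<dots> = (\<integral>\<^sup>+ \<omega>. indicator {\<omega>. chain \<omega> j = s} \<omega> *
        emeasure (?E S) {\<eta> \<in> space (?E S). (time \<omega> j, \<eta>) \<in> D} \<partial>clock_space)"
  proof (intro nn_integral_cong)
    fix \<omega> assume \<omega>: "\<omega> \<in> space clock_space"
    have "Pair (restrict \<omega> K) -` D' = (if chain \<omega> j = s then
        {\<rho> \<in> space (?E R). (time \<omega> j, row \<rho>) \<in> D} else {})"
      using measurable_space[OF rv(1) \<omega>] by (auto simp: D'_def c space_pair_measure)
    moreover have "emeasure (?E R) {\<rho> \<in> space (?E R). (time \<omega> j, row \<rho>) \<in> D} =
      emeasure (?E S) {\<eta> \<in> space (?E S). (time \<omega> j, \<eta>) \<in> D}"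
    proof -
      have "Pair (time \<omega> j) -` D \<in> sets (?E S)"
        using sets_Pair1[OF D[folded S_def]] .
      moreover have "{\<eta> \<in> space (?E S). (time \<omega> j, \<eta>) \<in> D} = Pair (time \<omega> j) -` D"
        using sets.sets_into_space[OF D[folded S_def]] by (auto simp: space_pair_measure)
      ultimately have "emeasure (distr (?E R) (?E S) row) {\<eta> \<in> space (?E S). (time \<omega> j, \<eta>) \<in> D} =
         emeasure (?E R) (row -` {\<eta> \<in> space (?E S). (time \<omega> j, \<eta>) \<in> D} \<inter> space (?E R))"
        by (intro emeasure_distr) auto
      moreover have "row -` {\<eta> \<in> space (?E S). (time \<omega> j, \<eta>) \<in> D} \<inter> space (?E R) =
          {\<rho> \<in> space (?E R). (time \<omega> j, row \<rho>) \<in> D}"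
        using measurable_space[OF row] by auto
      ultimately show ?thesis unfolding rd by simp
    qed
    ultimately show "emeasure (?E R) (Pair (restrict \<omega> K) -` D') = indicator {\<omega>. chain \<omega> j = s} \<omega> *
        emeasure (?E S) {\<eta> \<in> space (?E S). (time \<omega> j, \<eta>) \<in> D}" by simp
  qed
  finally show ?thesis unfolding row_def .
qed

lemma site_row: "site \<omega> j s = arg_min_on (\<lambda>y. (\<lambda>x\<in>occupied s. \<omega> (j, x)) y / rate s y) (occupied s)"
  unfolding jump_site_def ring_time_def by (rule arg_min_on_cong) simp

lemma row_arg_min_measurable:
  assumes "s \<in> reach j"
  shows "(\<lambda>\<eta>. arg_min_on (\<lambda>y. \<eta> y / rate s y) (occupied s)) \<in> PiM (occupied s) (\<lambda>_. std_exp) \<rightarrow>\<^sub>M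
      count_space (occupied s)"
proof (rule measurable_arg_min_on)
  fix y assume "y \<in> occupied s"
  then have "(\<lambda>\<eta>. \<eta> y) \<in> PiM (occupied s) (\<lambda>_. std_exp) \<rightarrow>\<^sub>M std_exp"
    by (rule measurable_component_singleton)
  then show "(\<lambda>\<eta>. \<eta> y / rate s y) \<in> borel_measurable (PiM (occupied s) (\<lambda>_. std_exp))" by simp
qed (use reach_occupied[OF assms] in auto)

lemma row_arg_min_sets:
  assumes "s \<in> reach j" "x \<in> occupied s"
  shows "{\<eta> \<in> space (PiM (occupied s) (\<lambda>_. std_exp)).
      arg_min_on (\<lambda>y. \<eta> y / rate s y) (occupied s) = x} \<in> sets (PiM (occupied s) (\<lambda>_. std_exp))"
proof -
  have "(\<lambda>\<eta>. arg_min_on (\<lambda>y. \<eta> y / rate s y) (occupied s)) -` {x} \<inter> space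
      (PiM (occupied s) (\<lambda>_. std_exp)) \<in> sets (PiM (occupied s) (\<lambda>_. std_exp))"
    using assms by (intro measurable_sets[OF row_arg_min_measurable]) auto
  then show ?thesis by (simp add: vimage_def Int_def conj_commute)
qed

lemma row_component_measurable:
  assumes "x \<in> occupied s"
  shows "(\<lambda>\<eta>. \<eta> x / rate s x) \<in> borel_measurable (PiM (occupied s) (\<lambda>_. std_exp))"
proof -
  have "(\<lambda>\<eta>. \<eta> x) \<in> PiM (occupied s) (\<lambda>_. std_exp) \<rightarrow>\<^sub>M std_exp" using assms
    by (rule measurable_component_singleton)
  then show ?thesis by simp
qed

lemma row_min_measurable:
  assumes "s \<in> reach j"
  shows "(\<lambda>\<eta>. \<eta> (arg_min_on (\<lambda>y. \<eta> y / rate s y) (occupied s)) / rate s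
      (arg_min_on (\<lambda>y. \<eta> y / rate s y) (occupied s)))
     \<in> borel_measurable (PiM (occupied s) (\<lambda>_. std_exp))"
  by (rule measurable_compose_countable'[where I = "occupied s" and f = "\<lambda>x \<eta>. \<eta> x / rate s x"
        and g = "\<lambda>\<eta>. arg_min_on (\<lambda>y. \<eta> y / rate s y) (occupied s)"])
    (use row_component_measurable row_arg_min_measurable[OF assms] reach_occupied[OF assms] in \<open>auto intro: countable_finite\<close>)

text \<open>By \<open>row_split\<close> this is the probability that the clock at \<open>x\<close>
  is the first to ring within the remaining time \<open>t - time \<omega> j\<close>. The condition
  \<open>time \<omega> j \<le> t\<close> is listed separately because clock values are non-negative,
  and \<open>time\<close> is monotone, only almost surely.\<close>

lemma emeasure_jump:
  assumes s: "s \<in> reach j" and x: "x \<in> occupied s"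
  shows "emeasure clock_space {\<omega> \<in> space clock_space. chain \<omega> j = s \<and> site \<omega> j s = x \<and>
      time \<omega> j \<le> t \<and> time \<omega> (Suc j) \<le> t} =
     (\<integral>\<^sup>+ \<omega>. indicator {\<omega>. chain \<omega> j = s \<and> time \<omega> j \<le> t} \<omega> *
        ennreal (rate s x / total_rate s * (1 - exp
          (- total_rate s * (t - time \<omega> j)))) \<partial>clock_space)"
proof -
  let ?S = "occupied s"
  let ?P = "PiM ?S (\<lambda>_. std_exp)"
  let ?m = "\<lambda>\<eta>. arg_min_on (\<lambda>y. \<eta> y / rate s y) ?S"
  define D where "D = {p \<in> space (borel \<Otimes>\<^sub>M ?P). ?m (snd p) = x \<and> fst p \<le> t \<and>
      snd p x / rate s x \<le> t - fst p}"
  note [measurable] = row_component_measurable[OF x]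
  have "{p \<in> space (borel \<Otimes>\<^sub>M ?P). ?m (snd p) = x} \<in> sets (borel \<Otimes>\<^sub>M ?P)"
  proof -
    have "snd -` {\<eta> \<in> space ?P. ?m \<eta> = x} \<inter> space (borel \<Otimes>\<^sub>M ?P) \<in> sets (borel \<Otimes>\<^sub>M ?P)"
      by (rule measurable_sets[OF measurable_snd row_arg_min_sets[OF s x]])
    also have "snd -` {\<eta> \<in> space ?P. ?m \<eta> = x} \<inter> space (borel \<Otimes>\<^sub>M ?P) =
        {p \<in> space (borel \<Otimes>\<^sub>M ?P). ?m (snd p) = x}"
      by (auto simp: space_pair_measure)
    finally show ?thesis .
  qed
  moreover have "{p \<in> space (borel \<Otimes>\<^sub>M ?P). fst p \<le> t \<and> snd p x / rate s x \<le> t -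
      fst p} \<in> sets (borel \<Otimes>\<^sub>M ?P)"
    by measurable
  ultimately have "{p \<in> space (borel \<Otimes>\<^sub>M ?P). ?m (snd p) = x} \<inter>
      {p \<in> space (borel \<Otimes>\<^sub>M ?P). fst p \<le> t \<and> snd p x / rate s x \<le> t - fst p} \<in> sets (borel \<Otimes>\<^sub>M ?P)"
    by (rule sets.Int)
  also have "{p \<in> space (borel \<Otimes>\<^sub>M ?P). ?m (snd p) = x} \<inter>
      {p \<in> space (borel \<Otimes>\<^sub>M ?P). fst p \<le> t \<and> snd p x / rate s x \<le> t - fst p} = D"
    by (auto simp: D_def)
  finally have D: "D \<in> sets (borel \<Otimes>\<^sub>M ?P)" .
  have "emeasure clock_space {\<omega> \<in> space clock_space. chain \<omega> j = s \<and> site \<omega> j s = x \<and> time \<omega> j \<le> t \<and>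
      time \<omega> (Suc j) \<le> t} =
    emeasure clock_space {\<omega> \<in> space clock_space. chain \<omega> j = s \<and> (time \<omega> j, \<lambda>x\<in>?S. \<omega> (j, x)) \<in> D}"
  proof (intro arg_cong[where f = "emeasure clock_space"] Collect_cong conj_cong refl)
    fix \<omega> assume "\<omega> \<in> space clock_space" and c: "chain \<omega> j = s"
    have "(time \<omega> j, \<lambda>x\<in>?S. \<omega> (j, x)) \<in> space (borel \<Otimes>\<^sub>M ?P)"
      by (auto simp: space_pair_measure space_PiM)
    then have "(time \<omega> j, \<lambda>x\<in>?S. \<omega> (j, x)) \<in> D \<longleftrightarrow> site \<omega> j s = x \<and> time \<omega> j \<le>
        t \<and> \<omega> (j, x) / rate s x \<le> t - time \<omega> j"
      unfolding D_def mem_Collect_eq fst_conv snd_conv site_row[symmetric] using x by simp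
    also have "\<dots> \<longleftrightarrow> site \<omega> j s = x \<and> time \<omega> j \<le> t \<and> time \<omega> (Suc j) \<le> t"
      by (auto simp: time_Suc c ring_time_def)
    finally show "(site \<omega> j s = x \<and> time \<omega> j \<le> t \<and> time \<omega> (Suc j) \<le> t) =
        ((time \<omega> j, \<lambda>x\<in>?S. \<omega> (j, x)) \<in> D)" ..
  qed
  also have "\<dots> = (\<integral>\<^sup>+ \<omega>. indicator {\<omega>. chain \<omega> j = s} \<omega> *
        emeasure ?P {\<eta> \<in> space ?P. (time \<omega> j, \<eta>) \<in> D} \<partial>clock_space)"
    by (rule row_split[OF s D])
  also have "\<dots> = (\<integral>\<^sup>+ \<omega>. indicator {\<omega>. chain \<omega> j = s \<and> time \<omega> j \<le> t} \<omega> *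
        ennreal (rate s x / total_rate s * (1 - exp
          (- total_rate s * (t - time \<omega> j)))) \<partial>clock_space)"
  proof (intro nn_integral_cong)
    fix \<omega>
    have "emeasure ?P {\<eta> \<in> space ?P. (time \<omega> j, \<eta>) \<in> D} =
        ennreal (rate s x / total_rate s * (1 - exp (- total_rate s * (t - time \<omega> j))))"
      if "time \<omega> j \<le> t"
    proof -
      have *: "{\<eta> \<in> space ?P. (time \<omega> j, \<eta>) \<in> D} =
          {\<eta> \<in> space ?P. ?m \<eta> = x \<and> \<eta> x / rate s x \<le> t - time \<omega> j}"
        using that by (auto simp: D_def space_pair_measure)
      have "{\<eta> \<in> space ?P. \<eta> x / rate s x \<le> t - time \<omega> j} \<in> sets ?P" by measurable
      then have "{\<eta> \<in> space ?P. ?m \<eta> = x \<and> \<eta> x / rate s x \<le> t - time \<omega> j} \<in> sets ?P"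
        by (intro sets.sets_Collect_conj row_arg_min_sets[OF s x])
      then show ?thesis unfolding *
        by (intro prob_first_clock_le) (use that x s reach_occupied[OF s] rate_pos in \<open>auto simp: total_rate_def\<close>)
    qed
    moreover have "emeasure ?P {\<eta> \<in> space ?P. (time \<omega> j, \<eta>) \<in> D} = 0" if "\<not> time \<omega> j \<le> t"
    proof -
      have "{\<eta> \<in> space ?P. (time \<omega> j, \<eta>) \<in> D} = {}" using that by (auto simp: D_def)
      then show ?thesis by (simp only: emeasure_empty)
    qed
    ultimately show "indicator {\<omega>. chain \<omega> j = s} \<omega> *
        emeasure ?P {\<eta> \<in> space ?P. (time \<omega> j, \<eta>) \<in> D} =
       indicator {\<omega>. chain \<omega> j = s \<and> time \<omega> j \<le> t} \<omega> *
        ennreal (rate s x / total_rate s * (1 - exp (- total_rate s * (t - time \<omega> j))))"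
      by (cases "time \<omega> j \<le> t") (auto simp: indicator_def)
  qed
  finally show ?thesis .
qed

text \<open>The holding time in \<open>s\<close> is the minimum of the competing clocks, hence
  exponential with the total rate; \<open>row_split\<close> makes it independent of the time at
  which \<open>s\<close> was entered.\<close>

lemma emeasure_wait:
  assumes s: "s \<in> reach j"
  shows "emeasure clock_space {\<omega> \<in> space clock_space. chain \<omega> j = s \<and> time \<omega> j \<le> t \<and>
      t < time \<omega> (Suc j)} =
     (\<integral>\<^sup>+ \<omega>. indicator {\<omega>. chain \<omega> j = s \<and> time \<omega> j \<le> t} \<omega> *
        ennreal (exp (- total_rate s * (t - time \<omega> j))) \<partial>clock_space)"
proof -
  let ?S = "occupied s"
  let ?P = "PiM ?S (\<lambda>_. std_exp)"
  let ?m = "\<lambda>\<eta>. arg_min_on (\<lambda>y. \<eta> y / rate s y) ?S"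
  define D where "D = {p \<in> space (borel \<Otimes>\<^sub>M ?P). fst p \<le> t \<and> t -
      fst p < snd p (?m (snd p)) / rate s (?m (snd p))}"
  note [measurable] = row_min_measurable[OF s]
  have D: "D \<in> sets (borel \<Otimes>\<^sub>M ?P)" unfolding D_def by measurable
  have "emeasure clock_space {\<omega> \<in> space clock_space. chain \<omega> j = s \<and> time \<omega> j \<le> t \<and>
      t < time \<omega> (Suc j)} =
    emeasure clock_space {\<omega> \<in> space clock_space. chain \<omega> j = s \<and> (time \<omega> j, \<lambda>x\<in>?S. \<omega> (j, x)) \<in> D}"
  proof (intro arg_cong[where f = "emeasure clock_space"] Collect_cong conj_cong refl)
    fix \<omega> assume "\<omega> \<in> space clock_space" and c: "chain \<omega> j = s"
    have "(time \<omega> j, \<lambda>x\<in>?S. \<omega> (j, x)) \<in> space (borel \<Otimes>\<^sub>M ?P)"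
      by (auto simp: space_pair_measure space_PiM)
    then have "(time \<omega> j, \<lambda>x\<in>?S. \<omega> (j, x)) \<in> D \<longleftrightarrow> time \<omega> j \<le> t \<and> t - time \<omega> j <
        \<omega> (j, site \<omega> j s) / rate s (site \<omega> j s)"
      unfolding D_def mem_Collect_eq fst_conv snd_conv site_row[symmetric] using site_occupied[OF s]
        by simp
    also have "\<dots> \<longleftrightarrow> time \<omega> j \<le> t \<and> t < time \<omega> (Suc j)"
      by (auto simp: time_Suc c ring_time_def)
    finally show "(time \<omega> j \<le> t \<and> t < time \<omega> (Suc j)) = ((time \<omega> j, \<lambda>x\<in>?S. \<omega> (j, x)) \<in> D)" ..
  qed
  also have "\<dots> = (\<integral>\<^sup>+ \<omega>. indicator {\<omega>. chain \<omega> j = s} \<omega> *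
        emeasure ?P {\<eta> \<in> space ?P. (time \<omega> j, \<eta>) \<in> D} \<partial>clock_space)"
    by (rule row_split[OF s D])
  also have "\<dots> = (\<integral>\<^sup>+ \<omega>. indicator {\<omega>. chain \<omega> j = s \<and> time \<omega> j \<le> t} \<omega> *
        ennreal (exp (- total_rate s * (t - time \<omega> j))) \<partial>clock_space)"
  proof (intro nn_integral_cong)
    fix \<omega>
    have "emeasure ?P {\<eta> \<in> space ?P. (time \<omega> j, \<eta>) \<in> D} =
        ennreal (exp (- total_rate s * (t - time \<omega> j)))"
      if "time \<omega> j \<le> t"
    proof -
      have *: "{\<eta> \<in> space ?P. (time \<omega> j, \<eta>) \<in> D} =
          {\<eta> \<in> space ?P. t - time \<omega> j < \<eta> (?m \<eta>) / rate s (?m \<eta>)}"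
        using that by (auto simp: D_def space_pair_measure)
      have "{\<eta> \<in> space ?P. ?m \<eta> = x \<and> \<eta> x / rate s x \<le> t - time \<omega> j} \<in> sets ?P" if x: "x \<in> ?S" for x
      proof -
        note [measurable] = row_component_measurable[OF x]
        have "{\<eta> \<in> space ?P. \<eta> x / rate s x \<le> t - time \<omega> j} \<in> sets ?P" by measurable
        then show ?thesis by (intro sets.sets_Collect_conj row_arg_min_sets[OF s x])
      qed
      then show ?thesis unfolding *
        by (intro prob_min_clock_gt) (use that s reach_occupied[OF s] rate_pos in \<open>auto simp: total_rate_def\<close>)
    qed
    moreover have "emeasure ?P {\<eta> \<in> space ?P. (time \<omega> j, \<eta>) \<in> D} = 0" if "\<not> time \<omega> j \<le> t"
    proof -
      have "{\<eta> \<in> space ?P. (time \<omega> j, \<eta>) \<in> D} = {}" using that by (auto simp: D_def)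
      then show ?thesis by (simp only: emeasure_empty)
    qed
    ultimately show "indicator {\<omega>. chain \<omega> j = s} \<omega> *
        emeasure ?P {\<eta> \<in> space ?P. (time \<omega> j, \<eta>) \<in> D} =
       indicator {\<omega>. chain \<omega> j = s \<and> time \<omega> j \<le> t} \<omega> *
        ennreal (exp (- total_rate s * (t - time \<omega> j)))"
      by (cases "time \<omega> j \<le> t") (auto simp: indicator_def)
  qed
  finally show ?thesis .
qed

end

section \<open>Occupation and jump probabilities after a given number of jumps\<close>

context tazrp
begin

lemma clock_measurable [measurable]:
  "(\<lambda>\<omega>. time \<omega> n) \<in> borel_measurable clock_space"
  "(\<lambda>\<omega>. chain \<omega> n) \<in> clock_space \<rightarrow>\<^sub>M count_space (reach n)"
  unfolding clock_space_def by (intro time_measurable chain_measurable; simp)+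

lemma chain_fun_measurable [measurable]:
  "(\<lambda>\<omega>. F (chain \<omega> n)) \<in> clock_space \<rightarrow>\<^sub>M count_space UNIV"
  by (rule measurable_compose[OF clock_measurable(2)]) simp

lemma chain_fun_borel [measurable]:
  fixes F :: "config \<Rightarrow> real"
  shows "(\<lambda>\<omega>. F (chain \<omega> n)) \<in> borel_measurable clock_space"
  by (rule measurable_compose[OF clock_measurable(2)]) simp

lemma site_chain_sets [measurable]:
  "Measurable.pred clock_space (\<lambda>\<omega>. chain \<omega> j = s \<and> site \<omega> j s = x)"
proof (cases "s \<in> reach j \<and> x \<in> occupied s")
  case True
  have "(\<lambda>\<omega>. site \<omega> j s) \<in> clock_space \<rightarrow>\<^sub>M count_space (occupied s)"
    unfolding clock_space_def using True by (intro site_measurable) auto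
  then have "(\<lambda>\<omega>. site \<omega> j s = x) \<in> clock_space \<rightarrow>\<^sub>M count_space UNIV"
    by (rule measurable_compose) simp
  then show ?thesis by measurable
next
  case False
  then have "(\<lambda>\<omega>. chain \<omega> j = s \<and> site \<omega> j s = x) = (\<lambda>\<omega>. False)"
    by (intro ext) (metis chain_reach site_occupied)
  then show ?thesis by simp
qed

lemma AE_time_mono: "AE \<omega> in clock_space. mono (time \<omega>)"
  using AE_clock_nonneg
proof eventually_elim
  fix \<omega> :: "nat \<times> int \<Rightarrow> real" assume \<omega>: "\<forall>p. 0 \<le> \<omega> p"
  show "mono (time \<omega>)"
  proof (rule incseq_SucI)
    fix n
    have "0 < rate (chain \<omega> n) (site \<omega> n (chain \<omega> n))"
      by (intro rate_pos site_occupied[OF chain_reach])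
    then show "time \<omega> n \<le> time \<omega> (Suc n)"
      using \<omega> by (simp add: time_Suc ring_time_def divide_nonneg_pos)
  qed
qed

lemma AE_time_nonneg: "AE \<omega> in clock_space. 0 \<le> time \<omega> n"
  using AE_time_mono by eventually_elim (metis mono_def time_0 zero_le)

definition occ_prob :: "nat \<Rightarrow> config \<Rightarrow> real \<Rightarrow> real" where
  "occ_prob j s t = clock.prob {\<omega> \<in> space clock_space. chain \<omega> j = s \<and> time \<omega> j \<le> t \<and>
      t < time \<omega> (Suc j)}"

definition jump_prob :: "nat \<Rightarrow> config \<Rightarrow> int \<Rightarrow> real \<Rightarrow> real" where
  "jump_prob j s x t = clock.prob {\<omega> \<in> space clock_space. chain \<omega> j = s \<and> site \<omega> j s = x \<and>
      time \<omega> (Suc j) \<le> t}"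

lemma occ_prob_bounds: "0 \<le> occ_prob j s t" "occ_prob j s t \<le> 1"
  by (auto simp: occ_prob_def)

text \<open>The defining event varies with \<open>t\<close>. \<open>emeasure_wait\<close> turns its
  probability into an integral over the clocks whose integrand is jointly measurable in
  \<open>t\<close> and \<open>\<omega>\<close>, so that measurability in \<open>t\<close> follows
  from Fubini.\<close>

lemma occ_prob_measurable [measurable]:
  assumes s: "s \<in> reach j"
  shows "occ_prob j s \<in> borel_measurable borel"
proof -
  have "occ_prob j s t = enn2real (\<integral>\<^sup>+ \<omega>. indicator {\<omega>\<in>space clock_space. chain \<omega> j = s} \<omega> *
      indicator {0..} (t - time \<omega> j) *
        ennreal (exp (- total_rate s * (t - time \<omega> j))) \<partial>clock_space)" for t
    unfolding occ_prob_def measure_def emeasure_wait[OF s]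
    by (intro arg_cong[where f = enn2real] nn_integral_cong) (auto simp: indicator_def)
  then have "occ_prob j s = (\<lambda>t. enn2real (\<integral>\<^sup>+ \<omega>. indicator {\<omega>\<in>space clock_space. chain \<omega> j = s} \<omega> *
      indicator {0..} (t - time \<omega> j) *
        ennreal (exp (- total_rate s * (t - time \<omega> j))) \<partial>clock_space))" by auto
  also have "\<dots> \<in> borel_measurable borel"
    by (intro measurable_compose[OF _ borel_measurable_enn2real] clock.borel_measurable_nn_integral) measurable
  finally show ?thesis .
qed

lemma integrable_occ_prob:
  assumes "s \<in> reach j"
  shows "integrable lborel (\<lambda>r. indicator {0..t} r * occ_prob j s r)"
proof (rule Bochner_Integration.integrable_bound[where f = "indicator {0..t} :: real \<Rightarrow> real"])
  show "(\<lambda>r. indicator {0..t} r * occ_prob j s r) \<in> borel_measurable lborel"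
    using occ_prob_measurable[OF assms] by measurable
qed (auto simp: indicator_def occ_prob_bounds integrable_indicator_iff emeasure_lborel_Icc_eq)

text \<open>While the chain sits in \<open>s\<close>, it jumps from \<open>x\<close> at rate
  \<open>rate s x\<close>; this is the time-integrated form. Both sides are expectations over the
  entry time \<open>T\<close> of \<open>s\<close>, matched by the fact that
  \<open>(1 - exp (- lam * (t - T))) / lam\<close> is the integral of
  \<open>exp (- lam * (v - T))\<close> over \<open>T \<le> v \<le> t\<close>.\<close>

lemma jump_prob_eq:
  assumes s: "s \<in> reach j" and x: "x \<in> occupied s" and t: "0 \<le> t"
  shows "jump_prob j s x t = rate s x * (\<integral>r. indicator {0..t} r * occ_prob j s r \<partial>lborel)"
proof -
  define lam where "lam = total_rate s"
  have lam: "0 < lam" using total_rate_pos[OF s] by (simp add: lam_def)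
  have r: "0 < rate s x" using rate_pos[OF x] .
  define Cs where "Cs = {\<omega> \<in> space clock_space. chain \<omega> j = s}"
  have [measurable]: "Cs \<in> sets clock_space" unfolding Cs_def by measurable
  define f where "f v \<omega> = indicator Cs \<omega> * (indicator {0..t} v * indicator {0..} (v - time \<omega> j) *
      ennreal (exp (- lam * (v - time \<omega> j))))" for v \<omega>
  interpret pair_sigma_finite lborel clock_space
    by (intro pair_sigma_finite.intro sigma_finite_lborel prob_space_imp_sigma_finite prob_space_clock)
  have "ennreal (jump_prob j s x t) = emeasure clock_space {\<omega> \<in> space clock_space. chain \<omega> j = s \<and>
      site \<omega> j s = x \<and> time \<omega> j \<le> t \<and> time \<omega> (Suc j) \<le> t}"
    unfolding jump_prob_def clock.emeasure_eq_measure[symmetric]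
  proof (rule emeasure_eq_AE)
    show "AE \<omega> in clock_space.
       (\<omega> \<in> {\<omega> \<in> space clock_space. chain \<omega> j = s \<and> site \<omega> j s = x \<and> time \<omega> (Suc j) \<le> t}) =
       (\<omega> \<in> {\<omega> \<in> space clock_space. chain \<omega> j = s \<and> site \<omega> j s = x \<and> time \<omega> j \<le> t \<and> time \<omega>
         (Suc j) \<le> t})"
      using AE_time_mono
    proof eventually_elim
      case (elim \<omega>)
      then have "time \<omega> j \<le> time \<omega> (Suc j)" by (auto simp: mono_def)
      then show ?case by auto
    qed
    have "{\<omega> \<in> space clock_space. (chain \<omega> j = s \<and> site \<omega> j s = x) \<and>
        time \<omega> (Suc j) \<le> t} \<in> sets clock_space"
      "{\<omega> \<in> space clock_space. (chain \<omega> j = s \<and> site \<omega> j s = x) \<and> time \<omega> j \<le> t \<and>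
          time \<omega> (Suc j) \<le> t} \<in> sets clock_space"
      by measurable
    then show "{\<omega> \<in> space clock_space. chain \<omega> j = s \<and> site \<omega> j s = x \<and>
        time \<omega> (Suc j) \<le> t} \<in> sets clock_space"
      "{\<omega> \<in> space clock_space. chain \<omega> j = s \<and> site \<omega> j s = x \<and> time \<omega> j \<le> t \<and>
          time \<omega> (Suc j) \<le> t} \<in> sets clock_space"
      by (simp_all only: conj_assoc)
  qed
  also have "\<dots> = (\<integral>\<^sup>+ \<omega>. indicator {\<omega>. chain \<omega> j = s \<and> time \<omega> j \<le> t} \<omega> *
        ennreal (rate s x / lam * (1 - exp (- lam * (t - time \<omega> j)))) \<partial>clock_space)"
    unfolding lam_def by (rule emeasure_jump[OF s x])
  also have "\<dots> = (\<integral>\<^sup>+ \<omega>. ennreal (rate s x) * (\<integral>\<^sup>+ v. f v \<omega> \<partial>lborel) \<partial>clock_space)"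
  proof (rule nn_integral_cong_AE)
    show "AE \<omega> in clock_space. indicator {\<omega>. chain \<omega> j = s \<and> time \<omega> j \<le> t} \<omega> *
        ennreal (rate s x / lam * (1 - exp (- lam * (t - time \<omega> j)))) = ennreal (rate s x) *
          (\<integral>\<^sup>+ v. f v \<omega> \<partial>lborel)"
      using AE_time_nonneg[of j] AE_space
    proof eventually_elim
      case (elim \<omega>)
      define T where "T = time \<omega> j"
      have "(\<integral>\<^sup>+ v. f v \<omega> \<partial>lborel) = indicator {\<omega>. chain \<omega> j = s \<and> time \<omega> j \<le> t} \<omega> *
          ennreal ((1 - exp (- lam * (t - T))) / lam)"
      proof (cases "chain \<omega> j = s \<and> T \<le> t")
        case True
        have "(\<integral>\<^sup>+ v. f v \<omega> \<partial>lborel) = (\<integral>\<^sup>+ v. ennreal (exp (- lam * (v - T))) *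
            indicator {T..t} v \<partial>lborel)"
          using True elim by (intro nn_integral_cong) (auto simp: f_def indicator_def Cs_def T_def)
        also have "\<dots> = ennreal (- exp (- lam * (t - T)) / lam - (- exp (- lam * (T - T)) / lam))"
          by (rule nn_integral_FTC_Icc) (use True lam in \<open>auto intro!: derivative_eq_intros\<close>)
        also have "- exp (- lam * (t - T)) / lam - (- exp (- lam * (T - T)) / lam) =
            (1 - exp (- lam * (t - T))) / lam"
          by (simp add: diff_divide_distrib)
        finally show ?thesis using True by (simp add: T_def)
      next
        case False
        then have "f v \<omega> = 0" for v by (auto simp: f_def indicator_def Cs_def T_def)
        then show ?thesis using False by (simp add: T_def)
      qed
      moreover have "ennreal (rate s x / lam * (1 - exp (- lam * (t - T)))) =
          ennreal (rate s x) * ennreal ((1 - exp (- lam * (t - T))) / lam)"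
        if "T \<le> t" using r lam that by (subst ennreal_mult[symmetric]) (auto simp: mult_ac)
      ultimately show ?case by (auto simp: T_def indicator_def)
    qed
  qed
  also have "\<dots> = ennreal (rate s x) * (\<integral>\<^sup>+ \<omega>. (\<integral>\<^sup>+ v. f v \<omega> \<partial>lborel) \<partial>clock_space)"
    unfolding f_def by (intro nn_integral_cmult) measurable
  also have "(\<integral>\<^sup>+ \<omega>. (\<integral>\<^sup>+ v. f v \<omega> \<partial>lborel) \<partial>clock_space) =
      (\<integral>\<^sup>+ v. (\<integral>\<^sup>+ \<omega>. f v \<omega> \<partial>clock_space) \<partial>lborel)"
    by (rule Fubini') (simp add: f_def, measurable)
  also have "\<dots> = (\<integral>\<^sup>+ v. ennreal (indicator {0..t} v * occ_prob j s v) \<partial>lborel)"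
  proof (rule nn_integral_cong)
    fix v
    have "(\<integral>\<^sup>+ \<omega>. f v \<omega> \<partial>clock_space) = (\<integral>\<^sup>+ \<omega>. indicator {0..t} v *
        (indicator {\<omega>. chain \<omega> j = s \<and> time \<omega> j \<le> v} \<omega> *
        ennreal (exp (- lam * (v - time \<omega> j)))) \<partial>clock_space)"
      by (intro nn_integral_cong) (auto simp: f_def Cs_def indicator_def)
    also have "\<dots> = (if v \<in> {0..t} then emeasure clock_space {\<omega> \<in> space clock_space. chain \<omega> j = s \<and>
        time \<omega> j \<le> v \<and> v < time \<omega> (Suc j)} else 0)"
      unfolding emeasure_wait[OF s] lam_def by simp
    also have "\<dots> = ennreal (indicator {0..t} v * occ_prob j s v)"
      by (simp add: occ_prob_def clock.emeasure_eq_measure)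
    finally show "(\<integral>\<^sup>+ \<omega>. f v \<omega> \<partial>clock_space) = ennreal (indicator {0..t} v * occ_prob j s v)" .
  qed
  also have "\<dots> = ennreal (\<integral>r. indicator {0..t} r * occ_prob j s r \<partial>lborel)"
    by (rule nn_integral_eq_integral[OF integrable_occ_prob[OF s]]) (auto simp: occ_prob_bounds)
  finally have "ennreal (jump_prob j s x t) =
      ennreal (rate s x * (\<integral>r. indicator {0..t} r * occ_prob j s r \<partial>lborel))"
    using r by (subst ennreal_mult) (auto intro!: Bochner_Integration.integral_nonneg simp: occ_prob_bounds)
  then show ?thesis
    using r by (subst (asm) ennreal_inj) (auto simp: jump_prob_def intro!: mult_nonneg_nonneg Bochner_Integration.integral_nonneg simp: occ_prob_bounds)
qed

definition alive_mean :: "nat \<Rightarrow> (config \<Rightarrow> real) \<Rightarrow> real \<Rightarrow> real" where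
  "alive_mean n F t = (\<integral>\<omega>. F (chain \<omega> n) * indicator {\<omega>. time \<omega> n \<le> t} \<omega> \<partial>clock_space)"

definition stage_mean :: "nat \<Rightarrow> (config \<Rightarrow> real) \<Rightarrow> real \<Rightarrow> real" where
  "stage_mean n F t = (\<integral>\<omega>. F (chain \<omega> n) * indicator {\<omega>. time \<omega> n \<le> t \<and>
      t < time \<omega> (Suc n)} \<omega> \<partial>clock_space)"

text \<open>The generator of the process. Its sum is over a finite set for reachable configurations,
  and only there are its values used.\<close>

definition gen :: "(config \<Rightarrow> real) \<Rightarrow> config \<Rightarrow> real" where
  "gen F s = (\<Sum>x\<in>occupied s. rate s x * (F (jump_from s x) - F s))"

lemma integrable_chain:
  fixes F :: "config \<Rightarrow> real"
  assumes "E \<in> sets clock_space"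
  shows "integrable clock_space (\<lambda>\<omega>. F (chain \<omega> n) * indicator E \<omega>)"
proof (rule clock.integrable_const_bound[where B = "\<Sum>s\<in>reach n. \<bar>F s\<bar>"])
  have "\<bar>F (chain \<omega> n)\<bar> \<le> (\<Sum>s\<in>reach n. \<bar>F s\<bar>)" for \<omega>
    by (rule member_le_sum[OF chain_reach]) (auto simp: finite_reach)
  then show "AE \<omega> in clock_space. norm (F (chain \<omega> n) * indicator E \<omega>) \<le> (\<Sum>s\<in>reach n. \<bar>F s\<bar>)"
    by (auto simp: indicator_def intro!: sum_nonneg AE_I2)
qed (use assms in measurable)

lemma stage_mean_eq: "stage_mean n F t = (\<Sum>s\<in>reach n. F s * occ_prob n s t)"
proof -
  have "F (chain \<omega> n) * indicator {\<omega>. time \<omega> n \<le> t \<and> t < time \<omega> (Suc n)} \<omega> =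
     (\<Sum>s\<in>reach n. F s * indicator {\<omega> \<in> space clock_space. chain \<omega> n = s \<and> time \<omega> n \<le> t \<and> t < time \<omega>
       (Suc n)} \<omega>)"
    if "\<omega> \<in> space clock_space" for \<omega>
  proof -
    have "(\<Sum>s\<in>reach n. F s * indicator {\<omega> \<in> space clock_space. chain \<omega> n = s \<and> time \<omega> n \<le> t \<and>
        t < time \<omega> (Suc n)} \<omega>) =
      (\<Sum>s\<in>reach n. if s = chain \<omega> n then F s * indicator {\<omega>. time \<omega> n \<le> t \<and> t < time \<omega>
        (Suc n)} \<omega> else 0)"
      using that by (intro sum.cong) (auto simp: indicator_def)
    then show ?thesis using chain_reach[of \<omega> n] by (simp add: finite_reach)
  qed
  then have "stage_mean n F t = (\<integral>\<omega>. (\<Sum>s\<in>reach n. F s *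
      indicator {\<omega> \<in> space clock_space. chain \<omega> n = s \<and> time \<omega> n \<le> t \<and> t < time \<omega>
    (Suc n)} \<omega>) \<partial>clock_space)"
    unfolding stage_mean_def by (intro Bochner_Integration.integral_cong) auto
  also have "\<dots> = (\<Sum>s\<in>reach n. F s * occ_prob n s t)"
    unfolding occ_prob_def by (subst Bochner_Integration.integral_sum)
      (auto simp: clock.emeasure_eq_measure)
  finally show ?thesis .
qed

lemma jump_mean_eq:
  "(\<integral>\<omega>. \<phi> (chain \<omega> n) (site \<omega> n (chain \<omega> n)) * indicator {\<omega>. time \<omega> (Suc n) \<le> t} \<omega> \<partial>clock_space) =
     (\<Sum>s\<in>reach n. \<Sum>x\<in>occupied s. \<phi> s x * jump_prob n s x t)" (is "?L = ?R")
  and integrable_jump_mean: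
  "integrable clock_space (\<lambda>\<omega>. \<phi> (chain \<omega> n) (site \<omega> n (chain \<omega> n)) *
      indicator {\<omega>. time \<omega> (Suc n) \<le> t} \<omega> :: real)"
proof -
  define D where "D s x = {\<omega> \<in> space clock_space. (chain \<omega> n = s \<and> site \<omega> n s = x) \<and>
      time \<omega> (Suc n) \<le> t}" for s x
  have Dm: "D s x \<in> sets clock_space" for s x unfolding D_def by measurable
  have eq: "\<phi> (chain \<omega> n) (site \<omega> n (chain \<omega> n)) * indicator {\<omega>. time \<omega> (Suc n) \<le> t} \<omega> =
     (\<Sum>s\<in>reach n. \<Sum>x\<in>occupied s. \<phi> s x * indicator (D s x) \<omega>)"
    if \<omega>: "\<omega> \<in> space clock_space" for \<omega>
  proof -
    have "(\<Sum>s\<in>reach n. \<Sum>x\<in>occupied s. \<phi> s x * indicator (D s x) \<omega>) =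
      (\<Sum>s\<in>reach n. if s = chain \<omega> n then (\<Sum>x\<in>occupied s. \<phi> s x * indicator (D s x) \<omega>) else 0)"
      by (intro sum.cong) (auto simp: D_def)
    also have "\<dots> = (\<Sum>x\<in>occupied (chain \<omega> n). \<phi> (chain \<omega> n) x * indicator (D (chain \<omega> n) x) \<omega>)"
      using chain_reach[of \<omega> n] by (simp add: finite_reach)
    also have "\<dots> = (\<Sum>x\<in>occupied (chain \<omega> n). if x = site \<omega> n (chain \<omega> n) then \<phi> (chain \<omega> n) x *
        indicator {\<omega>. time \<omega> (Suc n) \<le> t} \<omega> else 0)"
      using \<omega> by (intro sum.cong) (auto simp: D_def indicator_def)
    also have "\<dots> = \<phi> (chain \<omega> n) (site \<omega> n (chain \<omega> n)) * indicator {\<omega>. time \<omega> (Suc n) \<le> t} \<omega>"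
      using site_occupied[OF chain_reach] reach_occupied[OF chain_reach] by simp
    finally show ?thesis ..
  qed
  have int: "integrable clock_space (\<lambda>\<omega>. \<Sum>s\<in>reach n. \<Sum>x\<in>occupied s. \<phi> s x * indicator (D s x) \<omega>)"
    using Dm by (intro Bochner_Integration.integrable_sum integrable_mult_right)
      (auto simp: clock.emeasure_eq_measure)
  then show "integrable clock_space (\<lambda>\<omega>. \<phi> (chain \<omega> n) (site \<omega> n (chain \<omega> n)) *
      indicator {\<omega>. time \<omega> (Suc n) \<le> t} \<omega>)"
    using eq by (subst Bochner_Integration.integrable_cong[OF refl eq])
  have "?L = (\<integral>\<omega>. (\<Sum>s\<in>reach n. \<Sum>x\<in>occupied s. \<phi> s x * indicator (D s x) \<omega>) \<partial>clock_space)"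
    by (intro Bochner_Integration.integral_cong refl eq)
  also have "\<dots> = (\<Sum>s\<in>reach n. \<Sum>x\<in>occupied s. \<integral>\<omega>. \<phi> s x * indicator (D s x) \<omega> \<partial>clock_space)"
    using Dm by (subst Bochner_Integration.integral_sum | auto intro!: sum.cong integrable_mult_right simp: clock.emeasure_eq_measure)+
  also have "\<dots> = ?R"
    using Dm by (intro sum.cong refl) (simp add: D_def jump_prob_def conj_assoc)
  finally show "?L = ?R" .
qed

end

section \<open>Dynkin's formula and non-explosion\<close>

context tazrp
begin

lemma integrable_occ_gen:
  "integrable lborel (\<lambda>r. indicator {0..t} r * stage_mean n F r)"
  unfolding stage_mean_eq sum_distrib_left
  by (intro Bochner_Integration.integrable_sum)
    (use integrable_mult_right[OF integrable_occ_prob] in \<open>simp add: mult.left_commute\<close>)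

lemma integral_stage_mean:
  "(\<integral>r. indicator {0..t} r * stage_mean n F r \<partial>lborel) =
     (\<Sum>s\<in>reach n. F s * (\<integral>r. indicator {0..t} r * occ_prob n s r \<partial>lborel))"
proof -
  have "(\<integral>r. indicator {0..t} r * stage_mean n F r \<partial>lborel) =
     (\<integral>r. (\<Sum>s\<in>reach n. F s * (indicator {0..t} r * occ_prob n s r)) \<partial>lborel)"
    by (simp add: stage_mean_eq sum_distrib_left mult_ac)
  also have "\<dots> = (\<Sum>s\<in>reach n. F s * (\<integral>r. indicator {0..t} r * occ_prob n s r \<partial>lborel))"
    by (subst Bochner_Integration.integral_sum)
      (auto intro!: integrable_mult_right integrable_occ_prob)
  finally show ?thesis .
qed

text \<open>Once the \<open>n\<close>-th jump has occurred by time \<open>t\<close>, either the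
  chain is still in that state or the next jump has occurred too. In the latter case
  \<open>F\<close> changes by the increment along the jump, whose mean is, by
  \<open>jump_prob_eq\<close>, the time integral of \<open>gen F\<close> over stage
  \<open>n\<close>.\<close>

lemma alive_mean_step:
  assumes t: "0 \<le> t"
  shows "alive_mean (Suc n) F t + stage_mean n F t =
    alive_mean n F t + (\<integral>r. indicator {0..t} r * stage_mean n (gen F) r \<partial>lborel)"
proof -
  have Em: "{\<omega> \<in> space clock_space. time \<omega> m \<le> t} \<in> sets clock_space" 
    "{\<omega> \<in> space clock_space. time \<omega> m \<le> t \<and> t < time \<omega> (Suc m)} \<in> sets clock_space" for m
      by measurable
  have int1: "integrable clock_space (\<lambda>\<omega>. F (chain \<omega> m) * indicator {\<omega>. time \<omega> m \<le> t} \<omega>)" for m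
    using integrable_chain[OF Em(1)[of m], of F m]
    by (rule Bochner_Integration.integrable_cong[THEN iffD1, rotated -1]) (auto simp: indicator_def)
  have int2: "integrable clock_space (\<lambda>\<omega>. F (chain \<omega> m) *
      indicator {\<omega>. time \<omega> m \<le> t \<and> t < time \<omega> (Suc m)} \<omega>)" for m
    using integrable_chain[OF Em(2)[of m], of F m]
    by (rule Bochner_Integration.integrable_cong[THEN iffD1, rotated -1]) (auto simp: indicator_def)
  define \<phi> where "\<phi> s x = F (jump_from s x) - F s" for s x
  have "alive_mean (Suc n) F t + stage_mean n F t - alive_mean n F t =
     (\<integral>\<omega>. F (chain \<omega> (Suc n)) * indicator {\<omega>. time \<omega> (Suc n) \<le> t} \<omega> +
       F (chain \<omega> n) * indicator {\<omega>. time \<omega> n \<le> t \<and> t < time \<omega> (Suc n)} \<omega> -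
       F (chain \<omega> n) * indicator {\<omega>. time \<omega> n \<le> t} \<omega> \<partial>clock_space)"
    unfolding alive_mean_def stage_mean_def
    using int1[of "Suc n"] int1[of n] int2[of n]
    by (simp del: jump_chain.simps)
  also have "\<dots> = (\<integral>\<omega>. \<phi> (chain \<omega> n) (site \<omega> n (chain \<omega> n)) *
      indicator {\<omega>. time \<omega> (Suc n) \<le> t} \<omega> \<partial>clock_space)"
  proof (rule integral_cong_AE)
    show "AE \<omega> in clock_space. F (chain \<omega> (Suc n)) * indicator {\<omega>. time \<omega> (Suc n) \<le> t} \<omega> +
       F (chain \<omega> n) * indicator {\<omega>. time \<omega> n \<le> t \<and> t < time \<omega> (Suc n)} \<omega> -
       F (chain \<omega> n) * indicator {\<omega>. time \<omega> n \<le> t} \<omega> =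
       \<phi> (chain \<omega> n) (site \<omega> n (chain \<omega> n)) * indicator {\<omega>. time \<omega> (Suc n) \<le> t} \<omega>"
      using AE_time_mono
    proof eventually_elim
      case (elim \<omega>)
      then have "time \<omega> n \<le> time \<omega> (Suc n)" by (auto simp: mono_def)
      then show ?case by (auto simp: indicator_def \<phi>_def chain_Suc simp del: jump_chain.simps)
    qed
  qed (use int1[of "Suc n"] int1[of n] int2[of n] integrable_jump_mean[of \<phi> n t] in \<open>auto intro!: borel_measurable_add borel_measurable_diff simp del: jump_chain.simps\<close>)
  also have "\<dots> = (\<Sum>s\<in>reach n. \<Sum>x\<in>occupied s. \<phi> s x * jump_prob n s x t)"
    by (rule jump_mean_eq)
  also have "\<dots> = (\<Sum>s\<in>reach n. gen F s * (\<integral>r. indicator {0..t} r * occ_prob n s r \<partial>lborel))"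
    by (intro sum.cong refl) (simp add: gen_def \<phi>_def jump_prob_eq t sum_distrib_left sum_distrib_right mult_ac)
  also have "\<dots> = (\<integral>r. indicator {0..t} r * stage_mean n (gen F) r \<partial>lborel)"
    by (rule integral_stage_mean[symmetric])
  finally show ?thesis by simp
qed

lemma alive_mean_0: "0 \<le> t \<Longrightarrow> alive_mean 0 F t = F step_initial"
  by (simp add: alive_mean_def clock.prob_space)

text \<open>Dynkin's formula for the process stopped at the \<open>n\<close>-th jump, obtained by
  telescoping; \<open>alive_mean n F t\<close> is the contribution of the paths already
  stopped.\<close>

lemma alive_mean_partial:
  assumes t: "0 \<le> t"
  shows "alive_mean n F t + (\<Sum>j<n. stage_mean j F t) =
    F step_initial + (\<integral>r. indicator {0..t} r * (\<Sum>j<n. stage_mean j (gen F) r) \<partial>lborel)"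
proof (induction n)
  case 0
  then show ?case using t by (simp add: alive_mean_0)
next
  case (Suc n)
  have "(\<integral>r. indicator {0..t} r * (\<Sum>j<Suc n. stage_mean j (gen F) r) \<partial>lborel) =
    (\<integral>r. indicator {0..t} r * (\<Sum>j<n. stage_mean j (gen F) r) \<partial>lborel) +
    (\<integral>r. indicator {0..t} r * stage_mean n (gen F) r \<partial>lborel)"
  proof -
    have "integrable lborel (\<lambda>r. indicator {0..t} r * (\<Sum>j<n. stage_mean j (gen F) r))"
      unfolding sum_distrib_left by (intro Bochner_Integration.integrable_sum integrable_occ_gen)
    then show ?thesis using integrable_occ_gen[of t n "gen F"]
      by (simp add: distrib_left)
  qed
  then show ?case using Suc alive_mean_step[OF t, of n F] by simp
qed

lemma gen_const: "gen (\<lambda>_. c) = (\<lambda>_. 0)"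
  by (simp add: gen_def fun_eq_iff)

lemma alive_prob:
  "alive_mean n (\<lambda>_. 1) t = clock.prob {\<omega> \<in> space clock_space. time \<omega> n \<le> t}"
proof -
  have "alive_mean n (\<lambda>_. 1) t = (\<integral>\<omega>. indicator {\<omega> \<in> space clock_space.
      time \<omega> n \<le> t} \<omega> \<partial>clock_space)"
    unfolding alive_mean_def by (intro Bochner_Integration.integral_cong) (auto simp: indicator_def)
  then show ?thesis by simp
qed

lemma stage_sum_le:
  assumes "0 \<le> t"
  shows "(\<Sum>j<n. stage_mean j (\<lambda>_. 1) t) \<le> 1"
proof -
  have "stage_mean j (\<lambda>_. 0) r = 0" for j r by (simp add: stage_mean_def)
  then have "alive_mean n (\<lambda>_. 1) t + (\<Sum>j<n. stage_mean j (\<lambda>_. 1) t) = 1"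
    using alive_mean_partial[OF assms, of n "\<lambda>_. 1"] by (simp add: gen_const)
  moreover have "0 \<le> alive_mean n (\<lambda>_. 1) t" by (simp add: alive_prob)
  ultimately show ?thesis by simp
qed

lemma stage_mean_mono:
  assumes "\<And>s. s \<in> reach n \<Longrightarrow> F s \<le> G s"
  shows "stage_mean n F t \<le> stage_mean n G t"
  unfolding stage_mean_eq using assms by (intro sum_mono mult_right_mono occ_prob_bounds)

lemma stage_mean_cmult: "stage_mean n (\<lambda>s. c * F s) t = c * stage_mean n F t"
  unfolding stage_mean_eq by (simp add: sum_distrib_left mult_ac)

lemma alive_prob_antimono:
  "antimono (\<lambda>n. clock.prob {\<omega> \<in> space clock_space. time \<omega> n \<le> t})"
proof (rule antimonoI)
  fix m n :: nat assume "m \<le> n"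
  show "clock.prob {\<omega> \<in> space clock_space. time \<omega> n \<le> t} \<le>
      clock.prob {\<omega> \<in> space clock_space. time \<omega> m \<le> t}"
  proof (rule clock.finite_measure_mono_AE)
    show "AE \<omega> in clock_space. \<omega> \<in> {\<omega> \<in> space clock_space. time \<omega> n \<le> t} \<longrightarrow>
        \<omega> \<in> {\<omega> \<in> space clock_space. time \<omega> m \<le> t}"
      using AE_time_mono
    proof eventually_elim
      case (elim \<omega>)
      then have "time \<omega> m \<le> time \<omega> n" using \<open>m \<le> n\<close> by (auto simp: mono_def)
      then show ?case by auto
    qed
  qed measurable
qed

text \<open>Non-explosion: the total rate after \<open>j\<close> jumps is at most \<open>A (j + 1)\<close>, and the harmonic
  series diverges.\<close>

lemma alive_prob_harm:
  assumes t: "0 \<le> t"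
  shows "harm n * clock.prob {\<omega> \<in> space clock_space. time \<omega> n \<le> t} \<le> A * t"
proof -
  define p where "p n = clock.prob {\<omega> \<in> space clock_space. time \<omega> n \<le> t}" for n
  have A: "0 < A" using a_pos[of 0] a_le[of 0] by simp
  have p_step: "p (Suc j) \<le> A * real (Suc j) *
      (\<integral>r. indicator {0..t} r * stage_mean j (\<lambda>_. 1) r \<partial>lborel)" for j
  proof -
    have "p (Suc j) = (\<integral>\<omega>. 1 * indicator {\<omega>. time \<omega> (Suc j) \<le> t} \<omega> \<partial>clock_space)"
      unfolding p_def alive_prob[symmetric] alive_mean_def ..
    also have "\<dots> = (\<Sum>s\<in>reach j. \<Sum>x\<in>occupied s. 1 * jump_prob j s x t)"
      by (rule jump_mean_eq[where \<phi> = "\<lambda>_ _. 1"])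
    also have "\<dots> = (\<Sum>s\<in>reach j. total_rate s * (\<integral>r. indicator {0..t} r * occ_prob j s r \<partial>lborel))"
      by (intro sum.cong refl) (simp add: total_rate_def jump_prob_eq t sum_distrib_right)
    also have "\<dots> = (\<integral>r. indicator {0..t} r * stage_mean j total_rate r \<partial>lborel)"
      by (rule integral_stage_mean[symmetric])
    also have "\<dots> \<le> (\<integral>r. (A * real (Suc j)) * (indicator {0..t} r * stage_mean j (\<lambda>_. 1) r) \<partial>lborel)"
    proof (rule integral_mono)
      show "integrable lborel (\<lambda>r. indicator {0..t} r * stage_mean j total_rate r)"
        by (rule integrable_occ_gen)
      show "integrable lborel (\<lambda>r. (A * real (Suc j)) *
          (indicator {0..t} r * stage_mean j (\<lambda>_. 1) r))"
        by (intro integrable_mult_right integrable_occ_gen)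
      fix r
      have "stage_mean j total_rate r \<le> stage_mean j (\<lambda>s. A * real (Suc j) * 1) r"
        using total_rate_le by (intro stage_mean_mono) simp
      then show "indicator {0..t} r * stage_mean j total_rate r \<le>
          (A * real (Suc j)) * (indicator {0..t} r * stage_mean j (\<lambda>_. 1) r)"
        unfolding stage_mean_cmult by (auto simp: indicator_def)
    qed
    finally show ?thesis by simp
  qed
  have "harm n * p n = (\<Sum>j<n. inverse (real (Suc j)) * p n)"
    by (simp add: harm_altdef sum_distrib_right)
  also have "\<dots> \<le> (\<Sum>j<n. A * (\<integral>r. indicator {0..t} r * stage_mean j (\<lambda>_. 1) r \<partial>lborel))"
  proof (rule sum_mono)
    fix j assume "j \<in> {..<n}"
    then have "p n \<le> p (Suc j)" using alive_prob_antimono[of t] unfolding p_def antimono_def by simp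
    also note p_step
    finally have "inverse (real (Suc j)) * p n \<le>
        inverse (real (Suc j)) * (A * real (Suc j) *
      (\<integral>r. indicator {0..t} r * stage_mean j (\<lambda>_. 1) r \<partial>lborel))"
      by (intro mult_left_mono) auto
    also have "\<dots> = A * (\<integral>r. indicator {0..t} r * stage_mean j (\<lambda>_. 1) r \<partial>lborel)"
      by (simp del: of_nat_Suc)
    finally show "inverse (real (Suc j)) * p n \<le>
        A * (\<integral>r. indicator {0..t} r * stage_mean j (\<lambda>_. 1) r \<partial>lborel)" .
  qed
  also have "\<dots> = A * (\<integral>r. indicator {0..t} r * (\<Sum>j<n. stage_mean j (\<lambda>_. 1) r) \<partial>lborel)"
    unfolding sum_distrib_left[symmetric] 
    by (subst Bochner_Integration.integral_sum[symmetric])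
      (auto intro: integrable_occ_gen simp: sum_distrib_left)
  also have "\<dots> \<le> A * (\<integral>r. indicator {0..t} r \<partial>lborel)"
  proof (intro mult_left_mono integral_mono)
    show "integrable lborel (\<lambda>r. indicator {0..t} r * (\<Sum>j<n. stage_mean j (\<lambda>_. 1) r))"
      unfolding sum_distrib_left by (intro Bochner_Integration.integrable_sum integrable_occ_gen)
    show "integrable lborel (indicator {0..t} :: real \<Rightarrow> real)"
      by (simp add: integrable_indicator_iff emeasure_lborel_Icc_eq)
    show "indicator {0..t} r * (\<Sum>j<n. stage_mean j (\<lambda>_. 1) r) \<le> indicator {0..t} r" for r
      using stage_sum_le[of r n] by (auto simp: indicator_def)
  qed (use A in simp)
  also have "\<dots> = A * t" using t by simp
  finally show ?thesis by (simp add: p_def)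
qed

lemma alive_prob_tendsto:
  assumes t: "0 \<le> t"
  shows "(\<lambda>n. clock.prob {\<omega> \<in> space clock_space. time \<omega> n \<le> t}) \<longlonglongrightarrow> 0"
proof (rule tendsto_sandwich[of "\<lambda>_. 0" _ _ "\<lambda>n. A * t / harm n"])
  show "eventually (\<lambda>n. clock.prob {\<omega> \<in> space clock_space. time \<omega> n \<le> t} \<le> A *
      t / harm n) sequentially"
    using eventually_gt_at_top[of 0]
  proof eventually_elim
    case (elim n)
    then have "0 < (harm n :: real)" by (rule harm_pos)
    then show ?case using alive_prob_harm[OF t, of n] by (simp add: pos_le_divide_eq mult.commute)
  qed
  show "(\<lambda>n. A * t / harm n) \<longlonglongrightarrow> 0"
    by (rule real_tendsto_divide_at_top[OF tendsto_const harm_at_top])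
qed auto

definition ev :: "(config \<Rightarrow> real) \<Rightarrow> real \<Rightarrow> real" where
  "ev F t = (\<integral>\<omega>. F (qTAZRP q a step_initial \<omega> t) \<partial>clock_space)"

lemma qTAZRP_measurable:
  fixes F :: "config \<Rightarrow> 'b"
  shows "(\<lambda>\<omega>. F (qTAZRP q a step_initial \<omega> t)) \<in> clock_space \<rightarrow>\<^sub>M count_space UNIV"
  unfolding qTAZRP_def
  by (rule measurable_compose_countable[where g = "\<lambda>\<omega>. LEAST n. t < time \<omega> (Suc n)" and f = "\<lambda>n \<omega>.
      F (chain \<omega> n)"]) 
    measurable

lemma qTAZRP_borel [measurable]:
  fixes F :: "config \<Rightarrow> real"
  shows "(\<lambda>\<omega>. F (qTAZRP q a step_initial \<omega> t)) \<in> borel_measurable clock_space"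
  by (rule measurable_compose[OF qTAZRP_measurable[of "\<lambda>x. x"]]) simp

text \<open>Along a monotone sequence of jump times that passes \<open>t\<close>, exactly one stage
  contains \<open>t\<close>, and its index is the least number that defines
  \<open>qTAZRP\<close>.\<close>

lemma qTAZRP_stage:
  assumes mono: "mono (time \<omega>)" and t: "0 \<le> t" "t < time \<omega> n"
  shows "(\<Sum>j<n. F (chain \<omega> j) * indicator {\<omega>. time \<omega> j \<le> t \<and> t < time \<omega> (Suc j)} \<omega>) =
      (F (qTAZRP q a step_initial \<omega> t) :: real)"
proof -
  define N where "N = (LEAST n. t < time \<omega> (Suc n))"
  have n: "n \<noteq> 0" using t by (metis not_less time_0)
  then have ex: "t < time \<omega> (Suc (n - 1))" using t by simp
  have N1: "t < time \<omega> (Suc N)" unfolding N_def by (rule LeastI[of _ "n - 1"]) (rule ex)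
  have "N \<le> n - 1" unfolding N_def by (rule Least_le) (rule ex)
  then have Nn: "N < n" using n by simp
  have N2: "time \<omega> N \<le> t"
  proof (cases N)
    case (Suc k)
    then have "\<not> t < time \<omega> (Suc k)" using not_less_Least[of k "\<lambda>n. t < time \<omega> (Suc n)"]
      by (simp add: N_def)
    then show ?thesis using Suc by simp
  qed (use t in simp)
  have "indicator {\<omega>. time \<omega> j \<le> t \<and> t < time \<omega> (Suc j)} \<omega> = (if j = N then 1 else 0 :: real)" for j
  proof (cases j N rule: linorder_cases)
    case less
    then have "time \<omega> (Suc j) \<le> time \<omega> N" using mono by (auto simp: mono_def)
    then show ?thesis using less N2 by auto
  next
    case greater
    then have "time \<omega> (Suc N) \<le> time \<omega> j" using mono by (auto simp: mono_def)
    then show ?thesis using greater N1 by auto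
  qed (use N1 N2 in auto)
  then have "(\<Sum>j<n. F (chain \<omega> j) * indicator {\<omega>. time \<omega> j \<le> t \<and> t < time \<omega> (Suc j)} \<omega>) =
      (\<Sum>j<n. if j = N then F (chain \<omega> N) else 0)"
    by (intro sum.cong refl) simp
  also have "\<dots> = F (chain \<omega> N)" using Nn by simp
  finally show ?thesis by (simp add: qTAZRP_def N_def)
qed

lemma integrable_qTAZRP:
  fixes F :: "config \<Rightarrow> real"
  assumes B: "\<And>s. \<bar>F s\<bar> \<le> B"
  shows "integrable clock_space (\<lambda>\<omega>. F (qTAZRP q a step_initial \<omega> t))"
  by (rule clock.integrable_const_bound[where B = B]) (use B in auto)

text \<open>Dropping the stages from \<open>n\<close> on changes the integrand only if the
  \<open>n\<close>-th jump has occurred by time \<open>t\<close>. On that event all stages below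
  \<open>n\<close> are over, so the truncated sum is \<open>0\<close> and the error is at most
  \<open>B\<close>.\<close>

lemma ev_approx:
  assumes B: "\<And>s. \<bar>F s\<bar> \<le> B" and t: "0 \<le> t"
  shows "\<bar>ev F t - (\<Sum>j<n. stage_mean j F t)\<bar> \<le> B * clock.prob {\<omega> \<in> space clock_space. time \<omega> n \<le> t}"
proof -
  define S where "S \<omega> = (\<Sum>j<n. F (chain \<omega> j) * indicator {\<omega>. time \<omega> j \<le> t \<and> t < time \<omega> (Suc j)} \<omega>)"
    for \<omega>
  have Em: "{\<omega> \<in> space clock_space. time \<omega> m \<le> t \<and> t < time \<omega> (Suc m)} \<in> sets clock_space" for m
    by measurable
  have int2: "integrable clock_space (\<lambda>\<omega>. F (chain \<omega> m) *
      indicator {\<omega>. time \<omega> m \<le> t \<and> t < time \<omega> (Suc m)} \<omega>)" for m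
    using integrable_chain[OF Em[of m], of F m]
    by (rule Bochner_Integration.integrable_cong[THEN iffD1, rotated -1]) (auto simp: indicator_def)
  then have intS: "integrable clock_space S" unfolding S_def
    by (intro Bochner_Integration.integrable_sum)
  have "(\<Sum>j<n. stage_mean j F t) = (\<integral>\<omega>. S \<omega> \<partial>clock_space)"
    unfolding S_def stage_mean_def using int2 by (subst Bochner_Integration.integral_sum) auto
  then have "ev F t - (\<Sum>j<n. stage_mean j F t) =
      (\<integral>\<omega>. F (qTAZRP q a step_initial \<omega> t) - S \<omega> \<partial>clock_space)"
    unfolding ev_def using intS integrable_qTAZRP[of F, OF B] by simp
  also have "\<bar>\<dots>\<bar> \<le> (\<integral>\<omega>. \<bar>F (qTAZRP q a step_initial \<omega> t) - S \<omega>\<bar> \<partial>clock_space)"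
    by (rule integral_abs_bound)
  also have "\<dots> \<le> (\<integral>\<omega>. B * indicator {\<omega> \<in> space clock_space. time \<omega> n \<le> t} \<omega> \<partial>clock_space)"
  proof (rule integral_mono_AE)
    show "integrable clock_space (\<lambda>\<omega>. \<bar>F (qTAZRP q a step_initial \<omega> t) - S \<omega>\<bar>)"
      using intS integrable_qTAZRP[of F, OF B] by auto
    show "integrable clock_space (\<lambda>\<omega>. B * indicator {\<omega> \<in> space clock_space. time \<omega> n \<le> t} \<omega>)"
      by (intro integrable_mult_right) (auto simp: clock.emeasure_eq_measure)
    show "AE \<omega> in clock_space. \<bar>F (qTAZRP q a step_initial \<omega> t) - S \<omega>\<bar> \<le>
        B * indicator {\<omega> \<in> space clock_space. time \<omega> n \<le> t} \<omega>"
      using AE_time_mono AE_space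
    proof eventually_elim
      case (elim \<omega>)
      show ?case
      proof (cases "time \<omega> n \<le> t")
        case False
        then have "S \<omega> = F (qTAZRP q a step_initial \<omega> t)"
          unfolding S_def using elim t by (intro qTAZRP_stage) auto
        then show ?thesis using False by simp
      next
        case True
        have "S \<omega> = 0" unfolding S_def
        proof (intro sum.neutral ballI)
          fix j assume "j \<in> {..<n}"
          then have "time \<omega> (Suc j) \<le> time \<omega> n" using elim(1) by (auto simp: mono_def)
          then show "F (chain \<omega> j) * indicator {\<omega>. time \<omega> j \<le> t \<and> t < time \<omega> (Suc j)} \<omega> = 0"
            using True by auto
        qed
        then show ?thesis using True B elim by simp
      qed
    qed
  qed
  also have "\<dots> = B * clock.prob {\<omega> \<in> space clock_space. time \<omega> n \<le> t}" by simp
  finally show ?thesis .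
qed

lemma ev_tendsto:
  assumes B: "\<And>s. \<bar>F s\<bar> \<le> B" and t: "0 \<le> t"
  shows "(\<lambda>n. \<Sum>j<n. stage_mean j F t) \<longlonglongrightarrow> ev F t"
proof -
  have "(\<lambda>n. ev F t - (\<Sum>j<n. stage_mean j F t)) \<longlonglongrightarrow> 0"
  proof (rule Lim_null_comparison)
    show "eventually (\<lambda>n. norm (ev F t - (\<Sum>j<n. stage_mean j F t)) \<le> B *
        clock.prob {\<omega> \<in> space clock_space. time \<omega> n \<le> t}) sequentially"
      using ev_approx[OF B t] by simp
    show "(\<lambda>n. B * clock.prob {\<omega> \<in> space clock_space. time \<omega> n \<le> t}) \<longlonglongrightarrow> 0"
      using tendsto_mult_left[OF alive_prob_tendsto[OF t], of B] by simp
  qed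
  then show ?thesis using tendsto_diff[OF tendsto_const[of "ev F t"]] by fastforce
qed

lemma ev_bound:
  assumes B: "\<And>s. \<bar>F s\<bar> \<le> B"
  shows "\<bar>ev F t\<bar> \<le> B"
proof -
  have "\<bar>ev F t\<bar> \<le> (\<integral>\<omega>. \<bar>F (qTAZRP q a step_initial \<omega> t)\<bar> \<partial>clock_space)"
    unfolding ev_def by (rule integral_abs_bound)
  also have "\<dots> \<le> (\<integral>\<omega>. B \<partial>clock_space)"
    using B integrable_qTAZRP[of F, OF B] by (intro integral_mono) auto
  finally show ?thesis by (simp add: clock.prob_space)
qed

text \<open>\<open>gen F\<close> is replaced by a bounded \<open>G\<close> that agrees with it on
  reachable configurations, since only there is \<open>gen F\<close> under control. In the limit of
  \<open>alive_mean_partial\<close> the stopped part vanishes by non-explosion, and the integrals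
  converge because the stage sums of \<open>G\<close> are bounded by \<open>B'\<close>.\<close>

theorem dynkin:
  assumes F: "\<And>s. \<bar>F s\<bar> \<le> B" and G: "\<And>s. \<bar>G s\<bar> \<le> B'"
    and gen: "\<And>n s. s \<in> reach n \<Longrightarrow> gen F s = G s" and t: "0 \<le> t"
  shows "ev F t = F step_initial + (\<integral>r. indicator {0..t} r * ev G r \<partial>lborel)"
    and "integrable lborel (\<lambda>r. indicator {0..t} r * ev G r)"
proof -
  have G_eq: "stage_mean j (gen F) r = stage_mean j G r" for j r
    unfolding stage_mean_eq by (intro sum.cong refl) (simp add: gen)
  have B0: "0 \<le> B" "0 \<le> B'" using F[of step_initial] G[of step_initial] by auto
  have lim: "(\<lambda>n. indicator {0..t} r * (\<Sum>j<n. stage_mean j G r)) \<longlonglongrightarrow> indicator {0..t} r * ev G r"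
    for r
    using ev_tendsto[of G, OF G] by (cases "r \<in> {0..t}") auto
  have bnd: "\<bar>\<Sum>j<n. stage_mean j G r\<bar> \<le> B'" if "0 \<le> r" for n r
  proof -
    have "\<bar>\<Sum>j<n. stage_mean j G r\<bar> \<le> (\<Sum>j<n. B' * stage_mean j (\<lambda>_. 1) r)"
    proof (intro order_trans[OF sum_abs] sum_mono)
      fix j
      have "\<bar>G s\<bar> \<le> B'" for s by (rule G)
      then have "G s \<le> B' * 1" "- 1 * G s \<le> B' * 1" for s by (auto simp: abs_le_iff minus_le_iff)
      then have "stage_mean j G r \<le> stage_mean j (\<lambda>s. B' * 1) r" "stage_mean j (\<lambda>s. - 1 * G s) r \<le>
          stage_mean j (\<lambda>s. B' * 1) r"
        by (intro stage_mean_mono; blast)+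
      then show "\<bar>stage_mean j G r\<bar> \<le> B' * stage_mean j (\<lambda>_. 1) r"
        unfolding stage_mean_cmult by auto
    qed
    also have "\<dots> \<le> B' * 1"
      unfolding sum_distrib_left[symmetric] using stage_sum_le[OF that] B0
        by (intro mult_left_mono) auto
    finally show ?thesis by simp
  qed
  have meas: "(\<lambda>r. indicator {0..t} r * (\<Sum>j<n. stage_mean j G r)) \<in> borel_measurable lborel" for n
    unfolding sum_distrib_left
    by (intro borel_measurable_sum borel_measurable_integrable integrable_occ_gen)
  have measlim: "(\<lambda>r. indicator {0..t} r * ev G r) \<in> borel_measurable lborel"
    by (rule borel_measurable_LIMSEQ_real[OF lim meas])
  have dom: "integrable lborel (\<lambda>r. B' * indicator {0..t} r :: real)"
    by (intro integrable_mult_right) (simp add: integrable_indicator_iff emeasure_lborel_Icc_eq)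
  have bnd2: "norm (indicator {0..t} r * (\<Sum>j<n. stage_mean j G r)) \<le> B' * indicator {0..t} r"
    for n r
    using bnd[of r n] by (auto simp: indicator_def)
  show int: "integrable lborel (\<lambda>r. indicator {0..t} r * ev G r)"
    by (rule integrable_dominated_convergence[where s = "\<lambda>n r. indicator {0..t} r *
        (\<Sum>j<n. stage_mean j G r)", OF measlim meas dom]) (use lim bnd2 in auto)
  have lim_int: "(\<lambda>n. (\<integral>r. indicator {0..t} r * (\<Sum>j<n. stage_mean j G r) \<partial>lborel)) \<longlonglongrightarrow>
      (\<integral>r. indicator {0..t} r * ev G r \<partial>lborel)"
    by (rule integral_dominated_convergence[where s = "\<lambda>n r. indicator {0..t} r *
        (\<Sum>j<n. stage_mean j G r)", OF measlim meas dom]) (use lim bnd2 in auto)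
  have alive0: "(\<lambda>n. alive_mean n F t) \<longlonglongrightarrow> 0"
  proof (rule Lim_null_comparison)
    show "eventually (\<lambda>n. norm (alive_mean n F t) \<le> B *
        clock.prob {\<omega> \<in> space clock_space. time \<omega> n \<le> t}) sequentially"
    proof (intro always_eventually allI)
      fix n
      have Em: "{\<omega> \<in> space clock_space. time \<omega> n \<le> t} \<in> sets clock_space" by measurable
      have "alive_mean n F t = (\<integral>\<omega>. F (chain \<omega> n) *
          indicator {\<omega> \<in> space clock_space. time \<omega> n \<le> t} \<omega> \<partial>clock_space)"
        unfolding alive_mean_def by (intro Bochner_Integration.integral_cong)
          (auto simp: indicator_def)
      also have "\<bar>\<dots>\<bar> \<le> (\<integral>\<omega>. \<bar>F (chain \<omega> n) * indicator {\<omega> \<in> space clock_space.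
          time \<omega> n \<le> t} \<omega>\<bar> \<partial>clock_space)"
        by (rule integral_abs_bound)
      also have "\<dots> \<le> (\<integral>\<omega>. B * indicator {\<omega> \<in> space clock_space. time \<omega> n \<le> t} \<omega> \<partial>clock_space)"
      proof (rule integral_mono)
        show "integrable clock_space (\<lambda>\<omega>. \<bar>F (chain \<omega> n) *
            indicator {\<omega> \<in> space clock_space. time \<omega> n \<le> t} \<omega>\<bar>)"
          using integrable_chain[OF Em, of F n] by (rule integrable_abs)
        show "integrable clock_space (\<lambda>\<omega>. B * indicator {\<omega> \<in> space clock_space. time \<omega> n \<le> t} \<omega>)"
          using Em by (intro integrable_mult_right) (auto simp: clock.emeasure_eq_measure)
      qed (use F in \<open>auto simp: indicator_def\<close>)
      finally show "norm (alive_mean n F t) \<le> B * clock.prob {\<omega> \<in> space clock_space. time \<omega> n \<le> t}"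
        by simp
    qed
    show "(\<lambda>n. B * clock.prob {\<omega> \<in> space clock_space. time \<omega> n \<le> t}) \<longlonglongrightarrow> 0"
      using tendsto_mult_left[OF alive_prob_tendsto[OF t], of B] by simp
  qed
  have "(\<lambda>n. alive_mean n F t + (\<Sum>j<n. stage_mean j F t)) \<longlonglongrightarrow> 0 + ev F t"
    by (intro tendsto_add alive0 ev_tendsto[of F, OF F t])
  moreover have "(\<lambda>n. alive_mean n F t + (\<Sum>j<n. stage_mean j F t)) \<longlonglongrightarrow>
      F step_initial + (\<integral>r. indicator {0..t} r * ev G r \<partial>lborel)"
    unfolding alive_mean_partial[OF t] G_eq by (intro tendsto_add tendsto_const lim_int)
  ultimately show "ev F t = F step_initial + (\<integral>r. indicator {0..t} r * ev G r \<partial>lborel)"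
    using LIMSEQ_unique by fastforce
qed

end

subsection \<open>Observables of the particle counts\<close>

definition block :: "nat \<Rightarrow> (nat \<Rightarrow> nat) \<Rightarrow> nat \<Rightarrow> nat set" where
  "block k p v = {i. i < k \<and> p i = v}"

definition weakly_decreasing :: "nat \<Rightarrow> (nat \<Rightarrow> nat) \<Rightarrow> bool" where
  "weakly_decreasing k p \<longleftrightarrow> (\<forall>i j. i \<le> j \<longrightarrow> j < k \<longrightarrow> p j \<le> p i)"

lemma finite_block [simp]: "finite (block k p v)"
  by (simp add: block_def)

lemma block_interval:
  assumes p: "weakly_decreasing k p" and v: "v \<in> p ` {..<k}"
  obtains r c where "block k p v = {r..<r + Suc c}" "Max (block k p v) =
      r + c" "card (block k p v) = Suc c" "r + c < k"
proof -
  let ?B = "block k p v"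
  have ne: "?B \<noteq> {}" using v by (auto simp: block_def)
  define r where "r = Min ?B"
  define m where "m = Max ?B"
  have rm: "r \<in> ?B" "m \<in> ?B" "\<And>i. i \<in> ?B \<Longrightarrow> r \<le> i \<and> i \<le> m"
    unfolding r_def m_def using ne by (auto intro: Min_in Max_in)
  then have "r \<le> m" by blast
  have "?B = {r..m}"
  proof
    show "?B \<subseteq> {r..m}" using rm(3) by auto
    show "{r..m} \<subseteq> ?B"
    proof
      fix i assume i: "i \<in> {r..m}"
      have mk: "m < k" "p m = v" "p r = v" using rm(1,2) by (auto simp: block_def)
      have "p m \<le> p i" "p i \<le> p r" using p i mk(1) by (auto simp: weakly_decreasing_def)
      then show "i \<in> ?B" using i mk by (auto simp: block_def)
    qed
  qed
  moreover from this have "card ?B = Suc (m - r)" using \<open>r \<le> m\<close> by simp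
  moreover have "{r..m} = {r..<r + Suc (m - r)}" using \<open>r \<le> m\<close> by auto
  moreover have "m < k" using rm(2) by (simp add: block_def)
  ultimately show ?thesis using \<open>r \<le> m\<close> m_def
    by (intro that[of r "m - r"]) auto
qed

text \<open>Only the last index of a block can be lowered without destroying the order, so this
  choice keeps the evolution equations within weakly decreasing coordinates.\<close>

lemma weakly_decreasing_lower:
  assumes p: "weakly_decreasing k p" and v: "v \<in> p ` {..<k}"
  shows "weakly_decreasing k (p(Max (block k p v) := v - 1))"
proof -
  obtain r c where rc: "block k p v = {r..<r + Suc c}" "Max (block k p v) = r + c" "r + c < k"
    by (rule block_interval[OF p v])
  have "r + c \<in> block k p v" unfolding rc(1) by simp
  then have pm: "p (r + c) = v" by (simp add: block_def)
  have 1: "p j \<le> v - 1" if "r + c < j" "j < k" for j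
  proof -
    have "p j \<le> p (r + c)" using p that unfolding weakly_decreasing_def by simp
    moreover have "j \<notin> block k p v" unfolding rc(1) using that by simp
    then have "p j \<noteq> v" using that by (simp add: block_def)
    ultimately show ?thesis using pm by simp
  qed
  have 2: "v \<le> p i" if "i \<le> r + c" for i
    using p that rc(3) pm unfolding weakly_decreasing_def by metis
  have "(p(r + c := v - 1)) j \<le> (p(r + c := v - 1)) i" if ij: "i \<le> j" "j < k" for i j
  proof (cases "i = r + c")
    case True
    then show ?thesis using 1[of j] ij by (cases "j = r + c") auto
  next
    case False
    have "p j \<le> p i" using p ij unfolding weakly_decreasing_def by simp
    then show ?thesis using False 2[of i] ij by (cases "j = r + c") auto
  qed
  then show ?thesis unfolding rc(2) weakly_decreasing_def by blast
qed

text \<open>Each factor satisfies \<open>q * y - q ^ Suc i = q * (y - q ^ i)\<close>: replacing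
  \<open>y\<close> by \<open>q * y\<close> shifts the nodes by one, so only the lowest factor is new
  and the highest one drops out.\<close>

lemma prod_shift_q:
  fixes q y :: real
  shows "(\<Prod>i\<in>{r..<r + Suc c}. q * y - q ^ i) =
      q ^ c * (q * y - q ^ r) * (\<Prod>i\<in>{r..<r + c}. y - q ^ i)"
proof (induction c)
  case (Suc c)
  have "(\<Prod>i\<in>{r..<r + Suc (Suc c)}. q * y - q ^ i) = (\<Prod>i\<in>{r..<r + Suc c}. q * y - q ^ i) *
      (q * y - q ^ (r + Suc c))"
    by simp
  also have "\<dots> = q ^ c * (q * y - q ^ r) * (\<Prod>i\<in>{r..<r + c}. y - q ^ i) * (q * (y - q ^ (r + c)))"
    unfolding Suc by (simp add: algebra_simps)
  also have "\<dots> = q ^ Suc c * (q * y - q ^ r) * (\<Prod>i\<in>{r..<r + Suc c}. y - q ^ i)"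
    by simp
  finally show ?case .
qed simp

text \<open>The change in one block of an observable when one more particle is ahead. What survives
  is the block without its last factor, precisely the part that lowering the last index leaves
  untouched.\<close>

lemma prod_shift_q_diff:
  fixes q y :: real
  shows "(\<Prod>i\<in>{r..<r + Suc c}. q * y - q ^ i) - (\<Prod>i\<in>{r..<r + Suc c}. y - q ^ i) =
    - (1 - q ^ Suc c) * y * (\<Prod>i\<in>{r..<r + c}. y - q ^ i)"
  unfolding prod_shift_q by (simp add: algebra_simps power_add)

text \<open>\<open>ahead s p\<close> is the number of particles at sites \<open>\<ge> p\<close>; there are infinitely many of them
  for \<open>p = 0\<close>, which is why \<open>q_ahead\<close> vanishes there.\<close>

definition ahead :: "config \<Rightarrow> nat \<Rightarrow> nat" where
  "ahead s p = card {m. 1 \<le> m \<and> int p \<le> s m}"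

section \<open>Closed evolution equations of the q-moments\<close>

context tazrp
begin

definition q_ahead :: "config \<Rightarrow> nat \<Rightarrow> real" where
  "q_ahead s p = (if p = 0 then 0 else q ^ ahead s p)"

definition obs :: "nat \<Rightarrow> (nat \<Rightarrow> nat) \<Rightarrow> config \<Rightarrow> real" where
  "obs k p s = (\<Prod>i<k. q_ahead s (p i) - q ^ i)"

lemma q_ahead_bounds: "0 \<le> q_ahead s p" "q_ahead s p \<le> 1"
  using q by (auto simp: q_ahead_def power_le_one)

lemma obs_bound: "\<bar>obs k p s\<bar> \<le> 1"
proof -
  have "\<bar>q_ahead s v - q ^ i\<bar> \<le> 1" for i v
    using q_ahead_bounds[of s v] q power_le_one[of q i] zero_le_power[of q i] by linarith
  then show ?thesis unfolding obs_def abs_prod by (intro prod_le_1) auto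
qed

lemma finite_ahead:
  assumes "s \<in> reach n" "1 \<le> p"
  shows "finite {m. 1 \<le> m \<and> int p \<le> s m}"
proof -
  have "finite {m. s m \<noteq> 0}" using reach_good[OF assms(1)] by (simp add: good_config_def)
  then show ?thesis by (rule rev_finite_subset) (use assms(2) in auto)
qed

text \<open>A jump from \<open>y\<close> to \<open>y + 1\<close> crosses the single threshold
  \<open>Suc y\<close>, where it adds one particle to the count.\<close>

lemma q_ahead_jump:
  assumes s: "s \<in> reach n" and y: "int y \<in> occupied s"
  shows "q_ahead (jump_from s (int y)) p = (if p = Suc y then q * q_ahead s p else q_ahead s p)"
proof (cases "p = 0")
  case False
  define L where "L = (LEAST m. m \<in> particles_at s (int y))"
  note L = least_particle[OF y, folded L_def]
  have jf: "jump_from s (int y) = s(L := int y + 1)" by (simp add: jump_from_def L_def)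
  have fin: "finite {m. 1 \<le> m \<and> int p \<le> s m}" using finite_ahead[OF s] False by simp
  show ?thesis
  proof (cases "p = Suc y")
    case True
    have "{m. 1 \<le> m \<and> int p \<le> (s(L := int y + 1)) m} = insert L {m. 1 \<le> m \<and> int p \<le> s m}"
      using True L by auto
    moreover have "L \<notin> {m. 1 \<le> m \<and> int p \<le> s m}" using True L by auto
    ultimately show ?thesis using fin True by (simp add: q_ahead_def ahead_def jf)
  next
    case pne: False
    have "{m. 1 \<le> m \<and> int p \<le> (s(L := int y + 1)) m} = {m. 1 \<le> m \<and> int p \<le> s m}"
      using pne L by auto
    then show ?thesis using pne by (simp add: q_ahead_def ahead_def jf)
  qed
qed (simp add: q_ahead_def)

lemma q_ahead_Suc:
  assumes s: "s \<in> reach n" and y: "1 \<le> y"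
  shows "q_ahead s y = q_ahead s (Suc y) * q ^ card (particles_at s (int y))"
proof -
  have "{m. 1 \<le> m \<and> int y \<le> s m} = {m. 1 \<le> m \<and> int (Suc y) \<le> s m} \<union> particles_at s (int y)"
    by (auto simp: particles_at_def)
  moreover have "finite (particles_at s (int y))"
    using good_occupied(5)[OF reach_good[OF s]] y by simp
  ultimately have "ahead s y = ahead s (Suc y) + card (particles_at s (int y))"
    unfolding ahead_def using finite_ahead[OF s, of "Suc y"]
    by (simp, subst card_Un_disjoint) (auto simp: particles_at_def)
  then show ?thesis using y by (simp add: q_ahead_def power_add)
qed

text \<open>One formula covers both cases of \<open>jump_rate\<close>: at the infinitely occupied
  site \<open>0\<close> the value \<open>q_ahead s 0 = 0\<close> turns it into the rate
  \<open>a 0\<close>.\<close>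

lemma rate_q_ahead:
  assumes s: "s \<in> reach n"
  shows "rate s (int y) = a (int y) * (1 - q_ahead s y / q_ahead s (Suc y))"
proof (cases "y = 0")
  case True
  then show ?thesis using good_occupied(4)[OF reach_good[OF s]]
    by (simp add: jump_rate_def q_ahead_def)
next
  case False
  have "finite (particles_at s (int y))"
    using good_occupied(5)[OF reach_good[OF s]] False by simp
  moreover have "q_ahead s (Suc y) \<noteq> 0" using q by (simp add: q_ahead_def)
  ultimately show ?thesis using q_ahead_Suc[OF s, of y] False by (simp add: jump_rate_def)
qed

text \<open>Particles reach the sites \<open>\<ge> v\<close> from \<open>v - 1\<close>, hence the
  site in the rate. The rate depends on the block size but not on the configuration; this is what
  makes the system of moments closed.\<close>

definition lower_rate :: "nat \<Rightarrow> (nat \<Rightarrow> nat) \<Rightarrow> nat \<Rightarrow> real" where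
  "lower_rate k p v = a (int (v - 1)) * (1 - q ^ card (block k p v))"

abbreviation "lower k p v \<equiv> p(Max (block k p v) := v - 1)"

text \<open>The jump multiplies \<open>Y = q_ahead s v\<close> by \<open>q\<close>, which by
  \<open>prod_shift_q_diff\<close> produces a factor \<open>- Y\<close>. The jump rate supplies
  \<open>1 - Y' / Y\<close> with \<open>Y' = q_ahead s y\<close>, and the product
  \<open>Y' - Y\<close> is the difference between the last factors \<open>Y' - q ^ (r + c)\<close>
  and \<open>Y - q ^ (r + c)\<close>: the nonlinear rate has been absorbed.\<close>

lemma obs_jump:
  assumes s: "s \<in> reach n" and p: "weakly_decreasing k p" "v \<in> p ` {..<k}" and v: "v =
      Suc y" and y: "int y \<in> occupied s"
  shows "rate s (int y) * (obs k p (jump_from s (int y)) - obs k p s) =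
    lower_rate k p v * (obs k (lower k p v) s - obs k p s)"
proof -
  obtain r c where rc: "block k p v = {r..<r + Suc c}" "Max (block k p v) =
      r + c" "card (block k p v) = Suc c" "r + c < k"
    by (rule block_interval[OF p])
  define Y where "Y = q_ahead s v"
  define Y' where "Y' = q_ahead s y"
  have Y: "Y \<noteq> 0" using q v by (simp add: Y_def q_ahead_def)
  have split: "{..<k} = block k p v \<union> ({..<k} - block k p v)" by (auto simp: block_def)
  have spl: "(\<Prod>i<k. f i) = (\<Prod>i\<in>block k p v. f i) * (\<Prod>i\<in>{..<k} - block k p v. f i)"
    for f :: "nat \<Rightarrow> real"
    by (subst split, rule prod.union_disjoint) auto
  define R where "R = (\<Prod>i\<in>{..<k} - block k p v. q_ahead s (p i) - q ^ i)"
  define P where "P = (\<Prod>i\<in>{r..<r + c}. Y - q ^ i)"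
  have inb: "p i = v" if "i \<in> {r..<r + Suc c}" for i using that unfolding rc(1)[symmetric]
    by (simp add: block_def)
  have outb: "p i \<noteq> v" if "i < k" "i \<notin> {r..<r + Suc c}" for i
    using that unfolding rc(1)[symmetric] by (simp add: block_def)
  have o1: "obs k p s = (\<Prod>i\<in>{r..<r + Suc c}. Y - q ^ i) * R"
    unfolding obs_def spl[of "\<lambda>i. q_ahead s (p i) - q ^ i"] R_def unfolding rc(1)
    using inb by (intro arg_cong2[where f = "(*)"] prod.cong) (auto simp: Y_def)
  have o2: "obs k p (jump_from s (int y)) = (\<Prod>i\<in>{r..<r + Suc c}. q * Y - q ^ i) * R"
    unfolding obs_def spl[of "\<lambda>i. q_ahead (jump_from s (int y)) (p i) - q ^ i"] R_def
    unfolding rc(1)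
  proof (intro arg_cong2[where f = "(*)"] prod.cong refl)
    fix i assume "i \<in> {r..<r + Suc c}"
    then show "q_ahead (jump_from s (int y)) (p i) - q ^ i = q * Y - q ^ i"
      using inb[of i] by (simp add: q_ahead_jump[OF s y] Y_def v)
  next
    fix i assume "i \<in> {..<k} - {r..<r + Suc c}"
    then show "q_ahead (jump_from s (int y)) (p i) - q ^ i = q_ahead s (p i) - q ^ i"
      using outb[of i] by (simp add: q_ahead_jump[OF s y] v)
  qed
  have o3: "obs k (lower k p v) s = (Y' - q ^ (r + c)) * P * R"
  proof -
    have "(\<Prod>i\<in>{..<k} - block k p v. q_ahead s ((lower k p v) i) - q ^ i) = R"
      unfolding R_def rc(2) by (intro prod.cong refl) (auto simp: rc(1))
    moreover have "(\<Prod>i\<in>{r..<r + Suc c}. q_ahead s ((p(r + c := v - 1)) i) - q ^ i) =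
        (Y' - q ^ (r + c)) * P"
    proof -
      have "(\<Prod>i\<in>{r..<r + c}. q_ahead s ((p(r + c := v - 1)) i) - q ^ i) = P"
        unfolding P_def using inb by (intro prod.cong refl) (auto simp: Y_def)
      then show ?thesis using v by (simp add: Y'_def mult.commute)
    qed
    ultimately show ?thesis
      unfolding obs_def spl[of "\<lambda>i. q_ahead s ((lower k p v) i) - q ^ i"]
        by (simp only: rc(1) rc(2)[unfolded rc(1)] mult.assoc)
  qed
  have o1': "obs k p s = (Y - q ^ (r + c)) * P * R" unfolding o1 P_def by simp
  have "obs k p (jump_from s (int y)) - obs k p s = - (1 - q ^ Suc c) * Y * P * R"
    unfolding o1 o2 P_def left_diff_distrib[symmetric] prod_shift_q_diff ..
  have "rate s (int y) = a (int y) * (1 - Y' / Y)"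
    unfolding rate_q_ahead[OF s] Y_def Y'_def v ..
  have "rate s (int y) * (obs k p (jump_from s (int y)) - obs k p s) =
      a (int y) * (1 - q ^ Suc c) * ((1 - Y' / Y) * - Y) * P * R"
  proof -
    have "a' * b' * (- w * Y * P * R) = a' * w * (b' * - Y) * P * R" for a' b' w :: real
      by (simp add: mult_ac)
    then show ?thesis
      using \<open>obs k p (jump_from s (int y)) - obs k p s = - (1 - q ^ Suc c) * Y * P * R\<close> \<open>rate s
        (int y) = a (int y) * (1 - Y' / Y)\<close>
      by (simp only:)
  qed
  also have "(1 - Y' / Y) * - Y = Y' - Y" using Y by (simp add: field_simps)
  also have "a (int y) * (1 - q ^ Suc c) * (Y' - Y) * P * R =
      lower_rate k p v * (obs k (lower k p v) s - obs k p s)"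
  proof -
    have lr: "lower_rate k p v = a (int y) * (1 - q ^ Suc c)"
      unfolding lower_rate_def rc(3) using v by simp
    show ?thesis unfolding lr o3 o1' by (simp add: algebra_simps)
  qed
  finally show ?thesis .
qed

text \<open>Only jumps from \<open>v - 1\<close> with \<open>v\<close> a value of \<open>p\<close>
  affect the observable. If such a site is empty it is not \<open>0\<close>, no particle separates
  the thresholds \<open>v - 1\<close> and \<open>v\<close>, and the lowered observable equals the
  original; so the sum may run over all values of \<open>p\<close>.\<close>

lemma gen_obs:
  assumes s: "s \<in> reach n" and p: "weakly_decreasing k p" "\<And>i. i < k \<Longrightarrow> 1 \<le> p i"
  shows "gen (obs k p) s = (\<Sum>v\<in>p ` {..<k}. lower_rate k p v * (obs k (lower k p v) s - obs k p s))"
proof -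
  have occ: "occupied s \<subseteq> {0..}" using reach_occupied(3)[OF s] by auto
  define V where "V = {v \<in> p ` {..<k}. int (v - 1) \<in> occupied s}"
  have "gen (obs k p) s = (\<Sum>x\<in>(\<lambda>v. int (v - 1)) ` V. rate s x *
      (obs k p (jump_from s x) - obs k p s))"
    unfolding gen_def
  proof (rule sum.mono_neutral_right)
    show "finite (occupied s)" using reach_occupied[OF s] by simp
    show "(\<lambda>v. int (v - 1)) ` V \<subseteq> occupied s" by (auto simp: V_def)
    show "\<forall>x\<in>occupied s - (\<lambda>v. int (v - 1)) ` V. rate s x * (obs k p (jump_from s x) - obs k p s) =
        0"
    proof
      fix x assume x: "x \<in> occupied s - (\<lambda>v. int (v - 1)) ` V"
      then obtain y where y: "x = int y" using occ
        by (metis DiffD1 atLeast_iff nonneg_int_cases subsetD)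
      have "p i \<noteq> Suc y" if "i < k" for i
      proof
        assume "p i = Suc y"
        then have "Suc y \<in> p ` {..<k}" using that by (intro image_eqI[of _ _ i]) auto
        then have "Suc y \<in> V" using x y by (simp add: V_def)
        then show False using x y by force
      qed
      then have "obs k p (jump_from s x) = obs k p s"
        unfolding obs_def using x y by (intro prod.cong refl) (simp add: q_ahead_jump[OF s])
      then show "rate s x * (obs k p (jump_from s x) - obs k p s) = 0" by simp
    qed
  qed
  also have "\<dots> = (\<Sum>v\<in>V. rate s (int (v - 1)) * (obs k p (jump_from s (int (v - 1))) - obs k p s))"
  proof (rule sum.reindex_cong[OF _ refl refl])
    show "inj_on (\<lambda>v. int (v - 1)) V"
    proof (rule inj_onI)
      fix v w assume "v \<in> V" "w \<in> V" "int (v - 1) = int (w - 1)"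
      moreover from this have "1 \<le> v" "1 \<le> w" using p(2) by (auto simp: V_def)
      ultimately show "v = w" by simp
    qed
  qed
  also have "\<dots> = (\<Sum>v\<in>V. lower_rate k p v * (obs k (lower k p v) s - obs k p s))"
  proof (intro sum.cong refl)
    fix v assume v: "v \<in> V"
    then have "1 \<le> v" using p(2) by (auto simp: V_def)
    then have "v = Suc (v - 1)" by simp
    then show "rate s (int (v - 1)) * (obs k p (jump_from s (int (v - 1))) - obs k p s) =
        lower_rate k p v * (obs k (lower k p v) s - obs k p s)"
      using v by (intro obs_jump[OF s p(1)]) (auto simp: V_def)
  qed
  also have "\<dots> = (\<Sum>v\<in>p ` {..<k}. lower_rate k p v * (obs k (lower k p v) s - obs k p s))"
  proof (rule sum.mono_neutral_left)
    show "V \<subseteq> p ` {..<k}" by (auto simp: V_def)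
    show "\<forall>v\<in>p ` {..<k} - V. lower_rate k p v * (obs k (lower k p v) s - obs k p s) = 0"
    proof
      fix v assume v: "v \<in> p ` {..<k} - V"
      then have "particles_at s (int (v - 1)) = {}" by (auto simp: V_def occupied_def)
      moreover have "1 \<le> v - 1"
      proof (rule ccontr)
        assume "\<not> 1 \<le> v - 1"
        then show False using v good_occupied(2)[OF reach_good[OF s]] by (auto simp: V_def)
      qed
      ultimately have eq: "q_ahead s (v - 1) = q_ahead s v"
        using q_ahead_Suc[OF s, of "v - 1"] by simp
      have "obs k (lower k p v) s = obs k p s"
      proof -
        have "Max (block k p v) \<in> block k p v" using v by (intro Max_in) (auto simp: block_def)
        then have "p (Max (block k p v)) = v" by (simp add: block_def)
        then show ?thesis unfolding obs_def using eq by (intro prod.cong refl) auto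
      qed
      then show "lower_rate k p v * (obs k (lower k p v) s - obs k p s) = 0" by simp
    qed
  qed simp
  finally show ?thesis .
qed

text \<open>Initially no particle is ahead of a positive coordinate, so the factor with index
  \<open>0\<close> is \<open>1 - q ^ 0 = 0\<close>.\<close>

lemma obs_step_initial:
  assumes "0 < k" "1 \<le> p 0"
  shows "obs k p step_initial = 0"
proof -
  have "{m. 1 \<le> m \<and> int (p 0) \<le> step_initial m} = {}" using assms by (auto simp: step_initial_def)
  then have "ahead step_initial (p 0) = 0" unfolding ahead_def by (simp only: card.empty)
  then have "q_ahead step_initial (p 0) = 1" using assms by (simp add: q_ahead_def)
  then show ?thesis unfolding obs_def using assms(1)
    by (intro prod_zero) (auto intro!: bexI[of _ 0])
qed

lemma obs_Suc_zero: "p k = 0 \<Longrightarrow> obs (Suc k) p s = - (q ^ k) * obs k p s"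
  by (simp add: obs_def q_ahead_def)

lemma ev_obs_equation:
  assumes p: "weakly_decreasing k p" "\<And>i. i < k \<Longrightarrow> 1 \<le> p i" and k: "0 < k" and t: "0 \<le> t"
  defines "g \<equiv> \<lambda>r. \<Sum>v\<in>p ` {..<k}. lower_rate k p v * (ev (obs k (lower k p v)) r - ev (obs k p) r)"
  shows "(g has_integral ev (obs k p) t) {0..t}"
proof -
  define G where "G s = (\<Sum>v\<in>p ` {..<k}. lower_rate k p v * (obs k (lower k p v) s - obs k p s))"
    for s
  have Gb: "\<bar>G s\<bar> \<le> (\<Sum>v\<in>p ` {..<k}. \<bar>lower_rate k p v\<bar> * 2)" for s
    unfolding G_def
  proof (intro order_trans[OF sum_abs] sum_mono, unfold abs_mult, intro mult_left_mono abs_ge_zero)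
    fix v show "\<bar>obs k (lower k p v) s - obs k p s\<bar> \<le> 2"
      using obs_bound[of k "lower k p v" s] obs_bound[of k p s] by linarith
  qed
  have "ev G r = g r" for r
  proof -
    have int: "integrable clock_space (\<lambda>\<omega>. obs k p' (qTAZRP q a step_initial \<omega> r))" for p'
      by (rule integrable_qTAZRP[OF obs_bound])
    have "ev G r = (\<Sum>v\<in>p ` {..<k}. \<integral>\<omega>. lower_rate k p v *
        (obs k (lower k p v) (qTAZRP q a step_initial \<omega> r) -
        obs k p (qTAZRP q a step_initial \<omega> r)) \<partial>clock_space)"
      unfolding ev_def G_def using int
      by (intro Bochner_Integration.integral_sum integrable_mult_right Bochner_Integration.integrable_diff) auto
    also have "\<dots> = g r"
      unfolding g_def ev_def using int by (intro sum.cong refl) simp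
    finally show ?thesis .
  qed
  then have evG: "ev G = g" by auto
  note dk = dynkin[of "obs k p" 1 G, OF obs_bound Gb gen_obs[OF _ p, folded G_def] t]
  have "set_integrable lborel {0..t} g"
    using dk(2) unfolding evG set_integrable_def by simp
  then have "(g has_integral (LINT r:{0..t}|lborel. g r)) {0..t}"
    using set_borel_integral_eq_integral[of "{0..t}" g] by (simp add: has_integral_iff)
  moreover have "(LINT r:{0..t}|lborel. g r) = ev (obs k p) t"
    using dk(1) p(2)[of 0] k by (simp add: evG set_lebesgue_integral_def obs_step_initial)
  ultimately show ?thesis by simp
qed

end

subsection \<open>Contour integrals over admissible contours\<close>

abbreviation unit_lborel :: "real measure" where
  "unit_lborel \<equiv> restrict_space lborel {0..1}"

lemma space_unit_lborel [simp]: "space unit_lborel = {0..1}"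
  by (simp add: space_restrict_space)

lemma sets_unit_lborel: "sets unit_lborel = sets (restrict_space borel {0..1})"
  by (rule sets_restrict_space_cong) simp

lemma prob_space_unit_lborel: "prob_space unit_lborel"
  by (rule prob_spaceI) (simp add: emeasure_restrict_space)

lemma continuous_measurable_unit:
  fixes f :: "real \<Rightarrow> 'b::topological_space"
  assumes "continuous_on {0..1} f"
  shows "f \<in> borel_measurable unit_lborel"
  using borel_measurable_continuous_on_restrict[OF assms] measurable_cong_sets[OF sets_unit_lborel refl] by auto

text \<open>There is no residue at infinity: circles around all of \<open>P\<close> give the same
  integral, and its norm is at most \<open>2 * pi\<close> times the supremum of
  \<open>norm (z * F z)\<close> on arbitrarily large circles.\<close>

lemma sum_residues_zero:
  assumes F: "F holomorphic_on UNIV - P" and fin: "finite P"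
    and decay: "((\<lambda>z. z * F z) \<longlongrightarrow> 0) at_infinity"
  shows "(\<Sum>p\<in>P. residue F p) = 0"
proof -
  define c where "c = 2 * pi * \<i> * (\<Sum>p\<in>P. residue F p)"
  have "bounded P" using fin by (rule finite_imp_bounded)
  then obtain B where B: "0 < B" "\<And>p. p \<in> P \<Longrightarrow> norm p \<le> B" by (auto simp: bounded_pos)
  have circ: "contour_integral (circlepath 0 R) F = c" if "B < R" for R
  proof -
    have pin: "norm p < R" if "p \<in> P" for p using B(2)[OF that] \<open>B < R\<close> by simp
    have "contour_integral (circlepath 0 R) F =
        2 * pi * \<i> * (\<Sum>p\<in>P. winding_number (circlepath 0 R) p * residue F p)"
    proof (rule Residue_theorem[of UNIV])
      have "x \<notin> P" if "norm x = R" for x using pin[of x] that by auto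
      then show "path_image (circlepath 0 R) \<subseteq> UNIV - P"
        using B \<open>B < R\<close> by (auto simp: path_image_circlepath)
    qed (use F fin in auto)
    also have "\<dots> = c" unfolding c_def
      using pin by (intro arg_cong2[where f = "(*)"] sum.cong refl)
        (auto simp: winding_number_circlepath)
    finally show ?thesis .
  qed
  have "norm c \<le> e" if e: "0 < e" for e
  proof -
    define e' where "e' = e / (2 * pi)"
    have e': "0 < e'" using e by (simp add: e'_def)
    then have "eventually (\<lambda>z. norm (z * F z) < e') at_infinity"
      using decay by (simp add: tendsto_iff)
    then obtain C where C: "\<And>z. C \<le> norm z \<Longrightarrow> norm (z * F z) < e'"
      by (auto simp: eventually_at_infinity)
    define R where "R = max C (B + 1)"
    have R: "B < R" "C \<le> R" "0 < R" using B by (auto simp: R_def)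
    have "F contour_integrable_on circlepath 0 R"
    proof (rule contour_integrable_holomorphic_simple[of _ "UNIV - P"])
      show "open (UNIV - P)" using fin by (simp add: open_Diff finite_imp_closed)
      show "path_image (circlepath 0 R) \<subseteq> UNIV - P"
        using B(2) R by (fastforce simp: path_image_circlepath)
    qed (use F in auto)
    then have "(F has_contour_integral c) (circlepath 0 R)"
      using circ[OF R(1)] has_contour_integral_integral by fastforce
    moreover have "norm (F z) \<le> e' / R" if "norm (z - 0) = R" for z
    proof -
      have "norm z * norm (F z) < e'" using C[of z] that R by (simp add: norm_mult)
      then show ?thesis using that R by (simp add: field_simps)
    qed
    ultimately have "norm c \<le> e' / R * (2 * pi * R)"
      using R e' by (intro has_contour_integral_bound_circlepath) auto
    then show ?thesis using R by (simp add: e'_def)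
  qed
  then have "c = 0" by (metis dense_ge norm_le_zero_iff order_less_imp_le)
  then show ?thesis by (simp add: c_def)
qed

lemma circle_integral_rational_zero:
  assumes F: "F holomorphic_on UNIV - P" and fin: "finite P" and P: "\<And>p. p \<in> P \<Longrightarrow> norm p <
      R" and R: "0 < R"
    and decay: "((\<lambda>z. z * F z) \<longlongrightarrow> 0) at_infinity"
  shows "contour_integral (circlepath 0 R) F = 0"
proof -
  have "contour_integral (circlepath 0 R) F =
      2 * pi * \<i> * (\<Sum>p\<in>P. winding_number (circlepath 0 R) p * residue F p)"
  proof (rule Residue_theorem[of UNIV])
    have "x \<notin> P" if "norm x = R" for x using P[of x] that by auto
    then show "path_image (circlepath 0 R) \<subseteq> UNIV - P"
      using R by (auto simp: path_image_circlepath)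
  qed (use F fin in auto)
  also have "(\<Sum>p\<in>P. winding_number (circlepath 0 R) p * residue F p) = (\<Sum>p\<in>P. residue F p)"
    using P by (intro sum.cong refl) (auto simp: winding_number_circlepath)
  finally show ?thesis using sum_residues_zero[OF F fin decay] by simp
qed

locale admissible =
  fixes q :: real and b :: "nat \<Rightarrow> real" and M :: nat and \<Gamma> :: "real \<Rightarrow> complex"
  assumes q: "0 < q" "q < 1" and adm: "admissible_contour q b M \<Gamma>" and b: "\<And>k. k \<le> M \<Longrightarrow> 0 < b k"
begin

text \<open>The line element \<open>dz / (2 \<pi> i)\<close> in the parameter. Contour integrals
  become Lebesgue integrals over the unit interval, where Fubini and permutations of variables are
  available.\<close>

definition \<rho> :: "real \<Rightarrow> complex" where
  "\<rho> s = vector_derivative \<Gamma> (at s) / (2 * of_real pi * \<i>)"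

lemma adm_facts:
  shows "valid_path \<Gamma>" "simple_path \<Gamma>" "pathfinish \<Gamma> = pathstart \<Gamma>" "path \<Gamma>"
    "continuous_on {0..1} \<Gamma>" "compact (path_image \<Gamma>)" "path_image \<Gamma> \<noteq> {}"
  using adm by (auto simp: admissible_contour_def valid_path_imp_path path_def[symmetric] compact_path_image)

lemma winding_inside: "z \<in> inside (path_image \<Gamma>) \<Longrightarrow> winding_number \<Gamma> z = 1"
  using adm by (simp add: admissible_contour_def)

lemma scaled_inside: "z \<in> path_image \<Gamma> \<Longrightarrow> of_real q * z \<in> inside (path_image \<Gamma>)"
  using adm by (auto simp: admissible_contour_def)

lemma path_inside_disjoint: "z \<in> path_image \<Gamma> \<Longrightarrow> z \<notin> inside (path_image \<Gamma>)"
  by (simp add: inside_def)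

lemma path_ne:
  assumes "z \<in> path_image \<Gamma>"
  shows "z \<noteq> 0" "k \<le> M \<Longrightarrow> z \<noteq> of_real (b k)" "z' \<in> path_image \<Gamma> \<Longrightarrow> z \<noteq> of_real q * z'"
  using assms path_inside_disjoint[OF assms] adm scaled_inside[of z']
  by (auto simp: admissible_contour_def)

text \<open>The poles \<open>z / q\<close> lie outside. Dividing by \<open>q\<close> maps the
  outside of the contour into its complement, since a point hit on the contour would have come from
  inside; the image is connected and unbounded, hence lies in the outside. Closure carries this to
  points \<open>z\<close> of the contour, and \<open>z / q\<close> itself is not on the contour,
  again by admissibility.\<close>

lemma winding_expanded:
  assumes z: "z \<in> path_image \<Gamma>"
  shows "z / of_real q \<notin> path_image \<Gamma>" "winding_number \<Gamma> (z / of_real q) = 0"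
proof -
  let ?P = "path_image \<Gamma>"
  define h where "h = (\<lambda>w::complex. (1 / q) *\<^sub>R w)"
  have J: "connected (outside ?P)" "\<not> bounded (outside ?P)" "frontier (outside ?P) = ?P"
    using Jordan_inside_outside[OF adm_facts(2,3)] by auto
  have "h ` outside ?P \<subseteq> outside ?P"
  proof
    fix x assume x: "x \<in> h ` outside ?P"
    have sub: "h ` outside ?P \<subseteq> - ?P"
    proof
      fix u assume "u \<in> h ` outside ?P"
      then obtain w where w: "w \<in> outside ?P" "u = (1 / q) *\<^sub>R w" by (auto simp: h_def)
      show "u \<in> - ?P"
      proof
        assume "u \<in> ?P"
        from scaled_inside[OF this] have "w \<in> inside ?P" using q w(2)
          by (simp add: scaleR_conv_of_real)
        then show False using w(1) inside_Int_outside[of ?P] by (metis disjoint_iff)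
      qed
    qed
    have "connected (h ` outside ?P)"
      unfolding h_def by (intro connected_continuous_image J continuous_intros)
    then have "h ` outside ?P \<subseteq> connected_component_set (- ?P) x"
      using x sub by (intro connected_component_maximal)
    moreover have "\<not> bounded (h ` outside ?P)"
    proof
      assume "bounded (h ` outside ?P)"
      then have "bounded ((\<lambda>w. q *\<^sub>R w) ` h ` outside ?P)" by (rule bounded_scaling)
      moreover have "(\<lambda>w. q *\<^sub>R w) ` h ` outside ?P = outside ?P"
        using q by (simp add: h_def image_image)
      ultimately show False using J by simp
    qed
    ultimately have "\<not> bounded (connected_component_set (- ?P) x)"
      using bounded_subset by blast
    then show "x \<in> outside ?P" using x sub by (auto simp: outside_def)
  qed
  then have "closure (h ` outside ?P) \<subseteq> closure (outside ?P)" by (rule closure_mono)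
  moreover have "h ` closure (outside ?P) \<subseteq> closure (h ` outside ?P)"
    unfolding h_def by (intro closure_bounded_linear_image_subset bounded_linear_scaleR_right)
  moreover have "z \<in> closure (outside ?P)"
    using z J(3) by (auto simp: frontier_def)
  ultimately have "h z \<in> closure (outside ?P)" by auto
  then have hz: "h z \<in> outside ?P \<union> ?P"
    using J(3) closure_Un_frontier[of "outside ?P"] by auto
  have hz_eq: "h z = z / of_real q" by (simp add: h_def scaleR_conv_of_real)
  show nz: "z / of_real q \<notin> ?P"
  proof
    assume "z / of_real q \<in> ?P"
    from scaled_inside[OF this] show False using q path_inside_disjoint[OF z] by simp
  qed
  then have "h z \<in> outside ?P" using hz by (simp add: hz_eq)
  then show "winding_number \<Gamma> (z / of_real q) = 0"
    unfolding hz_eq using adm_facts by (intro winding_number_zero_in_outside) auto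
qed

lemma path_bounds:
  "\<exists>R \<delta>. 0 < \<delta> \<and> 0 < R \<and> (\<forall>z\<in>path_image \<Gamma>. norm z \<le> R) \<and>
     (\<forall>z\<in>path_image \<Gamma>. \<forall>z'\<in>path_image \<Gamma>. \<delta> \<le> norm (z - of_real q * z'))"
proof -
  have "bounded (path_image \<Gamma>)" using adm_facts(6) compact_imp_bounded by blast
  then obtain R where R: "0 < R" "\<And>z. z \<in> path_image \<Gamma> \<Longrightarrow> norm z \<le> R" by (auto simp: bounded_pos)
  have "compact ((\<lambda>w. of_real q * w) ` path_image \<Gamma>)"
    by (intro compact_continuous_image adm_facts continuous_intros)
  moreover have "path_image \<Gamma> \<inter> (\<lambda>w. of_real q * w) ` path_image \<Gamma> = {}"
    using path_ne(3) by auto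
  ultimately obtain \<delta> where "0 < \<delta>" "\<forall>x\<in>path_image \<Gamma>. \<forall>y\<in>(\<lambda>w. of_real q * w) ` path_image \<Gamma>. \<delta> \<le>
      dist x y"
    using separate_compact_closed[OF adm_facts(6)] compact_imp_closed by metis
  then show ?thesis using R by (intro exI[of _ R] exI[of _ \<delta>]) (auto simp: dist_norm)
qed

lemma \<Gamma>_in: "s \<in> {0..1} \<Longrightarrow> \<Gamma> s \<in> path_image \<Gamma>"
  by (simp add: path_image_def)

lemma \<Gamma>_measurable [measurable]: "\<Gamma> \<in> borel_measurable unit_lborel"
  by (rule continuous_measurable_unit) (rule adm_facts)

text \<open>Absolute integrability refers to the completed measure; Borel measurability comes from
  continuity of the derivative off the finitely many break points.\<close>

lemma vector_derivative_\<Gamma>_integrable: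
  "set_integrable lborel {0..1} (\<lambda>s. vector_derivative \<Gamma> (at s))"
proof -
  obtain S where S: "finite S" "\<Gamma> C1_differentiable_on {0..1} - S"
    using adm_facts(1) by (auto simp: valid_path_def piecewise_C1_differentiable_on_def)
  then have cont: "continuous_on ({0..1} - S) (\<lambda>s. vector_derivative \<Gamma> (at s))"
    by (simp add: C1_differentiable_on_eq)
  have m: "(\<lambda>s. indicator {0..1} s *\<^sub>R vector_derivative \<Gamma> (at s)) \<in> borel_measurable borel"
  proof (rule measurable_discrete_difference[where X = S])
    show "(\<lambda>s. indicator ({0..1} - S) s *\<^sub>R vector_derivative \<Gamma> (at s)) \<in> borel_measurable borel"
      using S by (intro borel_measurable_continuous_on_indicator cont)
        (auto intro: finite_imp_closed borel_closed)
  qed (use S in \<open>auto simp: countable_finite indicator_def\<close>)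
  have "integrable lebesgue (\<lambda>s. indicator {0..1} s *\<^sub>R vector_derivative \<Gamma> (at s))"
    using adm by (simp add: admissible_contour_def set_integrable_def)
  then show ?thesis unfolding set_integrable_def
    using integrable_completion[of _ lborel] m by auto
qed

lemma \<rho>_integrable: "integrable unit_lborel \<rho>"
proof -
  have "integrable lborel (\<lambda>s. indicator {0..1} s *\<^sub>R
      vector_derivative \<Gamma> (at s) / (2 * of_real pi * \<i>))"
    using vector_derivative_\<Gamma>_integrable unfolding set_integrable_def
      by (rule integrable_divide_zero[rotated])
  then show ?thesis
    unfolding \<rho>_def by (subst integrable_restrict_space) (auto simp: scaleR_conv_of_real)
qed

lemma \<rho>_measurable [measurable]: "\<rho> \<in> borel_measurable unit_lborel"
  using \<rho>_integrable by (rule borel_measurable_integrable)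

lemma continuous_path_measurable:
  "continuous_on (path_image \<Gamma>) F \<Longrightarrow> (\<lambda>s. F (\<Gamma> s) :: complex) \<in> borel_measurable unit_lborel"
  by (intro continuous_measurable_unit continuous_on_compose2[of "path_image \<Gamma>" F "{0..1}" \<Gamma>])
    (auto simp: adm_facts \<Gamma>_in)

lemma continuous_path_integrable:
  fixes F :: "complex \<Rightarrow> complex"
  assumes F: "continuous_on (path_image \<Gamma>) F"
  shows "integrable unit_lborel (\<lambda>s. F (\<Gamma> s) * \<rho> s)"
proof -
  have "bounded (F ` path_image \<Gamma>)"
    using F adm_facts(6) by (intro compact_imp_bounded compact_continuous_image)
  then obtain B where B: "\<And>z. z \<in> path_image \<Gamma> \<Longrightarrow> norm (F z) \<le> B" by (auto simp: bounded_iff)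
  show ?thesis
  proof (rule Bochner_Integration.integrable_bound[where f = "\<lambda>s. of_real B * \<rho> s"])
    show "integrable unit_lborel (\<lambda>s. of_real B * \<rho> s)"
      by (intro integrable_mult_right \<rho>_integrable)
    show "(\<lambda>s. F (\<Gamma> s) * \<rho> s) \<in> borel_measurable unit_lborel"
      using continuous_path_measurable[OF F] by measurable
    show "AE s in unit_lborel. norm (F (\<Gamma> s) * \<rho> s) \<le> norm (of_real B * \<rho> s)"
    proof (rule AE_I2)
      fix s assume "s \<in> space unit_lborel"
      then have "norm (F (\<Gamma> s)) \<le> \<bar>B\<bar>" using B[OF \<Gamma>_in] by force
      then show "norm (F (\<Gamma> s) * \<rho> s) \<le> norm (of_real B * \<rho> s)"
        by (simp add: norm_mult mult_right_mono)
    qed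
  qed
qed

lemma contour_integral_unit:
  fixes F :: "complex \<Rightarrow> complex"
  assumes F: "continuous_on (path_image \<Gamma>) F"
  shows "(\<integral>s. F (\<Gamma> s) * \<rho> s \<partial>unit_lborel) = contour_integral \<Gamma> F / (2 * of_real pi * \<i>)"
proof -
  let ?c = "2 * of_real pi * \<i>"
  have int: "set_integrable lborel {0..1} (\<lambda>s. F (\<Gamma> s) * \<rho> s)"
    using continuous_path_integrable[OF F] by (subst (asm) integrable_restrict_space)
      (auto simp: set_integrable_def)
  have "(\<integral>s. F (\<Gamma> s) * \<rho> s \<partial>unit_lborel) = (LINT s:{0..1}|lborel. F (\<Gamma> s) * \<rho> s)"
    by (subst integral_restrict_space) (auto simp: set_lebesgue_integral_def)
  also have "\<dots> = integral {0..1} (\<lambda>s. F (\<Gamma> s) * \<rho> s)"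
    by (rule set_borel_integral_eq_integral[OF int])
  also have "\<dots> = integral {0..1} (\<lambda>s. (F (\<Gamma> s) * vector_derivative \<Gamma> (at s)) / ?c)"
    by (simp add: \<rho>_def)
  also have "\<dots> = contour_integral \<Gamma> F / ?c"
    unfolding contour_integral_integral by (rule integral_divide)
  finally show ?thesis .
qed

text \<open>The poles of the product are at \<open>w i / q\<close>, where the winding number
  vanishes by \<open>winding_expanded\<close>. Cauchy's formula at \<open>0\<close> remains, and
  there every factor of the product is \<open>1\<close>.\<close>

lemma contour_integral_simple_pole:
  assumes E: "E holomorphic_on UNIV" and fin: "finite I" and w: "\<And>i. i \<in> I \<Longrightarrow> w i \<in> path_image \<Gamma>"
  shows "(\<integral>s. (E (\<Gamma> s) / \<Gamma> s * (\<Prod>i\<in>I. (w i - \<Gamma> s) / (w i - of_real q * \<Gamma> s))) * \<rho> s \<partial>unit_lborel) =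
      E 0"
proof -
  define g where "g z = E z * (\<Prod>i\<in>I. (w i - z) / (w i - of_real q * z))" for z
  define S where "S = - ((\<lambda>i. w i / of_real q) ` I)"
  have q0: "q \<noteq> 0" using q by simp
  have Sop: "open S" unfolding S_def using fin by (intro open_Compl finite_imp_closed) auto
  have nz: "w i - of_real q * z \<noteq> 0" if "z \<in> S" "i \<in> I" for z i
  proof
    assume "w i - of_real q * z = 0"
    then have "z = w i / of_real q" using q0 by (simp add: field_simps)
    then show False using that by (auto simp: S_def)
  qed
  have g: "g holomorphic_on S"
    unfolding g_def using nz by (intro holomorphic_intros holomorphic_on_subset[OF E]) auto
  have PS: "path_image \<Gamma> \<subseteq> S" using winding_expanded(1)[OF w] by (auto simp: S_def)
  have 0: "0 \<in> S" using path_ne(1)[OF w] q0 by (auto simp: S_def)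
  have "((\<lambda>z. g z / (z - 0)) has_contour_integral (2 * pi * \<i> * winding_number \<Gamma> 0 * g 0)) \<Gamma>"
  proof (rule Cauchy_integral_formula_global[OF Sop g 0 adm_facts(1)])
    show "pathfinish \<Gamma> = pathstart \<Gamma>" by (rule adm_facts)
    show "path_image \<Gamma> \<subseteq> S - {0}" using PS path_ne(1) by auto
    show "winding_number \<Gamma> z = 0" if "z \<notin> S" for z
      using that winding_expanded(2)[OF w] by (auto simp: S_def)
  qed
  moreover have "winding_number \<Gamma> 0 = 1" using adm by (simp add: admissible_contour_def)
  moreover have "g 0 = E 0"
  proof -
    have "(\<Prod>i\<in>I. (w i - 0) / (w i - of_real q * 0)) = 1"
      using path_ne(1)[OF w] by (intro prod.neutral) auto
    then show ?thesis by (simp add: g_def)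
  qed
  ultimately have "contour_integral \<Gamma> (\<lambda>z. g z / z) = 2 * pi * \<i> * E 0"
    by (simp add: contour_integral_unique)
  moreover have "continuous_on (path_image \<Gamma>) (\<lambda>z. g z / z)"
    using g PS path_ne(1) by (intro continuous_intros)
      (auto intro: holomorphic_on_imp_continuous_on holomorphic_on_subset)
  ultimately have "(\<integral>s. (g (\<Gamma> s) / \<Gamma> s) * \<rho> s \<partial>unit_lborel) = E 0"
    using contour_integral_unit[of "\<lambda>z. g z / z"] by simp
  then show ?thesis by (simp add: g_def)
qed

text \<open>All singularities are enclosed once, so the integral is the sum of all residues, which
  is zero by decay at infinity.\<close>

lemma contour_integral_rational_zero:
  assumes F: "F holomorphic_on UNIV - P" and fin: "finite P" and P: "P \<subseteq> inside (path_image \<Gamma>)"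
    and decay: "((\<lambda>z. z * F z) \<longlongrightarrow> 0) at_infinity"
  shows "(\<integral>s. F (\<Gamma> s) * \<rho> s \<partial>unit_lborel) = 0"
proof -
  have cont: "continuous_on (path_image \<Gamma>) F"
    using P path_inside_disjoint
    by (intro holomorphic_on_imp_continuous_on holomorphic_on_subset[OF F]) auto
  have "contour_integral \<Gamma> F = 2 * pi * \<i> * (\<Sum>p\<in>P. winding_number \<Gamma> p * residue F p)"
    by (rule Residue_theorem[of UNIV]) (use F fin adm_facts P path_inside_disjoint in auto)
  also have "(\<Sum>p\<in>P. winding_number \<Gamma> p * residue F p) = (\<Sum>p\<in>P. residue F p)"
    using P winding_inside by (intro sum.cong refl) auto
  finally have "contour_integral \<Gamma> F = 0" using sum_residues_zero[OF F fin decay] by simp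
  then show ?thesis using contour_integral_unit[OF cont] by simp
qed

end

section \<open>Algebra of the ordered product\<close>

lemma ord_prod_pairs:
  "ord_prod q k z = (\<Prod>(i, l)\<in>{(i, l). i < l \<and> l < k}. (z i - z l) / (z i - q * z l))"
proof -
  have "{(i, l). i < l \<and> l < k} = prod.swap ` (SIGMA l:{..<k}. {..<l})" by (auto simp: image_iff)
  then show ?thesis
    unfolding ord_prod_def by (simp add: prod.Sigma prod.reindex inj_on_def split_def)
qed

text \<open>The factor \<open>z j - q * z (Suc j)\<close> cancels the one denominator that the swap
  of adjacent variables does not preserve. The pair itself leaves the antisymmetric
  \<open>z j - z (Suc j)\<close>, and all other pairs are permuted among themselves without
  reversing their order.\<close>

lemma ord_prod_swap:
  fixes z :: "nat \<Rightarrow> complex"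
  assumes j: "Suc j < k" and nz: "\<And>i l. i < k \<Longrightarrow> l < k \<Longrightarrow> z i \<noteq> q * z l"
  defines "z' \<equiv> z \<circ> Transposition.transpose j (Suc j)"
  shows "ord_prod q k z' * (z' j - q * z' (Suc j)) = - (ord_prod q k z * (z j - q * z (Suc j)))"
proof -
  let ?t = "Transposition.transpose j (Suc j)"
  let ?P = "{(i, l). i < l \<and> l < k}" and ?P' = "{(i, l). i < l \<and> l < k} - {(j, Suc j)}"
  have fin: "finite ?P" by (rule finite_subset[of _ "{..<k} \<times> {..<k}"]) auto
  have jP: "(j, Suc j) \<in> ?P" using j by simp
  define R where "R w = (\<Prod>(i, l)\<in>?P'. (w i - w l) / (w i - q * w l))" for w :: "nat \<Rightarrow> complex"
  have split: "ord_prod q k w = (w j - w (Suc j)) / (w j - q * w (Suc j)) * R w" for w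
    unfolding ord_prod_pairs R_def by (subst prod.remove[OF fin jP]) simp
  have "R z' = R z" unfolding R_def
  proof (rule prod.reindex_bij_witness[of _ "map_prod ?t ?t" "map_prod ?t ?t"])
    fix p assume p: "p \<in> ?P'"
    then obtain i l where il: "p = (i, l)" "i < l" "l < k" "(i, l) \<noteq> (j, Suc j)" by auto
    show "map_prod ?t ?t (map_prod ?t ?t p) = p" by (cases p) simp
    show "map_prod ?t ?t p \<in> ?P'"
      using il j by (auto simp: Transposition.transpose_def)
    show "map_prod ?t ?t (map_prod ?t ?t p) = p" by (cases p) simp
    show "map_prod ?t ?t p \<in> ?P'"
      using il j by (auto simp: Transposition.transpose_def)
    show "(case map_prod ?t ?t p of (i, l) \<Rightarrow> (z i - z l) / (z i - q * z l)) =
        (case p of (i, l) \<Rightarrow> (z' i - z' l) / (z' i - q * z' l))"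
      by (cases p) (simp add: z'_def)
  qed
  moreover have "z' j = z (Suc j)" "z' (Suc j) = z j" by (simp_all add: z'_def)
  moreover have "z j - q * z (Suc j) \<noteq> 0" "z (Suc j) - q * z j \<noteq> 0"
    using nz[of j "Suc j"] nz[of "Suc j" j] j by auto
  ultimately have "ord_prod q k z' * (z' j - q * z' (Suc j)) = (z (Suc j) - z j) * R z"
    and "ord_prod q k z * (z j - q * z (Suc j)) = (z j - z (Suc j)) * R z"
    by (simp_all add: split)
  then show ?thesis by (simp only:) (simp add: left_diff_distrib)
qed

text \<open>The recursion of \<open>ord_prod\<close> splits off the last variable; here the variable
  with index \<open>0\<close> is isolated, which is the one to be integrated out at time
  \<open>0\<close>.\<close>

lemma ord_prod_first:
  "ord_prod q (Suc k) z = (\<Prod>j\<in>{1..<Suc k}. (z 0 - z j) / (z 0 - q * z j)) *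
      ord_prod q k (\<lambda>i. z (Suc i))"
proof (induction k)
  case 0
  then show ?case by (simp add: ord_prod_def)
next
  case (Suc k)
  have "ord_prod q (Suc (Suc k)) z = ord_prod q (Suc k) z *
      (\<Prod>i<Suc k. (z i - z (Suc k)) / (z i - q * z (Suc k)))"
    by (simp add: ord_prod_def)
  also have "(\<Prod>i<Suc k. (z i - z (Suc k)) / (z i - q * z (Suc k))) =
     (z 0 - z (Suc k)) / (z 0 - q * z (Suc k)) *
       (\<Prod>i<k. (z (Suc i) - z (Suc k)) / (z (Suc i) - q * z (Suc k)))"
    by (rule prod.lessThan_Suc_shift)
  finally have 1: "ord_prod q (Suc (Suc k)) z =
      ord_prod q (Suc k) z * ((z 0 - z (Suc k)) / (z 0 - q * z (Suc k)) *
      (\<Prod>i<k. (z (Suc i) - z (Suc k)) / (z (Suc i) - q * z (Suc k))))" .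
  have 2: "ord_prod q (Suc k) (\<lambda>i. z (Suc i)) = ord_prod q k (\<lambda>i. z (Suc i)) *
      (\<Prod>i<k. (z (Suc i) - z (Suc k)) / (z (Suc i) - q * z (Suc k)))"
    by (simp add: ord_prod_def)
  have 3: "(\<Prod>j\<in>{1..<Suc (Suc k)}. (z 0 - z j) / (z 0 - q * z j)) =
     (\<Prod>j\<in>{1..<Suc k}. (z 0 - z j) / (z 0 - q * z j)) * ((z 0 - z (Suc k)) / (z 0 - q * z (Suc k)))"
    by simp
  show ?case unfolding 1 2 3 Suc.IH by (simp only: mult_ac)
qed

section \<open>Nested integrals over a product of copies of one contour\<close>

context admissible
begin

abbreviation cube :: "nat \<Rightarrow> (nat \<Rightarrow> real) measure" where
  "cube k \<equiv> PiM {..<k} (\<lambda>_. unit_lborel)"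

abbreviation "cq \<equiv> complex_of_real q"

lemma product_sigma_finite_unit: "product_sigma_finite (\<lambda>_. unit_lborel)"
  by (rule product_sigma_finite.intro) (intro prob_space_imp_sigma_finite prob_space_unit_lborel)

lemma cube_in: "x \<in> space (cube k) \<Longrightarrow> i < k \<Longrightarrow> x i \<in> {0..1}"
  by (auto simp: space_PiM PiE_iff)

lemma cube_path: "x \<in> space (cube k) \<Longrightarrow> i < k \<Longrightarrow> \<Gamma> (x i) \<in> path_image \<Gamma>"
  using cube_in \<Gamma>_in by blast

lemma cube_comp_measurable:
  "f \<in> borel_measurable unit_lborel \<Longrightarrow> i < k \<Longrightarrow> (\<lambda>x. f (x i)) \<in> borel_measurable (cube k)"
  by (rule measurable_compose[OF measurable_component_singleton]) auto

lemma ord_prod_measurable: "(\<lambda>x. ord_prod cq k (\<lambda>i. \<Gamma> (x i))) \<in> borel_measurable (cube k)"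
  unfolding ord_prod_def
  by (intro borel_measurable_prod borel_measurable_divide borel_measurable_diff borel_measurable_times
      borel_measurable_const cube_comp_measurable \<Gamma>_measurable) auto

definition good_weight :: "nat \<Rightarrow> (nat \<Rightarrow> complex \<Rightarrow> complex) \<Rightarrow> bool" where
  "good_weight k w \<longleftrightarrow> (\<forall>j<k. continuous_on (path_image \<Gamma>) (w j))"

definition nested :: "nat \<Rightarrow> (nat \<Rightarrow> complex \<Rightarrow> complex) \<Rightarrow> (nat \<Rightarrow> real) \<Rightarrow> complex" where
  "nested k w x = ord_prod cq k (\<lambda>i. \<Gamma> (x i)) * (\<Prod>j<k. w j (\<Gamma> (x j)) * \<rho> (x j))"

definition I :: "nat \<Rightarrow> (nat \<Rightarrow> complex \<Rightarrow> complex) \<Rightarrow> complex" where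
  "I k w = (\<integral>x. nested k w x \<partial>cube k)"

lemma weight_prod_integrable:
  assumes "good_weight k w"
  shows "integrable (cube k) (\<lambda>x. \<Prod>j<k. w j (\<Gamma> (x j)) * \<rho> (x j))"
  by (rule product_sigma_finite.product_integrable_prod[OF product_sigma_finite_unit])
    (use assms in \<open>auto simp: good_weight_def intro: continuous_path_integrable\<close>)

lemma bounded_mult_integrable:
  fixes g :: "(nat \<Rightarrow> real) \<Rightarrow> complex"
  assumes w: "good_weight k w" and g: "g \<in> borel_measurable (cube k)" and B: "\<And>x.
      x \<in> space (cube k) \<Longrightarrow> norm (g x) \<le> B"
  shows "integrable (cube k) (\<lambda>x. g x * (\<Prod>j<k. w j (\<Gamma> (x j)) * \<rho> (x j)))"
proof (rule Bochner_Integration.integrable_bound[where f = "\<lambda>x. of_real B *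
    (\<Prod>j<k. w j (\<Gamma> (x j)) * \<rho> (x j))"])
  show "integrable (cube k) (\<lambda>x. complex_of_real B * (\<Prod>j<k. w j (\<Gamma> (x j)) * \<rho> (x j)))"
    by (intro integrable_mult_right weight_prod_integrable w)
  show "(\<lambda>x. g x * (\<Prod>j<k. w j (\<Gamma> (x j)) * \<rho> (x j))) \<in> borel_measurable (cube k)"
    using g borel_measurable_integrable[OF weight_prod_integrable[OF w]] by measurable
  show "AE x in cube k. norm (g x * (\<Prod>j<k. w j (\<Gamma> (x j)) * \<rho> (x j))) \<le>
      norm (complex_of_real B * (\<Prod>j<k. w j (\<Gamma> (x j)) * \<rho> (x j)))"
  proof (rule AE_I2)
    fix x assume "x \<in> space (cube k)"
    from B[OF this] have "norm (g x) \<le> \<bar>B\<bar>" by linarith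
    then show "norm (g x * (\<Prod>j<k. w j (\<Gamma> (x j)) * \<rho> (x j))) \<le>
        norm (complex_of_real B * (\<Prod>j<k. w j (\<Gamma> (x j)) * \<rho> (x j)))"
      by (simp add: norm_mult mult_right_mono)
  qed
qed

text \<open>\<open>\<Gamma>\<close> and \<open>q \<Gamma>\<close> are disjoint compact sets, so the
  denominators keep a positive distance \<open>\<delta>\<close> from zero.\<close>

lemma ord_prod_bounded:
  "\<exists>B. \<forall>z. (\<forall>i<k. z i \<in> path_image \<Gamma>) \<longrightarrow> norm (ord_prod cq k z) \<le> B"
proof -
  obtain R \<delta> where R: "0 < \<delta>" "0 < R" "\<And>z. z \<in> path_image \<Gamma> \<Longrightarrow> norm z \<le> R"
    "\<And>z z'. z \<in> path_image \<Gamma> \<Longrightarrow> z' \<in> path_image \<Gamma> \<Longrightarrow> \<delta> \<le> norm (z - cq * z')"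
    using path_bounds by blast
  have "norm (ord_prod cq k z) \<le> (\<Prod>j<k. \<Prod>i<j. 2 * R / \<delta>)" if z: "\<And>i. i < k \<Longrightarrow> z i \<in> path_image \<Gamma>"
    for z
    unfolding ord_prod_def prod_norm[symmetric]
  proof (intro prod_mono conjI norm_ge_zero prod_nonneg)
    fix j i assume "j \<in> {..<k}" "i \<in> {..<j}"
    then have zz: "z i \<in> path_image \<Gamma>" "z j \<in> path_image \<Gamma>" using z by auto
    have "norm (z i - z j) \<le> 2 * R" using R(3)[OF zz(1)] R(3)[OF zz(2)] norm_triangle_ineq4[of "z i"
      "z j"] by linarith
    then show "norm ((z i - z j) / (z i - cq * z j)) \<le> 2 * R / \<delta>"
      unfolding norm_divide using R(4)[OF zz] R(1,2) by (intro frac_le) auto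
  qed
  then show ?thesis by blast
qed

lemma nested_integrable:
  assumes "good_weight k w"
  shows "integrable (cube k) (nested k w)"
proof -
  obtain B where B: "\<And>z. \<forall>i<k. z i \<in> path_image \<Gamma> \<Longrightarrow> norm (ord_prod cq k z) \<le> B"
    using ord_prod_bounded[of k] by blast
  show ?thesis unfolding nested_def
    by (rule bounded_mult_integrable[OF assms ord_prod_measurable, of B]) (auto intro!: B cube_path)
qed

lemma nested_cong:
  assumes "\<And>j z. j < k \<Longrightarrow> z \<in> path_image \<Gamma> \<Longrightarrow> w j z = w' j z" and "x \<in> space (cube k)"
  shows "nested k w x = nested k w' x"
  unfolding nested_def using assms cube_path by (intro arg_cong2[where f = "(*)"] prod.cong refl) auto

lemma I_cong:
  assumes "\<And>j z. j < k \<Longrightarrow> z \<in> path_image \<Gamma> \<Longrightarrow> w j z = w' j z"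
  shows "I k w = I k w'"
  unfolding I_def by (intro Bochner_Integration.integral_cong refl nested_cong assms)

lemma nested_upd:
  assumes "j < k"
  shows "nested k (w(j := u)) x = u (\<Gamma> (x j)) *
      (ord_prod cq k (\<lambda>i. \<Gamma> (x i)) * \<rho> (x j) * (\<Prod>i\<in>{..<k} - {j}. w i (\<Gamma> (x i)) * \<rho> (x i)))"
proof -
  have "(\<Prod>i\<in>{..<k} - {j}. (w(j := u)) i (\<Gamma> (x i)) * \<rho> (x i)) =
      (\<Prod>i\<in>{..<k} - {j}. w i (\<Gamma> (x i)) * \<rho> (x i))"
    by (intro prod.cong) auto
  then show ?thesis
    unfolding nested_def using assms by (simp add: prod.remove[of "{..<k}" j] mult_ac)
qed

lemma good_weight_upd: "good_weight k w \<Longrightarrow> continuous_on (path_image \<Gamma>) u \<Longrightarrow>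
    good_weight k (w(j := u))"
  by (simp add: good_weight_def)

lemma I_linear:
  assumes w: "good_weight k w" and u: "continuous_on (path_image \<Gamma>) u"
    "continuous_on (path_image \<Gamma>) v" and j: "j < k"
  shows "I k (w(j := \<lambda>z. \<alpha> * u z + \<beta> * v z)) = \<alpha> * I k (w(j := u)) + \<beta> * I k (w(j := v))"
proof -
  have "nested k (w(j := \<lambda>z. \<alpha> * u z + \<beta> * v z)) x = \<alpha> * nested k (w(j := u)) x + \<beta> *
      nested k (w(j := v)) x" for x
    unfolding nested_upd[OF j] by (simp add: algebra_simps)
  then have eq: "nested k (w(j := \<lambda>z. \<alpha> * u z + \<beta> * v z)) =
      (\<lambda>x. \<alpha> * nested k (w(j := u)) x + \<beta> * nested k (w(j := v)) x)"
    by auto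
  show ?thesis unfolding I_def eq
    using nested_integrable[OF good_weight_upd[OF w u(1), of j]] nested_integrable[OF good_weight_upd[OF w u(2), of j]]
    by simp
qed

lemma cube_permute:
  fixes g :: "(nat \<Rightarrow> real) \<Rightarrow> complex"
  assumes \<sigma>: "\<sigma> permutes {..<k}" and g: "g \<in> borel_measurable (cube k)"
  shows "(\<integral>x. g (\<lambda>n\<in>{..<k}. x (\<sigma> n)) \<partial>cube k) = (\<integral>x. g x \<partial>cube k)"
proof -
  have d: "distr (cube k) (cube k) (\<lambda>x. \<lambda>n\<in>{..<k}. x (\<sigma> n)) = cube k"
  proof -
    have "inj_on \<sigma> {..<k}" "\<sigma> \<in> {..<k} \<rightarrow> {..<k}"
      using permutes_inj_on[OF \<sigma>] permutes_in_image[OF \<sigma>] by auto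
    from distr_PiM_reindex[OF prob_space_unit_lborel this] show ?thesis by simp
  qed
  have m: "(\<lambda>x. \<lambda>n\<in>{..<k}. x (\<sigma> n)) \<in> cube k \<rightarrow>\<^sub>M cube k"
    using permutes_in_image[OF \<sigma>] by (intro measurable_restrict measurable_component_singleton) auto
  have "(\<integral>x. g x \<partial>cube k) = (\<integral>x. g x \<partial>distr (cube k) (cube k) (\<lambda>x. \<lambda>n\<in>{..<k}. x (\<sigma> n)))"
    by (simp only: d)
  also have "\<dots> = (\<integral>x. g (\<lambda>n\<in>{..<k}. x (\<sigma> n)) \<partial>cube k)"
    by (rule integral_distr[OF m g])
  finally show ?thesis ..
qed

lemma ord_prod_cong: "(\<And>i. i < k \<Longrightarrow> z i = z' i) \<Longrightarrow> ord_prod q k z = ord_prod q k z'"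
  unfolding ord_prod_def by (intro prod.cong refl) auto

text \<open>The difference of the two sides is the integral of \<open>h * W\<close>. Exchanging the
  two adjacent variables reverses the sign of \<open>h\<close> by \<open>ord_prod_swap\<close> and
  preserves \<open>W\<close>, because the two weights agree on the contour; hence the integral
  equals its own negative.\<close>

lemma I_swap:
  assumes w: "good_weight k w" and j: "Suc j < k" and eq: "\<And>z. z \<in> path_image \<Gamma> \<Longrightarrow> w j z =
      w (Suc j) z"
  shows "I k (w(j := \<lambda>z. z * w j z)) = cq * I k (w(Suc j := \<lambda>z. z * w (Suc j) z))"
proof -
  define h where "h x = ord_prod cq k (\<lambda>i. \<Gamma> (x i)) * (\<Gamma> (x j) - cq * \<Gamma> (x (Suc j)))"
    for x :: "nat \<Rightarrow> real"
  define W where "W x = (\<Prod>i<k. w i (\<Gamma> (x i)) * \<rho> (x i))" for x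
  let ?t = "Transposition.transpose j (Suc j)"
  have t: "?t permutes {..<k}" using j by (intro permutes_swap_id) auto
  have good: "good_weight k (w(j := \<lambda>z. z * w j z))"
    "good_weight k (w(Suc j := \<lambda>z. z * w (Suc j) z))"
    using w j by (auto intro!: good_weight_upd continuous_intros simp: good_weight_def)
  have n1: "nested k (w(j := \<lambda>z. z * w j z)) x = \<Gamma> (x j) * (ord_prod cq k (\<lambda>i. \<Gamma> (x i)) * W x)"
    for x
    using j unfolding nested_upd[of j k, OF Suc_lessD[OF j]] W_def
    by (subst prod.remove[of "{..<k}" j]) auto
  have n2: "nested k (w(Suc j := \<lambda>z. z * w (Suc j) z)) x =
      \<Gamma> (x (Suc j)) * (ord_prod cq k (\<lambda>i. \<Gamma> (x i)) * W x)" for x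
    using j unfolding nested_upd[of "Suc j" k, OF j] W_def
    by (subst prod.remove[of "{..<k}" "Suc j"]) auto
  have diff: "I k (w(j := \<lambda>z. z * w j z)) - cq * I k (w(Suc j := \<lambda>z. z * w (Suc j) z)) =
      (\<integral>x. h x * W x \<partial>cube k)"
  proof -
    have "h x * W x = nested k (w(j := \<lambda>z. z * w j z)) x - cq *
        nested k (w(Suc j := \<lambda>z. z * w (Suc j) z)) x" for x
      unfolding n1 n2 h_def by (simp add: algebra_simps)
    then show ?thesis unfolding I_def using nested_integrable[OF good(1)] nested_integrable[OF good(2)] by simp
  qed
  have meas: "(\<lambda>x. h x * W x) \<in> borel_measurable (cube k)"
    unfolding h_def W_def using borel_measurable_integrable[OF weight_prod_integrable[OF w]] j
    by (intro borel_measurable_times borel_measurable_diff ord_prod_measurable cube_comp_measurable \<Gamma>_measurable borel_measurable_const) auto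
  have "(\<integral>x. h x * W x \<partial>cube k) = (\<integral>x. h (\<lambda>n\<in>{..<k}. x (?t n)) * W (\<lambda>n\<in>{..<k}. x (?t n)) \<partial>cube k)"
    using cube_permute[OF t meas] by simp
  also have "\<dots> = (\<integral>x. - (h x * W x) \<partial>cube k)"
  proof (rule Bochner_Integration.integral_cong[OF refl])
    fix x assume x: "x \<in> space (cube k)"
    define z where "z i = \<Gamma> (x i)" for i
    have zP: "z i \<in> path_image \<Gamma>" if "i < k" for i using cube_path[OF x that] by (simp add: z_def)
    have "ord_prod cq k (\<lambda>i. \<Gamma> ((\<lambda>n\<in>{..<k}. x (?t n)) i)) = ord_prod cq k (z \<circ> ?t)"
      by (intro ord_prod_cong) (simp add: z_def)
    then have "h (\<lambda>n\<in>{..<k}. x (?t n)) = ord_prod cq k (z \<circ> ?t) *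
        ((z \<circ> ?t) j - cq * (z \<circ> ?t) (Suc j))"
      using j by (simp add: h_def z_def)
    also have "\<dots> = - (ord_prod cq k z * (z j - cq * z (Suc j)))"
      using zP path_ne(3) by (intro ord_prod_swap j) auto
    also have "\<dots> = - h x" unfolding h_def z_def ..
    finally have 1: "h (\<lambda>n\<in>{..<k}. x (?t n)) = - h x" .
    have "W (\<lambda>n\<in>{..<k}. x (?t n)) = (\<Prod>i<k. w i (\<Gamma> (x (?t i))) * \<rho> (x (?t i)))"
      unfolding W_def by (intro prod.cong) auto
    also have "\<dots> = (\<Prod>i<k. w (?t i) (\<Gamma> (x (?t i))) * \<rho> (x (?t i)))"
    proof (intro prod.cong refl arg_cong2[where f = "(*)"])
      fix i assume "i \<in> {..<k}"
      then have "\<Gamma> (x (?t i)) \<in> path_image \<Gamma>" using permutes_in_image[OF t, of i]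
        by (intro cube_path[OF x]) auto
      then show "w i (\<Gamma> (x (?t i))) = w (?t i) (\<Gamma> (x (?t i)))"
        using eq by (auto simp: Transposition.transpose_def)
    qed
    also have "\<dots> = W x" unfolding W_def
      using prod.permute[OF t, of "\<lambda>i. w i (\<Gamma> (x i)) * \<rho> (x i)"] by (simp add: o_def)
    finally show "h (\<lambda>n\<in>{..<k}. x (?t n)) * W (\<lambda>n\<in>{..<k}. x (?t n)) = - (h x * W x)" using 1 by simp
  qed
  also have "\<dots> = - (\<integral>x. h x * W x \<partial>cube k)" by simp
  finally have "(\<integral>x. h x * W x \<partial>cube k) = 0" by simp
  then show ?thesis using diff by simp
qed

text \<open>The last variable appears in \<open>ord_prod\<close> only in denominators with poles
  outside the contour, so integrating it out leaves the residue at \<open>0\<close>.\<close>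

lemma I_last:
  assumes w: "good_weight (Suc k) w" and E: "E holomorphic_on UNIV" and wk: "w k = (\<lambda>z. E z / z)"
  shows "I (Suc k) w = E 0 * I k w"
proof -
  interpret product_sigma_finite "\<lambda>_::nat. unit_lborel" by (rule product_sigma_finite_unit)
  have ins: "{..<Suc k} = insert k {..<k}" by auto
  have "I (Suc k) w = (\<integral>x. (\<integral>s. nested (Suc k) w (x(k := s)) \<partial>unit_lborel) \<partial>cube k)"
    unfolding I_def ins using nested_integrable[OF w]
    by (intro product_integral_insert) (auto simp: lessThan_Suc)
  also have "\<dots> = (\<integral>x. E 0 * nested k w x \<partial>cube k)"
  proof (rule Bochner_Integration.integral_cong[OF refl])
    fix x assume x: "x \<in> space (cube k)"
    have "nested (Suc k) w (x(k := s)) = nested k w x *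
       ((E (\<Gamma> s) / \<Gamma> s * (\<Prod>i\<in>{..<k}. (\<Gamma> (x i) - \<Gamma> s) / (\<Gamma> (x i) - cq * \<Gamma> s))) * \<rho> s)" for s
    proof -
      have "ord_prod cq (Suc k) (\<lambda>i. \<Gamma> ((x(k := s)) i)) =
          ord_prod cq k (\<lambda>i. \<Gamma> (x i)) * (\<Prod>i\<in>{..<k}. (\<Gamma> (x i) - \<Gamma> s) / (\<Gamma> (x i) - cq * \<Gamma> s))"
      proof -
        have "ord_prod cq (Suc k) (\<lambda>i. \<Gamma> ((x(k := s)) i)) = ord_prod cq k (\<lambda>i. \<Gamma> ((x(k := s)) i)) *
           (\<Prod>i\<in>{..<k}. (\<Gamma> ((x(k := s)) i) - \<Gamma> ((x(k := s)) k)) /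
             (\<Gamma> ((x(k := s)) i) - cq * \<Gamma> ((x(k := s)) k)))"
          by (simp add: ord_prod_def)
        also have "ord_prod cq k (\<lambda>i. \<Gamma> ((x(k := s)) i)) = ord_prod cq k (\<lambda>i. \<Gamma> (x i))"
          by (intro ord_prod_cong) auto
        also have "(\<Prod>i\<in>{..<k}. (\<Gamma> ((x(k := s)) i) - \<Gamma> ((x(k := s)) k)) / (\<Gamma> ((x(k := s)) i) - cq *
            \<Gamma> ((x(k := s)) k))) =
           (\<Prod>i\<in>{..<k}. (\<Gamma> (x i) - \<Gamma> s) / (\<Gamma> (x i) - cq * \<Gamma> s))"
          by (intro prod.cong) auto
        finally show ?thesis .
      qed
      moreover have "(\<Prod>j<Suc k. w j (\<Gamma> ((x(k := s)) j)) * \<rho> ((x(k := s)) j)) =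
          (\<Prod>j<k. w j (\<Gamma> (x j)) * \<rho> (x j)) * (E (\<Gamma> s) / \<Gamma> s * \<rho> s)"
      proof -
        have "(\<Prod>j<k. w j (\<Gamma> ((x(k := s)) j)) * \<rho> ((x(k := s)) j)) = (\<Prod>j<k. w j (\<Gamma> (x j)) * \<rho> (x j))"
          by (intro prod.cong) auto
        then show ?thesis by (simp add: wk)
      qed
      ultimately show ?thesis unfolding nested_def by (simp only: mult_ac)
    qed
    then have "(\<integral>s. nested (Suc k) w (x(k := s)) \<partial>unit_lborel) = nested k w x *
       (\<integral>s. (E (\<Gamma> s) / \<Gamma> s * (\<Prod>i\<in>{..<k}. (\<Gamma> (x i) - \<Gamma> s) /
         (\<Gamma> (x i) - cq * \<Gamma> s))) * \<rho> s \<partial>unit_lborel)"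
      by (simp only: integral_mult_right_zero)
    also have "(\<integral>s. (E (\<Gamma> s) / \<Gamma> s * (\<Prod>i\<in>{..<k}. (\<Gamma> (x i) - \<Gamma> s) / (\<Gamma> (x i) - cq * \<Gamma> s))) *
        \<rho> s \<partial>unit_lborel) = E 0"
      using cube_path[OF x] by (intro contour_integral_simple_pole[OF E]) auto
    finally show "(\<integral>s. nested (Suc k) w (x(k := s)) \<partial>unit_lborel) = E 0 * nested k w x"
      by (simp only: mult.commute)
  qed
  also have "\<dots> = E 0 * I k w" unfolding I_def by simp
  finally show ?thesis .
qed

end

section \<open>Time evolution and boundary values of the nested integrals\<close>

lemma tendsto_inverse_shift_at_infinity:
  fixes d :: complex
  shows "((\<lambda>z. c / (z - d)) \<longlongrightarrow> 0) at_infinity"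
proof (rule tendsto_divide_0[OF tendsto_const])
  have "filterlim (\<lambda>z::complex. - d + z) at_infinity at_infinity"
    by (rule tendsto_add_filterlim_at_infinity[OF tendsto_const filterlim_ident])
  then show "filterlim (\<lambda>z. z - d) at_infinity at_infinity" by simp
qed

lemma tendsto_moebius_at_infinity:
  fixes c d :: complex
  shows "((\<lambda>z. (z - c) / (z - d)) \<longlongrightarrow> 1) at_infinity"
proof -
  have "((\<lambda>z. 1 + (d - c) / (z - d)) \<longlongrightarrow> 1 + 0) at_infinity"
    by (intro tendsto_intros tendsto_inverse_shift_at_infinity)
  moreover have "eventually (\<lambda>z. 1 + (d - c) / (z - d) = (z - c) / (z - d)) at_infinity"
    unfolding eventually_at_infinity
  proof (intro exI[of _ "norm d + 1"] allI impI)
    fix z :: complex assume "norm d + 1 \<le> norm z"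
    then have "z - d \<noteq> 0" by auto
    then show "1 + (d - c) / (z - d) = (z - c) / (z - d)" by (simp add: field_simps)
  qed
  ultimately have "((\<lambda>z. (z - c) / (z - d)) \<longlongrightarrow> 1 + 0) at_infinity"
    by (rule Lim_transform_eventually)
  then show ?thesis by simp
qed

text \<open>As \<open>S\<close> is bounded, the second-order Taylor remainder of the exponential is
  at most \<open>h\<^sup>2 * B'\<^sup>2 * exp B'\<close> uniformly in \<open>x\<close> for
  \<open>\<bar>h\<bar> \<le> 1\<close>; integrating it gives an error quadratic in
  \<open>h\<close>.\<close>

lemma has_vector_derivative_exp_integral:
  fixes S \<Phi> :: "'a \<Rightarrow> complex"
  assumes \<Phi>: "integrable M \<Phi>" and S: "S \<in> borel_measurable M" and B: "\<And>x. x \<in> space M \<Longrightarrow> norm (S x) \<le>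
      B"
  shows "((\<lambda>t. \<integral>x. exp (- (of_real t * S x)) * \<Phi> x \<partial>M) has_vector_derivative
     (\<integral>x. - S x * (exp (- (of_real t * S x)) * \<Phi> x) \<partial>M)) (at t)"
proof -
  define G where "G t = (\<integral>x. exp (- (of_real t * S x)) * \<Phi> x \<partial>M)" for t
  define \<Psi> where "\<Psi> x = exp (- (of_real t * S x)) * \<Phi> x" for x
  define D where "D = (\<integral>x. - S x * \<Psi> x \<partial>M)"
  define B' where "B' = \<bar>B\<bar>"
  have B': "0 \<le> B'" "\<And>x. x \<in> space M \<Longrightarrow> norm (S x) \<le> B'" using B unfolding B'_def by force+
  have \<Phi>m: "\<Phi> \<in> borel_measurable M" using \<Phi> by (rule borel_measurable_integrable)
  have int: "integrable M (\<lambda>x. exp (- (of_real s * S x)) * \<Phi> x)" for s :: real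
  proof (rule Bochner_Integration.integrable_bound[where f = "\<lambda>x. exp (\<bar>s\<bar> * B') *\<^sub>R \<Phi> x"])
    show "integrable M (\<lambda>x. exp (\<bar>s\<bar> * B') *\<^sub>R \<Phi> x)" using \<Phi> by (rule integrable_scaleR_right)
    show "(\<lambda>x. exp (- (of_real s * S x)) * \<Phi> x) \<in> borel_measurable M" using S \<Phi>m by measurable
    show "AE x in M. norm (exp (- (of_real s * S x)) * \<Phi> x) \<le> norm (exp (\<bar>s\<bar> * B') *\<^sub>R \<Phi> x)"
    proof (rule AE_I2)
      fix x assume x: "x \<in> space M"
      have "norm (exp (- (of_real s * S x))) \<le> exp (norm (of_real s * S x))"
        using norm_exp[of "- (of_real s * S x)"] by simp
      also have "\<dots> \<le> exp (\<bar>s\<bar> * B')" using B'(2)[OF x] by (simp add: norm_mult mult_left_mono)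
      finally show "norm (exp (- (of_real s * S x)) * \<Phi> x) \<le> norm (exp (\<bar>s\<bar> * B') *\<^sub>R \<Phi> x)"
        by (simp add: norm_mult mult_right_mono)
    qed
  qed
  have int\<Psi>: "integrable M \<Psi>" unfolding \<Psi>_def by (rule int)
  have \<Psi>m: "\<Psi> \<in> borel_measurable M" using int\<Psi> by (rule borel_measurable_integrable)
  have intD: "integrable M (\<lambda>x. - S x * \<Psi> x)"
  proof (rule Bochner_Integration.integrable_bound[where f = "\<lambda>x. B' *\<^sub>R \<Psi> x"])
    show "AE x in M. norm (- S x * \<Psi> x) \<le> norm (B' *\<^sub>R \<Psi> x)"
      using B' by (intro AE_I2) (simp add: norm_mult mult_right_mono)
  qed (use S \<Psi>m int\<Psi> in auto)
  define C where "C = B' ^ 2 * exp B' * (\<integral>x. norm (\<Psi> x) \<partial>M)"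
  have key: "norm (G (t + h) - G t - h *\<^sub>R D) \<le> \<bar>h\<bar> ^ 2 * C" if h: "\<bar>h\<bar> \<le> 1" for h
  proof -
    have shift: "exp (- (of_real (t + h) * S x)) * \<Phi> x = exp (- (of_real h * S x)) * \<Psi> x" for x
    proof -
      have "- (of_real (t + h) * S x) = - (of_real h * S x) + - (of_real t * S x)"
        by (simp add: algebra_simps)
      then show ?thesis unfolding \<Psi>_def by (simp only: exp_add mult.assoc)
    qed
    have inth: "integrable M (\<lambda>x. exp (- (of_real h * S x)) * \<Psi> x)"
      using int[of "t + h"] unfolding shift .
    have "G (t + h) - G t - h *\<^sub>R D = (\<integral>x. exp (- (of_real h * S x)) * \<Psi> x - \<Psi> x - h *\<^sub>R
        (- S x * \<Psi> x) \<partial>M)"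
    proof -
      have "G (t + h) = (\<integral>x. exp (- (of_real h * S x)) * \<Psi> x \<partial>M)"
        unfolding G_def by (intro Bochner_Integration.integral_cong refl shift)
      moreover have "G t = (\<integral>x. \<Psi> x \<partial>M)" by (simp add: G_def \<Psi>_def)
      moreover have "(\<integral>x. exp (- (of_real h * S x)) * \<Psi> x - \<Psi> x - h *\<^sub>R (- S x * \<Psi> x) \<partial>M) =
         (\<integral>x. exp (- (of_real h * S x)) * \<Psi> x \<partial>M) - (\<integral>x. \<Psi> x \<partial>M) - h *\<^sub>R (\<integral>x. - S x * \<Psi> x \<partial>M)"
        by (subst Bochner_Integration.integral_diff[OF Bochner_Integration.integrable_diff[OF inth int\<Psi>] integrable_scaleR_right[OF intD, of h]])
          (simp only: Bochner_Integration.integral_diff[OF inth int\<Psi>] integral_scaleR_right)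
      ultimately show ?thesis by (simp only: D_def)
    qed
    also have "norm \<dots> \<le> (\<integral>x. norm (exp (- (of_real h * S x)) * \<Psi> x - \<Psi> x - h *\<^sub>R (- S x * \<Psi> x)) \<partial>M)"
      by (rule integral_norm_bound)
    also have "\<dots> \<le> (\<integral>x. (\<bar>h\<bar> ^ 2 * (B' ^ 2 * exp B')) * norm (\<Psi> x) \<partial>M)"
    proof (rule integral_mono)
      show "integrable M (\<lambda>x. norm (exp (- (of_real h * S x)) * \<Psi> x - \<Psi> x - h *\<^sub>R (- S x * \<Psi> x)))"
        using inth int\<Psi> intD by (intro integrable_norm Bochner_Integration.integrable_diff integrable_scaleR_right)
      show "integrable M (\<lambda>x. (\<bar>h\<bar> ^ 2 * (B' ^ 2 * exp B')) * norm (\<Psi> x))"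
        using int\<Psi> by (intro integrable_mult_right integrable_norm)
      fix x assume x: "x \<in> space M"
      define w where "w = - (of_real h * S x)"
      have nw: "norm w \<le> \<bar>h\<bar> * B'" unfolding w_def using B'(2)[OF x]
        by (simp add: norm_mult mult_left_mono)
      have "\<bar>Re w\<bar> \<le> norm w" by (rule abs_Re_le_cmod)
      also note nw
      also have "\<bar>h\<bar> * B' \<le> 1 * B'" using h B'(1) by (intro mult_right_mono)
      finally have rw: "\<bar>Re w\<bar> \<le> B'" by simp
      have "norm (exp w - (\<Sum>i\<le>1. w ^ i / fact i)) \<le> exp \<bar>Re w\<bar> * norm w ^ Suc 1 / fact 1"
        by (rule Taylor_exp)
      then have "norm (exp w - 1 - w) \<le> exp \<bar>Re w\<bar> * norm w ^ 2"
        by (simp add: diff_diff_eq power2_eq_square)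
      also have "\<dots> \<le> exp B' * (\<bar>h\<bar> * B') ^ 2"
        using rw nw by (intro mult_mono power_mono) auto
      finally have "norm (exp w - 1 - w) \<le> \<bar>h\<bar> ^ 2 * (B' ^ 2 * exp B')"
        by (simp add: power_mult_distrib mult_ac)
      then have "norm ((exp w - 1 - w) * \<Psi> x) \<le> (\<bar>h\<bar> ^ 2 * (B' ^ 2 * exp B')) * norm (\<Psi> x)"
        unfolding norm_mult by (intro mult_right_mono) auto
      moreover have "exp (- (of_real h * S x)) * \<Psi> x - \<Psi> x - h *\<^sub>R (- S x * \<Psi> x) =
          (exp w - 1 - w) * \<Psi> x"
        by (simp add: w_def scaleR_conv_of_real algebra_simps)
      ultimately show "norm (exp (- (of_real h * S x)) * \<Psi> x - \<Psi> x - h *\<^sub>R (- S x * \<Psi> x)) \<le>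
          (\<bar>h\<bar> ^ 2 * (B' ^ 2 * exp B')) * norm (\<Psi> x)"
        by simp
    qed
    also have "\<dots> = \<bar>h\<bar> ^ 2 * C" by (simp add: C_def)
    finally show ?thesis .
  qed
  have "(\<lambda>h. norm (G (t + h) - G t - h *\<^sub>R D) / norm h) \<midarrow>0\<rightarrow> 0"
  proof (rule Lim_null_comparison)
    show "eventually (\<lambda>h. norm (norm (G (t + h) - G t - h *\<^sub>R D) / norm h) \<le> \<bar>h\<bar> * C) (at 0)"
      unfolding eventually_at
    proof (intro exI[of _ 1] conjI ballI impI)
      fix h :: real assume h: "h \<noteq> 0 \<and> dist h 0 < 1"
      then have "norm (G (t + h) - G t - h *\<^sub>R D) / \<bar>h\<bar> \<le> \<bar>h\<bar> ^ 2 * C / \<bar>h\<bar>"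
        by (intro divide_right_mono key) auto
      moreover have "a ^ 2 * C / a = a * C" if "a \<noteq> 0" for a :: real using that
        by (simp add: power2_eq_square)
      from this[of "\<bar>h\<bar>"] have "\<bar>h\<bar> ^ 2 * C / \<bar>h\<bar> = \<bar>h\<bar> * C" using h by simp
      ultimately show "norm (norm (G (t + h) - G t - h *\<^sub>R D) / norm h) \<le> \<bar>h\<bar> * C" by simp
    qed simp
    show "(\<lambda>h::real. \<bar>h\<bar> * C) \<midarrow>0\<rightarrow> 0" by (rule tendsto_eq_intros refl)+ simp
  qed
  then have "(G has_vector_derivative D) (at t)"
    unfolding has_vector_derivative_def has_derivative_at
    by (auto intro: bounded_linear_scaleR_left)
  then show ?thesis by (simp add: G_def[abs_def] D_def \<Psi>_def)
qed

context admissible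
begin

text \<open>For \<open>p = Suc M\<close> this is the numerator of \<open>K_pre\<close>; smaller
  \<open>p\<close> keeps only the sites below \<open>p\<close>, so that lowering a coordinate
  removes one factor.\<close>

definition factor :: "nat \<Rightarrow> real \<Rightarrow> complex \<Rightarrow> complex" where
  "factor p t z = exp (- z * of_real t) * (\<Prod>i<p. of_real (b i) / (of_real (b i) - z))"

definition weight :: "(nat \<Rightarrow> nat) \<Rightarrow> real \<Rightarrow> nat \<Rightarrow> complex \<Rightarrow> complex" where
  "weight p t j z = factor (p j) t z / z"

text \<open>The sign and the powers of \<open>q\<close> are dictated by coordinate \<open>0\<close>:
  dropping a last coordinate \<open>0\<close> multiplies \<open>obs\<close> by
  \<open>- (q ^ k)\<close> but leaves \<open>I\<close> unchanged.\<close>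

definition U :: "nat \<Rightarrow> (nat \<Rightarrow> nat) \<Rightarrow> real \<Rightarrow> complex" where
  "U k p t = (- 1) ^ k * (\<Prod>i<k. cq ^ i) * I k (weight p t)"

lemma good_weight_weight:
  assumes "\<And>j. j < k \<Longrightarrow> p j \<le> Suc M"
  shows "good_weight k (weight p t)"
  unfolding good_weight_def weight_def factor_def
proof (intro allI impI)
  fix j assume "j < k"
  then have "p j \<le> Suc M" by (rule assms)
  then show "continuous_on (path_image \<Gamma>) (\<lambda>z. exp (- z * of_real t) *
      (\<Prod>i<p j. of_real (b i) / (of_real (b i) - z)) / z)"
  proof (intro continuous_intros ballI)
    fix z i assume z: "z \<in> path_image \<Gamma>" and i: "i \<in> {..<p j}"
    then have "i \<le> M" using \<open>p j \<le> Suc M\<close> by simp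
    then show "of_real (b i) - z \<noteq> 0" using path_ne(2)[OF z] by auto
  qed (rule path_ne(1))
qed

lemma U_0: "U 0 p t = 1"
proof -
  have "I 0 (weight p t) = 1"
    unfolding I_def nested_def by (simp add: ord_prod_def PiM_empty lebesgue_integral_count_space_finite)
  then show ?thesis by (simp add: U_def)
qed

lemma U_Suc_zero:
  assumes "\<And>j. j < Suc k \<Longrightarrow> p j \<le> Suc M" and "p k = 0"
  shows "U (Suc k) p t = - (cq ^ k) * U k p t"
proof -
  have "I (Suc k) (weight p t) = exp (- 0 * of_real t) * I k (weight p t)"
  proof (rule I_last)
    show "good_weight (Suc k) (weight p t)" using assms(1) by (rule good_weight_weight)
    show "(\<lambda>z. exp (- z * of_real t)) holomorphic_on UNIV" by (intro holomorphic_intros)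
    show "weight p t k = (\<lambda>z. exp (- z * of_real t) / z)"
      by (simp add: weight_def factor_def fun_eq_iff assms(2))
  qed
  then show ?thesis by (simp add: U_def)
qed

text \<open>At time \<open>0\<close> the integrand is rational in the first variable, with poles at
  \<open>0\<close>, at the \<open>b i\<close> and at \<open>q\<close> times the other variables, all
  inside. Since \<open>p 0 \<ge> 1\<close>, at least one factor \<open>b i / (b i - z)\<close> is
  present and gives the decay needed to conclude that the integral is zero.\<close>

lemma U_initial:
  assumes p: "\<And>j. j < Suc k \<Longrightarrow> p j \<le> Suc M" and p0: "1 \<le> p 0"
  shows "U (Suc k) p 0 = 0"
proof -
  interpret product_sigma_finite "\<lambda>_::nat. unit_lborel" by (rule product_sigma_finite_unit)
  let ?J = "{1..<Suc k}" and ?w = "weight p 0"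
  have ins: "{..<Suc k} = insert 0 ?J" by auto
  have good: "good_weight (Suc k) ?w" using p by (rule good_weight_weight)
  have "I (Suc k) ?w = (\<integral>x. (\<integral>s. nested (Suc k) ?w (x(0 := s)) \<partial>unit_lborel) \<partial>PiM ?J
      (\<lambda>_. unit_lborel))"
    unfolding I_def ins using nested_integrable[OF good]
    by (intro product_integral_insert) (auto simp: ins)
  also have "\<dots> = (\<integral>x. 0 \<partial>PiM ?J (\<lambda>_. unit_lborel))"
  proof (rule Bochner_Integration.integral_cong[OF refl])
    fix x assume x: "x \<in> space (PiM ?J (\<lambda>_. unit_lborel))"
    have xP: "\<Gamma> (x j) \<in> path_image \<Gamma>" if "j \<in> ?J" for j
      using x that by (intro \<Gamma>_in) (auto simp: space_PiM PiE_iff)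
    define F where "F z = ?w 0 z * (\<Prod>j\<in>?J. (z - \<Gamma> (x j)) / (z - cq * \<Gamma> (x j)))" for z
    define C where "C = ord_prod cq k (\<lambda>i. \<Gamma> (x (Suc i))) * (\<Prod>j\<in>?J. ?w j (\<Gamma> (x j)) * \<rho> (x j))"
    have "nested (Suc k) ?w (x(0 := s)) = C * (F (\<Gamma> s) * \<rho> s)" for s
    proof -
      have "ord_prod cq (Suc k) (\<lambda>i. \<Gamma> ((x(0 := s)) i)) =
         (\<Prod>j\<in>?J. (\<Gamma> s - \<Gamma> (x j)) / (\<Gamma> s - cq * \<Gamma> (x j))) * ord_prod cq k (\<lambda>i. \<Gamma> (x (Suc i)))"
        unfolding ord_prod_first by (intro arg_cong2[where f = "(*)"] prod.cong) auto
      moreover have "(\<Prod>j<Suc k. ?w j (\<Gamma> ((x(0 := s)) j)) * \<rho> ((x(0 := s)) j)) =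
          ?w 0 (\<Gamma> s) * \<rho> s * (\<Prod>j\<in>?J. ?w j (\<Gamma> (x j)) * \<rho> (x j))"
      proof -
        have "(\<Prod>j\<in>?J. ?w j (\<Gamma> ((x(0 := s)) j)) * \<rho> ((x(0 := s)) j)) =
            (\<Prod>j\<in>?J. ?w j (\<Gamma> (x j)) * \<rho> (x j))"
          by (intro prod.cong) auto
        then show ?thesis unfolding ins by simp
      qed
      ultimately show ?thesis unfolding nested_def C_def F_def by (simp only: mult_ac)
    qed
    then have "(\<integral>s. nested (Suc k) ?w (x(0 := s)) \<partial>unit_lborel) =
        C * (\<integral>s. F (\<Gamma> s) * \<rho> s \<partial>unit_lborel)"
      by (simp only: integral_mult_right_zero)
    also have "(\<integral>s. F (\<Gamma> s) * \<rho> s \<partial>unit_lborel) = 0"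
    proof (rule contour_integral_rational_zero)
      define P where "P = insert 0 ((\<lambda>i. complex_of_real (b i)) ` {..<p 0} \<union> (\<lambda>j. cq *
          \<Gamma> (x j)) ` ?J)"
      show "F holomorphic_on UNIV - P"
        unfolding F_def weight_def factor_def by (intro holomorphic_intros) (auto simp: P_def)
      show "finite P" by (simp add: P_def)
      show "P \<subseteq> inside (path_image \<Gamma>)"
        using adm p[of 0] scaled_inside[OF xP] by (auto simp: P_def admissible_contour_def)
      have "((\<lambda>z. (\<Prod>i<p 0. of_real (b i) / (of_real (b i) - z)) *
          (\<Prod>j\<in>?J. (z - \<Gamma> (x j)) / (z - cq * \<Gamma> (x j)))) \<longlongrightarrow>
         (\<Prod>i<p 0. 0) * (\<Prod>j\<in>?J. 1)) at_infinity"
      proof (intro tendsto_mult tendsto_prod tendsto_moebius_at_infinity)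
        fix i
        have "((\<lambda>z. - complex_of_real (b i) / (z - of_real (b i))) \<longlongrightarrow> 0) at_infinity"
          by (rule tendsto_inverse_shift_at_infinity)
        moreover have "- complex_of_real (b i) / (z - of_real (b i)) =
            of_real (b i) / (of_real (b i) - z)" for z
          by (metis minus_diff_eq minus_divide_divide)
        ultimately show "((\<lambda>z. complex_of_real (b i) / (of_real (b i) - z)) \<longlongrightarrow> 0) at_infinity"
          by simp
      qed
      moreover have "(\<Prod>i<p 0. 0::complex) = 0" using p0 by (intro prod_zero bexI[of _ 0]) auto
      ultimately have lim: "((\<lambda>z. (\<Prod>i<p 0. of_real (b i) / (of_real (b i) - z)) *
          (\<Prod>j\<in>?J. (z - \<Gamma> (x j)) / (z - cq * \<Gamma> (x j)))) \<longlongrightarrow> 0) at_infinity"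
        by (simp only: mult_zero_left)
      show "((\<lambda>z. z * F z) \<longlongrightarrow> 0) at_infinity"
      proof (rule Lim_transform_eventually[OF lim])
        show "\<forall>\<^sub>F z in at_infinity. (\<Prod>i<p 0. of_real (b i) / (of_real (b i) - z)) *
            (\<Prod>j\<in>?J. (z - \<Gamma> (x j)) / (z - cq * \<Gamma> (x j))) = z * F z"
          unfolding eventually_at_infinity
          by (intro exI[of _ 1]) (auto simp: F_def weight_def factor_def)
      qed
    qed
    finally show "(\<integral>s. nested (Suc k) ?w (x(0 := s)) \<partial>unit_lborel) = 0"
      by (simp only: mult_zero_right)
  qed
  finally show ?thesis by (simp add: U_def)
qed

text \<open>Write \<open>z = B - (B - z)\<close> with \<open>B = b (p j - 1)\<close>: the factor
  \<open>B - z\<close> cancels the last factor of the weight. Multiplication by \<open>z\<close> is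
  thus \<open>B\<close> times the identity minus lowering.\<close>

lemma weight_lower:
  assumes z: "z \<in> path_image \<Gamma>" and pj: "1 \<le> p j" "p j \<le> Suc M"
  shows "z * weight p t j z = - of_real (b (p j - 1)) * (factor (p j - 1) t z / z) +
      of_real (b (p j - 1)) * weight p t j z"
proof -
  define n where "n = p j - 1"
  have n: "p j = Suc n" "n \<le> M" using pj by (auto simp: n_def)
  have nz: "z \<noteq> 0" "of_real (b n) - z \<noteq> 0" "b n \<noteq> 0"
    using path_ne(1)[OF z] path_ne(2)[OF z n(2)] b[OF n(2)] by auto
  define e where "e = exp (- z * of_real t) * (\<Prod>i<n. of_real (b i) / (of_real (b i) - z))"
  have "weight p t j z = e * (of_real (b n) / (of_real (b n) - z)) / z"
    unfolding weight_def factor_def n(1) e_def by simp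
  moreover have "factor (p j - 1) t z = e" by (simp add: factor_def e_def n_def)
  moreover have "z * (e * (B / (B - z)) / z) = - B * (e / z) + B * (e * (B / (B - z)) / z)"
    if "B - z \<noteq> 0" for B
    using nz(1) that by (simp add: divide_simps) (simp add: algebra_simps)
  ultimately show ?thesis unfolding n_def[symmetric] using nz(2) by simp
qed

text \<open>An extra factor \<open>z\<close> in the variable \<open>j\<close>; up to sign, this is
  what differentiating \<open>exp (- z * t)\<close> in that variable contributes to the time
  derivative.\<close>

definition mom :: "nat \<Rightarrow> (nat \<Rightarrow> nat) \<Rightarrow> real \<Rightarrow> nat \<Rightarrow> complex" where
  "mom k p t j = I k ((weight p t)(j := \<lambda>z. z * weight p t j z))"

lemma mom_lower:
  assumes p: "\<And>i. i < k \<Longrightarrow> p i \<le> Suc M" and j: "j < k" "1 \<le> p j"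
  shows "- mom k p t j = of_real (b (p j - 1)) *
      (I k (weight (p(j := p j - 1)) t) - I k (weight p t))"
proof -
  let ?B = "complex_of_real (b (p j - 1))"
  let ?w = "weight p t"
  have good: "good_weight k ?w" "good_weight k (weight (p(j := p j - 1)) t)"
    using p j by (auto intro!: good_weight_weight simp: le_diff_conv le_SucI)
  have c1: "continuous_on (path_image \<Gamma>) (\<lambda>z. factor (p j - 1) t z / z)"
    using good(2) j unfolding good_weight_def weight_def by (auto dest!: spec[of _ j])
  have c2: "continuous_on (path_image \<Gamma>) (?w j)" using good(1) j by (simp add: good_weight_def)
  have "mom k p t j = I k (?w(j := \<lambda>z. - ?B * (factor (p j - 1) t z / z) + ?B * ?w j z))"
    unfolding mom_def using weight_lower p j by (intro I_cong) auto
  also have "\<dots> = - ?B * I k (?w(j := \<lambda>z. factor (p j - 1) t z / z)) + ?B * I k (?w(j := ?w j))"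
    by (rule I_linear[OF good(1) c1 c2 j(1)])
  also have "?w(j := \<lambda>z. factor (p j - 1) t z / z) = weight (p(j := p j - 1)) t"
    by (auto simp: weight_def fun_eq_iff)
  finally show ?thesis by (simp add: algebra_simps)
qed

lemma mom_swap:
  assumes p: "\<And>i. i < k \<Longrightarrow> p i \<le> Suc M" and j: "Suc j < k" "p j = p (Suc j)"
  shows "mom k p t j = cq * mom k p t (Suc j)"
  unfolding mom_def by (rule I_swap[OF good_weight_weight[OF p] j(1)]) (auto simp: weight_def j(2))

lemma I_derivative:
  assumes p: "\<And>i. i < k \<Longrightarrow> p i \<le> Suc M"
  shows "((\<lambda>t. I k (weight p t)) has_vector_derivative (\<Sum>j<k. - mom k p t j)) (at t)"
proof -
  define S where "S x = (\<Sum>j<k. \<Gamma> (x j))" for x :: "nat \<Rightarrow> real"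
  define \<Phi> where "\<Phi> = nested k (weight p 0)"
  have good: "good_weight k (weight p t)" for t using p by (rule good_weight_weight)
  have nest: "nested k (weight p t) x = exp (- (of_real t * S x)) * \<Phi> x" for t x
  proof -
    have "(\<Prod>j<k. weight p t j (\<Gamma> (x j)) * \<rho> (x j)) =
        (\<Prod>j<k. exp (- (of_real t * \<Gamma> (x j))) * (weight p 0 j (\<Gamma> (x j)) * \<rho> (x j)))"
      by (intro prod.cong refl) (simp add: weight_def factor_def mult_ac)
    also have "\<dots> = exp (- (of_real t * S x)) * (\<Prod>j<k. weight p 0 j (\<Gamma> (x j)) * \<rho> (x j))"
      by (simp add: prod.distrib exp_sum[symmetric] S_def sum_distrib_left sum_negf)
    finally show ?thesis by (simp add: nested_def \<Phi>_def mult_ac)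
  qed
  obtain R where R: "\<And>z. z \<in> path_image \<Gamma> \<Longrightarrow> norm z \<le> R" using path_bounds by blast
  have "((\<lambda>t. \<integral>x. exp (- (of_real t * S x)) * \<Phi> x \<partial>cube k) has_vector_derivative
     (\<integral>x. - S x * (exp (- (of_real t * S x)) * \<Phi> x) \<partial>cube k)) (at t)"
  proof (rule has_vector_derivative_exp_integral[where B = "real k * R"])
    show "integrable (cube k) \<Phi>" unfolding \<Phi>_def by (rule nested_integrable[OF good])
    show "S \<in> borel_measurable (cube k)" unfolding S_def
      by (intro borel_measurable_sum cube_comp_measurable \<Gamma>_measurable) auto
    fix x assume x: "x \<in> space (cube k)"
    have "norm (S x) \<le> (\<Sum>j<k. norm (\<Gamma> (x j)))" unfolding S_def by (rule norm_sum)
    also have "\<dots> \<le> (\<Sum>j<k. R)" using cube_path[OF x] R by (intro sum_mono) auto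
    finally show "norm (S x) \<le> real k * R" by simp
  qed
  moreover have "(\<integral>x. - S x * (exp (- (of_real t * S x)) * \<Phi> x) \<partial>cube k) = (\<Sum>j<k. - mom k p t j)"
  proof -
    have mj: "nested k ((weight p t)(j := \<lambda>z. z * weight p t j z)) x =
        \<Gamma> (x j) * nested k (weight p t) x" if "j < k" for j x
      using nested_upd[OF that, of "weight p t" "\<lambda>z. z *
          weight p t j z" x] nested_upd[OF that, of "weight p t" "weight p t j" x]
      by (simp add: mult_ac)
    have int: "integrable (cube k) (nested k ((weight p t)(j := \<lambda>z. z * weight p t j z)))"
      if "j < k" for j
      using good[of t] that by (intro nested_integrable good_weight_upd)
        (auto simp: good_weight_def intro!: continuous_intros)
    have "(\<Sum>j<k. - mom k p t j) = - (\<integral>x. (\<Sum>j<k.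
        nested k ((weight p t)(j := \<lambda>z. z * weight p t j z)) x) \<partial>cube k)"
      unfolding mom_def I_def using int by (subst Bochner_Integration.integral_sum)
        (auto simp: sum_negf)
    also have "\<dots> = (\<integral>x. - (\<Sum>j<k. nested k ((weight p t)(j := \<lambda>z. z * weight p t j z)) x) \<partial>cube k)"
      by simp
    also have "\<dots> = (\<integral>x. - S x * (exp (- (of_real t * S x)) * \<Phi> x) \<partial>cube k)"
      by (intro Bochner_Integration.integral_cong refl) (simp add: mj nest S_def sum_distrib_right)
    finally show ?thesis ..
  qed
  ultimately show ?thesis unfolding I_def nest by simp
qed

text \<open>Inside a block the weights coincide, so \<open>mom_swap\<close> makes the moments a
  geometric sequence of ratio \<open>q\<close>, read from the last index backwards. The sum reduces
  to the last index of the block, the one that may be lowered.\<close>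

lemma sum_mom_block:
  assumes wd: "weakly_decreasing k p" and p: "\<And>i. i < k \<Longrightarrow> p i \<le> Suc M" and v: "v \<in> p ` {..<k}"
  shows "(\<Sum>j\<in>block k p v. mom k p t j) = (1 - cq ^ card (block k p v)) / (1 - cq) *
      mom k p t (Max (block k p v))"
proof -
  obtain r c where rc: "block k p v = {r..<r + Suc c}" "Max (block k p v) =
      r + c" "card (block k p v) = Suc c" "r + c < k"
    by (rule block_interval[OF wd v])
  have pv: "p i = v" if "i \<in> {r..<r + Suc c}" for i using that unfolding rc(1)[symmetric]
    by (simp add: block_def)
  have step: "mom k p t (r + c - i) = cq ^ i * mom k p t (r + c)" if "i \<le> c" for i
    using that
  proof (induction i)
    case (Suc i)
    have "mom k p t (r + c - Suc i) = cq * mom k p t (Suc (r + c - Suc i))"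
    proof (intro mom_swap p)
      have "r + c - Suc i \<in> {r..<r + Suc c}" "Suc (r + c - Suc i) \<in> {r..<r + Suc c}" using Suc.prems
        by auto
      from this[THEN pv] show "p (r + c - Suc i) = p (Suc (r + c - Suc i))" by simp
    qed (use Suc.prems rc(4) in auto)
    also have "Suc (r + c - Suc i) = r + c - i" using Suc.prems by simp
    finally show ?case using Suc by simp
  qed simp
  have "(\<Sum>j\<in>{r..<r + Suc c}. mom k p t j) = (\<Sum>i\<in>{..<Suc c}. mom k p t (r + c - i))"
    by (rule sum.reindex_bij_witness[of _ "\<lambda>i. r + c - i" "\<lambda>j. r + c - j"]) auto
  also have "\<dots> = (\<Sum>i\<in>{..<Suc c}. cq ^ i) * mom k p t (r + c)"
    unfolding sum_distrib_right by (intro sum.cong refl step) auto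
  also have "(\<Sum>i\<in>{..<Suc c}. cq ^ i) = (1 - cq ^ Suc c) / (1 - cq)"
    using q by (intro sum_gp_strict[THEN trans]) auto
  finally have "(\<Sum>j\<in>{r..<r + Suc c}. mom k p t j) = (1 - cq ^ Suc c) / (1 - cq) *
      mom k p t (r + c)" .
  then show ?thesis unfolding rc(2) rc(3) unfolding rc(1) .
qed

text \<open>The same linear system as in \<open>ev_obs_equation\<close>:
  \<open>b (v - 1) / (1 - q)\<close> is the rate \<open>a (v - 1)\<close>, and the geometric sum
  over the block supplies \<open>1 - q ^ card (block k p v)\<close>.\<close>

lemma U_derivative:
  assumes wd: "weakly_decreasing k p" and p: "\<And>i. i < k \<Longrightarrow> 1 \<le> p i \<and> p i \<le> Suc M"
  shows "(U k p has_vector_derivative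
     (\<Sum>v\<in>p ` {..<k}. of_real (b (v - 1) / (1 - q) * (1 - q ^ card (block k p v))) *
       (U k (p(Max (block k p v) := v - 1)) t - U k p t))) (at t)"
proof -
  let ?c = "(- 1) ^ k * (\<Prod>i<k. cq ^ i)"
  have "(U k p has_vector_derivative ?c * (\<Sum>j<k. - mom k p t j)) (at t)"
    unfolding U_def[abs_def] using p by (intro has_vector_derivative_mult_right I_derivative) auto
  moreover have "?c * (\<Sum>j<k. - mom k p t j) =
      (\<Sum>v\<in>p ` {..<k}. of_real (b (v - 1) / (1 - q) * (1 - q ^ card (block k p v))) *
       (U k (p(Max (block k p v) := v - 1)) t - U k p t))"
  proof -
    have "(\<Sum>j<k. mom k p t j) = (\<Sum>v\<in>p ` {..<k}. \<Sum>j\<in>block k p v. mom k p t j)"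
      using sum.group[of "{..<k}" "p ` {..<k}" p "mom k p t"] by (simp add: block_def)
    also have "\<dots> = (\<Sum>v\<in>p ` {..<k}. (1 - cq ^ card (block k p v)) / (1 - cq) *
        mom k p t (Max (block k p v)))"
      using p by (intro sum.cong refl sum_mom_block wd) auto
    finally have "?c * (\<Sum>j<k. - mom k p t j) =
        (\<Sum>v\<in>p ` {..<k}. (1 - cq ^ card (block k p v)) / (1 - cq) *
      (?c * - mom k p t (Max (block k p v))))"
      by (simp add: sum_negf sum_distrib_left mult_ac)
    also have "\<dots> = (\<Sum>v\<in>p ` {..<k}. of_real (b (v - 1) / (1 - q) * (1 - q ^ card (block k p v))) *
       (U k (p(Max (block k p v) := v - 1)) t - U k p t))"
    proof (intro sum.cong refl)
      fix v assume v: "v \<in> p ` {..<k}"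
      define m where "m = Max (block k p v)"
      have "m \<in> block k p v" unfolding m_def using v by (intro Max_in) (auto simp: block_def)
      then have m: "m < k" "p m = v" by (auto simp: block_def)
      have ml: "- mom k p t m = of_real (b (v - 1)) *
          (I k (weight (p(m := v - 1)) t) - I k (weight p t))"
        using mom_lower[of k p m t] p m by auto
      have "?c * - mom k p t m = of_real (b (v - 1)) * (U k (p(m := v - 1)) t - U k p t)"
        unfolding ml U_def by (simp add: algebra_simps)
      then show "(1 - cq ^ card (block k p v)) / (1 - cq) * (?c * - mom k p t (Max (block k p v))) =
        of_real (b (v - 1) / (1 - q) * (1 - q ^ card (block k p v))) *
          (U k (p(Max (block k p v) := v - 1)) t - U k p t)"
        unfolding m_def[symmetric] by simp
    qed
    finally show ?thesis .
  qed
  ultimately show ?thesis by simp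
qed

end

subsection \<open>Moments and the Fredholm series\<close>

text \<open>No regularity of \<open>v\<close> is presupposed, since expectations are known only
  through an integral equation. Being an indefinite integral, \<open>v\<close> is continuous, then
  differentiable with derivative \<open>c * v\<close>, so \<open>exp (- c * x) * v x\<close> is
  constant with value \<open>v 0 = 0\<close>.\<close>

lemma volterra_zero:
  fixes v :: "real \<Rightarrow> complex" and c :: complex
  assumes v: "\<And>t. 0 \<le> t \<Longrightarrow> ((\<lambda>r. c * v r) has_integral v t) {0..t}" and T: "0 \<le> T"
  shows "v T = 0"
proof -
  define f where "f r = c * v r" for r
  have int: "f integrable_on {0..T}" using v[OF T] unfolding f_def by blast
  have v_eq: "v u = integral {0..u} f" if "u \<in> {0..T}" for u
  proof -
    have "(f has_integral v u) {0..u}" unfolding f_def using that by (intro v) simp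
    then show ?thesis by (rule integral_unique[symmetric])
  qed
  have "continuous_on {0..T} (\<lambda>u. integral {0..u} f)"
    by (rule indefinite_integral_continuous_1[OF int])
  then have "continuous_on {0..T} v" by (rule continuous_on_eq) (use v_eq in auto)
  then have cf: "continuous_on {0..T} f" unfolding f_def by (intro continuous_intros)
  have dv: "(v has_vector_derivative c * v x) (at x within {0..T})" if x: "x \<in> {0..T}" for x
  proof -
    have "((\<lambda>u. integral {0..u} f) has_vector_derivative f x) (at x within {0..T})"
      by (rule integral_has_vector_derivative[OF cf x])
    then show ?thesis
      unfolding f_def[of x] by (rule has_vector_derivative_transform[OF x, rotated])
        (use v_eq in auto)
  qed
  define h where "h x = exp (- c * of_real x) * v x" for x
  have "(h has_derivative (\<lambda>_. 0)) (at x within {0..T})" if x: "x \<in> {0..T}" for x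
  proof -
    have "((\<lambda>x. exp (- c * complex_of_real x)) has_vector_derivative (- c * 1) *
        exp (- c * of_real x)) (at x within {0..T})"
    proof (rule field_vector_diff_chain_within[where f = "\<lambda>x. - c *
        complex_of_real x" and g = exp, unfolded o_def])
      show "((\<lambda>x. - c * complex_of_real x) has_vector_derivative - c * 1) (at x within {0..T})"
      proof (rule has_vector_derivative_mult_right)
        have "((\<lambda>x. complex_of_real x) has_vector_derivative of_real 1) (at x within {0..T})"
          by (rule has_vector_derivative_of_real) (rule DERIV_ident)
        then show "(complex_of_real has_vector_derivative 1) (at x within {0..T})" by simp
      qed
      show "(exp has_field_derivative exp (- c * of_real x)) (at (- c * of_real x) within (\<lambda>x. - c *
          complex_of_real x) ` {0..T})"
        by (rule DERIV_subset[OF DERIV_exp]) simp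
    qed
    from has_vector_derivative_mult[OF this dv[OF x]]
    have "(h has_vector_derivative 0) (at x within {0..T})"
      unfolding h_def by (simp add: mult_ac)
    then show ?thesis by (simp add: has_vector_derivative_def)
  qed
  then obtain d where d: "\<And>x. x \<in> {0..T} \<Longrightarrow> h x = d"
    using has_derivative_zero_constant[of "{0..T}" h] by auto
  have "v 0 = 0" using v_eq[of 0] T by simp
  then have "d = 0" using d[of 0] T by (simp add: h_def)
  then show ?thesis using d[of T] T by (simp add: h_def)
qed

locale tazrp_contour = tazrp q a A + admissible q b M \<Gamma> for q a A b M \<Gamma> +
  assumes rates: "\<And>k. k \<le> M \<Longrightarrow> b k = (1 - q) * a (int k)"
begin

lemma q_pos: "0 < q" "q < 1"
  using tazrp_axioms by (auto simp: tazrp_def)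

text \<open>Lowering a coordinate decreases the sum, dropping a final coordinate \<open>0\<close>
  decreases \<open>k\<close>. By the induction hypothesis the lowered terms on both sides agree, so
  the difference \<open>v\<close> of the two solutions satisfies the scalar equation with constant
  \<open>- lam\<close>, the negative sum of the rates, and zero initial value.\<close>

lemma ev_obs_eq_U:
  assumes "weakly_decreasing k p" "\<And>i. i < k \<Longrightarrow> p i \<le> Suc M" "0 \<le> t"
  shows "of_real (ev (obs k p) t) = U k p t"
  using assms
proof (induction "k + (\<Sum>i<k. p i)" arbitrary: k p t rule: less_induct)
  case less
  note wd = less.prems(1) and pM = less.prems(2)
  \<comment> \<open>The coordinates decrease weakly, so the last one decides: if it is
    \<open>0\<close> it can be split off on both sides, otherwise all coordinates are at least
    \<open>1\<close> and the evolution equations apply.\<close>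
  consider "k = 0" | k' where "k = Suc k'" "p k' = 0" | k' where "k = Suc k'" "1 \<le> p k'"
  proof (cases k)
    case (Suc n)
    then show ?thesis using that(2,3)[of n] by (cases "p n") auto
  qed (use that in simp)
  then show ?case
  proof cases
    case 1
    have "obs 0 p = (\<lambda>_. 1)" by (simp add: obs_def fun_eq_iff)
    then show ?thesis using 1 by (simp add: U_0 ev_def clock.prob_space)
  next
    case 2
    have "obs k p = (\<lambda>s. - (q ^ k') * obs k' p s)" using 2 by (simp add: obs_Suc_zero fun_eq_iff)
    then have "ev (obs k p) t = - (q ^ k') * ev (obs k' p) t" by (simp add: ev_def)
    moreover have "of_real (ev (obs k' p) t) = U k' p t"
    proof (rule less.hyps)
      show "k' + (\<Sum>i<k'. p i) < k + (\<Sum>i<k. p i)" using 2 by simp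
      show "weakly_decreasing k' p" using wd 2 by (auto simp: weakly_decreasing_def)
    qed (use pM 2 less.prems(3) in auto)
    moreover have "U k p t = - (cq ^ k') * U k' p t"
      unfolding 2(1) by (rule U_Suc_zero) (use 2 pM in auto)
    ultimately show ?thesis by simp
  next
    case 3
    have p1: "1 \<le> p i" if "i < k" for i
    proof -
      have "p k' \<le> p i" using wd that 3 unfolding weakly_decreasing_def
        by (metis lessI less_Suc_eq_le)
      then show ?thesis using 3 by simp
    qed
    have pp: "\<And>i. i < k \<Longrightarrow> 1 \<le> p i \<and> p i \<le> Suc M" using p1 pM by auto
    define lam where "lam = (\<Sum>v\<in>p ` {..<k}. lower_rate k p v)"
    define v where "v r = of_real (ev (obs k p) r) - U k p r" for r
    have IH: "of_real (ev (obs k (lower k p v)) r) = U k (lower k p v) r"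
      if v: "v \<in> p ` {..<k}" and r: "0 \<le> r" for v r
    proof (rule less.hyps)
      define m where "m = Max (block k p v)"
      have "m \<in> block k p v" unfolding m_def using v by (intro Max_in) (auto simp: block_def)
      then have m: "m < k" "p m = v" by (auto simp: block_def)
      then have "1 \<le> v" using p1 by auto
      have "(\<Sum>i<k. (p(m := v - 1)) i) < (\<Sum>i<k. p i)"
        using m \<open>1 \<le> v\<close> by (intro sum_strict_mono_ex1) auto
      then show "k + (\<Sum>i<k. (lower k p v) i) < k + (\<Sum>i<k. p i)" by (simp add: m_def)
      show "weakly_decreasing k (lower k p v)" using wd v by (rule weakly_decreasing_lower)
      show "(lower k p v) i \<le> Suc M" if "i < k" for i using pM[of i] pM[of m] m that
        by (auto simp: m_def[symmetric])
    qed (rule r)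
    define g where "g r = (\<Sum>v\<in>p ` {..<k}. lower_rate k p v *
        (ev (obs k (lower k p v)) r - ev (obs k p) r))" for r
    define g' where "g' r = (\<Sum>v\<in>p ` {..<k}. of_real (b (v - 1) / (1 - q) *
        (1 - q ^ card (block k p v))) * (U k (lower k p v) r - U k p r))" for r
    have "((\<lambda>r. complex_of_real (- lam) * v r) has_integral v s) {0..s}" if s: "0 \<le> s" for s
    proof -
      have "(g has_integral ev (obs k p) s) {0..s}"
        unfolding g_def using wd p1 3 s by (intro ev_obs_equation) auto
      then have 1: "((\<lambda>r. complex_of_real (g r)) has_integral of_real (ev (obs k p) s)) {0..s}"
        by (rule has_integral_of_real)
      have "(g' has_integral U k p s - U k p 0) {0..s}"
        unfolding g'_def by (rule fundamental_theorem_of_calculus[OF s])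
          (rule has_vector_derivative_at_within[OF U_derivative[OF wd pp]])
      moreover have "U k p 0 = 0" unfolding 3(1) using pp 3 by (intro U_initial) auto
      ultimately have "((\<lambda>r. of_real (g r) - g' r) has_integral v s) {0..s}"
        unfolding v_def using has_integral_diff[OF 1] by fastforce
      moreover have "of_real (g r) - g' r = complex_of_real (- lam) * v r" if r: "r \<in> {0..s}" for r
      proof -
        have lr: "b (v - 1) / (1 - q) * (1 - q ^ card (block k p v)) = lower_rate k p v"
          if "v \<in> p ` {..<k}" for v
        proof -
          have "v \<le> Suc M" using that pM by auto
          then have "v - 1 \<le> M" by simp
          then show ?thesis using q_pos by (simp add: lower_rate_def rates)
        qed
        have "of_real (g r) - g' r = (\<Sum>v\<in>p ` {..<k}. complex_of_real (lower_rate k p v) *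
           ((of_real (ev (obs k (lower k p v)) r) - U k (lower k p v) r) -
             (of_real (ev (obs k p) r) - U k p r)))"
          unfolding g_def g'_def of_real_sum sum_subtractf[symmetric]
          by (intro sum.cong refl) (simp only: lr of_real_mult of_real_diff, simp add: algebra_simps)
        also have "\<dots> = (\<Sum>w\<in>p ` {..<k}. complex_of_real (lower_rate k p w) * (0 - v r))"
        proof (intro sum.cong refl)
          fix w assume "w \<in> p ` {..<k}"
          then have "of_real (ev (obs k (lower k p w)) r) = U k (lower k p w) r" using r
            by (intro IH) auto
          then show "complex_of_real (lower_rate k p w) *
             ((of_real (ev (obs k (lower k p w)) r) - U k (lower k p w) r) -
               (of_real (ev (obs k p) r) - U k p r)) =
             complex_of_real (lower_rate k p w) * (0 - v r)"
            by (simp only: v_def diff_self)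
        qed
        also have "\<dots> = complex_of_real (- lam) * v r"
          by (simp add: lam_def sum_distrib_right sum_negf)
        finally show ?thesis .
      qed
      ultimately show ?thesis by (rule has_integral_eq[rotated])
    qed
    then have "v t = 0" using less.prems(3) by (rule volterra_zero)
    then show ?thesis by (simp add: v_def)
  qed
qed

end

section \<open>Terms of the Fredholm series as nested integrals\<close>

context admissible
begin

text \<open>With equal weights the integral of \<open>nested\<close> does not change when the
  variables are permuted. Summing over all permutations replaces \<open>ord_prod\<close> by its
  symmetrization, computed in \<open>sum_permutes_ord_prod\<close>.\<close>

lemma integral_pair_prod:
  assumes w: "good_weight k w" and eq: "\<And>i j z. i < k \<Longrightarrow> j < k \<Longrightarrow> w i z = w j z"
  shows "(\<integral>x. pair_prod cq {..<k} (\<lambda>i. \<Gamma> (x i)) * (\<Prod>j<k. w j (\<Gamma> (x j)) * \<rho> (x j)) \<partial>cube k) *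
      (\<Prod>i<k. (1 - cq ^ Suc i) / (1 - cq)) =
     fact k * I k w"
proof -
  define W where "W x = (\<Prod>j<k. w j (\<Gamma> (x j)) * \<rho> (x j))" for x
  let ?c = "\<Prod>i<k. (1 - cq ^ Suc i) / (1 - cq)"
  have meas: "nested k w \<in> borel_measurable (cube k)"
    using nested_integrable[OF w] by (rule borel_measurable_integrable)
  define N where "N \<sigma> x = ord_prod cq k ((\<lambda>i. \<Gamma> (x i)) \<circ> \<sigma>) * W x" for \<sigma> x
  have N: "N \<sigma> x = nested k w (\<lambda>n\<in>{..<k}. x (\<sigma> n))" if \<sigma>: "\<sigma> permutes {..<k}" for \<sigma> x
  proof -
    have "(\<Prod>j<k. w j (\<Gamma> (x (\<sigma> j))) * \<rho> (x (\<sigma> j))) = (\<Prod>j<k. w (\<sigma> j) (\<Gamma> (x (\<sigma> j))) * \<rho> (x (\<sigma> j)))"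
      using permutes_in_image[OF \<sigma>] by (intro prod.cong refl arg_cong2[where f = "(*)"] eq) auto
    also have "\<dots> = W x" unfolding W_def
      using prod.permute[OF \<sigma>, of "\<lambda>j. w j (\<Gamma> (x j)) * \<rho> (x j)"] by (simp add: o_def)
    finally have "(\<Prod>j<k. w j (\<Gamma> ((\<lambda>n\<in>{..<k}. x (\<sigma> n)) j)) * \<rho> ((\<lambda>n\<in>{..<k}. x (\<sigma> n)) j)) = W x"
      by simp
    moreover have "ord_prod cq k (\<lambda>i. \<Gamma> ((\<lambda>n\<in>{..<k}. x (\<sigma> n)) i)) =
        ord_prod cq k ((\<lambda>i. \<Gamma> (x i)) \<circ> \<sigma>)"
      by (intro ord_prod_cong) simp
    ultimately show ?thesis by (simp only: nested_def N_def)
  qed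
  have intN: "integrable (cube k) (N \<sigma>)" if \<sigma>: "\<sigma> permutes {..<k}" for \<sigma>
  proof -
    obtain B where B: "\<And>z. \<forall>i<k. z i \<in> path_image \<Gamma> \<Longrightarrow> norm (ord_prod cq k z) \<le> B"
      using ord_prod_bounded[of k] by blast
    have in_k: "\<sigma> i < k" if "i < k" for i using permutes_in_image[OF \<sigma>, of i] that by simp
    show ?thesis unfolding N_def W_def
    proof (rule bounded_mult_integrable[OF w, of _ B])
      show "(\<lambda>x. ord_prod cq k ((\<lambda>i. \<Gamma> (x i)) \<circ> \<sigma>)) \<in> borel_measurable (cube k)"
        unfolding ord_prod_def o_def using in_k
        by (intro borel_measurable_prod borel_measurable_divide borel_measurable_diff borel_measurable_times
            borel_measurable_const cube_comp_measurable \<Gamma>_measurable) auto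
      show "norm (ord_prod cq k ((\<lambda>i. \<Gamma> (x i)) \<circ> \<sigma>)) \<le> B" if "x \<in> space (cube k)" for x
        using cube_path[OF that] in_k by (intro B) auto
    qed
  qed
  have "fact k * I k w = (\<Sum>\<sigma> | \<sigma> permutes {..<k}. I k w)"
    by (simp add: card_permutations[of "{..<k}" k])
  also have "\<dots> = (\<Sum>\<sigma> | \<sigma> permutes {..<k}. \<integral>x. N \<sigma> x \<partial>cube k)"
    unfolding I_def by (intro sum.cong refl) (simp add: N cube_permute meas)
  also have "\<dots> = (\<integral>x. (\<Sum>\<sigma> | \<sigma> permutes {..<k}. N \<sigma> x) \<partial>cube k)"
    using intN by (subst Bochner_Integration.integral_sum) auto
  also have "\<dots> = (\<integral>x. (pair_prod cq {..<k} (\<lambda>i. \<Gamma> (x i)) * W x) * ?c \<partial>cube k)"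
  proof (rule Bochner_Integration.integral_cong[OF refl])
    fix x assume x: "x \<in> space (cube k)"
    have "(\<Sum>\<sigma> | \<sigma> permutes {..<k}. N \<sigma> x) = (\<Sum>\<sigma> | \<sigma> permutes {..<k}.
        ord_prod cq k ((\<lambda>i. \<Gamma> (x i)) \<circ> \<sigma>)) * W x"
      unfolding N_def by (simp add: sum_distrib_right)
    also have "(\<Sum>\<sigma> | \<sigma> permutes {..<k}. ord_prod cq k ((\<lambda>i. \<Gamma> (x i)) \<circ> \<sigma>)) =
        ?c * pair_prod cq {..<k} (\<lambda>i. \<Gamma> (x i))"
      using cube_path[OF x] path_ne(1) path_ne(3) q by (intro sum_permutes_ord_prod) auto
    finally show "(\<Sum>\<sigma> | \<sigma> permutes {..<k}. N \<sigma> x) = (pair_prod cq {..<k} (\<lambda>i. \<Gamma> (x i)) * W x) * ?c"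
      by (simp only: mult_ac)
  qed
  also have "\<dots> = (\<integral>x. pair_prod cq {..<k} (\<lambda>i. \<Gamma> (x i)) * W x \<partial>cube k) * ?c" by simp
  finally show ?thesis by (simp add: W_def)
qed

text \<open>The numerators of the kernel leave the determinant as row factors, the line elements as
  column factors. The Cauchy determinant that remains gives \<open>pair_prod\<close> and the factors
  \<open>1 / z\<close>, which complete \<open>factor\<close> to \<open>weight\<close>; the powers of
  \<open>1 - q\<close> cancel against those from the symmetrization.\<close>

lemma fredholm_term:
  "(\<integral>x. Determinant.det (Matrix.mat k k (\<lambda>(i, j). \<zeta> * K_pre q b M t (\<Gamma> (x i)) (\<Gamma> (x j)) *
       vector_derivative \<Gamma> (at (x j)) / (2 * of_real pi * \<i>))) \<partial>cube k) / fact k =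
     \<zeta> ^ k * U k (\<lambda>_. Suc M) t / (\<Prod>i<k. 1 - cq ^ Suc i)"
proof -
  let ?p = "\<lambda>_::nat. Suc M"
  let ?w = "weight ?p t"
  define Cc where "Cc = (- 1) ^ k * (\<Prod>i<k. cq ^ i)"
  define W where "W x = (\<Prod>j<k. ?w j (\<Gamma> (x j)) * \<rho> (x j))" for x
  have q1: "1 - cq \<noteq> 0" using q by simp
  have qi: "1 - cq ^ Suc i \<noteq> 0" for i
  proof
    assume "1 - cq ^ Suc i = 0"
    then have "complex_of_real (q ^ Suc i) = of_real 1"
      by (simp del: of_real_power add: of_real_power[symmetric])
    then have "q ^ Suc i = 1" by (simp only: of_real_eq_iff)
    then show False using power_Suc_less_one[of q i] q by simp
  qed
  have det: "Determinant.det (Matrix.mat k k (\<lambda>(i, j). \<zeta> * K_pre q b M t (\<Gamma> (x i)) (\<Gamma> (x j)) *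
       vector_derivative \<Gamma> (at (x j)) / (2 * of_real pi * \<i>))) =
     \<zeta> ^ k * (Cc / (1 - cq) ^ k) * (pair_prod cq {..<k} (\<lambda>i. \<Gamma> (x i)) * W x)" if x: "x \<in> space
       (cube k)" for x
  proof -
    define z where "z i = \<Gamma> (x i)" for i
    have zP: "z i \<in> path_image \<Gamma>" if "i < k" for i using cube_path[OF x that] by (simp add: z_def)
    have "Matrix.mat k k (\<lambda>(i, j). \<zeta> * K_pre q b M t (z i) (z j) *
        vector_derivative \<Gamma> (at (x j)) / (2 * of_real pi * \<i>)) =
       Matrix.mat k k (\<lambda>(i, j). (\<zeta> * factor (Suc M) t (z i)) * \<rho> (x j) * (1 / (cq * z j - z i)))"
      by (rule eq_matI) (auto simp: K_pre_def factor_def \<rho>_def lessThan_Suc_atMost)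
    then have "Determinant.det (Matrix.mat k k (\<lambda>(i, j). \<zeta> * K_pre q b M t (z i) (z j) *
        vector_derivative \<Gamma> (at (x j)) / (2 * of_real pi * \<i>))) =
       (\<Prod>i<k. \<zeta> * factor (Suc M) t (z i)) * (\<Prod>j<k. \<rho> (x j)) * Determinant.det
         (Matrix.mat k k (\<lambda>(i, j). 1 / (cq * z j - z i)))"
      by (simp only: det_mat_scale)
    also have "Determinant.det (Matrix.mat k k (\<lambda>(i, j). 1 / (cq * z j - z i))) =
       (- 1) ^ k * (\<Prod>i<k. cq ^ i) / (1 - cq) ^ k * pair_prod cq {..<k} z * (\<Prod>i<k. 1 / z i)"
      using zP path_ne(1) path_ne(3) q by (intro det_q_cauchy) auto
    also have "(\<Prod>i<k. \<zeta> * factor (Suc M) t (z i)) = \<zeta> ^ k * (\<Prod>i<k. factor (Suc M) t (z i))"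
      by (simp add: prod.distrib)
    finally have "Determinant.det (Matrix.mat k k (\<lambda>(i, j). \<zeta> * K_pre q b M t (z i) (z j) *
        vector_derivative \<Gamma> (at (x j)) / (2 * of_real pi * \<i>))) =
       \<zeta> ^ k * (Cc / (1 - cq) ^ k) * (pair_prod cq {..<k} z *
         ((\<Prod>i<k. factor (Suc M) t (z i)) * (\<Prod>i<k. 1 / z i) * (\<Prod>j<k. \<rho> (x j))))"
      unfolding Cc_def by (simp only: mult_ac times_divide_eq_right times_divide_eq_left)
    also have "(\<Prod>i<k. factor (Suc M) t (z i)) * (\<Prod>i<k. 1 / z i) * (\<Prod>j<k. \<rho> (x j)) = W x"
      unfolding W_def weight_def prod.distrib[symmetric] by (simp add: z_def)
    finally show ?thesis unfolding z_def .
  qed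
  have good: "good_weight k ?w" by (rule good_weight_weight) simp
  have "(\<integral>x. Determinant.det (Matrix.mat k k (\<lambda>(i, j). \<zeta> * K_pre q b M t (\<Gamma> (x i)) (\<Gamma> (x j)) *
       vector_derivative \<Gamma> (at (x j)) / (2 * of_real pi * \<i>))) \<partial>cube k) =
     (\<integral>x. \<zeta> ^ k * (Cc / (1 - cq) ^ k) * (pair_prod cq {..<k} (\<lambda>i. \<Gamma> (x i)) * W x) \<partial>cube k)"
    by (intro Bochner_Integration.integral_cong refl det)
  also have "\<dots> = \<zeta> ^ k * (Cc / (1 - cq) ^ k) *
      (\<integral>x. pair_prod cq {..<k} (\<lambda>i. \<Gamma> (x i)) * W x \<partial>cube k)"
    by simp
  also have "(\<integral>x. pair_prod cq {..<k} (\<lambda>i. \<Gamma> (x i)) * W x \<partial>cube k) =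
      fact k * I k ?w * (1 - cq) ^ k / (\<Prod>i<k. 1 - cq ^ Suc i)"
  proof -
    have "(\<integral>x. pair_prod cq {..<k} (\<lambda>i. \<Gamma> (x i)) * W x \<partial>cube k) *
        (\<Prod>i<k. (1 - cq ^ Suc i) / (1 - cq)) = fact k * I k ?w"
      unfolding W_def by (rule integral_pair_prod[OF good]) (simp add: weight_def)
    moreover have "(\<Prod>i<k. (1 - cq ^ Suc i) / (1 - cq)) = (\<Prod>i<k. 1 - cq ^ Suc i) / (1 - cq) ^ k"
      by (simp add: prod_dividef)
    moreover have "(\<Prod>i<k. 1 - cq ^ Suc i) \<noteq> 0" using qi by simp
    moreover have "(1 - cq) ^ k \<noteq> 0" using q1 by simp
    moreover have "X = Y * R / Q" if "X * S = Y" "S = Q / R" "Q \<noteq> 0" "R \<noteq> 0"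
      for X Y Q R S :: complex
      using that by (auto simp: field_simps)
    ultimately show ?thesis by blast
  qed
  finally have "(\<integral>x. Determinant.det (Matrix.mat k k (\<lambda>(i, j). \<zeta> *
      K_pre q b M t (\<Gamma> (x i)) (\<Gamma> (x j)) *
       vector_derivative \<Gamma> (at (x j)) / (2 * of_real pi * \<i>))) \<partial>cube k) =
     \<zeta> ^ k * (Cc / (1 - cq) ^ k) * (fact k * I k ?w * (1 - cq) ^ k / (\<Prod>i<k. 1 - cq ^ Suc i))" .
  moreover have "z * (c / r) * (f * i * r / Q) / f = z * (c * i) / Q" if "r \<noteq> 0" "f \<noteq> 0"
    for z c r f i Q :: complex
    using that by simp
  moreover have "(1 - cq) ^ k \<noteq> 0" using q1 by simp
  ultimately show ?thesis unfolding U_def Cc_def[symmetric]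
    by (simp only: fact_nonzero not_False_eq_True)
qed

end

subsection \<open>The q-binomial theorem\<close>

text \<open>The Gaussian binomial coefficient times
  \<open>(- 1) ^ k * q ^ (k * (k - 1) / 2)\<close>. The quotient of differences is the shape in
  which \<open>obs\<close> with all coordinates equal and the denominator of
  \<open>fredholm_term\<close> deliver it.\<close>

definition qbin :: "real \<Rightarrow> nat \<Rightarrow> nat \<Rightarrow> real" where
  "qbin q n k = (\<Prod>i<k. (q ^ n - q ^ i) / (1 - q ^ Suc i))"

text \<open>The limit of the absolute value of \<open>qbin q n k\<close> for large \<open>n\<close>.
  It decays super-exponentially in \<open>k\<close>, so every power series dominated by it is
  entire.\<close>

definition qbin_bd :: "real \<Rightarrow> nat \<Rightarrow> real" where
  "qbin_bd q k = (\<Prod>i<k. q ^ i / (1 - q ^ Suc i))"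

text \<open>A q-Pochhammer product over a range of indices; with the lower bound \<open>m\<close> it
  expresses the quotient of the products up to \<open>n\<close> and up to \<open>m\<close>.\<close>

definition qpoch :: "real \<Rightarrow> nat \<Rightarrow> nat \<Rightarrow> complex \<Rightarrow> complex" where
  "qpoch q m n z = (\<Prod>j\<in>{m..<n}. 1 - of_real q ^ j * z)"

locale q_unit =
  fixes q :: real
  assumes q: "0 < q" "q < 1"
begin

lemma one_minus_pos: "0 < 1 - q ^ Suc i"
  using power_Suc_less_one[of q i] q by simp

lemma qbin_bd_pos: "0 < qbin_bd q k"
  unfolding qbin_bd_def using q one_minus_pos by (intro prod_pos divide_pos_pos) auto

lemma qbin_eq_0: "n < k \<Longrightarrow> qbin q n k = 0"
  unfolding qbin_def by (intro prod_zero bexI[of _ n]) auto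

lemma qbin_bound: "\<bar>qbin q n k\<bar> \<le> qbin_bd q k"
proof (cases "n < k")
  case True
  then show ?thesis using qbin_bd_pos[of k] by (simp add: qbin_eq_0)
next
  case False
  have "\<bar>(q ^ n - q ^ i) / (1 - q ^ Suc i)\<bar> \<le> q ^ i / (1 - q ^ Suc i)" if "i < k" for i
  proof -
    have "q ^ n \<le> q ^ i" using False that q by (intro power_decreasing) auto
    then have "\<bar>q ^ n - q ^ i\<bar> \<le> q ^ i" using q by simp
    then show ?thesis using one_minus_pos[of i]
      by (simp add: abs_divide divide_right_mono del: power_Suc)
  qed
  then show ?thesis unfolding qbin_def qbin_bd_def abs_prod by (intro prod_mono) auto
qed

text \<open>The Pascal rule that corresponds to splitting the factor \<open>1 - q ^ n * z\<close>
  off the product \<open>qpoch q 0 (Suc n) z\<close>.\<close>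

lemma qbin_Suc: "qbin q (Suc n) (Suc k) = qbin q n (Suc k) - q ^ n * qbin q n k"
proof -
  define P where "P = (\<Prod>i<k. q ^ n - q ^ i)"
  define Q where "Q = (\<Prod>i<k. 1 - q ^ Suc i)"
  have "0 < Q" unfolding Q_def by (intro prod_pos ballI one_minus_pos)
  then have Q: "Q \<noteq> 0" by simp
  have k: "1 - q ^ Suc k \<noteq> 0" using one_minus_pos[of k] by simp
  have "qbin q (Suc n) (Suc k) = (\<Prod>i<Suc k. q ^ Suc n - q ^ i) / (Q * (1 - q ^ Suc k))"
    by (simp add: qbin_def prod_dividef Q_def)
  also have "(\<Prod>i<Suc k. q ^ Suc n - q ^ i) = (q ^ Suc n - 1) * (\<Prod>i<k. q * (q ^ n - q ^ i))"
    unfolding prod.lessThan_Suc_shift by (simp add: right_diff_distrib)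
  also have "(\<Prod>i<k. q * (q ^ n - q ^ i)) = q ^ k * P" by (simp add: prod.distrib P_def)
  finally have 1: "qbin q (Suc n) (Suc k) = (q ^ Suc n - 1) * (q ^ k * P) / (Q * (1 - q ^ Suc k))" .
  have 2: "qbin q n (Suc k) = P * (q ^ n - q ^ k) / (Q * (1 - q ^ Suc k))"
    by (simp add: qbin_def prod_dividef Q_def P_def)
  have 3: "qbin q n k = P / Q" by (simp add: qbin_def prod_dividef Q_def P_def)
  have "P * X / (Q * W) - Y * (P / Q) = P * (X - Y * W) / (Q * W)" if "W \<noteq> 0" for X Y W
    using Q that by (simp add: field_simps)
  from this[OF k, of "q ^ n - q ^ k" "q ^ n"] show ?thesis
    unfolding 1 2 3 by (simp add: algebra_simps)
qed

lemma qbin_0: "qbin q n 0 = 1"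
  by (simp add: qbin_def)

lemma sum_qbin:
  assumes "n < K"
  shows "(\<Sum>k<K. of_real (qbin q n k) * z ^ k) = qpoch q 0 n z"
proof -
  have "(\<Sum>k<Suc n. of_real (qbin q n k) * z ^ k) = qpoch q 0 n z"
  proof (induction n)
    case 0
    then show ?case by (simp add: qbin_0 qpoch_def)
  next
    case (Suc n)
    have "(\<Sum>k<Suc (Suc n). of_real (qbin q (Suc n) k) * z ^ k) =
       1 + (\<Sum>k<Suc n. of_real (qbin q (Suc n) (Suc k)) * z ^ Suc k)"
      by (subst sum.lessThan_Suc_shift) (simp add: qbin_0)
    also have "\<dots> = 1 + (\<Sum>k<Suc n. of_real (qbin q n (Suc k)) * z ^ Suc k) - of_real q ^ n * z *
        (\<Sum>k<Suc n. of_real (qbin q n k) * z ^ k)"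
      unfolding qbin_Suc by (simp add: sum_subtractf sum_distrib_left algebra_simps del: sum.lessThan_Suc)
    also have "1 + (\<Sum>k<Suc n. of_real (qbin q n (Suc k)) * z ^ Suc k) =
        (\<Sum>k<Suc (Suc n). of_real (qbin q n k) * z ^ k)"
      by (subst (2) sum.lessThan_Suc_shift) (simp add: qbin_0)
    also have "\<dots> = (\<Sum>k<Suc n. of_real (qbin q n k) * z ^ k)" by (simp add: qbin_eq_0)
    finally show ?case unfolding Suc by (simp add: qpoch_def algebra_simps)
  qed
  moreover have "(\<Sum>k<K. of_real (qbin q n k) * z ^ k) = (\<Sum>k<Suc n. of_real (qbin q n k) * z ^ k)"
    by (rule sum.mono_neutral_right) (use assms in \<open>auto simp: qbin_eq_0\<close>)
  ultimately show ?thesis by simp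
qed

text \<open>Successive terms have ratio \<open>q ^ k * R / (1 - q ^ Suc k)\<close>, which tends to
  zero for any \<open>R\<close>.\<close>

lemma summable_qbin_bd:
  assumes "0 \<le> R"
  shows "summable (\<lambda>k. qbin_bd q k * R ^ k)"
proof -
  have "(\<lambda>k. q ^ k * (R / (1 - q))) \<longlonglongrightarrow> 0 * (R / (1 - q))"
    using q by (intro tendsto_mult tendsto_const LIMSEQ_power_zero) auto
  then have "(\<lambda>k. q ^ k * (R / (1 - q))) \<longlonglongrightarrow> 0" by (simp only: mult_zero_left)
  then have "eventually (\<lambda>k. q ^ k * (R / (1 - q)) < 1 / 2) sequentially"
    by (rule order_tendstoD(2)) simp
  then obtain K where K: "\<And>k. K \<le> k \<Longrightarrow> q ^ k * (R / (1 - q)) < 1 / 2"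
    by (auto simp: eventually_sequentially)
  show ?thesis
  proof (rule summable_ratio_test[of "1 / 2" K])
    fix k assume "K \<le> k"
    have "q ^ k / (1 - q ^ Suc k) * R \<le> q ^ k / (1 - q) * R"
    proof (intro mult_right_mono divide_left_mono assms)
      show "1 - q \<le> 1 - q ^ Suc k" using q power_decreasing[of 1 "Suc k" q] by simp
    qed (use q one_minus_pos[of k] in \<open>auto simp del: power_Suc\<close>)
    also have "\<dots> \<le> 1 / 2" using K[OF \<open>K \<le> k\<close>] by simp
    finally have "qbin_bd q k * R ^ k * (q ^ k / (1 - q ^ Suc k) * R) \<le>
        qbin_bd q k * R ^ k * (1 / 2)"
      using qbin_bd_pos[of k] assms by (intro mult_left_mono mult_nonneg_nonneg) auto
    then show "norm (qbin_bd q (Suc k) * R ^ Suc k) \<le> 1 / 2 * norm (qbin_bd q k * R ^ k)"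
      using qbin_bd_pos[of k] qbin_bd_pos[of "Suc k"] assms
      by (simp add: abs_mult, simp add: qbin_bd_def mult_ac)
  qed simp
qed

lemma qpoch_nonzero:
  assumes z: "norm z = R" and R: "\<And>j. j < m \<Longrightarrow> 1 / q ^ j < R"
  shows "qpoch q l m z \<noteq> 0"
proof -
  have "1 - of_real q ^ j * z \<noteq> 0" if "j < m" for j
  proof
    assume "1 - of_real q ^ j * z = 0"
    then have "norm (of_real q ^ j * z) = 1" by simp
    then have "q ^ j * R = 1" using z q by (simp add: norm_mult norm_power)
    then have "R = 1 / q ^ j" using q by (simp add: field_simps)
    then show False using R[OF that] by simp
  qed
  then show ?thesis unfolding qpoch_def by simp
qed

text \<open>The integral detects \<open>m \<le> n\<close>. In that case the quotient is the
  polynomial \<open>qpoch q m n z\<close> over \<open>z\<close>, with residue \<open>1\<close> at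
  \<open>0\<close>. Otherwise numerator factors cancel and \<open>1 / (z * qpoch q n m z)\<close>
  remains, whose poles all lie inside the circle and which decays at least quadratically.\<close>

lemma contour_integral_qpoch:
  assumes m: "1 \<le> m" and R: "0 < R" "\<And>j. j < m \<Longrightarrow> 1 / q ^ j < R"
  shows "contour_integral (circlepath 0 R) (\<lambda>z. qpoch q 0 n z / (z * qpoch q 0 m z)) =
      (if m \<le> n then 2 * of_real pi * \<i> else 0)"
proof -
  have nz: "qpoch q l m z \<noteq> 0" if "z \<in> path_image (circlepath 0 R)" for z l
    using that R by (intro qpoch_nonzero[of z R]) (auto simp: path_image_circlepath)
  have split: "qpoch q 0 c z = qpoch q 0 d z * qpoch q d c z" if "d \<le> c" for c d z
    unfolding qpoch_def using that by (simp add: prod.atLeastLessThan_concat)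
  show ?thesis
  proof (cases "m \<le> n")
    case True
    have "((\<lambda>z. qpoch q m n z / (z - 0)) has_contour_integral (2 * of_real pi * \<i> *
        qpoch q m n 0)) (circlepath 0 R)"
      by (rule Cauchy_integral_circlepath_simple)
        (use R in \<open>auto simp: qpoch_def intro!: holomorphic_intros\<close>)
    then have "contour_integral (circlepath 0 R) (\<lambda>z. qpoch q m n z / (z - 0)) = 2 * of_real pi * \<i>"
      by (simp add: contour_integral_unique qpoch_def)
    moreover have "contour_integral (circlepath 0 R) (\<lambda>z. qpoch q 0 n z / (z * qpoch q 0 m z)) =
      contour_integral (circlepath 0 R) (\<lambda>z. qpoch q m n z / (z - 0))"
      using nz[of _ 0] by (intro contour_integral_cong refl) (simp add: split[OF True])
    ultimately show ?thesis using True by simp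
  next
    case False
    define F where "F z = 1 / (z * qpoch q n m z)" for z
    define P where "P = insert 0 ((\<lambda>j. 1 / complex_of_real (q ^ j)) ` {n..<m})"
    have "contour_integral (circlepath 0 R) (\<lambda>z. qpoch q 0 n z / (z * qpoch q 0 m z)) =
        contour_integral (circlepath 0 R) F"
    proof (intro contour_integral_cong refl)
      fix z assume z: "z \<in> path_image (circlepath 0 R)"
      have "qpoch q 0 m z = qpoch q 0 n z * qpoch q n m z" using False by (intro split) auto
      then show "qpoch q 0 n z / (z * qpoch q 0 m z) = F z" using nz[OF z, of 0]
        by (auto simp: F_def)
    qed
    also have "\<dots> = 0"
    proof (rule circle_integral_rational_zero[of _ P])
      have "1 - complex_of_real q ^ j * z \<noteq> 0" if "z \<notin> P" "j \<in> {n..<m}" for z j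
      proof
        assume "1 - complex_of_real q ^ j * z = 0"
        then have "z = 1 / complex_of_real (q ^ j)" using q by (simp add: field_simps)
        then show False using that by (auto simp: P_def)
      qed
      then show "F holomorphic_on UNIV - P"
        unfolding F_def qpoch_def by (intro holomorphic_intros) (auto simp: P_def)
      show "finite P" by (simp add: P_def)
      show "norm p < R" if "p \<in> P" for p
        using that R q by (auto simp: P_def norm_divide norm_power)
      have "((\<lambda>z. \<Prod>j\<in>{n..<m}. 1 / (1 - complex_of_real q ^ j * z)) \<longlongrightarrow> (\<Prod>j\<in>{n..<m}. 0)) at_infinity"
      proof (intro tendsto_prod)
        fix j
        have q0: "complex_of_real q ^ j \<noteq> 0" using q by simp
        have "((\<lambda>z. (- 1 / complex_of_real q ^ j) / (z - 1 / complex_of_real q ^ j)) \<longlongrightarrow> 0)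
            at_infinity"
          by (rule tendsto_inverse_shift_at_infinity)
        moreover have "(- 1 / u) / (z - 1 / u) = 1 / (1 - u * z)" if "u \<noteq> 0" for u z :: complex
        proof -
          have eq: "z - 1 / u = (- 1 / u) * (1 - u * z)" using that by (simp add: field_simps)
          have "e / (e * d) = 1 / d" if "e \<noteq> 0" for e d :: complex using that by simp
          from this[of "- 1 / u" "1 - u * z"] show ?thesis unfolding eq using that by simp
        qed
        ultimately show "((\<lambda>z. 1 / (1 - complex_of_real q ^ j * z)) \<longlongrightarrow> 0) at_infinity" using q0
          by simp
      qed
      moreover have "(\<Prod>j\<in>{n..<m}. 0::complex) = 0" using False
        by (intro prod_zero bexI[of _ n]) auto
      ultimately have lim: "((\<lambda>z. \<Prod>j\<in>{n..<m}. 1 / (1 - complex_of_real q ^ j * z)) \<longlongrightarrow> 0) at_infinity"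
        by (simp only:)
      show "((\<lambda>z. z * F z) \<longlongrightarrow> 0) at_infinity"
      proof (rule Lim_transform_eventually[OF lim])
        show "\<forall>\<^sub>F z in at_infinity. (\<Prod>j\<in>{n..<m}. 1 / (1 - complex_of_real q ^ j * z)) = z * F z"
          unfolding eventually_at_infinity
          by (intro exI[of _ 1]) (auto simp: F_def qpoch_def prod_dividef)
      qed
    qed (use R in auto)
    finally show ?thesis using False by simp
  qed
qed

text \<open>The weight with which the \<open>k\<close>-th coefficient of the generating function enters the
  contour integral for the probability.\<close>

definition cauchy_weight :: "nat \<Rightarrow> real \<Rightarrow> nat \<Rightarrow> complex" where
  "cauchy_weight m R k = contour_integral (circlepath 0 R) (\<lambda>z. z ^ k / (z * qpoch q 0 m z)) / (2 *
      of_real pi * \<i>)"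

context
  fixes m :: nat and R :: real
  assumes m: "1 \<le> m" and R: "0 < R" "\<And>j. j < m \<Longrightarrow> 1 / q ^ j < R"
begin

lemma circle_nonzero:
  assumes "z \<in> path_image (circlepath 0 R)"
  shows "z * qpoch q 0 m z \<noteq> 0"
  using assms R qpoch_nonzero[of z R m 0] by (auto simp: path_image_circlepath)

lemma circle_denominator_continuous:
  "continuous_on (path_image (circlepath 0 R)) (\<lambda>z. z * qpoch q 0 m z)"
  unfolding qpoch_def by (intro continuous_intros)

lemma circle_integrable:
  assumes "continuous_on (path_image (circlepath 0 R)) g"
  shows "(\<lambda>z. g z / (z * qpoch q 0 m z)) contour_integrable_on circlepath 0 R"
  by (intro contour_integrable_continuous_circlepath continuous_on_divide assms circle_denominator_continuous)
    (use circle_nonzero in auto)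

text \<open>The integrand without \<open>z ^ k\<close> is bounded on the circle, so the weights grow
  only like \<open>R ^ k\<close>, which the decay of \<open>qbin_bd\<close> overcomes.\<close>

lemma cauchy_weight_bound: "\<exists>C. \<forall>k. norm (cauchy_weight m R k) \<le> C * R ^ k"
proof -
  have "compact ((\<lambda>z. 1 / (z * qpoch q 0 m z)) ` path_image (circlepath 0 R))"
    by (intro compact_continuous_image continuous_on_divide continuous_on_const circle_denominator_continuous compact_path_image)
      (use circle_nonzero in auto)
  then have "bounded ((\<lambda>z. 1 / (z * qpoch q 0 m z)) ` path_image (circlepath 0 R))"
    by (rule compact_imp_bounded)
  then obtain B where "\<forall>y\<in>(\<lambda>z. 1 / (z * qpoch q 0 m z)) ` path_image (circlepath 0 R). norm y \<le> B"
    unfolding bounded_iff by blast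
  then have B: "\<And>z. z \<in> path_image (circlepath 0 R) \<Longrightarrow> norm (1 / (z * qpoch q 0 m z)) \<le> B" by blast
  have "of_real R \<in> path_image (circlepath 0 R)" using R by (simp add: path_image_circlepath)
  then have B0: "0 \<le> B" using B norm_ge_zero order_trans by metis
  have "norm (cauchy_weight m R k) \<le> (B * R) * R ^ k" for k
  proof -
    have "norm (contour_integral (circlepath 0 R) (\<lambda>z. z ^ k / (z * qpoch q 0 m z))) \<le>
        (B * R ^ k) * (2 * pi * R)"
    proof (rule has_contour_integral_bound_circlepath)
      show "((\<lambda>z. z ^ k / (z * qpoch q 0 m z)) has_contour_integral
          contour_integral (circlepath 0 R) (\<lambda>z. z ^ k / (z * qpoch q 0 m z))) (circlepath 0 R)"
        by (intro has_contour_integral_integral circle_integrable continuous_intros)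
      fix z :: complex assume z: "norm (z - 0) = R"
      then have "norm (1 / (z * qpoch q 0 m z)) \<le> B" using R
        by (intro B) (auto simp: path_image_circlepath)
      then have "norm (1 / (z * qpoch q 0 m z)) * norm (z ^ k) \<le> B * R ^ k"
        using z R B0 by (intro mult_mono) (auto simp: norm_power)
      then show "norm (z ^ k / (z * qpoch q 0 m z)) \<le> B * R ^ k"
        by (simp add: norm_divide mult.commute)
    qed (use R B0 in auto)
    then have "norm (contour_integral (circlepath 0 R) (\<lambda>z. z ^ k / (z * qpoch q 0 m z))) / (2 *
        pi) \<le> (B * R ^ k) * (2 * pi * R) / (2 * pi)"
      by (intro divide_right_mono) auto
    then show ?thesis by (simp add: cauchy_weight_def norm_divide norm_mult mult_ac)
  qed
  then show ?thesis by blast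
qed

lemma sum_cauchy_weight:
  "(\<Sum>k<K. c k * cauchy_weight m R k) = contour_integral (circlepath 0 R) (\<lambda>z. (\<Sum>k<K. c k *
      z ^ k) / (z * qpoch q 0 m z)) / (2 * of_real pi * \<i>)"
proof -
  have int: "(\<lambda>z. c k * (z ^ k / (z * qpoch q 0 m z))) contour_integrable_on circlepath 0 R" for k
    by (intro contour_integrable_lmul circle_integrable continuous_intros)
  have "contour_integral (circlepath 0 R) (\<lambda>z. (\<Sum>k<K. c k * z ^ k) / (z * qpoch q 0 m z)) =
    contour_integral (circlepath 0 R) (\<lambda>z. \<Sum>k<K. c k * (z ^ k / (z * qpoch q 0 m z)))"
    by (simp add: sum_divide_distrib)
  also have "\<dots> = (\<Sum>k<K. contour_integral (circlepath 0 R) (\<lambda>z. c k *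
      (z ^ k / (z * qpoch q 0 m z))))"
    using int by (intro contour_integral_sum) auto
  also have "\<dots> = (\<Sum>k<K. c k * contour_integral (circlepath 0 R) (\<lambda>z. z ^ k / (z * qpoch q 0 m z)))"
    by (intro sum.cong refl contour_integral_lmul circle_integrable continuous_intros)
  finally show ?thesis by (simp add: cauchy_weight_def sum_divide_distrib)
qed

lemma sum_qbin_cauchy_weight:
  assumes "n < K"
  shows "(\<Sum>k<K. of_real (qbin q n k) * cauchy_weight m R k) = (if m \<le> n then 1 else 0)"
  unfolding sum_cauchy_weight sum_qbin[OF assms] using contour_integral_qpoch[OF m R, of n] by simp

text \<open>The series converges uniformly on the circle by comparison with
  \<open>qbin_bd q k * R ^ k\<close>, which allows summation and contour integration to be
  exchanged.\<close>

lemma suminf_cauchy_weight: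
  assumes c: "\<And>k. norm (c k) \<le> qbin_bd q k"
  shows "(\<lambda>k. c k * cauchy_weight m R k) sums
     (contour_integral (circlepath 0 R) (\<lambda>z. (\<Sum>k. c k * z ^ k) / (z * qpoch q 0 m z)) /
       (2 * of_real pi * \<i>))"
proof -
  have unif: "uniform_limit (path_image (circlepath 0 R)) (\<lambda>K z. \<Sum>k<K. c k * z ^ k) (\<lambda>z. \<Sum>k. c k *
      z ^ k) sequentially"
  proof (rule Weierstrass_m_test[where M = "\<lambda>k. qbin_bd q k * R ^ k"])
    show "summable (\<lambda>k. qbin_bd q k * R ^ k)" using R by (intro summable_qbin_bd) auto
    fix k z assume "z \<in> path_image (circlepath 0 R)"
    then have "norm z = R" using R by (simp add: path_image_circlepath)
    then show "norm (c k * z ^ k) \<le> qbin_bd q k * R ^ k"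
      using c[of k] R by (auto simp: norm_mult norm_power intro!: mult_right_mono)
  qed
  have bd: "bounded ((\<lambda>z. 1 / (z * qpoch q 0 m z)) ` path_image (circlepath 0 R))"
    by (intro compact_imp_bounded compact_continuous_image continuous_on_divide continuous_on_const circle_denominator_continuous compact_path_image)
      (use circle_nonzero in auto)
  have "uniform_limit (path_image (circlepath 0 R)) (\<lambda>K z. (\<Sum>k<K. c k * z ^ k) *
      (1 / (z * qpoch q 0 m z)))
     (\<lambda>z. (\<Sum>k. c k * z ^ k) * (1 / (z * qpoch q 0 m z))) sequentially"
  proof (rule uniform_lim_mult[OF unif uniform_limit_const])
    have "continuous_on (path_image (circlepath 0 R)) (\<lambda>z. \<Sum>k. c k * z ^ k)"
      by (rule uniform_limit_theorem[OF always_eventually unif])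
        (intro allI continuous_intros, simp)
    then show "bounded ((\<lambda>z. \<Sum>k. c k * z ^ k) ` path_image (circlepath 0 R))"
      by (intro compact_imp_bounded compact_continuous_image compact_path_image) auto
  qed (rule bd)
  then have lim: "uniform_limit (path_image (circlepath 0 R)) (\<lambda>K z. (\<Sum>k<K. c k * z ^ k) / (z *
      qpoch q 0 m z))
     (\<lambda>z. (\<Sum>k. c k * z ^ k) / (z * qpoch q 0 m z)) sequentially"
    by (simp only: times_divide_eq_right mult_1_right)
  have "(\<lambda>K. contour_integral (circlepath 0 R) (\<lambda>z. (\<Sum>k<K. c k * z ^ k) / (z * qpoch q 0 m z))) \<longlonglongrightarrow>
     contour_integral (circlepath 0 R) (\<lambda>z. (\<Sum>k. c k * z ^ k) / (z * qpoch q 0 m z))"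
  proof (rule contour_integral_uniform_limit_circlepath(2))
    have "path_image (circlepath 0 R) = sphere 0 R" using R by simp
    from lim[unfolded this] show "uniform_limit (sphere 0 R) (\<lambda>K z. (\<Sum>k<K. c k * z ^ k) / (z *
        qpoch q 0 m z))
        (\<lambda>z. (\<Sum>k. c k * z ^ k) / (z * qpoch q 0 m z)) sequentially" .
    show "\<forall>\<^sub>F K in sequentially. (\<lambda>z. (\<Sum>k<K. c k * z ^ k) / (z *
        qpoch q 0 m z)) contour_integrable_on circlepath 0 R"
      by (intro always_eventually allI circle_integrable continuous_intros)
  qed (use R in auto)
  then show ?thesis unfolding sums_def sum_cauchy_weight
    by (intro tendsto_divide tendsto_const) auto
qed

end

end

section \<open>The probability as a series in the coefficients\<close>

lemma ahead_iff:
  assumes s: "s \<in> reach n" and m: "1 \<le> m"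
  shows "int M < s m \<longleftrightarrow> m \<le> ahead s (Suc M)"
proof -
  define D where "D = {m. 1 \<le> m \<and> int (Suc M) \<le> s m}"
  have g: "good_config n s" using s by (rule reach_good)
  have "finite {m. s m \<noteq> 0}" using g by (simp add: good_config_def)
  then have fin: "finite D" by (rule rev_finite_subset) (auto simp: D_def)
  have dec: "s j \<le> s i" if "1 \<le> i" "i \<le> j" for i j using g that by (auto simp: good_config_def)
  have c: "ahead s (Suc M) = card D" by (simp add: ahead_def D_def)
  show ?thesis
  proof
    assume "int M < s m"
    then have "{1..m} \<subseteq> D" using dec[of _ m] by (force simp: D_def)
    from card_mono[OF fin this] show "m \<le> ahead s (Suc M)" by (simp add: c)
  next
    assume le: "m \<le> ahead s (Suc M)"
    show "int M < s m"
    proof (rule ccontr)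
      assume "\<not> int M < s m"
      then have "j < m" if "j \<in> D" for j
        using that dec[OF m, of j] by (cases "m \<le> j") (auto simp: D_def)
      then have "D \<subseteq> {1..<m}" by (auto simp: D_def)
      from card_mono[OF _ this] show False using le m by (simp add: c)
    qed
  qed
qed

context tazrp
begin

lemma q_unit: "q_unit q"
  using q by unfold_locales

text \<open>By \<open>sum_qbin\<close> this is the expected coefficient of \<open>z ^ k\<close> in
  \<open>qpoch q 0 N z\<close>, where \<open>N\<close> is the random number of particles beyond
  \<open>M\<close>. It refers to no contour.\<close>

definition coef :: "nat \<Rightarrow> real \<Rightarrow> nat \<Rightarrow> real" where
  "coef M t k = ev (\<lambda>s. qbin q (ahead s (Suc M)) k) t"

lemma coef_bound: "\<bar>coef M t k\<bar> \<le> qbin_bd q k"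
  unfolding coef_def by (rule ev_bound) (rule q_unit.qbin_bound[OF q_unit])

lemma qTAZRP_reach: "\<exists>n. qTAZRP q a step_initial \<omega> t \<in> reach n"
  unfolding qTAZRP_def using chain_reach by blast

text \<open>For each \<open>\<omega>\<close> the sum of \<open>qbin q (N \<omega>) k\<close> times
  the weights terminates after \<open>N \<omega>\<close> and is the indicator of
  \<open>m \<le> N \<omega>\<close>, that is, of the particle \<open>m\<close> being beyond
  \<open>M\<close>. The partial sums are dominated uniformly in \<open>\<omega>\<close> through
  \<open>qbin_bd\<close>, so expectations may be taken term by term.\<close>

lemma prob_sums:
  assumes m: "1 \<le> m" and R: "0 < R" "\<And>j. j < m \<Longrightarrow> 1 / q ^ j < R"
  shows "(\<lambda>k. of_real (coef M t k) * q_unit.cauchy_weight q m R k) sums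
    complex_of_real (\<P>(\<omega> in clock_space. int M < qTAZRP q a step_initial \<omega> t m))"
proof -
  interpret Q: q_unit q by (rule q_unit)
  let ?e = "Q.cauchy_weight m R"
  define N where "N \<omega> = ahead (qTAZRP q a step_initial \<omega> t) (Suc M)" for \<omega>
  obtain C where C: "\<And>k. norm (?e k) \<le> C * R ^ k" using Q.cauchy_weight_bound[OF m R] by blast
  have C0: "0 \<le> C" using order_trans[OF norm_ge_zero C[of 0]] by simp
  have sm: "summable (\<lambda>k. qbin_bd q k * (C * R ^ k))"
    using summable_mult[OF Q.summable_qbin_bd[of R], of C] R by (simp add: mult_ac)
  have Nm: "(\<lambda>\<omega>. h (N \<omega>)) \<in> borel_measurable clock_space" for h :: "nat \<Rightarrow> complex"
    unfolding N_def using qTAZRP_measurable[of "\<lambda>s. h (ahead s (Suc M))"]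
      by (rule measurable_compose) simp
  have "(\<lambda>K. \<integral>\<omega>. (\<Sum>k<K. of_real (qbin q (N \<omega>) k) * ?e k) \<partial>clock_space) \<longlonglongrightarrow>
     (\<integral>\<omega>. (if m \<le> N \<omega> then 1 else 0 :: complex) \<partial>clock_space)"
  proof (rule integral_dominated_convergence[where w = "\<lambda>_. \<Sum>k. qbin_bd q k * (C * R ^ k)"])
    show "(\<lambda>\<omega>. (if m \<le> N \<omega> then 1 else 0 :: complex)) \<in> borel_measurable clock_space"
      by (rule Nm)
    show "(\<lambda>\<omega>. \<Sum>k<K. of_real (qbin q (N \<omega>) k) * ?e k) \<in> borel_measurable clock_space" for K
      by (rule Nm)
    show "AE \<omega> in clock_space. (\<lambda>K. \<Sum>k<K. of_real (qbin q (N \<omega>) k) * ?e k) \<longlonglongrightarrow>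
        (if m \<le> N \<omega> then 1 else 0)"
    proof (rule AE_I2)
      fix \<omega>
      show "(\<lambda>K. \<Sum>k<K. of_real (qbin q (N \<omega>) k) * ?e k) \<longlonglongrightarrow> (if m \<le> N \<omega> then 1 else 0)"
        by (rule tendsto_eventually, rule eventually_mono[OF eventually_gt_at_top[of "N \<omega>"]])
          (rule Q.sum_qbin_cauchy_weight[OF m R])
    qed
    show "AE \<omega> in clock_space. norm (\<Sum>k<K. of_real (qbin q (N \<omega>) k) * ?e k) \<le>
        (\<Sum>k. qbin_bd q k * (C * R ^ k))" for K
    proof (rule AE_I2)
      fix \<omega>
      have "norm (\<Sum>k<K. of_real (qbin q (N \<omega>) k) * ?e k) \<le> (\<Sum>k<K. qbin_bd q k * (C * R ^ k))"
      proof (rule order_trans[OF norm_sum], rule sum_mono)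
        fix k
        show "norm (of_real (qbin q (N \<omega>) k) * ?e k) \<le> qbin_bd q k * (C * R ^ k)"
          unfolding norm_mult norm_of_real
          using Q.qbin_bound C Q.qbin_bd_pos[of k] by (intro mult_mono) (auto intro: less_imp_le)
      qed
      also have "\<dots> \<le> (\<Sum>k. qbin_bd q k * (C * R ^ k))"
      proof (rule sum_le_suminf[OF sm])
        show "0 \<le> qbin_bd q n * (C * R ^ n)" for n
          using Q.qbin_bd_pos[of n] C0 R by simp
      qed simp
      finally show "norm (\<Sum>k<K. of_real (qbin q (N \<omega>) k) * ?e k) \<le>
          (\<Sum>k. qbin_bd q k * (C * R ^ k))" .
    qed
  qed simp
  moreover have "(\<integral>\<omega>. (\<Sum>k<K. of_real (qbin q (N \<omega>) k) * ?e k) \<partial>clock_space) =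
      (\<Sum>k<K. of_real (coef M t k) * ?e k)" for K
  proof -
    have i: "integrable clock_space (\<lambda>\<omega>. qbin q (N \<omega>) k)" for k
      unfolding N_def by (rule integrable_qTAZRP[of "\<lambda>s. qbin q (ahead s (Suc M)) k"])
        (rule Q.qbin_bound)
    then have ci: "integrable clock_space (\<lambda>\<omega>. complex_of_real (qbin q (N \<omega>) k) * ?e k)" for k
      by (intro integrable_mult_left integrable_of_real)
    have ce: "(\<integral>\<omega>. qbin q (N \<omega>) k \<partial>clock_space) = coef M t k" for k
      unfolding coef_def ev_def N_def ..
    have "(\<integral>\<omega>. (\<Sum>k<K. of_real (qbin q (N \<omega>) k) * ?e k) \<partial>clock_space) =
       (\<Sum>k<K. \<integral>\<omega>. complex_of_real (qbin q (N \<omega>) k) * ?e k \<partial>clock_space)"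
      by (rule Bochner_Integration.integral_sum[OF ci])
    also have "\<dots> = (\<Sum>k<K. of_real (coef M t k) * ?e k)"
      by (intro sum.cong refl) (simp add: ce)
    finally show ?thesis .
  qed
  moreover have "(\<integral>\<omega>. (if m \<le> N \<omega> then 1 else 0 :: complex) \<partial>clock_space) =
     complex_of_real (\<P>(\<omega> in clock_space. int M < qTAZRP q a step_initial \<omega> t m))"
  proof -
    have iff: "int M < qTAZRP q a step_initial \<omega> t m \<longleftrightarrow> m \<le> N \<omega>" for \<omega>
      using qTAZRP_reach[of \<omega> t] ahead_iff[OF _ m] unfolding N_def by blast
    have "{\<omega> \<in> space clock_space. m \<le> N \<omega>} \<in> sets clock_space"
    proof -
      have "(\<lambda>\<omega>. N \<omega>) \<in> clock_space \<rightarrow>\<^sub>M count_space UNIV"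
        unfolding N_def by (rule qTAZRP_measurable)
      then show ?thesis by measurable
    qed
    moreover have "(\<integral>\<omega>. (if m \<le> N \<omega> then 1 else 0 :: complex) \<partial>clock_space) =
        (\<integral>\<omega>. of_real (indicator {\<omega> \<in> space clock_space. m \<le> N \<omega>} \<omega>) \<partial>clock_space)"
      by (intro Bochner_Integration.integral_cong refl) (auto simp: indicator_def)
    ultimately show ?thesis unfolding iff by simp
  qed
  ultimately show ?thesis unfolding sums_def by simp
qed

end

context tazrp_contour
begin

text \<open>With all coordinates equal to \<open>Suc M\<close>, the observable is
  \<open>qbin\<close> of the particle count times exactly the product \<open>Qk\<close> by which
  \<open>fredholm_term\<close> divides. No trace of the contour remains on the right.\<close>

lemma fredholm_term_eq_coef:
  assumes t: "0 \<le> t"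
  shows "(\<integral>x. Determinant.det (Matrix.mat k k (\<lambda>(i, j). \<zeta> * K_pre q b M t (\<Gamma> (x i)) (\<Gamma> (x j)) *
       vector_derivative \<Gamma> (at (x j)) / (2 * of_real pi * \<i>))) \<partial>cube k) / fact k = of_real
         (coef M t k) * \<zeta> ^ k"
proof -
  interpret Q: q_unit q using q_pos by unfold_locales
  define Qk where "Qk = (\<Prod>i<k. 1 - q ^ Suc i)"
  have "0 < Qk" unfolding Qk_def by (intro prod_pos ballI Q.one_minus_pos)
  then have Qk: "Qk \<noteq> 0" by simp
  have "obs k (\<lambda>_. Suc M) s = Qk * qbin q (ahead s (Suc M)) k" for s
  proof -
    have "obs k (\<lambda>_. Suc M) s = (\<Prod>i<k. (1 - q ^ Suc i) *
        ((q ^ ahead s (Suc M) - q ^ i) / (1 - q ^ Suc i)))"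
      unfolding obs_def
    proof (intro prod.cong refl)
      fix i
      have "1 - q ^ Suc i \<noteq> 0" using Q.one_minus_pos[of i] by simp
      then show "q_ahead s (Suc M) - q ^ i = (1 - q ^ Suc i) *
          ((q ^ ahead s (Suc M) - q ^ i) / (1 - q ^ Suc i))"
        by (simp add: q_ahead_def)
    qed
    then show ?thesis by (simp only: prod.distrib Qk_def qbin_def)
  qed
  then have "ev (obs k (\<lambda>_. Suc M)) t = Qk * coef M t k" by (simp add: ev_def coef_def)
  moreover have "of_real (ev (obs k (\<lambda>_. Suc M)) t) = U k (\<lambda>_. Suc M) t"
    by (rule ev_obs_eq_U) (use t in \<open>auto simp: weakly_decreasing_def\<close>)
  ultimately have "U k (\<lambda>_. Suc M) t = of_real Qk * of_real (coef M t k)" by simp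
  moreover have "(\<Prod>i<k. 1 - cq ^ Suc i) = of_real Qk" by (simp add: Qk_def)
  ultimately show ?thesis unfolding fredholm_term using Qk by simp
qed

lemma contour_fredholm_det_eq:
  assumes t: "0 \<le> t"
  shows "contour_fredholm_det {0..1} \<Gamma> (\<lambda>w w'. \<zeta> * K_pre q b M t w w') =
      (\<Sum>k. of_real (coef M t k) * \<zeta> ^ k)"
  unfolding contour_fredholm_det_def fredholm_det_def by (simp add: fredholm_term_eq_coef[OF t])

end

subsection \<open>Scaling limit of the Fredholm series\<close>

text \<open>Jordan's inequality: the sine is concave on this interval and lies above its chord. It
  is used through \<open>one_minus_cos_ge\<close>, which provides the Gaussian decay along the
  circle.\<close>

lemma sin_ge_linear:
  assumes "0 \<le> x" "x \<le> pi / 2"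
  shows "2 / pi * x \<le> sin x"
proof -
  have "convex_on {0..pi / 2} (\<lambda>x. - sin x)"
  proof (rule f''_ge0_imp_convex[where f' = "\<lambda>x. - cos x" and f'' = sin])
    fix x assume "x \<in> {0..pi / 2}"
    then show "0 \<le> sin x" by (intro sin_ge_zero) auto
  qed (auto intro!: derivative_eq_intros)
  from convex_onD[OF this, of "2 / pi * x" 0 "pi / 2"]
  show ?thesis using assms by (simp add: field_simps)
qed

lemma one_minus_cos_ge:
  assumes "\<bar>x\<bar> \<le> pi"
  shows "2 * x\<^sup>2 / pi\<^sup>2 \<le> 1 - cos x"
proof -
  have "2 / pi * (\<bar>x\<bar> / 2) \<le> sin (\<bar>x\<bar> / 2)" using assms by (intro sin_ge_linear) auto
  then have "(2 / pi * (\<bar>x\<bar> / 2))\<^sup>2 \<le> (sin (\<bar>x\<bar> / 2))\<^sup>2" by (intro power_mono) auto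
  moreover have "cos \<bar>x\<bar> = 1 - 2 * (sin (\<bar>x\<bar> / 2))\<^sup>2" using cos_double_sin[of "\<bar>x\<bar> / 2"] by simp
  moreover have "(2 / pi * (\<bar>x\<bar> / 2))\<^sup>2 = x\<^sup>2 / pi\<^sup>2" by (simp add: power_divide)
  ultimately have "x\<^sup>2 / pi\<^sup>2 \<le> (1 - cos x) / 2" by simp
  then show ?thesis by (simp add: mult.commute)
qed

text \<open>The crude bound from the Leibniz expansion is enough, because it serves for the limit of
  one term with \<open>k\<close> fixed; uniformity in \<open>k\<close> comes from
  \<open>coef_bound\<close>.\<close>

lemma det_norm_le:
  fixes A :: "nat \<Rightarrow> nat \<Rightarrow> complex"
  assumes "\<And>i j. i < k \<Longrightarrow> j < k \<Longrightarrow> norm (A i j) \<le> B"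
  shows "norm (Determinant.det (Matrix.mat k k (\<lambda>(i, j). A i j))) \<le> fact k * B ^ k"
proof -
  have "Determinant.det (Matrix.mat k k (\<lambda>(i, j). A i j)) =
      (\<Sum>p | p permutes {0..<k}. signof p * (\<Prod>i = 0..<k. A i (p i)))"
    by (rule det_mat_expand)
  also have "norm \<dots> \<le> (\<Sum>p | p permutes {0..<k}. norm (signof p * (\<Prod>i = 0..<k. A i (p i))))"
    by (rule norm_sum)
  also have "\<dots> \<le> (\<Sum>p | p permutes {0..<k}. B ^ k)"
  proof (rule sum_mono)
    fix p assume "p \<in> {p. p permutes {0..<k}}"
    then have p: "p permutes {0..<k}" by simp
    have "norm (\<Prod>i = 0..<k. A i (p i)) \<le> (\<Prod>i = 0..<k. B)"
      unfolding prod_norm[symmetric] using permutes_in_image[OF p] assms by (intro prod_mono) auto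
    then show "norm (signof p * (\<Prod>i = 0..<k. A i (p i))) \<le> B ^ k"
      by (simp add: norm_mult sign_def)
  qed
  also have "\<dots> = fact k * B ^ k" by (simp add: card_permutations[of "{0..<k}" k])
  finally show ?thesis .
qed

lemma det_tendsto:
  fixes A :: "'a \<Rightarrow> nat \<Rightarrow> nat \<Rightarrow> complex"
  assumes "\<And>i j. i < k \<Longrightarrow> j < k \<Longrightarrow> ((\<lambda>n. A n i j) \<longlongrightarrow> A' i j) F"
  shows "((\<lambda>n. Determinant.det (Matrix.mat k k (\<lambda>(i, j). A n i j))) \<longlongrightarrow> Determinant.det
      (Matrix.mat k k (\<lambda>(i, j). A' i j))) F"
proof -
  show ?thesis unfolding det_mat_expand
  proof (intro tendsto_sum tendsto_mult tendsto_const tendsto_prod)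
    fix p i assume "p \<in> {p. p permutes {0..<k}}" "i \<in> {0..<k}"
    then show "((\<lambda>n. A n i (p i)) \<longlongrightarrow> A' i (p i)) F"
      using permutes_in_image[of p "{0..<k}" i] by (intro assms) auto
  qed
qed

lemma det_measurable:
  fixes A :: "'a \<Rightarrow> nat \<Rightarrow> nat \<Rightarrow> complex"
  assumes "\<And>i j. i < k \<Longrightarrow> j < k \<Longrightarrow> (\<lambda>x. A x i j) \<in> borel_measurable N"
  shows "(\<lambda>x. Determinant.det (Matrix.mat k k (\<lambda>(i, j). A x i j))) \<in> borel_measurable N"
proof -
  show ?thesis unfolding det_mat_expand
  proof (intro borel_measurable_sum borel_measurable_times borel_measurable_const borel_measurable_prod)
    fix p i assume "p \<in> {p. p permutes {0..<k}}" "i \<in> {0..<k}"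
    then show "(\<lambda>x. A x i (p i)) \<in> borel_measurable N"
      using permutes_in_image[of p "{0..<k}" i] by (intro assms) auto
  qed
qed

lemma product_sigma_finite_lborel: "product_sigma_finite (\<lambda>_. lborel :: real measure)"
  by (rule product_sigma_finite.intro) (rule sigma_finite_lborel)

text \<open>The substitution \<open>x i = a + c * y i\<close> in each coordinate. The restriction to
  the unit interval moves into the density, so that integrals for different \<open>c\<close> are all
  taken over the same space and dominated convergence can be applied.\<close>

lemma integral_unit_cube_affine:
  fixes g :: "(nat \<Rightarrow> real) \<Rightarrow> complex" and a c :: real
  assumes c: "0 < c" and g: "g \<in> borel_measurable (PiM {..<k} (\<lambda>_. unit_lborel))"
  shows "(\<integral>x. g x \<partial>PiM {..<k} (\<lambda>_. unit_lborel)) =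
    (\<integral>y. (\<Prod>i<k. c * indicator {0..1} (a + c * y i)) *\<^sub>R g (\<lambda>i\<in>{..<k}.
      if a + c * y i \<in> {0..1} then a + c * y i else 0)
       \<partial>PiM {..<k} (\<lambda>_. lborel))"
proof -
  interpret L: product_sigma_finite "\<lambda>_::nat. lborel :: real measure"
    by (rule product_sigma_finite_lborel)
  interpret Un: product_sigma_finite "\<lambda>_::nat. unit_lborel"
    by (rule product_sigma_finite.intro) (intro prob_space_imp_sigma_finite prob_space_unit_lborel)
  \<comment> \<open>\<open>T\<close> has to map into the unit interval everywhere; the value
    \<open>0\<close> is a filler where the density \<open>d\<close> vanishes.\<close>
  define T where "T y = (if a + c * y \<in> {0..1} then a + c * y else 0)" for y :: real
  define d where "d y = c * indicator {0..1} (a + c * y)" for y :: real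
  have Tm: "T \<in> borel \<rightarrow>\<^sub>M unit_lborel"
    unfolding T_def by (rule measurable_restrict_space2) auto
  have Tm': "(\<lambda>y. \<lambda>i\<in>{..<k}. T (y i)) \<in> PiM {..<k} (\<lambda>_. lborel) \<rightarrow>\<^sub>M PiM {..<k} (\<lambda>_. unit_lborel)"
    by (intro measurable_restrict measurable_compose[OF measurable_component_singleton])
      (use Tm in auto)
  have d0: "0 \<le> d y" for y using c by (simp add: d_def)
  have dm: "d \<in> borel_measurable borel" unfolding d_def by measurable
  have Dm: "(\<lambda>y. \<Prod>i<k. d (y i)) \<in> borel_measurable (PiM {..<k} (\<lambda>_. lborel))"
    by (intro borel_measurable_prod measurable_compose[OF measurable_component_singleton])
      (use dm in auto)
  define P where "P = distr (density (PiM {..<k} (\<lambda>_. lborel)) (\<lambda>y. ennreal (\<Prod>i<k. d (y i))))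
     (PiM {..<k} (\<lambda>_. unit_lborel)) (\<lambda>y. \<lambda>i\<in>{..<k}. T (y i))"
  have "P = PiM {..<k} (\<lambda>_. unit_lborel)"
  proof (rule Un.PiM_eqI)
    show "sets P = sets (PiM {..<k} (\<lambda>_. unit_lborel))" by (simp add: P_def)
    fix A :: "nat \<Rightarrow> real set" assume A: "\<And>i. i \<in> {..<k} \<Longrightarrow> A i \<in> sets unit_lborel"
    have one: "(\<integral>\<^sup>+ y. ennreal (d y) * indicator (A i) (T y) \<partial>lborel) = emeasure unit_lborel (A i)"
      if i: "i \<in> {..<k}" for i
    proof -
      have Ai: "A i \<subseteq> {0..1}" "A i \<in> sets borel"
        using A[OF i] by (auto simp: sets_restrict_space)
      have "emeasure unit_lborel (A i) = emeasure lborel (A i)"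
        using Ai by (subst emeasure_restrict_space) auto
      also have "\<dots> = (\<integral>\<^sup>+ s. indicator (A i) s \<partial>lborel)" using Ai by simp
      also have "\<dots> = ennreal \<bar>c\<bar> * (\<integral>\<^sup>+ y. indicator (A i) (a + c * y) \<partial>lborel)"
        using Ai c by (intro nn_integral_real_affine) auto
      also have "\<dots> = (\<integral>\<^sup>+ y. ennreal c * indicator (A i) (a + c * y) \<partial>lborel)"
        using Ai c by (subst nn_integral_cmult) auto
      also have "\<dots> = (\<integral>\<^sup>+ y. ennreal (d y) * indicator (A i) (T y) \<partial>lborel)"
        using Ai by (intro nn_integral_cong) (auto simp: d_def T_def indicator_def)
      finally show ?thesis ..
    qed
    have TA: "(\<lambda>y. indicator (A i) (T y) :: ennreal) \<in> borel_measurable lborel" if "i \<in> {..<k}"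
      for i
      using measurable_compose[OF Tm borel_measurable_indicator[OF A[OF that]]] by simp
    have "emeasure P (Pi\<^sub>E {..<k} A) = emeasure
        (density (PiM {..<k} (\<lambda>_. lborel)) (\<lambda>y. ennreal (\<Prod>i<k. d (y i))))
       ((\<lambda>y. \<lambda>i\<in>{..<k}. T (y i)) -` Pi\<^sub>E {..<k} A \<inter> space (PiM {..<k} (\<lambda>_. lborel)))"
      unfolding P_def using Tm' A by (subst emeasure_distr) (auto intro!: sets_PiM_I_finite)
    also have "\<dots> = (\<integral>\<^sup>+ y. ennreal (\<Prod>i<k. d (y i)) *
        indicator ((\<lambda>y. \<lambda>i\<in>{..<k}. T (y i)) -` Pi\<^sub>E {..<k} A \<inter> space
          (PiM {..<k} (\<lambda>_. lborel))) y \<partial>PiM {..<k} (\<lambda>_. lborel))"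
      using Dm A by (intro emeasure_density measurable_sets[OF Tm'])
        (auto intro!: sets_PiM_I_finite)
    also have "\<dots> = (\<integral>\<^sup>+ y. (\<Prod>i<k. ennreal (d (y i)) *
        indicator (A i) (T (y i))) \<partial>PiM {..<k} (\<lambda>_. lborel))"
    proof (intro nn_integral_cong)
      fix y :: "nat \<Rightarrow> real" assume y: "y \<in> space (PiM {..<k} (\<lambda>_. lborel))"
      have "indicator ((\<lambda>y. \<lambda>i\<in>{..<k}. T (y i)) -` Pi\<^sub>E {..<k} A \<inter> space (PiM {..<k} (\<lambda>_. lborel)))
          y = (\<Prod>i<k. indicator (A i) (T (y i)) :: ennreal)"
      proof (cases "\<forall>i<k. T (y i) \<in> A i")
        case True
        then show ?thesis using y by (auto simp: PiE_iff)
      next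
        case False
        then have "(\<Prod>i<k. indicator (A i) (T (y i)) :: ennreal) = 0"
          by (intro prod_zero) (auto intro!: bexI)
        moreover have "(\<lambda>i\<in>{..<k}. T (y i)) \<notin> Pi\<^sub>E {..<k} A" using False by (auto simp: PiE_iff)
        ultimately show ?thesis by simp
      qed
      then show "ennreal (\<Prod>i<k. d (y i)) *
        indicator ((\<lambda>y. \<lambda>i\<in>{..<k}. T (y i)) -` Pi\<^sub>E {..<k} A \<inter> space (PiM {..<k} (\<lambda>_. lborel))) y =
        (\<Prod>i<k. ennreal (d (y i)) * indicator (A i) (T (y i)))"
        by (simp only: prod.distrib prod_ennreal[OF d0, symmetric])
    qed
    also have "\<dots> = (\<Prod>i<k. \<integral>\<^sup>+ y. ennreal (d y) * indicator (A i) (T y) \<partial>lborel)"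
      using TA dm by (intro L.product_nn_integral_prod) auto
    also have "\<dots> = (\<Prod>i\<in>{..<k}. emeasure unit_lborel (A i))"
      by (intro prod.cong refl one)
    finally show "emeasure P (Pi\<^sub>E {..<k} A) = (\<Prod>i\<in>{..<k}. emeasure unit_lborel (A i))" .
  qed simp
  then have "(\<integral>x. g x \<partial>PiM {..<k} (\<lambda>_. unit_lborel)) = (\<integral>x. g x \<partial>P)" by simp
  also have "\<dots> = (\<integral>y. g (\<lambda>i\<in>{..<k}. T (y i)) \<partial>density (PiM {..<k} (\<lambda>_. lborel)) (\<lambda>y. ennreal (\<Prod>i<k.
      d (y i))))"
    unfolding P_def using Tm' g by (intro integral_distr) auto
  also have "\<dots> = (\<integral>y. (\<Prod>i<k. d (y i)) *\<^sub>R g (\<lambda>i\<in>{..<k}. T (y i)) \<partial>PiM {..<k} (\<lambda>_. lborel))"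
    using measurable_compose[OF Tm' g] Dm d0 by (intro integral_density) (auto intro: prod_nonneg)
  finally show ?thesis unfolding d_def T_def .
qed

lemma integrable_gaussian: "0 < c \<Longrightarrow> integrable lborel (\<lambda>y. exp (- c * y\<^sup>2) :: real)"
proof -
  assume c: "0 < c"
  define \<sigma> where "\<sigma> = sqrt (1 / (2 * c))"
  have s: "2 * \<sigma>\<^sup>2 = 1 / c" using c by (simp add: \<sigma>_def)
  have s0: "0 < \<sigma>" using c by (simp add: \<sigma>_def)
  have "integrable lborel (\<lambda>y. sqrt (2 * pi * \<sigma>\<^sup>2) * normal_density 0 \<sigma> y)"
    using s0 by (intro integrable_mult_right integrable_normal_density)
  moreover have "sqrt (2 * pi * \<sigma>\<^sup>2) * normal_density 0 \<sigma> y = exp (- c * y\<^sup>2)" for y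
    using s0 c unfolding normal_density_def s by simp
  ultimately show ?thesis by simp
qed

section \<open>Blow-up of the circle and convergence of each Fredholm term\<close>

locale scaling =
  fixes q \<tau> :: real and l :: int and \<beta> :: "nat \<Rightarrow> real"
    and M :: "nat \<Rightarrow> nat" and t :: "nat \<Rightarrow> real" and b :: "nat \<Rightarrow> nat \<Rightarrow> real"
  assumes q: "0 < q" "q < 1"
    and l: "l \<ge> -1"
    and \<beta>: "\<And>k. int k \<le> l \<Longrightarrow> \<beta> k > 0"
    and M: "\<And>n. int (M n) = int n + l + 1"
    and t: "\<And>n. t n = real n - \<tau> * sqrt (real n)"
    and b_slow: "\<And>n k. int k \<le> l \<Longrightarrow> b n k = \<beta> k / sqrt (real n)"
    and b_one: "\<And>n k. int k > l \<Longrightarrow> b n k = 1"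
begin

definition L :: nat where "L = nat (l + 1)"

lemma less_L: "k < L \<longleftrightarrow> int k \<le> l"
  using l by (auto simp: L_def)

lemma M_eq: "M n = n + L"
  using M[of n] l by (simp add: L_def)

lemma gamma_factor_eq: "gamma_factor l \<beta> z = (\<Prod>k<L. of_real (\<beta> k) / (of_real (\<beta> k) - z))"
  unfolding gamma_factor_def by (intro prod.cong) (auto simp: less_L)

text \<open>Conditions that hold for all large \<open>n\<close>. The bound on \<open>\<beta>\<close>
  gives \<open>b n k \<le> 1\<close>, which places these poles inside the circle; the bound on
  \<open>\<tau>\<close> gives \<open>t n \<ge> n / 2\<close>, hence a non-negative time and enough
  decay away from \<open>0\<close>.\<close>

definition good :: "nat \<Rightarrow> bool" where
  "good n \<longleftrightarrow> 1 \<le> n \<and> (\<forall>k<L. \<beta> k \<le> sqrt n) \<and> 2 * \<tau> \<le> sqrt n"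

lemma sqrt_at_top: "filterlim (\<lambda>n. sqrt (real n)) at_top sequentially"
  by real_asymp

lemma eventually_good: "eventually good sequentially"
proof -
  have *: "\<forall>\<^sub>F n in sequentially. c \<le> sqrt (real n)" for c
    using sqrt_at_top by (simp add: filterlim_at_top)
  have "\<forall>\<^sub>F n in sequentially. \<forall>k\<in>{..<L}. \<beta> k \<le> sqrt (real n)"
    by (intro eventually_ball_finite) (use * in auto)
  then show ?thesis
    using *[of "2 * \<tau>"] eventually_ge_at_top[of 1] unfolding good_def by eventually_elim auto
qed

definition \<delta> :: "nat \<Rightarrow> real" where "\<delta> n = 1 / sqrt n"

text \<open>
  The steepest descent happens near \<open>0\<close>: the point of the circle with parameter
  \<open>1 / 2 + \<delta> n * y / (2 * pi)\<close> is \<open>V n y\<close>, and its blow-up \<open>W n y\<close> tends to \<open>- 1 - y * \<i>\<close>.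
\<close>

definition V :: "nat \<Rightarrow> real \<Rightarrow> complex" where
  "V n y = 1 - of_real (1 + \<delta> n) * cis (y * \<delta> n)"

definition W :: "nat \<Rightarrow> real \<Rightarrow> complex" where
  "W n y = of_real (sqrt n) * V n y"

definition circ :: "nat \<Rightarrow> real \<Rightarrow> complex" where
  "circ n = circlepath 1 (1 + \<delta> n)"

text \<open>Parameter \<open>1 / 2\<close> is the leftmost point \<open>- \<delta> n\<close>. The
  positively oriented circle runs downward there, in agreement with the orientation of
  \<open>Gamma_inf\<close>.\<close>

lemma circ_eq: "circ n (1 / 2 + \<delta> n / (2 * pi) * y) = V n y"
proof -
  have "2 * of_real pi * \<i> * complex_of_real (1 / 2 + \<delta> n / (2 * pi) * y) =
      \<i> * of_real pi + \<i> * of_real (y * \<delta> n)"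
    by (simp add: field_simps)
  then have "exp (2 * of_real pi * \<i> * complex_of_real (1 / 2 + \<delta> n / (2 * pi) * y)) =
      - cis (y * \<delta> n)"
    by (simp only: exp_add cis_conv_exp) simp
  then show ?thesis by (simp only: circ_def circlepath V_def) simp
qed

lemma vector_derivative_circ: "vector_derivative (circ n) (at s) =
    2 * of_real pi * \<i> * (circ n s - 1)"
  unfolding circ_def vector_derivative_circlepath by (simp add: circlepath)

context
  fixes n :: nat
  assumes good: "good n"
begin

lemma n_pos: "0 < n" and \<delta>_pos: "0 < \<delta> n" and sqrt_\<delta>: "sqrt n * \<delta> n = 1"
  using good by (auto simp: good_def \<delta>_def)

lemma t_ge: "real n / 2 \<le> t n"
proof -
  have "2 * \<tau> * sqrt n \<le> sqrt n * sqrt n" using good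
    by (intro mult_right_mono) (auto simp: good_def)
  then show ?thesis by (simp add: t)
qed

lemma t_nonneg: "0 \<le> t n"
  using t_ge by (rule order_trans[rotated]) simp

lemma b_pos: "0 < b n k"
  using \<beta>[of k] b_slow[of k n] b_one[of k n] n_pos by (cases "int k \<le> l") auto

lemma b_le_1: "b n k \<le> 1"
  using good b_slow[of k n] b_one[of k n] n_pos
  by (cases "int k \<le> l") (auto simp: good_def less_L)

lemma norm_1_V: "norm (1 - V n y) = 1 + \<delta> n"
proof -
  have "norm (complex_of_real (1 + \<delta> n)) = 1 + \<delta> n" unfolding norm_of_real using \<delta>_pos by simp
  then show ?thesis by (simp add: V_def norm_mult del: of_real_add)
qed

text \<open>Seen from the centre \<open>1\<close>, the circle is at distance
  \<open>1 + \<delta> n\<close> and the pole \<open>b n k\<close> at distance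
  \<open>1 - b n k\<close>. Hence they are at least \<open>b n k\<close> apart, and the slow factors
  never exceed \<open>1\<close> in norm.\<close>

lemma norm_slow: "k < L \<Longrightarrow> norm (of_real (\<beta> k) / (of_real (\<beta> k) - W n y)) \<le> 1"
proof -
  assume k: "k < L"
  then have bk: "\<beta> k = sqrt n * b n k" using n_pos b_slow[of k n] by (simp add: less_L)
  have "norm (1 - complex_of_real (b n k)) = 1 - b n k"
  proof -
    have "1 - complex_of_real (b n k) = of_real (1 - b n k)" by simp
    then have "norm (1 - complex_of_real (b n k)) = \<bar>1 - b n k\<bar>" by (simp only: norm_of_real)
    then show ?thesis using b_le_1[of k] by simp
  qed
  moreover have "norm (1 - V n y) - norm (1 - complex_of_real (b n k)) \<le>
      norm ((1 - V n y) - (1 - complex_of_real (b n k)))"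
    by (rule norm_triangle_ineq2)
  moreover have "(1 - V n y) - (1 - complex_of_real (b n k)) = of_real (b n k) - V n y"
    by (rule diff_diff_eq2[THEN trans]) simp
  ultimately have "1 + \<delta> n - (1 - b n k) \<le> norm (of_real (b n k) - V n y)" by (simp only: norm_1_V)
  then have "b n k \<le> norm (of_real (b n k) - V n y)" using \<delta>_pos by simp
  then have "sqrt n * b n k \<le> sqrt n * norm (of_real (b n k) - V n y)"
    by (intro mult_left_mono) auto
  also have "\<dots> = norm (of_real (\<beta> k) - W n y)"
    unfolding bk W_def of_real_mult right_diff_distrib[symmetric] norm_mult by simp
  finally have le: "\<beta> k \<le> norm (of_real (\<beta> k) - W n y)" unfolding bk .
  have pos: "0 < \<beta> k" using k \<beta> by (simp add: less_L)
  then have "0 < norm (of_real (\<beta> k) - W n y)" using le by linarith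
  then show ?thesis using le pos by (simp add: norm_divide divide_le_eq_1)
qed

text \<open>Distances are again measured from the centre: \<open>1 - V'\<close> is
  \<open>q V - V'\<close> plus \<open>q (1 - V)\<close> plus \<open>1 - q\<close>, so the triangle
  inequality gives distance at least \<open>(1 - q) * \<delta> n\<close>. The factor
  \<open>sqrt n\<close> makes this a bound free of \<open>n\<close>.\<close>

lemma norm_denom: "1 - q \<le> norm (of_real q * W n y - W n y')"
proof -
  have "norm (1 - V n y') \<le> norm (of_real q * V n y - V n y') + norm (of_real q * (1 - V n y)) +
      norm (complex_of_real (1 - q))"
  proof -
    have "1 - V n y' = (of_real q * V n y - V n y') + (of_real q * (1 - V n y) + of_real (1 - q))"
      by (simp add: algebra_simps)
    then have "norm (1 - V n y') \<le> norm (of_real q * V n y - V n y') +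
        norm (of_real q * (1 - V n y) + complex_of_real (1 - q))"
      by (simp only: norm_triangle_ineq)
    also have "\<dots> \<le> norm (of_real q * V n y - V n y') +
        (norm (of_real q * (1 - V n y)) + norm (complex_of_real (1 - q)))"
      by (intro add_left_mono norm_triangle_ineq)
    finally show ?thesis by (simp only: add.assoc)
  qed
  moreover have "norm (of_real q * (1 - V n y)) = q * (1 + \<delta> n)" using q
    by (simp add: norm_mult norm_1_V)
  moreover have "norm (complex_of_real (1 - q)) = 1 - q" unfolding norm_of_real using q by simp
  ultimately have "(1 - q) * \<delta> n \<le> norm (of_real q * V n y - V n y')"
    by (simp add: norm_1_V algebra_simps)
  then have "sqrt n * ((1 - q) * \<delta> n) \<le> sqrt n * norm (of_real q * V n y - V n y')"
    by (intro mult_left_mono) auto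
  moreover have "sqrt n * norm (of_real q * V n y - V n y') = norm (of_real q * W n y - W n y')"
  proof -
    have "of_real q * W n y - W n y' = of_real (sqrt n) * (of_real q * V n y - V n y')"
      by (simp add: W_def algebra_simps)
    then show ?thesis by (simp add: norm_mult)
  qed
  moreover have "sqrt n * ((1 - q) * \<delta> n) = 1 - q" using sqrt_\<delta> by (simp add: mult.left_commute)
  ultimately show ?thesis by simp
qed

end

text \<open>
  The exponent is \<open>n\<close> although \<open>n + 1\<close> of the \<open>b n k\<close> equal \<open>1\<close>: the line element of the circle
  contributes a factor \<open>1 - V n y\<close>.
\<close>

definition fast :: "nat \<Rightarrow> real \<Rightarrow> complex" where
  "fast n y = exp (- V n y * of_real (t n)) / (1 - V n y) ^ n"

definition slow :: "nat \<Rightarrow> real \<Rightarrow> complex" where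
  "slow n y = (\<Prod>k<L. of_real (\<beta> k) / (of_real (\<beta> k) - W n y))"

lemma K_pre_circ:
  assumes "good n"
  shows "(1 - V n y) * (exp (- V n y * of_real (t n)) *
      (\<Prod>k\<le>M n. of_real (b n k) / (of_real (b n k) - V n y))) = fast n y * slow n y"
proof -
  have "{..M n} = {..<L} \<union> {L..M n}" by (auto simp: M_eq)
  then have "(\<Prod>k\<le>M n. of_real (b n k) / (of_real (b n k) - V n y)) =
     (\<Prod>k<L. of_real (b n k) / (of_real (b n k) - V n y)) *
       (\<Prod>k=L..M n. of_real (b n k) / (of_real (b n k) - V n y))"
    by (simp only:) (rule prod.union_disjoint, auto)
  also have "(\<Prod>k<L. of_real (b n k) / (of_real (b n k) - V n y)) = slow n y"
    unfolding slow_def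
  proof (intro prod.cong refl)
    fix k assume "k \<in> {..<L}"
    then have "complex_of_real (\<beta> k) = of_real (sqrt n) * of_real (b n k)"
      using n_pos[OF assms] b_slow[of k n] by (simp add: less_L)
    then show "of_real (b n k) / (of_real (b n k) - V n y) =
        of_real (\<beta> k) / (of_real (\<beta> k) - W n y)"
      unfolding W_def using n_pos[OF assms] by (simp only: right_diff_distrib[symmetric]) simp
  qed
  also have "(\<Prod>k=L..M n. of_real (b n k) / (of_real (b n k) - V n y)) =
      (\<Prod>k=L..M n. 1 / (1 - V n y))"
  proof (intro prod.cong refl)
    fix k assume "k \<in> {L..M n}"
    then have "b n k = 1" using less_L[of k] by (intro b_one) simp
    then show "of_real (b n k) / (of_real (b n k) - V n y) = 1 / (1 - V n y)" by simp
  qed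
  also have "\<dots> = 1 / (1 - V n y) ^ Suc n" by (simp add: M_eq power_one_over)
  finally show ?thesis
    using norm_1_V[OF assms, of y] \<delta>_pos[OF assms] by (auto simp: fast_def)
qed

lemma fast_eq:
  assumes "good n"
  shows "fast n y = exp (Complex (- t n * (1 - (1 + \<delta> n) * cos (y * \<delta> n)) - n * ln (1 + \<delta> n))
    (t n * (1 + \<delta> n) * sin (y * \<delta> n) - n * (y * \<delta> n)))"
proof -
  have "1 - V n y = of_real (1 + \<delta> n) * cis (y * \<delta> n)" by (simp add: V_def)
  also have "\<dots> = exp (of_real (ln (1 + \<delta> n)) + \<i> * of_real (y * \<delta> n))"
    using \<delta>_pos[OF assms] by (simp add: exp_add exp_of_real cis_conv_exp)
  finally have "fast n y = exp (- V n y * of_real (t n)) / exp (of_nat n *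
      (of_real (ln (1 + \<delta> n)) + \<i> * of_real (y * \<delta> n)))"
    by (simp only: fast_def exp_of_nat_mult)
  also have "\<dots> = exp (- V n y * of_real (t n) - of_nat n *
      (of_real (ln (1 + \<delta> n)) + \<i> * of_real (y * \<delta> n)))"
    by (rule exp_diff[symmetric])
  also have "- V n y * of_real (t n) - of_nat n * (of_real (ln (1 + \<delta> n)) + \<i> * of_real (y * \<delta> n)) =
    Complex (- t n * (1 - (1 + \<delta> n) * cos (y * \<delta> n)) - n * ln (1 + \<delta> n))
    (t n * (1 + \<delta> n) * sin (y * \<delta> n) - n * (y * \<delta> n))"
    by (simp add: complex_eq_iff V_def algebra_simps)
  finally show ?thesis .
qed

text \<open>With \<open>\<theta> = y * \<delta> n\<close>, write
  \<open>1 - (1 + \<delta> n) cos \<theta>\<close> as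
  \<open>- \<delta> n + (1 + \<delta> n) (1 - cos \<theta>)\<close>. The first part gives
  \<open>t n * \<delta> n = sqrt n - \<tau>\<close> against
  \<open>n ln (1 + \<delta> n) \<ge> sqrt n - 1\<close>, leaving \<open>1 - \<tau>\<close>. The
  second gives at least \<open>y\<^sup>2 / pi\<^sup>2\<close>, from \<open>t n \<ge> n / 2\<close>
  and \<open>one_minus_cos_ge\<close>. The range of \<open>y\<close> is the whole circle.\<close>

lemma norm_fast_le:
  assumes g: "good n" and y: "\<bar>y\<bar> \<le> pi * sqrt n"
  shows "norm (fast n y) \<le> exp (1 - \<tau>) * exp (- (1 / pi\<^sup>2) * y\<^sup>2)"
proof -
  note d = \<delta>_pos[OF g] and n = n_pos[OF g] and sd = sqrt_\<delta>[OF g]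
  have nd: "n * \<delta> n = sqrt n" "n * (\<delta> n)\<^sup>2 = 1" using n
    by (simp_all add: \<delta>_def real_div_sqrt power_divide)
  have "\<delta> n - (\<delta> n)\<^sup>2 \<le> ln (1 + \<delta> n)" using d n
    by (intro ln_one_plus_pos_lower_bound) (auto simp: \<delta>_def)
  then have "n * (\<delta> n - (\<delta> n)\<^sup>2) \<le> n * ln (1 + \<delta> n)" by (intro mult_left_mono) auto
  then have ln: "sqrt n - 1 \<le> n * ln (1 + \<delta> n)" using nd by (simp add: right_diff_distrib)
  have td: "t n * \<delta> n = sqrt n - \<tau>" using nd sd by (simp add: t left_diff_distrib mult.assoc)
  have th: "\<bar>y * \<delta> n\<bar> \<le> pi"
  proof -
    have "\<bar>y * \<delta> n\<bar> \<le> pi * sqrt n * \<delta> n" using y d by (simp add: abs_mult)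
    then show ?thesis using sd by (simp add: mult.assoc)
  qed
  have "y\<^sup>2 / pi\<^sup>2 = n / 2 * (2 * (y * \<delta> n)\<^sup>2 / pi\<^sup>2)" using nd(2) n
    by (simp add: power_mult_distrib field_simps)
  also have "\<dots> \<le> t n * (1 - cos (y * \<delta> n))"
    using t_ge[OF g] one_minus_cos_ge[OF th] t_nonneg[OF g] by (intro mult_mono) auto
  also have "\<dots> \<le> t n * ((1 + \<delta> n) * (1 - cos (y * \<delta> n)))"
    using d t_nonneg[OF g] mult_right_mono[of 1 "1 + \<delta> n" "1 - cos (y * \<delta> n)"]
      by (intro mult_left_mono) auto
  finally have "- t n * (1 - (1 + \<delta> n) * cos (y * \<delta> n)) - n * ln (1 + \<delta> n) \<le> 1 - \<tau> - y\<^sup>2 / pi\<^sup>2"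
    using ln td by (simp add: algebra_simps)
  then show ?thesis by (simp add: fast_eq[OF g] exp_add[symmetric])
qed

lemma W_tendsto: "(\<lambda>n. W n y) \<longlonglongrightarrow> Gamma_inf y"
proof -
  have "(\<lambda>n. sqrt (real n) * (1 - (1 + 1 / sqrt n) * cos (y * (1 / sqrt n)))) \<longlonglongrightarrow> - 1"
    by real_asymp
  moreover have "(\<lambda>n. - sqrt (real n) * (1 + 1 / sqrt n) * sin (y * (1 / sqrt n))) \<longlonglongrightarrow> - y"
    by (cases "y = 0") (simp, real_asymp)
  ultimately show ?thesis
    unfolding tendsto_complex_iff by (simp add: W_def V_def \<delta>_def Gamma_inf_def mult.assoc)
qed

lemma fast_tendsto: "(\<lambda>n. fast n y) \<longlonglongrightarrow> exp ((Gamma_inf y)\<^sup>2 / 2 + of_real \<tau> * Gamma_inf y)"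
proof -
  have 1: "(\<lambda>n. - (real n - \<tau> * sqrt n) * (1 - (1 + 1 / sqrt n) * cos (y * (1 / sqrt n))) - n *
      ln (1 + 1 / sqrt n)) \<longlonglongrightarrow> - (y * y / 2) - \<tau> + 1 / 2"
    by real_asymp
  have 2: "(\<lambda>n. (real n - \<tau> * sqrt n) * (1 + 1 / sqrt n) * sin (y * (1 / sqrt n)) - n *
      (y * (1 / sqrt n))) \<longlonglongrightarrow> (1 - \<tau>) * y"
    by real_asymp
  have lim: "(\<lambda>n. exp (Complex (- t n * (1 - (1 + \<delta> n) * cos (y * \<delta> n)) - n * ln (1 + \<delta> n))
    (t n * (1 + \<delta> n) * sin (y * \<delta> n) - n * (y * \<delta> n)))) \<longlonglongrightarrow> exp
      (Complex (- (y * y / 2) - \<tau> + 1 / 2) ((1 - \<tau>) * y))"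
    using 1 2 unfolding t \<delta>_def by (intro tendsto_exp tendsto_Complex)
  have E: "Complex (- (y * y / 2) - \<tau> + 1 / 2) ((1 - \<tau>) * y) = (Gamma_inf y)\<^sup>2 / 2 + of_real \<tau> *
      Gamma_inf y"
    by (simp add: complex_eq_iff Gamma_inf_def power2_eq_square algebra_simps)
  have ev: "\<forall>\<^sub>F n in sequentially. exp (Complex (- t n * (1 - (1 + \<delta> n) * cos (y * \<delta> n)) - n *
      ln (1 + \<delta> n))
    (t n * (1 + \<delta> n) * sin (y * \<delta> n) - n * (y * \<delta> n))) = fast n y"
    using eventually_good by (rule eventually_mono) (rule fast_eq[symmetric])
  show ?thesis unfolding E[symmetric] using lim ev by (rule Lim_transform_eventually)
qed

lemma \<beta>_ne: "k < L \<Longrightarrow> of_real (\<beta> k) - Gamma_inf y \<noteq> 0"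
  using \<beta>[of k] by (auto simp: less_L Gamma_inf_def complex_eq_iff)

lemma slow_tendsto: "(\<lambda>n. slow n y) \<longlonglongrightarrow> gamma_factor l \<beta> (Gamma_inf y)"
  unfolding slow_def gamma_factor_eq
  by (intro tendsto_prod tendsto_divide tendsto_diff tendsto_const W_tendsto \<beta>_ne) auto

lemma norm_slow_le: "good n \<Longrightarrow> norm (slow n y) \<le> 1"
  unfolding slow_def prod_norm[symmetric] by (intro prod_le_1) (auto intro!: norm_slow)

text \<open>The part of the integrand that belongs to one variable, once a Cauchy determinant in
  \<open>W n\<close> is split off. The line element over \<open>2 \<pi> i\<close> is
  \<open>V n y - 1\<close>, whence the sign; \<open>2 * pi\<close> stems from the substitution in
  the parameter.\<close>

definition dens :: "nat \<Rightarrow> real \<Rightarrow> complex" where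
  "dens n y = - (fast n y * slow n y) / (2 * of_real pi)"

definition lim_dens :: "real \<Rightarrow> complex" where
  "lim_dens y = - (exp ((Gamma_inf y)\<^sup>2 / 2 + of_real \<tau> * Gamma_inf y) *
      gamma_factor l \<beta> (Gamma_inf y)) / (2 * of_real pi)"

lemma dens_tendsto: "(\<lambda>n. dens n y) \<longlonglongrightarrow> lim_dens y"
  unfolding dens_def lim_dens_def
  by (intro tendsto_divide tendsto_minus tendsto_mult fast_tendsto slow_tendsto tendsto_const) auto

lemma norm_dens_le:
  assumes "good n" "\<bar>y\<bar> \<le> pi * sqrt n"
  shows "norm (dens n y) \<le> exp (1 - \<tau>) * exp (- (1 / pi\<^sup>2) * y\<^sup>2)"
proof -
  have "norm (dens n y) = norm (fast n y) * norm (slow n y) * (1 / (2 * pi))"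
    by (simp add: dens_def norm_mult norm_divide)
  also have "\<dots> \<le> (exp (1 - \<tau>) * exp (- (1 / pi\<^sup>2) * y\<^sup>2)) * 1 * 1"
    using pi_ge_two by (intro mult_mono norm_fast_le norm_slow_le assms) auto
  finally show ?thesis by simp
qed

abbreviation pre_det :: "nat \<Rightarrow> nat \<Rightarrow> (nat \<Rightarrow> real) \<Rightarrow> complex" where
  "pre_det n k x \<equiv> Determinant.det (Matrix.mat k k (\<lambda>(i,
      j). K_pre q (b n) (M n) (t n) (circ n (x i)) (circ n (x j)) *
       vector_derivative (circ n) (at (x j)) / (2 * of_real pi * \<i>)))"

abbreviation lim_det :: "nat \<Rightarrow> (nat \<Rightarrow> real) \<Rightarrow> complex" where
  "lim_det k y \<equiv> Determinant.det (Matrix.mat k k (\<lambda>(i,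
      j). K_lim q \<tau> l \<beta> (Gamma_inf (y i)) (Gamma_inf (y j)) *
       vector_derivative Gamma_inf (at (y j)) / (2 * of_real pi * \<i>)))"

abbreviation shifted_cauchy_det :: "(real \<Rightarrow> complex) \<Rightarrow> nat \<Rightarrow> (nat \<Rightarrow> real) \<Rightarrow> complex" where
  "shifted_cauchy_det Z k y \<equiv> Determinant.det
      (Matrix.mat k k (\<lambda>(i, j). 1 / (of_real q * Z (y j) - Z (y i))))"

definition pre_integrand :: "nat \<Rightarrow> nat \<Rightarrow> (nat \<Rightarrow> real) \<Rightarrow> complex" where
  "pre_integrand n k y = (\<Prod>i<k. indicator {- (pi * sqrt n)..pi * sqrt n} (y i)) *\<^sub>R
      ((\<Prod>i<k. dens n (y i)) * shifted_cauchy_det (W n) k y)"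

lemma circ_measurable:
  assumes "i < k"
  shows "(\<lambda>x. circ n (x i)) \<in> borel_measurable (PiM {..<k} (\<lambda>_. unit_lborel))"
proof -
  have "circ n \<in> borel_measurable borel"
    unfolding circ_def circlepath by (intro borel_measurable_continuous_onI continuous_intros)
  then have "circ n \<in> borel_measurable unit_lborel" by (intro measurable_restrict_space1) simp
  then show ?thesis using assms by (intro measurable_compose[OF measurable_component_singleton]) auto
qed

lemma K_pre_measurable:
  assumes [measurable]: "f \<in> borel_measurable N" "g \<in> borel_measurable N"
  shows "(\<lambda>x. K_pre q b' m s (f x) (g x)) \<in> borel_measurable N"
  unfolding K_pre_def by measurable

lemma det_circ:
  assumes g: "good n"
  shows "(\<Prod>i<k. of_real (\<delta> n / (2 * pi))) * Determinant.det
      (Matrix.mat k k (\<lambda>(i, j). K_pre q (b n) (M n) (t n) (V n (y i)) (V n (y j)) *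
    (V n (y j) - 1))) =
    (\<Prod>i<k. dens n (y i)) * shifted_cauchy_det (W n) k y"
proof -
  define \<phi> where "\<phi> z = exp (- z * of_real (t n)) *
      (\<Prod>k\<le>M n. of_real (b n k) / (of_real (b n k) - z))" for z :: complex
  have sn: "complex_of_real (sqrt n) \<noteq> 0" using n_pos[OF g] by simp
  \<comment> \<open>Passing from \<open>V n\<close> to \<open>W n\<close> in the Cauchy entry costs
    a factor \<open>sqrt n\<close>, which the \<open>\<delta> n\<close> of the substitution
    compensates.\<close>
  have entry: "K_pre q (b n) (M n) (t n) (V n u) (V n v) * (V n v - 1) =
     \<phi> (V n u) * ((V n v - 1) * of_real (sqrt n)) * (1 / (of_real q * W n v - W n u))" for u v
  proof -
    have "of_real q * W n v - W n u = of_real (sqrt n) * (of_real q * V n v - V n u)"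
      by (simp add: W_def algebra_simps)
    then show ?thesis using sn by (simp add: K_pre_def \<phi>_def)
  qed
  have dens: "of_real (\<delta> n / (2 * pi)) * (\<phi> (V n u) * ((V n u - 1) * of_real (sqrt n))) = dens n u"
    for u
  proof -
    have "(1 - V n u) * \<phi> (V n u) = fast n u * slow n u" unfolding \<phi>_def by (rule K_pre_circ[OF g])
    moreover have "complex_of_real (\<delta> n) * of_real (sqrt n) = 1"
      using sqrt_\<delta>[OF g] by (metis mult.commute of_real_1 of_real_mult)
    moreover have "of_real (\<delta> n / (2 * pi)) * (\<phi> (V n u) * ((V n u - 1) * of_real (sqrt n))) =
      (complex_of_real (\<delta> n) * of_real (sqrt n)) * - ((1 - V n u) * \<phi> (V n u)) / (2 * of_real pi)"
      by (simp add: field_simps)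
    ultimately show ?thesis by (simp add: dens_def)
  qed
  show ?thesis
    unfolding entry det_mat_scale
    by (simp only: dens[symmetric] prod.distrib mult_ac)
qed

lemma circ_integral:
  assumes g: "good n"
  shows "(\<integral>x. pre_det n k x \<partial>PiM {..<k} (\<lambda>_. unit_lborel)) =
    (\<integral>y. pre_integrand n k y \<partial>PiM {..<k} (\<lambda>_. lborel))"
proof -
  note d = \<delta>_pos[OF g]
  define D where "D x = Determinant.det (Matrix.mat k k (\<lambda>(i,
      j). K_pre q (b n) (M n) (t n) (circ n (x i)) (circ n (x j)) * (circ n (x j) - 1)))" for x ::
      "nat \<Rightarrow> real"
  define c where "c = \<delta> n / (2 * pi)"
  have c: "0 < c" using d by (simp add: c_def)
  have "D \<in> borel_measurable (PiM {..<k} (\<lambda>_. unit_lborel))"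
    unfolding D_def
    by (intro det_measurable borel_measurable_times borel_measurable_diff borel_measurable_const K_pre_measurable circ_measurable)
  note affine = integral_unit_cube_affine[OF c this, of "1 / 2"]
  have range: "1 / 2 + c * u \<in> {0..1} \<longleftrightarrow> u \<in> {- (pi * sqrt n)..pi * sqrt n}" for u
    using n_pos[OF g] by (auto simp: c_def \<delta>_def field_simps)
  have "(\<Prod>i<k. c * indicator {0..1} (1 / 2 + c * y i)) *\<^sub>R
      D (\<lambda>i\<in>{..<k}. if 1 / 2 + c * y i \<in> {0..1} then 1 / 2 + c * y i else 0)
     = pre_integrand n k y" for y
  proof (cases "\<forall>i<k. y i \<in> {- (pi * sqrt n)..pi * sqrt n}")
    case True
    have "D (\<lambda>i\<in>{..<k}. if 1 / 2 + c * y i \<in> {0..1} then 1 / 2 + c * y i else 0) =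
        Determinant.det (Matrix.mat k k (\<lambda>(i, j). K_pre q (b n) (M n) (t n) (V n (y i))
          (V n (y j)) * (V n (y j) - 1)))"
      unfolding D_def
      by (intro arg_cong[of _ _ Determinant.det] cong_mat refl)
        (use True range in \<open>auto simp: circ_eq[of n, folded c_def]\<close>)
    moreover have "(\<Prod>i<k. c * indicator {0..1} (1 / 2 + c * y i)) = (\<Prod>i<k. c)"
      using True range by (intro prod.cong) auto
    moreover have "(\<Prod>i<k. indicator {- (pi * sqrt n)..pi * sqrt n} (y i)) = (1::real)"
      using True by (intro prod.neutral) auto
    moreover note det_circ[OF g, of k y]
    ultimately show ?thesis
      by (simp add: pre_integrand_def scaleR_conv_of_real c_def)
  next
    case False
    then obtain i where i: "i < k" "y i \<notin> {- (pi * sqrt n)..pi * sqrt n}" by auto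
    have "(\<Prod>i<k. c * indicator {0..1} (1 / 2 + c * y i)) = 0"
      using i range[of "y i"] by (intro prod_zero) (auto intro!: bexI[of _ i])
    moreover have "(\<Prod>i<k. indicator {- (pi * sqrt n)..pi * sqrt n} (y i)) = (0::real)"
      using i by (intro prod_zero) (auto intro!: bexI[of _ i])
    ultimately show ?thesis by (simp only: pre_integrand_def scaleR_zero_left)
  qed
  then have "(\<integral>x. D x \<partial>PiM {..<k} (\<lambda>_. unit_lborel)) =
      (\<integral>y. pre_integrand n k y \<partial>PiM {..<k} (\<lambda>_. lborel))"
    unfolding affine by simp
  moreover have "K_pre q (b n) (M n) (t n) z w *
      vector_derivative (circ n) (at u) / (2 * of_real pi * \<i>) =
     K_pre q (b n) (M n) (t n) z w * (circ n u - 1)" for z w u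
  proof -
    let ?c = "2 * complex_of_real pi * \<i>" and ?K = "K_pre q (b n) (M n) (t n) z w"
    have eq: "?K * (?c * (circ n u - 1)) = ?c * (?K * (circ n u - 1))" by (rule mult.left_commute)
    show ?thesis unfolding vector_derivative_circ eq by (rule nonzero_mult_div_cancel_left) simp
  qed
  ultimately show ?thesis unfolding D_def by simp
qed

text \<open>\<open>K_lim\<close> carries its exponential in the second argument and its
  \<open>q\<close> on the first, opposite to \<open>K_pre\<close>; transposing the Cauchy matrix
  reconciles the two without changing the determinant.\<close>

lemma det_lim:
  "lim_det k y = (\<Prod>i<k. lim_dens (y i)) * shifted_cauchy_det Gamma_inf k y"
proof -
  have "(Gamma_inf has_vector_derivative - \<i>) (at u)" for u
    unfolding Gamma_inf_def has_vector_derivative_def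
    by (auto intro!: derivative_eq_intros simp: scaleR_conv_of_real)
  then have vd: "vector_derivative Gamma_inf (at u) = - \<i>" for u by (rule vector_derivative_at)
  have entry: "K_lim q \<tau> l \<beta> (Gamma_inf u) (Gamma_inf v) *
      vector_derivative Gamma_inf (at v) / (2 * of_real pi * \<i>) =
     1 * lim_dens v * (1 / (of_real q * Gamma_inf u - Gamma_inf v))" for u v
    unfolding vd K_lim_def lim_dens_def by simp
  have tr: "Matrix.mat k k (\<lambda>(i, j). 1 / (of_real q * Gamma_inf (y i) - Gamma_inf (y j))) =
     transpose_mat (Matrix.mat k k (\<lambda>(i, j). 1 / (of_real q * Gamma_inf (y j) - Gamma_inf (y i))))"
    by (intro eq_matI) auto
  have "Determinant.det (Matrix.mat k k (\<lambda>(i, j). 1 / (of_real q * Gamma_inf (y i) -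
      Gamma_inf (y j)))) = shifted_cauchy_det Gamma_inf k y"
    unfolding tr by (rule det_transpose[of _ k]) simp
  then show ?thesis unfolding entry det_mat_scale by simp
qed

lemma denom_ne: "of_real q * Gamma_inf u - Gamma_inf v \<noteq> 0"
  using q by (auto simp: Gamma_inf_def complex_eq_iff)

lemma pre_integrand_tendsto:
  "(\<lambda>n. pre_integrand n k y) \<longlonglongrightarrow> (\<Prod>i<k. lim_dens (y i)) * shifted_cauchy_det Gamma_inf k y"
proof -
  have "(\<lambda>n. (\<Prod>i<k. dens n (y i)) * shifted_cauchy_det (W n) k y) \<longlonglongrightarrow>
      (\<Prod>i<k. lim_dens (y i)) * shifted_cauchy_det Gamma_inf k y"
    by (intro tendsto_mult tendsto_prod dens_tendsto det_tendsto tendsto_divide tendsto_diff tendsto_const W_tendsto denom_ne)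
  moreover have "\<forall>\<^sub>F n in sequentially. (\<Prod>i<k. dens n (y i)) * shifted_cauchy_det (W n) k y =
      pre_integrand n k y"
  proof -
    have "\<forall>\<^sub>F n in sequentially. \<bar>y i\<bar> / pi \<le> sqrt (real n)" for i
      using sqrt_at_top by (simp add: filterlim_at_top)
    then have "\<forall>\<^sub>F n in sequentially. \<forall>i\<in>{..<k}. \<bar>y i\<bar> / pi \<le> sqrt (real n)"
      by (intro eventually_ball_finite) auto
    then show ?thesis
    proof (rule eventually_mono)
      fix n assume le: "\<forall>i\<in>{..<k}. \<bar>y i\<bar> / pi \<le> sqrt (real n)"
      have "(\<Prod>i<k. indicator {- (pi * sqrt n)..pi * sqrt n} (y i)) = (1::real)"
      proof (intro prod.neutral ballI)
        fix i assume "i \<in> {..<k}"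
        then have "\<bar>y i\<bar> \<le> pi * sqrt n" using le by (simp add: field_simps)
        then show "indicator {- (pi * sqrt n)..pi * sqrt n} (y i) = (1::real)"
          by (auto simp: indicator_def abs_le_iff)
      qed
      then show "(\<Prod>i<k. dens n (y i)) * shifted_cauchy_det (W n) k y = pre_integrand n k y"
        by (simp only: pre_integrand_def scaleR_one)
    qed
  qed
  ultimately show ?thesis by (rule Lim_transform_eventually)
qed

lemma norm_pre_integrand_le:
  assumes g: "good n"
  shows "norm (pre_integrand n k y) \<le>
    (\<Prod>i<k. exp (1 - \<tau>) * exp (- (1 / pi\<^sup>2) * (y i)\<^sup>2)) * (fact k * (1 / (1 - q)) ^ k)"
proof -
  have det: "norm (shifted_cauchy_det (W n) k y) \<le> fact k * (1 / (1 - q)) ^ k"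
  proof (rule det_norm_le)
    fix i j
    have "0 < 1 - q" using q by simp
    then show "norm (1 / (of_real q * W n (y j) - W n (y i))) \<le> 1 / (1 - q)"
      using norm_denom[OF g, of "y j" "y i"] by (simp add: norm_divide frac_le)
  qed
  have "norm (pre_integrand n k y) =
      (\<Prod>i<k. indicator {- (pi * sqrt n)..pi * sqrt n} (y i) * norm (dens n (y i))) * norm
        (shifted_cauchy_det (W n) k y)"
    by (simp add: pre_integrand_def norm_mult prod.distrib prod_norm abs_prod)
  also have "\<dots> \<le> (\<Prod>i<k. exp (1 - \<tau>) * exp (- (1 / pi\<^sup>2) * (y i)\<^sup>2)) * (fact k * (1 / (1 - q)) ^ k)"
  proof (rule mult_mono[OF _ det])
    show "(\<Prod>i<k. indicator {- (pi * sqrt n)..pi * sqrt n} (y i) * norm (dens n (y i))) \<le>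
      (\<Prod>i<k. exp (1 - \<tau>) * exp (- (1 / pi\<^sup>2) * (y i)\<^sup>2))"
    proof (rule prod_mono, rule conjI)
      fix i
      show "indicator {- (pi * sqrt n)..pi * sqrt n} (y i) * norm (dens n (y i)) \<le>
          exp (1 - \<tau>) * exp (- (1 / pi\<^sup>2) * (y i)\<^sup>2)"
      proof (cases "y i \<in> {- (pi * sqrt n)..pi * sqrt n}")
        case True
        then show ?thesis using norm_dens_le[OF g, of "y i"] by (simp add: abs_le_iff)
      qed simp
    qed simp
  qed (use q in \<open>auto intro!: prod_nonneg\<close>)
  finally show ?thesis .
qed

lemma continuous_lborel_measurable:
  "continuous_on UNIV f \<Longrightarrow> i < k \<Longrightarrow> (\<lambda>y. f (y i) :: complex) \<in> borel_measurable
      (PiM {..<k} (\<lambda>_. lborel :: real measure))"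
  by (intro measurable_compose[OF measurable_component_singleton])
    (auto intro: borel_measurable_continuous_onI)

lemma continuous_Gamma_inf: "continuous_on UNIV Gamma_inf"
  unfolding Gamma_inf_def by (intro continuous_intros)

lemma lim_measurable:
  "(\<lambda>y. (\<Prod>i<k. lim_dens (y i)) * shifted_cauchy_det Gamma_inf k y) \<in> borel_measurable
      (PiM {..<k} (\<lambda>_. lborel))"
proof -
  have "continuous_on UNIV lim_dens"
    unfolding lim_dens_def gamma_factor_eq
    by (intro continuous_intros continuous_Gamma_inf) (use \<beta>_ne in auto)
  then show ?thesis
    by (intro borel_measurable_times borel_measurable_prod det_measurable borel_measurable_divide borel_measurable_diff
        borel_measurable_const continuous_lborel_measurable continuous_Gamma_inf) auto
qed

lemma pre_integrand_measurable:
  assumes g: "good n"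
  shows "pre_integrand n k \<in> borel_measurable (PiM {..<k} (\<lambda>_. lborel))"
proof -
  have V: "continuous_on UNIV (V n)" unfolding V_def by (intro continuous_intros)
  then have W: "continuous_on UNIV (W n)" unfolding W_def by (intro continuous_intros)
  have \<beta>W: "of_real (\<beta> k) - W n y \<noteq> 0" if k: "k < L" for k y
  proof
    assume 0: "of_real (\<beta> k) - W n y = 0"
    have "\<beta> k = sqrt n * b n k" using k n_pos[OF g] b_slow[of k n] by (simp add: less_L)
    then have "b n k = V n y" using 0 n_pos[OF g] by (simp add: W_def)
    then have "norm (1 - complex_of_real (b n k)) = 1 + \<delta> n" using norm_1_V[OF g, of y] by simp
    moreover have "norm (1 - complex_of_real (b n k)) = \<bar>1 - b n k\<bar>"
      by (metis norm_of_real of_real_1 of_real_diff)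
    ultimately show False using b_pos[OF g, of k] b_le_1[OF g, of k] \<delta>_pos[OF g] by simp
  qed
  have "1 - V n y \<noteq> 0" for y using norm_1_V[OF g, of y] \<delta>_pos[OF g] by auto
  then have "continuous_on UNIV (dens n)"
    unfolding dens_def fast_def slow_def by (intro continuous_intros V W) (use \<beta>W in auto)
  moreover have "(\<lambda>y. indicator A (y i) :: real) \<in> borel_measurable
      (PiM {..<k} (\<lambda>_. lborel :: real measure))"
    if "i < k" "A \<in> sets borel" for i A
    using that by (intro measurable_compose[OF measurable_component_singleton]) auto
  ultimately show ?thesis unfolding pre_integrand_def
    by (intro borel_measurable_scaleR borel_measurable_times borel_measurable_prod det_measurable borel_measurable_divide borel_measurable_diff
        borel_measurable_const continuous_lborel_measurable W) auto
qed

text \<open>Dominated convergence over the product of lines: pointwise convergence of densities and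
  Cauchy determinants, with a product of Gaussians times the constant
  \<open>fact k * (1 / (1 - q)) ^ k\<close> as majorant.\<close>

lemma circ_term_tendsto:
  "(\<lambda>n. \<integral>x. pre_det n k x \<partial>PiM {..<k} (\<lambda>_. unit_lborel)) \<longlonglongrightarrow>
   (\<integral>y. lim_det k y \<partial>PiM {..<k} (\<lambda>_. lborel))"
proof -
  interpret P: product_sigma_finite "\<lambda>_::nat. lborel :: real measure"
    by (rule product_sigma_finite_lborel)
  \<comment> \<open>The majorant is available only for \<open>good n\<close>, while dominated
    convergence asks for it at every \<open>n\<close>; the finitely many other indices are set to
    \<open>0\<close>.\<close>
  let ?F = "\<lambda>n y. if good n then pre_integrand n k y else 0"
  let ?w = "\<lambda>y. (\<Prod>i<k. exp (1 - \<tau>) * exp (- (1 / pi\<^sup>2) * (y i)\<^sup>2)) * (fact k * (1 / (1 - q)) ^ k)"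
  have "(\<lambda>n. \<integral>y. ?F n y \<partial>PiM {..<k} (\<lambda>_. lborel)) \<longlonglongrightarrow>
      (\<integral>y. (\<Prod>i<k. lim_dens (y i)) * shifted_cauchy_det Gamma_inf k y \<partial>PiM {..<k} (\<lambda>_. lborel))"
  proof (rule integral_dominated_convergence[where w = ?w])
    show "?F n \<in> borel_measurable (PiM {..<k} (\<lambda>_. lborel))" for n
      by (cases "good n") (auto simp: pre_integrand_measurable)
    show "integrable (PiM {..<k} (\<lambda>_. lborel)) ?w"
      by (intro integrable_mult_left P.product_integrable_prod integrable_mult_right integrable_gaussian) auto
    show "AE y in PiM {..<k} (\<lambda>_. lborel). (\<lambda>n. ?F n y) \<longlonglongrightarrow>
        (\<Prod>i<k. lim_dens (y i)) * shifted_cauchy_det Gamma_inf k y"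
    proof (rule AE_I2)
      fix y
      have "\<forall>\<^sub>F n in sequentially. pre_integrand n k y = ?F n y"
        using eventually_good by (rule eventually_mono) simp
      with pre_integrand_tendsto show "(\<lambda>n. ?F n y) \<longlonglongrightarrow>
          (\<Prod>i<k. lim_dens (y i)) * shifted_cauchy_det Gamma_inf k y"
        by (rule Lim_transform_eventually)
    qed
    show "AE y in PiM {..<k} (\<lambda>_. lborel). norm (?F n y) \<le> ?w y" for n
    proof (rule AE_I2)
      fix y
      have "0 \<le> ?w y" using q by (intro mult_nonneg_nonneg prod_nonneg) auto
      then show "norm (?F n y) \<le> ?w y" using norm_pre_integrand_le[of n k y]
        by (cases "good n") simp_all
    qed
  qed (rule lim_measurable)
  moreover have "\<forall>\<^sub>F n in sequentially. (\<integral>y. ?F n y \<partial>PiM {..<k} (\<lambda>_. lborel)) =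
     (\<integral>x. pre_det n k x \<partial>PiM {..<k} (\<lambda>_. unit_lborel))"
    using eventually_good
  proof (rule eventually_mono)
    fix n assume g: "good n"
    show "(\<integral>y. ?F n y \<partial>PiM {..<k} (\<lambda>_. lborel)) =
     (\<integral>x. pre_det n k x \<partial>PiM {..<k} (\<lambda>_. unit_lborel))"
      unfolding circ_integral[OF g] using g by simp
  qed
  ultimately show ?thesis unfolding det_lim by (rule Lim_transform_eventually)
qed

end

section \<open>Passage to the limit in power series\<close>

lemma tendsto_suminf_dominated:
  fixes u :: "nat \<Rightarrow> nat \<Rightarrow> 'a::{real_normed_algebra, banach}"
  assumes lim: "\<And>k. (\<lambda>n. u n k) \<longlonglongrightarrow> c k"
    and bound: "\<forall>\<^sub>F n in sequentially. \<forall>k. norm (u n k) \<le> B k"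
    and B: "summable B"
  shows "(\<lambda>n. \<Sum>k. u n k) \<longlonglongrightarrow> (\<Sum>k. c k)"
proof -
  have "eventually (\<lambda>x. True \<and> (\<forall>k. norm (u (snd x) k) \<le> B k)) (at_top \<times>\<^sub>F sequentially)"
    by (rule eventually_prodI[OF _ bound]) simp
  then have "eventually (\<lambda>(k, n). norm (u n k) \<le> B k) (at_top \<times>\<^sub>F sequentially)"
    by (rule eventually_mono) auto
  from tannerys_theorem[of "\<lambda>k n. u n k", OF lim this B] show ?thesis by simp
qed

text \<open>On a set contained in the disc of radius \<open>R\<close> the difference of the two
  series is at most \<open>D n\<close>, which no longer depends on \<open>\<zeta>\<close> and tends
  to zero by dominated convergence for series.\<close>

lemma power_series_uniform_limit:
  fixes u :: "nat \<Rightarrow> nat \<Rightarrow> complex"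
  assumes lim: "\<And>k. (\<lambda>n. u n k) \<longlonglongrightarrow> c k"
    and bound: "\<forall>\<^sub>F n in sequentially. \<forall>k. norm (u n k) \<le> B k" and c: "\<And>k. norm (c k) \<le> B k"
    and B: "\<And>R. 0 \<le> R \<Longrightarrow> summable (\<lambda>k. B k * R ^ k)"
    and S: "compact S"
  shows "uniform_limit S (\<lambda>n \<zeta>. \<Sum>k. u n k * \<zeta> ^ k) (\<lambda>\<zeta>. \<Sum>k. c k * \<zeta> ^ k) sequentially"
proof -
  obtain R where R: "\<And>\<zeta>. \<zeta> \<in> S \<Longrightarrow> norm \<zeta> \<le> R" "0 < R"
    using compact_imp_bounded[OF S] unfolding bounded_pos by blast
  have sB: "summable (\<lambda>k. B k * R ^ k)" using B R by simp
  define D where "D n = (\<Sum>k. norm (u n k - c k) * R ^ k)" for n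
  have Dk: "norm (u n k - c k) * R ^ k \<le> 2 * (B k * R ^ k)" if "\<forall>k. norm (u n k) \<le> B k" for n k
  proof -
    have "norm (u n k - c k) \<le> 2 * B k" using norm_triangle_ineq4[of "u n k" "c k"] that c[of k]
      by (smt (verit))
    then have "norm (u n k - c k) * R ^ k \<le> 2 * B k * R ^ k" using R by (intro mult_right_mono) auto
    then show ?thesis by (simp only: mult.assoc)
  qed
  have "D \<longlonglongrightarrow> (\<Sum>k::nat. 0)"
    unfolding D_def
  proof (rule tendsto_suminf_dominated)
    show "(\<lambda>n. norm (u n k - c k) * R ^ k) \<longlonglongrightarrow> 0" for k
      using tendsto_norm_zero[OF LIM_zero[OF lim]] by (rule tendsto_mult_left_zero)
    show "\<forall>\<^sub>F n in sequentially. \<forall>k. norm (norm (u n k - c k) * R ^ k) \<le> 2 * (B k * R ^ k)"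
      using bound by (rule eventually_mono) (use Dk R in \<open>simp add: norm_mult\<close>)
    show "summable (\<lambda>k. 2 * (B k * R ^ k))" using sB by (rule summable_mult)
  qed
  then have D: "D \<longlonglongrightarrow> 0" by simp
  show ?thesis
  proof (rule uniform_limitI)
    fix e :: real assume "0 < e"
    with D have "\<forall>\<^sub>F n in sequentially. D n < e" by (rule order_tendstoD)
    with bound show "\<forall>\<^sub>F n in sequentially. \<forall>\<zeta>\<in>S. dist (\<Sum>k. u n k * \<zeta> ^ k) (\<Sum>k. c k * \<zeta> ^ k) < e"
    proof eventually_elim
      case (elim n)
      show ?case
      proof
        fix \<zeta> assume "\<zeta> \<in> S"
        then have \<zeta>: "norm \<zeta> \<le> R" by (rule R)
        have le: "norm (v k * \<zeta> ^ k) \<le> norm (v k) * R ^ k" for v :: "nat \<Rightarrow> complex" and k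
          using \<zeta> by (simp add: norm_mult norm_power mult_left_mono power_mono)
        have sm: "summable (\<lambda>k. v k * \<zeta> ^ k)" if v: "\<And>k. norm (v k) \<le> B k" for v
        proof (rule summable_comparison_test'[OF sB])
          fix k
          have "norm (v k) * R ^ k \<le> B k * R ^ k" using v R by (intro mult_right_mono) auto
          with le show "norm (v k * \<zeta> ^ k) \<le> B k * R ^ k" by (rule order_trans)
        qed
        have "(\<Sum>k. u n k * \<zeta> ^ k) - (\<Sum>k. c k * \<zeta> ^ k) = (\<Sum>k. (u n k - c k) * \<zeta> ^ k)"
          by (subst suminf_diff[OF sm sm]) (use elim c in \<open>auto simp: left_diff_distrib\<close>)
        moreover have "norm (\<Sum>k. (u n k - c k) * \<zeta> ^ k) \<le> D n"
          unfolding D_def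
        proof (rule norm_suminf_le[OF le])
          show "summable (\<lambda>k. norm (u n k - c k) * R ^ k)"
            by (rule summable_comparison_test'[OF summable_mult[OF sB, of 2], of 0])
              (use Dk elim R in \<open>simp add: norm_mult\<close>)
        qed
        ultimately show "dist (\<Sum>k. u n k * \<zeta> ^ k) (\<Sum>k. c k * \<zeta> ^ k) < e"
          using elim by (simp add: dist_norm)
      qed
    qed
  qed
qed

lemma inside_sphere:
  fixes z :: complex
  assumes "0 < r"
  shows "inside (sphere z r) = ball z r"
  using inside_frontier_eq_interior[of "cball z r"] assms by simp

section \<open>Limits of the determinants and of the probabilities\<close>

context scaling
begin

lemma q_unit: "q_unit q"
  using q by unfold_locales

text \<open>The disc contains \<open>0\<close> because its radius exceeds \<open>1\<close>. Scaling
  by \<open>q\<close> moves the circle into distance at most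
  \<open>q * (1 + \<delta> n) + (1 - q) = 1 + q * \<delta> n\<close> from the centre, strictly less
  than the radius.\<close>

lemma circ_admissible:
  assumes g: "good n"
  shows "admissible_contour q (b n) (M n) (circ n)"
proof -
  have r: "0 < 1 + \<delta> n" using \<delta>_pos[OF g] by simp
  have path: "path_image (circ n) = sphere 1 (1 + \<delta> n)"
    unfolding circ_def using r by (intro path_image_circlepath_nonneg) simp
  have "continuous_on {0..1} (\<lambda>s. vector_derivative (circ n) (at s))"
    unfolding vector_derivative_circ unfolding circ_def circlepath by (intro continuous_intros)
  then have "(\<lambda>s. vector_derivative (circ n) (at s)) absolutely_integrable_on {0..1}"
    by (rule absolutely_integrable_continuous_real)
  moreover have "winding_number (circ n) z = 1" if "z \<in> ball 1 (1 + \<delta> n)" for z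
    unfolding circ_def using that by (intro winding_number_circlepath)
      (simp add: dist_norm norm_minus_commute)
  moreover have "0 \<in> ball (1::complex) (1 + \<delta> n)" using \<delta>_pos[OF g] by simp
  moreover have "of_real (b n k) \<in> ball (1::complex) (1 + \<delta> n)" for k
  proof -
    have "norm (1 - complex_of_real (b n k)) = \<bar>1 - b n k\<bar>"
      by (metis norm_of_real of_real_1 of_real_diff)
    then show ?thesis using b_pos[OF g, of k] b_le_1[OF g, of k] \<delta>_pos[OF g]
      by (simp add: dist_norm)
  qed
  moreover have "of_real q * z \<in> ball 1 (1 + \<delta> n)" if z: "z \<in> sphere 1 (1 + \<delta> n)" for z :: complex
  proof -
    have "1 - of_real q * z = of_real q * (1 - z) + of_real (1 - q)" by (simp add: algebra_simps)
    then have "norm (1 - of_real q * z) \<le> norm (of_real q * (1 - z)) +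
        norm (complex_of_real (1 - q))"
      by (simp only: norm_triangle_ineq)
    also have "norm (of_real q * (1 - z)) = q * (1 + \<delta> n)" using z q
      by (simp add: norm_mult dist_norm)
    also have "norm (complex_of_real (1 - q)) = 1 - q" unfolding norm_of_real using q by simp
    also have "q * (1 + \<delta> n) + (1 - q) = 1 + q * \<delta> n" by (simp add: algebra_simps)
    also have "\<dots> < 1 + \<delta> n" using q \<delta>_pos[OF g] by simp
    finally show ?thesis by (simp add: dist_norm)
  qed
  moreover have "valid_path (circ n)" "simple_path (circ n)" "pathfinish (circ n) =
      pathstart (circ n)"
    using r by (simp_all add: circ_def simple_path_circlepath)
  ultimately show ?thesis unfolding admissible_contour_def path inside_sphere[OF r] by auto
qed

lemma tazrp_contour_good:
  assumes g: "good n" and a: "\<And>x. 0 < a x" "\<And>k. b n k = (1 - q) * a (int k)"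
    and \<Gamma>: "admissible_contour q (b n) (M n) \<Gamma>"
  shows "tazrp_contour q a (1 / (1 - q)) (b n) (M n) \<Gamma>"
proof unfold_locales
  fix x :: int assume "0 \<le> x"
  then have "b n (nat x) = (1 - q) * a x" using a(2)[of "nat x"] by simp
  then show "a x \<le> 1 / (1 - q)" using b_le_1[OF g, of "nat x"] q by (simp add: field_simps)
qed (use q a b_pos[OF g] \<Gamma> in auto)

definition lim_coef :: "nat \<Rightarrow> complex" where
  "lim_coef k = (\<integral>y. lim_det k y \<partial>PiM {..<k} (\<lambda>_. lborel)) / fact k"

lemma lim_fredholm_det:
  "contour_fredholm_det UNIV Gamma_inf (\<lambda>z w. \<zeta> * K_lim q \<tau> l \<beta> z w) = (\<Sum>k. lim_coef k * \<zeta> ^ k)"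
proof -
  have "Determinant.det (Matrix.mat k k (\<lambda>(i, j). \<zeta> *
      K_lim q \<tau> l \<beta> (Gamma_inf (y i)) (Gamma_inf (y j)) *
       vector_derivative Gamma_inf (at (y j)) / (2 * of_real pi * \<i>))) =
    \<zeta> ^ k * lim_det k y" for k and y :: "nat \<Rightarrow> real"
    using det_mat_scale[of k "\<lambda>_. \<zeta>" "\<lambda>_. 1" "\<lambda>i j. K_lim q \<tau> l \<beta> (Gamma_inf (y i))
        (Gamma_inf (y j)) *
       vector_derivative Gamma_inf (at (y j)) / (2 * of_real pi * \<i>)"] by (simp add: mult.assoc)
  moreover have "restrict_space lborel UNIV = (lborel :: real measure)"
    by (rule measure_eqI) (auto simp: emeasure_restrict_space sets_restrict_space)
  ultimately show ?thesis
    by (simp add: contour_fredholm_det_def fredholm_det_def lim_coef_def mult.commute)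
qed

text \<open>The coefficient does not see the contour, so it may be computed on the circle
  \<open>circ n\<close>, where the scaling limit of each term is known.\<close>

lemma coef_tendsto:
  assumes a: "\<And>n x. good n \<Longrightarrow> 0 < a n x" "\<And>n k. good n \<Longrightarrow> b n k = (1 - q) * a n (int k)"
  shows "(\<lambda>n. complex_of_real (tazrp.coef q (a n) (M n) (t n) k)) \<longlonglongrightarrow> lim_coef k"
proof -
  have "(\<lambda>n. (\<integral>x. pre_det n k x \<partial>PiM {..<k} (\<lambda>_. unit_lborel)) / fact k) \<longlonglongrightarrow> lim_coef k"
    unfolding lim_coef_def by (intro tendsto_divide circ_term_tendsto tendsto_const) simp
  moreover have "\<forall>\<^sub>F n in sequentially. (\<integral>x. pre_det n k x \<partial>PiM {..<k} (\<lambda>_. unit_lborel)) / fact k =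
       complex_of_real (tazrp.coef q (a n) (M n) (t n) k)"
    using eventually_good
  proof (rule eventually_mono)
    fix n assume g: "good n"
    interpret tazrp_contour q "a n" "1 / (1 - q)" "b n" "M n" "circ n"
      using g a by (intro tazrp_contour_good circ_admissible) auto
    show "(\<integral>x. pre_det n k x \<partial>PiM {..<k} (\<lambda>_. unit_lborel)) / fact k =
       complex_of_real (coef (M n) (t n) k)"
      using fredholm_term_eq_coef[OF t_nonneg[OF g], of k 1] by simp
  qed
  ultimately show ?thesis by (rule Lim_transform_eventually)
qed

lemma coef_bound_good:
  assumes g: "good n" and a: "\<And>n x. good n \<Longrightarrow> 0 < a n x" "\<And>n k. good n \<Longrightarrow> b n k =
      (1 - q) * a n (int k)"
  shows "norm (complex_of_real (tazrp.coef q (a n) (M n) (t n) k)) \<le> qbin_bd q k"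
proof -
  interpret tazrp_contour q "a n" "1 / (1 - q)" "b n" "M n" "circ n"
    using g a by (intro tazrp_contour_good circ_admissible) auto
  show ?thesis using coef_bound by simp
qed

text \<open>The statement about determinants mentions no process; these rates provide one whose
  parameters are the given \<open>b n k\<close>, so that the moment formulas apply. Truncation by
  \<open>nat\<close> keeps the rates positive at negative sites.\<close>

definition site_rate :: "nat \<Rightarrow> int \<Rightarrow> real" where
  "site_rate n x = b n (nat x) / (1 - q)"

lemma site_rate: "good n \<Longrightarrow> 0 < site_rate n x" "b n k = (1 - q) * site_rate n (int k)"
  using q b_pos[of n "nat x"] by (simp_all add: site_rate_def)

text \<open>The bound is inherited in the limit from the particle systems. The estimates behind
  \<open>circ_term_tendsto\<close> would only give geometric growth in \<open>k\<close>, hence a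
  finite disc of convergence.\<close>

lemma lim_coef_bound: "norm (lim_coef k) \<le> qbin_bd q k"
proof (rule tendsto_upperbound)
  show "(\<lambda>n. norm (complex_of_real (tazrp.coef q (site_rate n) (M n) (t n) k))) \<longlonglongrightarrow> norm (lim_coef k)"
    by (intro tendsto_norm coef_tendsto site_rate)
  show "\<forall>\<^sub>F n in sequentially. norm (complex_of_real (tazrp.coef q (site_rate n) (M n) (t n) k)) \<le>
      qbin_bd q k"
    using eventually_good by (rule eventually_mono) (intro coef_bound_good site_rate)
qed simp

text \<open>The contours may vary arbitrarily with \<open>n\<close>: each determinant is the power
  series with coefficients \<open>coef\<close>, so the convergence of the coefficients and their
  common bound suffice.\<close>

lemma fredholm_det_uniform_limit:
  assumes \<Gamma>: "\<And>n. 1 \<le> n \<Longrightarrow> admissible_contour q (b n) (M n) (\<Gamma> n)" and S: "compact S"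
  shows "uniform_limit S (\<lambda>n \<zeta>. contour_fredholm_det {0..1} (\<Gamma> n) (\<lambda>w w'. \<zeta> *
      K_pre q (b n) (M n) (t n) w w'))
    (\<lambda>\<zeta>. contour_fredholm_det UNIV Gamma_inf (\<lambda>z w. \<zeta> * K_lim q \<tau> l \<beta> z w)) sequentially"
proof -
  let ?u = "\<lambda>n k. complex_of_real (tazrp.coef q (site_rate n) (M n) (t n) k)"
  have "uniform_limit S (\<lambda>n \<zeta>. \<Sum>k. ?u n k * \<zeta> ^ k) (\<lambda>\<zeta>. \<Sum>k. lim_coef k * \<zeta> ^ k) sequentially"
  proof (rule power_series_uniform_limit[OF _ _ lim_coef_bound _ S])
    show "(\<lambda>n. ?u n k) \<longlonglongrightarrow> lim_coef k" for k by (intro coef_tendsto site_rate)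
    show "\<forall>\<^sub>F n in sequentially. \<forall>k. norm (?u n k) \<le> qbin_bd q k"
      using eventually_good by (rule eventually_mono) (intro allI coef_bound_good site_rate)
    show "summable (\<lambda>k. qbin_bd q k * R ^ k)" if "0 \<le> R" for R
      using q_unit.summable_qbin_bd[OF q_unit that] .
  qed
  moreover have "\<forall>\<^sub>F n in sequentially. \<forall>\<zeta>\<in>S. (\<Sum>k. ?u n k * \<zeta> ^ k) =
      contour_fredholm_det {0..1} (\<Gamma> n) (\<lambda>w w'. \<zeta> * K_pre q (b n) (M n) (t n) w w')"
    using eventually_good
  proof (rule eventually_mono)
    fix n assume g: "good n"
    then have "1 \<le> n" by (simp add: good_def)
    interpret tazrp_contour q "site_rate n" "1 / (1 - q)" "b n" "M n" "\<Gamma> n"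
      using g site_rate \<Gamma>[OF \<open>1 \<le> n\<close>] by (intro tazrp_contour_good) auto
    show "\<forall>\<zeta>\<in>S. (\<Sum>k. ?u n k * \<zeta> ^ k) =
      contour_fredholm_det {0..1} (\<Gamma> n) (\<lambda>w w'. \<zeta> * K_pre q (b n) (M n) (t n) w w')"
      using contour_fredholm_det_eq[OF t_nonneg[OF g]] by simp
  qed
  ultimately show ?thesis unfolding lim_fredholm_det
    by (subst (asm) uniform_limit_cong) auto
qed

text \<open>Both the probabilities and the limiting contour integral are series in the same weights
  \<open>?e k\<close>, with coefficients \<open>coef\<close> and \<open>lim_coef\<close>
  respectively; coefficientwise convergence passes to the sums because
  \<open>qbin_bd q k * (C * R ^ k)\<close> is a summable majorant.\<close>

lemma prob_tendsto:
  assumes m: "1 \<le> m" and R: "0 < R" "\<And>j. j < m \<Longrightarrow> 1 / q ^ j < R"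
    and a: "\<And>n x. 1 \<le> n \<Longrightarrow> 0 < a n x" "\<And>n k. 1 \<le> n \<Longrightarrow> b n k = (1 - q) * a n (int k)"
  shows "(\<lambda>n. complex_of_real (\<P>(\<omega> in clock_space.
      qTAZRP q (a n) step_initial \<omega> (t n) m > int (M n))))
    \<longlonglongrightarrow> 1 / (2 * of_real pi * \<i>) * contour_integral (circlepath 0 R)
      (\<lambda>\<zeta>. contour_fredholm_det UNIV Gamma_inf (\<lambda>z w. \<zeta> * K_lim q \<tau> l \<beta> z w) /
        (\<zeta> * (\<Prod>j<m. 1 - of_real q ^ j * \<zeta>)))"
proof -
  interpret Q: q_unit q by (rule q_unit)
  have a': "\<And>n x. good n \<Longrightarrow> 0 < a n x" "\<And>n k. good n \<Longrightarrow> b n k = (1 - q) * a n (int k)"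
    using a by (auto simp: good_def)
  let ?e = "Q.cauchy_weight m R"
  let ?u = "\<lambda>n k. complex_of_real (tazrp.coef q (a n) (M n) (t n) k)"
  obtain C where C: "\<And>k. norm (?e k) \<le> C * R ^ k" using Q.cauchy_weight_bound[OF m R] by blast
  have lim: "(\<lambda>n. \<Sum>k. ?u n k * ?e k) \<longlonglongrightarrow> (\<Sum>k. lim_coef k * ?e k)"
  proof (rule tendsto_suminf_dominated)
    show "(\<lambda>n. ?u n k * ?e k) \<longlonglongrightarrow> lim_coef k * ?e k" for k
      by (intro tendsto_mult tendsto_const coef_tendsto a')
    show "summable (\<lambda>k. qbin_bd q k * (C * R ^ k))"
      using summable_mult[OF Q.summable_qbin_bd[of R], of C] R by (simp add: mult_ac)
    show "\<forall>\<^sub>F n in sequentially. \<forall>k. norm (?u n k * ?e k) \<le> qbin_bd q k * (C * R ^ k)"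
      using eventually_good
    proof (rule eventually_mono, intro allI)
      fix n k assume g: "good n"
      show "norm (?u n k * ?e k) \<le> qbin_bd q k * (C * R ^ k)"
        unfolding norm_mult using coef_bound_good[OF g a'] C Q.qbin_bd_pos[of k]
          by (intro mult_mono) auto
    qed
  qed
  have ev: "\<forall>\<^sub>F n in sequentially. (\<Sum>k. ?u n k * ?e k) =
     complex_of_real (\<P>(\<omega> in clock_space. qTAZRP q (a n) step_initial \<omega> (t n) m > int (M n)))"
    using eventually_good
  proof (rule eventually_mono)
    fix n assume g: "good n"
    interpret tazrp_contour q "a n" "1 / (1 - q)" "b n" "M n" "circ n"
      using g a' by (intro tazrp_contour_good circ_admissible) auto
    show "(\<Sum>k. ?u n k * ?e k) = complex_of_real (\<P>(\<omega> in clock_space.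
        qTAZRP q (a n) step_initial \<omega> (t n) m > int (M n)))"
      using prob_sums[OF m R] by (rule sums_unique[symmetric])
  qed
  have eq: "(\<Sum>k. lim_coef k * ?e k) = 1 / (2 * of_real pi * \<i>) * contour_integral (circlepath 0 R)
      (\<lambda>\<zeta>. (\<Sum>k. lim_coef k * \<zeta> ^ k) / (\<zeta> * (\<Prod>j<m. 1 - of_real q ^ j * \<zeta>)))"
    using sums_unique[OF Q.suminf_cauchy_weight[OF m R lim_coef_bound]]
    by (simp add: qpoch_def lessThan_atLeast0)
  show ?thesis unfolding lim_fredholm_det eq[symmetric] using lim ev
    by (rule Lim_transform_eventually)
qed

end

theorem theorem1p4:
  fixes q \<tau> :: real and l :: int and \<beta> :: "nat \<Rightarrow> real"
    and M :: "nat \<Rightarrow> nat" and t :: "nat \<Rightarrow> real" and b :: "nat \<Rightarrow> nat \<Rightarrow> real"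
  assumes q: "0 < q" "q < 1"
    and l: "l \<ge> -1"
    and \<beta>: "\<And>k. int k \<le> l \<Longrightarrow> \<beta> k > 0"
    and M: "\<And>n. int (M n) = int n + l + 1"
    and t: "\<And>n. t n = real n - \<tau> * sqrt (real n)"
    and b_slow: "\<And>n k. int k \<le> l \<Longrightarrow> b n k = \<beta> k / sqrt (real n)"
    and b_one: "\<And>n k. int k > l \<Longrightarrow> b n k = 1"
  shows
    "(\<forall>\<Gamma> S. (\<forall>n\<ge>1. admissible_contour q (b n) (M n) (\<Gamma> n)) \<and> compact S \<longrightarrow>
        uniform_limit S
          (\<lambda>n \<zeta>. contour_fredholm_det {0..1} (\<Gamma> n) (\<lambda>w w'. \<zeta> * K_pre q (b n) (M n) (t n) w w'))
          (\<lambda>\<zeta>. contour_fredholm_det UNIV Gamma_inf (\<lambda>z w. \<zeta> * K_lim q \<tau> l \<beta> z w))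
          sequentially)
     \<and>
     (\<forall>(m::nat) (a :: nat \<Rightarrow> int \<Rightarrow> real) R.
        m \<ge> 1 \<and>
        (\<forall>n\<ge>1. (\<forall>x. a n x > 0) \<and> (\<forall>k. b n k = (1 - q) * a n (int k))) \<and>
        R > 0 \<and> (\<forall>j<m. 1 / q ^ j < R) \<longrightarrow>
        (\<lambda>n. complex_of_real
               (\<P>(\<omega> in clock_space. qTAZRP q (a n) step_initial \<omega> (t n) m > int (M n))))
          \<longlonglongrightarrow>
          1 / (2 * of_real pi * \<i>) *
            contour_integral (circlepath 0 R)
              (\<lambda>\<zeta>. contour_fredholm_det UNIV Gamma_inf (\<lambda>z w. \<zeta> * K_lim q \<tau> l \<beta> z w) /
                     (\<zeta> * (\<Prod>j<m. 1 - of_real q ^ j * \<zeta>))))"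
proof -
  interpret scaling q \<tau> l \<beta> M t b
    by (rule scaling.intro) (fact q l \<beta> M t b_slow b_one)+
  show ?thesis
    by (intro conjI allI impI; elim conjE) (use fredholm_det_uniform_limit prob_tendsto in auto)
qed

end
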